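(* Let $g\colon U\to V$ be a morphism of associative algebras over a field of characteristic $0$. There is an $L_\infty$-algebra structure $(d_{GS}=l_1,l_2,l_3,\ldots)$ on $C^{*+1}_{GS}(g;g)$ (where $C^{n+1}_{GS}(g;g)$ is placed in degree $n$) governing deformations of the associative algebra morphism $g$, i.e. such that deformations of $g$ (the $\mathsf F(E)$-algebra structures on $T=U\oplus V$) correspond to the degree $1$ elements $\kappa\in C^2_{GS}(g;g)$ satisfying the Quantum Master Equation $$0=d_{GS}(\kappa)+\frac1{2!}l_2(\kappa,\kappa)-\frac1{3!}l_3(\kappa,\kappa,\kappa)-\frac1{4!}l_4(\kappa,\kappa,\kappa,\kappa)+\cdots .$$
   Context: $\mathbf k$ is a field of characteristic $0$; $U,V$ are associative $\mathbf k$-algebras, $g\colon U\to V$ an algebra morphism. **Gerstenhaber–Schack complex.** For $n\ge1$, $C^n_{GS}(g;g)=\mathrm{Hom}(U^{\otimes n},U)\oplus\mathrm{Hom}(V^{\otimes n},V)\oplus\mathrm{Hom}(U^{\otimes n-1},V)$, with $d_{GS}(x_U,x_V,x_g)=(bx_U,bx_V,gx_U-x_Vg^{\otimes n}-bx_g)$, where $b$ is the Hochschild differential and $V$ is a $U$-bimodule via $g$. **The resolution $\mathsf F(E)$.** $T=U\oplus V$ is two-colored ($T_B=U$, $T_W=V$). $(\mathsf F(E),\partial)$ is the minimal model of the 2-colored operad $\mathbf{As}_{B\to W}$ whose algebras are morphisms of associative algebras: the free 2-colored PROP on generators $\mu_n\colon B^{\otimes n}\to B$ of degree $n-2$ ($n\ge2$),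 $\nu_n\colon W^{\otimes n}\to W$ of degree $n-2$ ($n\ge2$), $f_n\colon B^{\otimes n}\to W$ of degree $n-1$ ($n\ge1$), with $$\partial(\mu_n)=\sum_{\substack{i+j=n+1\\ i,j\ge2}}\sum_{s=0}^{n-j}(-1)^{i+s(j+1)}\mu_i\circ_{s+1}\mu_j,\qquad \partial(\nu_n)=\sum_{\substack{i+j=n+1\\ i,j\ge2}}\sum_{s=0}^{n-j}(-1)^{i+s(j+1)}\nu_i\circ_{s+1}\nu_j,$$ $$\partial(f_n)=-\sum_{l=2}^n\sum_{r_1+\cdots+r_l=n}(-1)^{\sum_{1\le i<j\le l}r_i(r_j+1)}\nu_l(f_{r_1}\otimes\cdots\otimes f_{r_l})-\sum_{\substack{i+j=n+1\\ i\ge1,j\ge2}}\sum_{s=0}^{n-j}(-1)^{i+s(j+1)}f_i\circ_{s+1}\mu_j,$$ where $x\circ_{s+1}y$ plugs $y$ into the $(s+1)$st input of $x$. An $\mathsf F(E)$-algebra structure on $T$ is a morphism of differential graded 2-colored PROPs $\mathsf F(E)\to\mathrm{End}_T$, where $\mathrm{End}_T$ (multilinear maps between tensor products of $U$'s and $V$'s) has zero differential. **$L_\infty$-structure.** On a $\mathbb Z$-graded module $L$, it is a sequence of operations $l_n\colon L^{\otimes n}\to L$, $n\ge1$, of degree $2-n$, each anti-symmetric, $l_n(x_{\sigma(1)},\ldots,x_{\sigma(n)})=\chi(\sigma)l_n(x_1,\ldots,x_n)$, with $$\sum_{i+j=n+1}\sum_\sigma\chi(\sigma)(-1)^{i(j-1)}l_j\big(l_i(x_{\sigma(1)},\ldots,x_{\sigma(i)}),x_{\sigma(i+1)},\ldots,x_{\sigma(n)}\big)=0$$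 for all $n\ge1$, where $i\ge1$, $\sigma$ runs over $(i,n-i)$-unshuffles and $\chi(\sigma)=\mathrm{sgn}(\sigma)\varepsilon(\sigma;x_1,\ldots,x_n)$ with $\varepsilon$ the Koszul sign: $x_1\wedge\cdots\wedge x_n=\varepsilon\, x_{\sigma(1)}\wedge\cdots\wedge x_{\sigma(n)}$. In the Quantum Master Equation the coefficient of $l_k(\kappa,\ldots,\kappa)$ is $-(-1)^{k(k+1)/2}/k!$ (signs $+,+,-,-,+,+,\ldots$). *)

theory Defs
  imports
    Complex_Main
    "HOL-Library.Function_Algebras"
    "HOL-Library.Product_Plus"
    "HOL-Combinatorics.Permutations"
begin

section \<open>Algebras and multilinear maps\<close>

text \<open>
  Algebras are not required to be unital. The ring \<open>'a\<close> carries the addition and the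
  multiplication, \<open>s\<close> is the scalar multiplication.
\<close>

definition assoc_algebra :: "('k::field \<Rightarrow> 'a::ring \<Rightarrow> 'a) \<Rightarrow> bool" where
  "assoc_algebra s \<longleftrightarrow> vector_space s \<and>
     (\<forall>c x y. s c (x * y) = s c x * y \<and> s c (x * y) = x * s c y)"

definition algebra_morphism ::
  "('k::field \<Rightarrow> 'a::ring \<Rightarrow> 'a) \<Rightarrow> ('k \<Rightarrow> 'b::ring \<Rightarrow> 'b) \<Rightarrow> ('a \<Rightarrow> 'b) \<Rightarrow> bool" where
  "algebra_morphism s s' g \<longleftrightarrow> Vector_Spaces.linear s s' g \<and> (\<forall>x y. g (x * y) = g x * g y)"

text \<open>
  \<open>multilin s s' n\<close> is $\mathrm{Hom}(A^{\otimes n},M)$: multilinear maps of \<open>n\<close> arguments, given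
  as functions on lists that are extended by zero to the lists of other lengths.
\<close>

definition multilin ::
  "('k::field \<Rightarrow> 'a::ab_group_add \<Rightarrow> 'a) \<Rightarrow> ('k \<Rightarrow> 'm::ab_group_add \<Rightarrow> 'm) \<Rightarrow> nat
     \<Rightarrow> ('a list \<Rightarrow> 'm) set" where
  "multilin s s' n = {f.
     (\<forall>xs. length xs \<noteq> n \<longrightarrow> f xs = 0) \<and>
     (\<forall>xs ys. length xs + length ys + 1 = n \<longrightarrow>
        Vector_Spaces.linear s s' (\<lambda>a. f (xs @ a # ys)))}"


section \<open>The Gerstenhaber--Schack complex\<close>

text \<open>
  Hochschild differential with coefficients in a bimodule with left action \<open>la\<close> and right
  action \<open>ra\<close>. The arity of the cochain is read off from the length $n+1$ of the argument list.
\<close>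

definition hochschild ::
  "('a::ring \<Rightarrow> 'm::ab_group_add \<Rightarrow> 'm) \<Rightarrow> ('m \<Rightarrow> 'a \<Rightarrow> 'm) \<Rightarrow> ('a list \<Rightarrow> 'm) \<Rightarrow> 'a list \<Rightarrow> 'm" where
  "hochschild la ra x as = (if as = [] then 0 else
     (let n = length as - 1 in
        la (hd as) (x (tl as))
        + (\<Sum>i = 1..n.
             (let y = x (take (i - 1) as @ (as ! (i - 1) * as ! i) # drop (i + 1) as)
              in if even i then y else - y))
        + (let y = ra (x (butlast as)) (last as) in if even (n + 1) then y else - y)))"

type_synonym ('u, 'v) gs_cochain = "('u list \<Rightarrow> 'u) \<times> ('v list \<Rightarrow> 'v) \<times> ('u list \<Rightarrow> 'v)"

definition C_GS ::
  "('k::field \<Rightarrow> 'u::ring \<Rightarrow> 'u) \<Rightarrow> ('k \<Rightarrow> 'v::ring \<Rightarrow> 'v) \<Rightarrow> nat \<Rightarrow> ('u, 'v) gs_cochain set" where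
  "C_GS sU sV n = multilin sU sU n \<times> multilin sV sV n \<times> multilin sU sV (n - 1)"

definition gs_scale ::
  "('k \<Rightarrow> 'u \<Rightarrow> 'u) \<Rightarrow> ('k \<Rightarrow> 'v \<Rightarrow> 'v) \<Rightarrow> 'k \<Rightarrow> ('u, 'v) gs_cochain \<Rightarrow> ('u, 'v) gs_cochain" where
  "gs_scale sU sV c = (\<lambda>(xU, xV, xg). (\<lambda>as. sU c (xU as), \<lambda>bs. sV c (xV bs), \<lambda>as. sV c (xg as)))"

definition d_GS :: "('u::ring \<Rightarrow> 'v::ring) \<Rightarrow> ('u, 'v) gs_cochain \<Rightarrow> ('u, 'v) gs_cochain" where
  "d_GS g = (\<lambda>(xU, xV, xg).
     (hochschild (*) (*) xU,
      hochschild (*) (*) xV,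
      \<lambda>as. g (xU as) - xV (map g as) - hochschild (\<lambda>a m. g a * m) (\<lambda>m a. m * g a) xg as))"

text \<open>The graded module $C^{*+1}_{GS}(g;g)$, with $C^{n+1}_{GS}$ in degree \<open>n\<close>.\<close>

definition L_GS ::
  "('k::field \<Rightarrow> 'u::ring \<Rightarrow> 'u) \<Rightarrow> ('k \<Rightarrow> 'v::ring \<Rightarrow> 'v) \<Rightarrow> int \<Rightarrow> ('u, 'v) gs_cochain set" where
  "L_GS sU sV p = (if p < 0 then {0} else C_GS sU sV (nat p + 1))"


section \<open>L-infinity structures\<close>

text \<open>
  A graded module is given by its homogeneous components \<open>L p\<close>, which are submodules of an
  ambient module. The operations \<open>l n\<close> are applied to lists of \<open>n\<close> homogeneous elements;
  \<open>ps\<close> is the list of degrees of the list \<open>xs\<close>.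
\<close>

definition homogeneous :: "(int \<Rightarrow> 'x set) \<Rightarrow> int list \<Rightarrow> 'x list \<Rightarrow> bool" where
  "homogeneous L ps xs \<longleftrightarrow> list_all2 (\<lambda>p x. x \<in> L p) ps xs"

definition ksign :: "int \<Rightarrow> 'r::ring_1" where
  "ksign p = (if even p then 1 else - 1)"

definition koszul_sign :: "(nat \<Rightarrow> nat) \<Rightarrow> int list \<Rightarrow> int" where
  "koszul_sign \<sigma> ps =
     (\<Prod>(i, j) \<in> {(i, j). i < j \<and> j < length ps \<and> \<sigma> j < \<sigma> i}. ksign (ps ! \<sigma> i * ps ! \<sigma> j))"

definition chi :: "(nat \<Rightarrow> nat) \<Rightarrow> int list \<Rightarrow> int" where
  "chi \<sigma> ps = sign \<sigma> * koszul_sign \<sigma> ps"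

definition unshuffles :: "nat \<Rightarrow> nat \<Rightarrow> (nat \<Rightarrow> nat) set" where
  "unshuffles i n = {\<sigma>. \<sigma> permutes {..<n} \<and>
     strict_mono_on {..<i} \<sigma> \<and> strict_mono_on {i..<n} \<sigma>}"

definition L_infinity ::
  "('k::field \<Rightarrow> 'x::ab_group_add \<Rightarrow> 'x) \<Rightarrow> (int \<Rightarrow> 'x set) \<Rightarrow> (nat \<Rightarrow> 'x list \<Rightarrow> 'x) \<Rightarrow> bool" where
  "L_infinity scale L l \<longleftrightarrow>
     module scale \<and> (\<forall>p. module.subspace scale (L p)) \<and>
     \<comment> \<open>degree\<close>
     (\<forall>ps xs. xs \<noteq> [] \<longrightarrow> homogeneous L ps xs \<longrightarrow>
        l (length xs) xs \<in> L (sum_list ps + 2 - int (length xs))) \<and>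
     \<comment> \<open>multilinearity\<close>
     (\<forall>ps xs qs ys p a b c. homogeneous L ps xs \<longrightarrow> homogeneous L qs ys \<longrightarrow> a \<in> L p \<longrightarrow> b \<in> L p \<longrightarrow>
        (let n = length xs + length ys + 1 in
           l n (xs @ (a + b) # ys) = l n (xs @ a # ys) + l n (xs @ b # ys) \<and>
           l n (xs @ scale c a # ys) = scale c (l n (xs @ a # ys)))) \<and>
     \<comment> \<open>antisymmetry\<close>
     (\<forall>ps xs \<sigma>. xs \<noteq> [] \<longrightarrow> homogeneous L ps xs \<longrightarrow> \<sigma> permutes {..<length xs} \<longrightarrow>
        l (length xs) (permute_list \<sigma> xs) = scale (of_int (chi \<sigma> ps)) (l (length xs) xs)) \<and>
     \<comment> \<open>generalized Jacobi identities\<close>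
     (\<forall>ps xs. xs \<noteq> [] \<longrightarrow> homogeneous L ps xs \<longrightarrow>
        (let n = length xs in
           (\<Sum>i = 1..n. let j = n + 1 - i in
              \<Sum>\<sigma> \<in> unshuffles i n.
                scale (of_int (chi \<sigma> ps * (-1) ^ (i * (j - 1))))
                  (l j (l i (take i (permute_list \<sigma> xs)) # drop i (permute_list \<sigma> xs)))) = 0))"

definition qme_term ::
  "('k::field_char_0 \<Rightarrow> 'x \<Rightarrow> 'x) \<Rightarrow> (nat \<Rightarrow> 'x list \<Rightarrow> 'x) \<Rightarrow> 'x \<Rightarrow> nat \<Rightarrow> 'x" where
  "qme_term scale l \<kappa> k = scale (- ((-1) ^ (k * (k + 1) div 2)) / fact k) (l k (replicate k \<kappa>))"

definition qme_support ::
  "('k::field_char_0 \<Rightarrow> 'x::ab_group_add \<Rightarrow> 'x) \<Rightarrow> (nat \<Rightarrow> 'x list \<Rightarrow> 'x) \<Rightarrow> 'x \<Rightarrow> nat set" where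
  "qme_support scale l \<kappa> = {k. 1 \<le> k \<and> qme_term scale l \<kappa> k \<noteq> 0}"

definition quantum_master_equation ::
  "('k::field_char_0 \<Rightarrow> 'x::ab_group_add \<Rightarrow> 'x) \<Rightarrow> (nat \<Rightarrow> 'x list \<Rightarrow> 'x) \<Rightarrow> 'x \<Rightarrow> bool" where
  "quantum_master_equation scale l \<kappa> \<longleftrightarrow>
     finite (qme_support scale l \<kappa>) \<and>
     (\<Sum>k \<in> qme_support scale l \<kappa>. qme_term scale l \<kappa> k) = 0"


section \<open>The free 2-colored PROP on the generators $\mu_n$, $\nu_n$, $f_n$\<close>

datatype color = Black | White

datatype gen = Mu nat | Nu nat | Fn nat

fun gen_valid :: "gen \<Rightarrow> bool" where
  "gen_valid (Mu n) \<longleftrightarrow> 2 \<le> n"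
| "gen_valid (Nu n) \<longleftrightarrow> 2 \<le> n"
| "gen_valid (Fn n) \<longleftrightarrow> 1 \<le> n"

fun gen_in :: "gen \<Rightarrow> color list" where
  "gen_in (Mu n) = replicate n Black"
| "gen_in (Nu n) = replicate n White"
| "gen_in (Fn n) = replicate n Black"

fun gen_out :: "gen \<Rightarrow> color" where
  "gen_out (Mu n) = Black"
| "gen_out (Nu n) = White"
| "gen_out (Fn n) = White"

fun gen_deg :: "gen \<Rightarrow> int" where
  "gen_deg (Mu n) = int n - 2"
| "gen_deg (Nu n) = int n - 2"
| "gen_deg (Fn n) = int n - 1"

text \<open>
  A 2-colored PROP is a symmetric strict monoidal category, enriched in graded modules, whose
  objects are the words of colors. The free one is presented by terms: its morphisms
  \<open>cs \<rightarrow> ds\<close> of degree \<open>p\<close> are the terms \<open>t\<close> with \<open>typed t cs ds p\<close>, modulo the congruence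
  \<open>prop_eq\<close> generated by the axioms. \<open>Comp s t\<close> is \<open>s\<close> after \<open>t\<close>, and \<open>Swap cs ds\<close> is the
  symmetry \<open>cs @ ds \<rightarrow> ds @ cs\<close>, so that the actions of the symmetric groups are compositions
  with iterated swaps.
\<close>

datatype 'k pterm =
    Gen gen
  | Iden "color list"
  | Swap "color list" "color list"
  | Comp "'k pterm" "'k pterm"
  | Tens "'k pterm" "'k pterm"
  | Zero "color list" "color list" int
  | Add "'k pterm" "'k pterm"
  | Scale 'k "'k pterm"

inductive typed :: "'k pterm \<Rightarrow> color list \<Rightarrow> color list \<Rightarrow> int \<Rightarrow> bool" where
  "gen_valid e \<Longrightarrow> typed (Gen e) (gen_in e) [gen_out e] (gen_deg e)"
| "typed (Iden cs) cs cs 0"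
| "typed (Swap cs ds) (cs @ ds) (ds @ cs) 0"
| "typed s ds es p \<Longrightarrow> typed t cs ds q \<Longrightarrow> typed (Comp s t) cs es (p + q)"
| "typed s cs ds p \<Longrightarrow> typed t cs' ds' q \<Longrightarrow> typed (Tens s t) (cs @ cs') (ds @ ds') (p + q)"
| "typed (Zero cs ds p) cs ds p"
| "typed s cs ds p \<Longrightarrow> typed t cs ds p \<Longrightarrow> typed (Add s t) cs ds p"
| "typed s cs ds p \<Longrightarrow> typed (Scale c s) cs ds p"

inductive prop_eq :: "'k::field pterm \<Rightarrow> 'k pterm \<Rightarrow> bool" (infix "\<simeq>" 50) where
  refl: "typed s cs ds p \<Longrightarrow> s \<simeq> s"
| sym: "s \<simeq> t \<Longrightarrow> t \<simeq> s"
| trans: "s \<simeq> t \<Longrightarrow> t \<simeq> u \<Longrightarrow> s \<simeq> u"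
\<comment> \<open>congruence\<close>
| cong_comp: "s \<simeq> s' \<Longrightarrow> t \<simeq> t' \<Longrightarrow> typed s ds es p \<Longrightarrow> typed t cs ds q \<Longrightarrow> Comp s t \<simeq> Comp s' t'"
| cong_tens: "s \<simeq> s' \<Longrightarrow> t \<simeq> t' \<Longrightarrow> Tens s t \<simeq> Tens s' t'"
| cong_add: "s \<simeq> s' \<Longrightarrow> t \<simeq> t' \<Longrightarrow> typed s cs ds p \<Longrightarrow> typed t cs ds p \<Longrightarrow> Add s t \<simeq> Add s' t'"
| cong_scale: "s \<simeq> s' \<Longrightarrow> Scale c s \<simeq> Scale c s'"
\<comment> \<open>the morphisms of given type form a vector space\<close>
| add_assoc: "typed s cs ds p \<Longrightarrow> typed t cs ds p \<Longrightarrow> typed u cs ds p \<Longrightarrow>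
    Add (Add s t) u \<simeq> Add s (Add t u)"
| add_comm: "typed s cs ds p \<Longrightarrow> typed t cs ds p \<Longrightarrow> Add s t \<simeq> Add t s"
| add_zero: "typed s cs ds p \<Longrightarrow> Add s (Zero cs ds p) \<simeq> s"
| scale_zero: "typed s cs ds p \<Longrightarrow> Scale 0 s \<simeq> Zero cs ds p"
| scale_one: "typed s cs ds p \<Longrightarrow> Scale 1 s \<simeq> s"
| scale_scale: "typed s cs ds p \<Longrightarrow> Scale a (Scale b s) \<simeq> Scale (a * b) s"
| scale_left: "typed s cs ds p \<Longrightarrow> Scale (a + b) s \<simeq> Add (Scale a s) (Scale b s)"
| scale_right: "typed s cs ds p \<Longrightarrow> typed t cs ds p \<Longrightarrow>
    Scale a (Add s t) \<simeq> Add (Scale a s) (Scale a t)"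
\<comment> \<open>both compositions are bilinear\<close>
| comp_add_left: "typed s ds es p \<Longrightarrow> typed s' ds es p \<Longrightarrow> typed t cs ds q \<Longrightarrow>
    Comp (Add s s') t \<simeq> Add (Comp s t) (Comp s' t)"
| comp_add_right: "typed s ds es p \<Longrightarrow> typed t cs ds q \<Longrightarrow> typed t' cs ds q \<Longrightarrow>
    Comp s (Add t t') \<simeq> Add (Comp s t) (Comp s t')"
| comp_scale_left: "typed s ds es p \<Longrightarrow> typed t cs ds q \<Longrightarrow>
    Comp (Scale a s) t \<simeq> Scale a (Comp s t)"
| comp_scale_right: "typed s ds es p \<Longrightarrow> typed t cs ds q \<Longrightarrow>
    Comp s (Scale a t) \<simeq> Scale a (Comp s t)"
| tens_add_left: "typed s cs ds p \<Longrightarrow> typed s' cs ds p \<Longrightarrow> typed t cs' ds' q \<Longrightarrow>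
    Tens (Add s s') t \<simeq> Add (Tens s t) (Tens s' t)"
| tens_add_right: "typed s cs ds p \<Longrightarrow> typed t cs' ds' q \<Longrightarrow> typed t' cs' ds' q \<Longrightarrow>
    Tens s (Add t t') \<simeq> Add (Tens s t) (Tens s t')"
| tens_scale_left: "typed s cs ds p \<Longrightarrow> typed t cs' ds' q \<Longrightarrow>
    Tens (Scale a s) t \<simeq> Scale a (Tens s t)"
| tens_scale_right: "typed s cs ds p \<Longrightarrow> typed t cs' ds' q \<Longrightarrow>
    Tens s (Scale a t) \<simeq> Scale a (Tens s t)"
\<comment> \<open>category\<close>
| comp_assoc: "typed s es fs p \<Longrightarrow> typed t ds es q \<Longrightarrow> typed u cs ds r \<Longrightarrow>
    Comp (Comp s t) u \<simeq> Comp s (Comp t u)"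
| comp_id_left: "typed s cs ds p \<Longrightarrow> Comp (Iden ds) s \<simeq> s"
| comp_id_right: "typed s cs ds p \<Longrightarrow> Comp s (Iden cs) \<simeq> s"
\<comment> \<open>strict monoidal structure, with the Koszul sign in the interchange law\<close>
| tens_assoc: "typed s cs ds p \<Longrightarrow> typed t cs' ds' q \<Longrightarrow> typed u cs'' ds'' r \<Longrightarrow>
    Tens (Tens s t) u \<simeq> Tens s (Tens t u)"
| tens_unit_left: "typed s cs ds p \<Longrightarrow> Tens (Iden []) s \<simeq> s"
| tens_unit_right: "typed s cs ds p \<Longrightarrow> Tens s (Iden []) \<simeq> s"
| tens_id: "Tens (Iden cs) (Iden ds) \<simeq> Iden (cs @ ds)"
| interchange: "typed s ds es p \<Longrightarrow> typed t cs ds q \<Longrightarrow> typed s' ds' es' p' \<Longrightarrow> typed t' cs' ds' q' \<Longrightarrow>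
    Comp (Tens s s') (Tens t t') \<simeq> Scale (ksign (p' * q)) (Tens (Comp s t) (Comp s' t'))"
\<comment> \<open>symmetry\<close>
| swap_swap: "Comp (Swap ds cs) (Swap cs ds) \<simeq> Iden (cs @ ds)"
| swap_hexagon: "Swap cs (ds @ es) \<simeq>
    Comp (Tens (Iden ds) (Swap cs es)) (Tens (Swap cs ds) (Iden es))"
| swap_natural: "typed s cs ds p \<Longrightarrow> typed t cs' ds' q \<Longrightarrow>
    Comp (Swap ds ds') (Tens s t) \<simeq> Scale (ksign (p * q)) (Comp (Tens t s) (Swap cs cs'))"


section \<open>The differential of $\mathsf F(E)$\<close>

definition term_sum :: "color list \<Rightarrow> color list \<Rightarrow> int \<Rightarrow> 'k pterm list \<Rightarrow> 'k pterm" where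
  "term_sum cs ds p ts = foldr Add ts (Zero cs ds p)"

text \<open>\<open>plug x s y\<close> is $x \circ_{s+1} y$.\<close>

definition plug :: "gen \<Rightarrow> nat \<Rightarrow> gen \<Rightarrow> 'k pterm" where
  "plug x s y = Comp (Gen x)
     (Tens (Iden (take s (gen_in x))) (Tens (Gen y) (Iden (drop (Suc s) (gen_in x)))))"

text \<open>\<open>compositions l n\<close> lists all $(r_1,\dots,r_l)$ with $r_i \ge 1$ and $r_1+\cdots+r_l = n$.\<close>

fun compositions :: "nat \<Rightarrow> nat \<Rightarrow> nat list list" where
  "compositions 0 n = (if n = 0 then [[]] else [])"
| "compositions (Suc l) n = [r # rs. r \<leftarrow> [1..<Suc n], rs \<leftarrow> compositions l (n - r)]"

definition r_exponent :: "nat list \<Rightarrow> nat" where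
  "r_exponent rs = (\<Sum>j < length rs. \<Sum>i < j. rs ! i * (rs ! j + 1))"

fun diff_gen_terms :: "gen \<Rightarrow> 'k::field pterm list" where
  "diff_gen_terms (Mu n) =
     [Scale ((-1) ^ (i + s * (j + 1))) (plug (Mu i) s (Mu j)).
        i \<leftarrow> [2..<n], j \<leftarrow> [n + 1 - i], s \<leftarrow> [0..<Suc (n - j)]]"
| "diff_gen_terms (Nu n) =
     [Scale ((-1) ^ (i + s * (j + 1))) (plug (Nu i) s (Nu j)).
        i \<leftarrow> [2..<n], j \<leftarrow> [n + 1 - i], s \<leftarrow> [0..<Suc (n - j)]]"
| "diff_gen_terms (Fn n) =
     [Scale (- ((-1) ^ r_exponent rs))
        (Comp (Gen (Nu l)) (foldr Tens (map (\<lambda>r. Gen (Fn r)) rs) (Iden []))).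
        l \<leftarrow> [2..<Suc n], rs \<leftarrow> compositions l n]
     @ [Scale (- ((-1) ^ (i + s * (j + 1)))) (plug (Fn i) s (Mu j)).
        i \<leftarrow> [1..<n], j \<leftarrow> [n + 1 - i], s \<leftarrow> [0..<Suc (n - j)]]"

fun tdeg :: "'k pterm \<Rightarrow> int" where
  "tdeg (Gen e) = gen_deg e"
| "tdeg (Iden cs) = 0"
| "tdeg (Swap cs ds) = 0"
| "tdeg (Comp s t) = tdeg s + tdeg t"
| "tdeg (Tens s t) = tdeg s + tdeg t"
| "tdeg (Zero cs ds p) = p"
| "tdeg (Add s t) = tdeg s"
| "tdeg (Scale c s) = tdeg s"

fun diff :: "'k::field pterm \<Rightarrow> 'k pterm" where
  "diff (Gen e) = term_sum (gen_in e) [gen_out e] (gen_deg e - 1) (diff_gen_terms e)"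
| "diff (Iden cs) = Zero cs cs (- 1)"
| "diff (Swap cs ds) = Zero (cs @ ds) (ds @ cs) (- 1)"
| "diff (Comp s t) = Add (Comp (diff s) t) (Scale (ksign (tdeg s)) (Comp s (diff t)))"
| "diff (Tens s t) = Add (Tens (diff s) t) (Scale (ksign (tdeg s)) (Tens s (diff t)))"
| "diff (Zero cs ds p) = Zero cs ds (p - 1)"
| "diff (Add s t) = Add (diff s) (diff t)"
| "diff (Scale c s) = Scale c (diff s)"


section \<open>The endomorphism PROP of $T = U \oplus V$\<close>

text \<open>
  A word of elements of \<open>T\<close> stands for a decomposable tensor; \<open>Inl\<close> marks elements of $U = T_B$ and
  \<open>Inr\<close> elements of $V = T_W$. For a word \<open>cs\<close> of colors, \<open>col_multilin\<close> consists of the multilinear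
  maps on $T_{cs} = T_{c_1} \times \cdots \times T_{c_n}$, extended by zero to all words.
\<close>

type_synonym ('u, 'v) word = "('u + 'v) list"

fun color_of :: "'u + 'v \<Rightarrow> color" where
  "color_of (Inl a) = Black"
| "color_of (Inr b) = White"

abbreviation colors :: "('u, 'v) word \<Rightarrow> color list" where
  "colors w \<equiv> map color_of w"

definition col_multilin ::
  "('k::field \<Rightarrow> 'u::ab_group_add \<Rightarrow> 'u) \<Rightarrow> ('k \<Rightarrow> 'v::ab_group_add \<Rightarrow> 'v)
     \<Rightarrow> ('k \<Rightarrow> 'm::ab_group_add \<Rightarrow> 'm) \<Rightarrow> color list \<Rightarrow> (('u, 'v) word \<Rightarrow> 'm) set" where
  "col_multilin sU sV s' cs = {f.
     (\<forall>w. colors w \<noteq> cs \<longrightarrow> f w = 0) \<and>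
     (\<forall>w w'. colors w @ Black # colors w' = cs \<longrightarrow>
        Vector_Spaces.linear sU s' (\<lambda>a. f (w @ Inl a # w'))) \<and>
     (\<forall>w w'. colors w @ White # colors w' = cs \<longrightarrow>
        Vector_Spaces.linear sV s' (\<lambda>b. f (w @ Inr b # w')))}"

text \<open>
  Over a field, the tensor product $T_{c_1} \otimes \cdots \otimes T_{c_n}$ embeds into the dual of
  the space of multilinear forms on $T_{cs}$, because multilinear forms separate its points. It
  is realized here as the span of the evaluations \<open>pure cs w\<close>, where \<open>pure cs [x1, ..., xn]\<close>
  is the tensor $x_1 \otimes \cdots \otimes x_n$. The functionals are extended by zero to functions
  that are not multilinear forms.
\<close>

type_synonym ('u, 'v, 'k) tensor = "(('u, 'v) word \<Rightarrow> 'k) \<Rightarrow> 'k"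

abbreviation tscale :: "'k::field \<Rightarrow> ('u, 'v, 'k) tensor \<Rightarrow> ('u, 'v, 'k) tensor" where
  "tscale \<equiv> \<lambda>c \<tau> \<phi>. c * \<tau> \<phi>"

definition forms ::
  "('k::field \<Rightarrow> 'u::ab_group_add \<Rightarrow> 'u) \<Rightarrow> ('k \<Rightarrow> 'v::ab_group_add \<Rightarrow> 'v)
     \<Rightarrow> color list \<Rightarrow> (('u, 'v) word \<Rightarrow> 'k) set" where
  "forms sU sV cs = col_multilin sU sV (*) cs"

definition pure ::
  "('k::field \<Rightarrow> 'u::ab_group_add \<Rightarrow> 'u) \<Rightarrow> ('k \<Rightarrow> 'v::ab_group_add \<Rightarrow> 'v)
     \<Rightarrow> color list \<Rightarrow> ('u, 'v) word \<Rightarrow> ('u, 'v, 'k) tensor" where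
  "pure sU sV cs w = (\<lambda>\<phi>. if \<phi> \<in> forms sU sV cs then \<phi> w else 0)"

definition tensors ::
  "('k::field \<Rightarrow> 'u::ab_group_add \<Rightarrow> 'u) \<Rightarrow> ('k \<Rightarrow> 'v::ab_group_add \<Rightarrow> 'v)
     \<Rightarrow> color list \<Rightarrow> ('u, 'v, 'k) tensor set" where
  "tensors sU sV cs = module.span tscale (pure sU sV cs ` {w. colors w = cs})"

text \<open>
  The tensor product of \<open>\<tau>\<close> in $T_{cs}$ and \<open>\<tau>'\<close> in $T_{ds}$: on decomposable tensors it sends
  \<open>pure cs w\<close> and \<open>pure ds w'\<close> to \<open>pure (cs @ ds) (w @ w')\<close>.
\<close>

definition tensor_mult ::
  "('k::field \<Rightarrow> 'u::ab_group_add \<Rightarrow> 'u) \<Rightarrow> ('k \<Rightarrow> 'v::ab_group_add \<Rightarrow> 'v)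
     \<Rightarrow> color list \<Rightarrow> color list \<Rightarrow> ('u, 'v, 'k) tensor \<Rightarrow> ('u, 'v, 'k) tensor \<Rightarrow> ('u, 'v, 'k) tensor" where
  "tensor_mult sU sV cs ds \<tau> \<tau>' =
     (\<lambda>\<phi>. if \<phi> \<in> forms sU sV (cs @ ds) then \<tau> (\<lambda>w. \<tau>' (\<lambda>w'. \<phi> (w @ w'))) else 0)"

text \<open>
  A linear map out of $T_{cs}$ is given by its values on decomposable tensors, that is, by a
  multilinear map. Since \<open>U\<close> and \<open>V\<close> are ungraded, $\mathrm{End}_T$ is concentrated in degree 0.
\<close>

type_synonym ('u, 'v, 'k) endo = "('u, 'v) word \<Rightarrow> ('u, 'v, 'k) tensor"

definition End_T ::
  "('k::field \<Rightarrow> 'u::ab_group_add \<Rightarrow> 'u) \<Rightarrow> ('k \<Rightarrow> 'v::ab_group_add \<Rightarrow> 'v)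
     \<Rightarrow> color list \<Rightarrow> color list \<Rightarrow> int \<Rightarrow> ('u, 'v, 'k) endo set" where
  "End_T sU sV cs ds p = (if p = 0
     then {f \<in> col_multilin sU sV tscale cs. \<forall>w. f w \<in> tensors sU sV ds}
     else {0})"

definition end_swap ::
  "('k::field \<Rightarrow> 'u::ab_group_add \<Rightarrow> 'u) \<Rightarrow> ('k \<Rightarrow> 'v::ab_group_add \<Rightarrow> 'v)
     \<Rightarrow> color list \<Rightarrow> color list \<Rightarrow> ('u, 'v, 'k) endo" where
  "end_swap sU sV cs ds w =
     pure sU sV (ds @ cs) (drop (length cs) w @ take (length cs) w)"

text \<open>
  The linear extension of a multilinear map \<open>f\<close> sends a tensor \<open>\<tau>\<close> to
  \<open>\<lambda>\<phi>. \<tau> (\<lambda>v. f v \<phi>)\<close>; in particular it sends \<open>pure ds v\<close> to \<open>f v\<close>.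
\<close>

definition end_comp ::
  "('u, 'v, 'k) endo \<Rightarrow> ('u, 'v, 'k) endo \<Rightarrow> ('u, 'v, 'k) endo" where
  "end_comp f g w = (\<lambda>\<phi>. g w (\<lambda>v. f v \<phi>))"

text \<open>Horizontal composition of \<open>f : cs \<rightarrow> ds\<close> and \<open>f' : cs' \<rightarrow> ds'\<close>.\<close>

definition end_tens ::
  "('k::field \<Rightarrow> 'u::ab_group_add \<Rightarrow> 'u) \<Rightarrow> ('k \<Rightarrow> 'v::ab_group_add \<Rightarrow> 'v)
     \<Rightarrow> color list \<Rightarrow> color list \<Rightarrow> color list \<Rightarrow> ('u, 'v, 'k) endo \<Rightarrow> ('u, 'v, 'k) endo
     \<Rightarrow> ('u, 'v, 'k) endo" where
  "end_tens sU sV cs ds ds' f f' w =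
     tensor_mult sU sV ds ds' (f (take (length cs) w)) (f' (drop (length cs) w))"


section \<open>$\mathsf F(E)$-algebra structures on $T$\<close>

text \<open>
  A morphism of differential graded 2-colored PROPs from $\mathsf F(E)$ to $\mathrm{End}_T$: a map
  of the morphism spaces of $\mathsf F(E)$, i.e. a map on typed terms compatible with \<open>prop_eq\<close>,
  that preserves types, degrees and all operations and commutes with the differentials (the
  one of $\mathrm{End}_T$ is zero). Its values at ill-typed terms carry no information and are
  fixed to be \<open>0\<close>.
\<close>

definition FE_algebra ::
  "('k::field \<Rightarrow> 'u::ab_group_add \<Rightarrow> 'u) \<Rightarrow> ('k \<Rightarrow> 'v::ab_group_add \<Rightarrow> 'v)
     \<Rightarrow> ('k pterm \<Rightarrow> ('u, 'v, 'k) endo) \<Rightarrow> bool" where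
  "FE_algebra sU sV \<Phi> \<longleftrightarrow>
     (\<forall>t. (\<nexists>cs ds p. typed t cs ds p) \<longrightarrow> \<Phi> t = 0) \<and>
     (\<forall>s t. s \<simeq> t \<longrightarrow> \<Phi> s = \<Phi> t) \<and>
     (\<forall>t cs ds p. typed t cs ds p \<longrightarrow> \<Phi> t \<in> End_T sU sV cs ds p) \<and>
     (\<forall>s t cs ds p. typed s cs ds p \<longrightarrow> typed t cs ds p \<longrightarrow> \<Phi> (Add s t) = \<Phi> s + \<Phi> t) \<and>
     (\<forall>c s cs ds p. typed s cs ds p \<longrightarrow> \<Phi> (Scale c s) = (\<lambda>w. tscale c (\<Phi> s w))) \<and>
     (\<forall>cs. \<Phi> (Iden cs) = pure sU sV cs) \<and>
     (\<forall>cs ds. \<Phi> (Swap cs ds) = end_swap sU sV cs ds) \<and>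
     (\<forall>s t cs ds es p q. typed s ds es p \<longrightarrow> typed t cs ds q \<longrightarrow>
        \<Phi> (Comp s t) = end_comp (\<Phi> s) (\<Phi> t)) \<and>
     (\<forall>s t cs ds cs' ds' p q. typed s cs ds p \<longrightarrow> typed t cs' ds' q \<longrightarrow>
        \<Phi> (Tens s t) = end_tens sU sV cs ds ds' (\<Phi> s) (\<Phi> t)) \<and>
     (\<forall>t cs ds p. typed t cs ds p \<longrightarrow> \<Phi> (diff t) = 0)"


section \<open>The structure deformed by a degree 1 cochain\<close>

text \<open>The triple (multiplication of \<open>U\<close>, multiplication of \<open>V\<close>, \<open>g\<close>), an element of $C^2_{GS}(g;g)$.\<close>

definition product_cochain :: "'a::ring list \<Rightarrow> 'a" where
  "product_cochain as = (if length as = 2 then as ! 0 * as ! 1 else 0)"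

definition base_structure :: "('u::ring \<Rightarrow> 'v::ring) \<Rightarrow> ('u, 'v) gs_cochain" where
  "base_structure g =
     (product_cochain, product_cochain, \<lambda>as. if length as = 1 then g (as ! 0) else 0)"

text \<open>Multilinear maps $U^{\otimes n} \to U$, $V^{\otimes n} \to V$ and $U^{\otimes n} \to V$ as elements of $\mathrm{End}_T$.\<close>

definition embed_UU ::
  "('k::field \<Rightarrow> 'u::ab_group_add \<Rightarrow> 'u) \<Rightarrow> ('k \<Rightarrow> 'v::ab_group_add \<Rightarrow> 'v)
     \<Rightarrow> ('u list \<Rightarrow> 'u) \<Rightarrow> ('u, 'v, 'k) endo" where
  "embed_UU sU sV m w = (if list_all isl w then pure sU sV [Black] [Inl (m (map projl w))] else 0)"

definition embed_VV ::
  "('k::field \<Rightarrow> 'u::ab_group_add \<Rightarrow> 'u) \<Rightarrow> ('k \<Rightarrow> 'v::ab_group_add \<Rightarrow> 'v)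
     \<Rightarrow> ('v list \<Rightarrow> 'v) \<Rightarrow> ('u, 'v, 'k) endo" where
  "embed_VV sU sV m w =
     (if list_all (\<lambda>x. \<not> isl x) w then pure sU sV [White] [Inr (m (map projr w))] else 0)"

definition embed_UV ::
  "('k::field \<Rightarrow> 'u::ab_group_add \<Rightarrow> 'u) \<Rightarrow> ('k \<Rightarrow> 'v::ab_group_add \<Rightarrow> 'v)
     \<Rightarrow> ('u list \<Rightarrow> 'v) \<Rightarrow> ('u, 'v, 'k) endo" where
  "embed_UV sU sV m w = (if list_all isl w then pure sU sV [White] [Inr (m (map projl w))] else 0)"

text \<open>
  \<open>\<Phi>\<close> is the structure obtained by adding \<open>\<kappa>\<close> to the given structure \<open>(U, V, g)\<close>: the generators
  of degree 0 act by the components of \<open>base_structure g + \<kappa>\<close>. The other generators act by 0 for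
  degree reasons.
\<close>

definition deformed_by ::
  "('k::field \<Rightarrow> 'u::ring \<Rightarrow> 'u) \<Rightarrow> ('k \<Rightarrow> 'v::ring \<Rightarrow> 'v) \<Rightarrow> ('u \<Rightarrow> 'v)
     \<Rightarrow> ('u, 'v) gs_cochain \<Rightarrow> ('k pterm \<Rightarrow> ('u, 'v, 'k) endo) \<Rightarrow> bool" where
  "deformed_by sU sV g \<kappa> \<Phi> \<longleftrightarrow> (case base_structure g + \<kappa> of (mU, mV, f) \<Rightarrow>
     \<Phi> (Gen (Mu 2)) = embed_UU sU sV mU \<and>
     \<Phi> (Gen (Nu 2)) = embed_VV sU sV mV \<and>
     \<Phi> (Gen (Fn 1)) = embed_UV sU sV f)"

end

theory Submission
  imports Defs
begin

text \<open>
  Deformations of the structure \<open>(U, V, g)\<close> are treated with several formal parameters at once: a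
  family indexed by lists of cochains stands for a power series, and products of series become
  convolutions with respect to the graded unshuffle coproduct. If \<open>X\<close> denotes the deformed products
  and \<open>f\<close> the deformed morphism, the structure equations are given by the odd vector field \<open>F\<close> with
  components $X_U \circ X_U$, $X_V \circ X_V$ and $f \circ \hat X_U - X_V \circ e^f$, where $\hat X$ is
  the coderivation extending \<open>X\<close> and $e^f$ the coalgebra morphism extending \<open>f\<close>. Associativity of
  these compositions gives $F \circ F = 0$; up to a degree shift, the multilinear parts of \<open>F\<close> at the
  point \<open>(U, V, g)\<close> are the brackets, and $F \circ F = 0$ is the Jacobi identity. At a degree 1
  element \<open>\<kappa>\<close> the field \<open>F\<close> is cubic, and its vanishing says that \<open>base_structure g + \<kappa>\<close> consists
  of two associative products and a morphism between them.

  On the other side, $\mathrm{End}_T$ is concentrated in degree 0. Hence generators of positive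
  degree act by 0, and compatibility with the differential is a condition only at the generators
  of degree 1, namely \<open>Mu 3\<close>, \<open>Nu 3\<close> and \<open>Fn 2\<close>: again associativity and multiplicativity.
\<close>

section \<open>Signs and signed sums over decompositions\<close>

text \<open>The brackets take arguments of arbitrary degrees, so a power series in one parameter
  does not see the signs of the Jacobi identity. An argument of degree p gets its own parameter of
  parity p - 1; each identity is then multilinear from the start, a sum over splittings of a list
  with one Koszul sign per splitting and no factorials. The degree is stored with the argument,
  since 0 lies in every component. Letters of a word count as odd, as in the bar construction. The
  series e^f is the second obstacle. C^1 contains Hom(k, V) = V, so a component of f can have arity
  0 and a word can be cut into more pieces than it has letters. The number of tensor factors is
  therefore read off from the arity of the map applied to them, which its degree determines. On the
  PROP side tensors are functionals on multilinear forms, and each law becomes an identity between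
  iterated evaluations. A tensor vanishes on functions that are not forms, so every inner function
  has to be shown to be one.\<close>

definition sg :: "int \<Rightarrow> 'a::ab_group_add \<Rightarrow> 'a" where
  "sg n x = (if even n then x else - x)"

lemma sg_sg [simp]: "sg n (sg m x) = sg (n + m) x"
  by (simp add: sg_def)

lemma sg_add: "sg n (x + y) = sg n x + sg n y"
  by (simp add: sg_def)

lemma sg_diff: "sg n (x - y) = sg n x - sg n y"
  by (simp add: sg_def)

lemma sg_0 [simp]: "sg n 0 = 0"
  by (simp add: sg_def)

lemma sg_even: "even n \<Longrightarrow> sg n x = x"
  by (simp add: sg_def)

lemma sg_zero [simp]: "sg 0 x = x"
  by (simp add: sg_def)

lemma sg_one: "sg 1 x = - x"
  by (simp add: sg_def)

lemma sg_cong: "even (n - m) \<Longrightarrow> x = y \<Longrightarrow> sg n x = sg m y"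
  by (auto simp add: sg_def)

lemma sg_cong_nonzero: "(x \<noteq> 0 \<Longrightarrow> even (n - m)) \<Longrightarrow> sg n x = sg m x"
  by (cases "x = 0") (auto simp add: sg_def)

lemma additive_sg: "additive (sg n)"
  by (simp add: additive_def sg_add)

lemma additive_sg_comp: "additive h \<Longrightarrow> h (sg n x) = sg n (h x)"
  by (simp add: sg_def additive.minus)

section \<open>Coproducts: graded unshuffles of the items and deconcatenation of the words\<close>

definition dg :: "(int \<times> 'x) list \<Rightarrow> int" where
  "dg K = (\<Sum>k\<leftarrow>K. fst k - 1)"

lemma dg_simps [simp]: "dg [] = 0" "dg (k # K) = fst k - 1 + dg K" "dg (K @ K') = dg K + dg K'"
  by (simp_all add: dg_def)

text \<open>The graded unshuffle coproduct in continuation style: \<open>H\<close> receives the two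
  parts of each splitting. Putting \<open>k\<close> into the right part moves it past all of
  \<open>I\<close>, which explains the exponent.\<close>

primrec Us :: "(int \<times> 'x) list \<Rightarrow> ((int \<times> 'x) list \<Rightarrow> (int \<times> 'x) list \<Rightarrow> 'm::ab_group_add) \<Rightarrow> 'm"
  where
    "Us [] H = H [] []"
  | "Us (k # K) H = Us K (\<lambda>I J. H (k # I) J) + Us K (\<lambda>I J. sg ((fst k - 1) * dg I) (H I (k # J)))"

lemma Us_cong:
  "(\<And>I J. dg K = dg I + dg J \<Longrightarrow> length I + length J = length K \<Longrightarrow> H I J = H' I J)
     \<Longrightarrow> Us K H = Us K H'"
proof (induction K arbitrary: H H')
  case (Cons k K)
  show ?case
    by (simp, intro arg_cong2[of _ _ _ _ "(+)"] Cons.IH) (auto intro!: sg_cong Cons.prems)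
qed simp

lemma Us_additive: "additive h \<Longrightarrow> h (Us K H) = Us K (\<lambda>I J. h (H I J))"
  by (induction K arbitrary: H) (simp_all add: additive.add additive_sg_comp)

lemma Us_add: "Us K (\<lambda>I J. H I J + H' I J) = Us K H + Us K H'"
  by (induction K arbitrary: H H') (simp_all add: sg_add)

lemma Us_sg: "Us K (\<lambda>I J. sg n (H I J)) = sg n (Us K H)"
  by (rule Us_additive[symmetric]) (rule additive_sg)

lemma Us_0 [simp]: "Us K (\<lambda>I J. 0) = 0"
  by (induction K) simp_all

lemma Us_minus: "Us K (\<lambda>I J. - H I J) = - Us K H"
  using Us_sg[of K 1 H] by (simp add: sg_one)

lemma Us_diff: "Us K (\<lambda>I J. H I J - H' I J) = Us K H - Us K H'"
  using Us_add[of K H "\<lambda>I J. - H' I J"] by (simp add: Us_minus)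

lemma Us_sum: "Us K (\<lambda>I J. \<Sum>r\<in>R. H r I J) = (\<Sum>r\<in>R. Us K (H r))"
  by (induction R rule: infinite_finite_induct) (simp_all add: Us_add)

text \<open>Coassociativity. An item that ends up in the last part passes \<open>A\<close> and
  \<open>B\<close> at once or one after the other; the signs agree because \<open>dg\<close> is
  additive on splittings, a fact that \<open>Us_cong\<close> supplies.\<close>

lemma Us_assoc:
  "Us K (\<lambda>I J. Us I (\<lambda>A B. H A B J)) = Us K (\<lambda>A R. Us R (\<lambda>B J. H A B J))"
proof (induction K arbitrary: H)
  case (Cons k K)
  let ?d = "fst k - 1"
  have "Us K (\<lambda>I J. sg (?d * dg I) (Us I (\<lambda>A B. H A B (k # J))))
      = Us K (\<lambda>I J. Us I (\<lambda>A B. sg (?d * dg A + ?d * dg B) (H A B (k # J))))"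
    unfolding Us_sg[symmetric]
    by (intro Us_cong sg_cong refl) (auto simp: algebra_simps)
  then show ?case
    by (simp add: Us_add Cons.IH Us_sg[symmetric] sg_add add.assoc)
qed simp

text \<open>Graded cocommutativity. In \<open>comp_comp\<close> it makes two insertions at disjoint
  places cancel.\<close>

lemma Us_comm: "Us K H = Us K (\<lambda>I J. sg (dg I * dg J) (H J I))"
proof (induction K arbitrary: H)
  case (Cons k K)
  have "Us K (\<lambda>I J. H (k # I) J) = Us K (\<lambda>I J. sg (dg I * dg J) (H (k # J) I))"
    by (rule Cons.IH)
  also have "\<dots> = Us K (\<lambda>I J. sg ((fst k - 1) * dg I) (sg (dg I * dg (k # J)) (H (k # J) I)))"
    by (intro Us_cong) (auto intro!: sg_cong simp: algebra_simps)
  finally have 1: "Us K (\<lambda>I J. H (k # I) J) = \<dots>" .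
  have "Us K (\<lambda>I J. sg ((fst k - 1) * dg I) (H I (k # J)))
      = Us K (\<lambda>I J. sg (dg I * dg J + (fst k - 1) * dg J) (H J (k # I)))"
    by (subst Cons.IH) simp
  also have "\<dots> = Us K (\<lambda>I J. sg (dg (k # I) * dg J) (H J (k # I)))"
    by (intro Us_cong) (auto intro!: sg_cong simp: algebra_simps)
  finally show ?case using 1 by (simp add: add.commute)
qed simp

lemma Us_swap:
  "Us K (\<lambda>A R. Us R (\<lambda>B J. H A B J)) = Us K (\<lambda>B R. Us R (\<lambda>A J. sg (dg A * dg B) (H A B J)))"
proof -
  have "Us K (\<lambda>A R. Us R (\<lambda>B J. H A B J)) = Us K (\<lambda>I J. Us I (\<lambda>A B. H A B J))"
    by (rule Us_assoc[symmetric])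
  also have "\<dots> = Us K (\<lambda>I J. Us I (\<lambda>B A. sg (dg B * dg A) (H A B J)))"
    by (subst (2) Us_comm) simp
  finally show ?thesis by (simp add: Us_assoc mult.commute)
qed

lemma Us_swap23:
  "Us K (\<lambda>I R. Us R (\<lambda>A J. H I A J)) = Us K (\<lambda>I R. Us R (\<lambda>J A. sg (dg A * dg J) (H I A J)))"
  by (subst (2) Us_comm) (simp add: mult.commute)

lemma Us_Nil_left: "Us K (\<lambda>I J. if I = [] then h J else 0) = h K"
  by (induction K arbitrary: h) (simp_all add: if_distrib[of "sg _"] cong: if_cong)

lemma Us_Nil_right: "Us K (\<lambda>I J. if J = [] then h I else 0) = h K"
  by (induction K arbitrary: h) (simp_all add: if_distrib[of "sg _"] cong: if_cong)

text \<open>Empty pieces are included, since maps of arity 0 occur and take in an empty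
  piece.\<close>

primrec Dc :: "'a list \<Rightarrow> ('a list \<Rightarrow> 'a list \<Rightarrow> 'm::ab_group_add) \<Rightarrow> 'm" where
  "Dc [] H = H [] []"
| "Dc (a # w) H = H [] (a # w) + Dc w (\<lambda>u v. H (a # u) v)"

lemma Dc_cong: "(\<And>u v. u @ v = w \<Longrightarrow> H u v = H' u v) \<Longrightarrow> Dc w H = Dc w H'"
proof (induction w arbitrary: H H')
  case (Cons a w)
  show ?case by (simp, intro arg_cong2[of _ _ _ _ "(+)"] Cons.IH) (auto intro!: Cons.prems)
qed simp

lemma Dc_additive: "additive h \<Longrightarrow> h (Dc w H) = Dc w (\<lambda>u v. h (H u v))"
  by (induction w arbitrary: H) (simp_all add: additive.add)

lemma Dc_add: "Dc w (\<lambda>u v. H u v + H' u v) = Dc w H + Dc w H'"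
  by (induction w arbitrary: H H') simp_all

lemma Dc_sg: "Dc w (\<lambda>u v. sg n (H u v)) = sg n (Dc w H)"
  by (rule Dc_additive[symmetric]) (rule additive_sg)

lemma Dc_0 [simp]: "Dc w (\<lambda>u v. 0) = 0"
  by (induction w) simp_all

lemma Dc_assoc:
  "Dc w (\<lambda>u v. Dc u (\<lambda>u1 u2. H u1 u2 v)) = Dc w (\<lambda>u1 r. Dc r (\<lambda>u2 v. H u1 u2 v))"
  by (induction w arbitrary: H) (simp_all add: Dc_add add.assoc)

lemma Dc_Us: "Dc w (\<lambda>u v. Us K (\<lambda>I J. H u v I J)) = Us K (\<lambda>I J. Dc w (\<lambda>u v. H u v I J))"
  by (induction w arbitrary: H) (simp_all add: Us_add)

text \<open>The coproduct of pairs: moving the second part \<open>J\<close> of the items past \<open>u\<close> costs a sign.\<close>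

definition Cp :: "(int \<times> 'x) list \<Rightarrow> 'a list
    \<Rightarrow> ((int \<times> 'x) list \<Rightarrow> 'a list \<Rightarrow> (int \<times> 'x) list \<Rightarrow> 'a list \<Rightarrow> 'm::ab_group_add) \<Rightarrow> 'm" where
  "Cp K w H = Us K (\<lambda>I J. Dc w (\<lambda>u v. sg (dg J * int (length u)) (H I u J v)))"

lemma Cp_cong:
  "(\<And>I u J v. dg K = dg I + dg J \<Longrightarrow> length I + length J = length K \<Longrightarrow> u @ v = w
      \<Longrightarrow> H I u J v = H' I u J v) \<Longrightarrow> Cp K w H = Cp K w H'"
  unfolding Cp_def by (intro Us_cong Dc_cong sg_cong) auto

lemma Cp_additive: "additive h \<Longrightarrow> h (Cp K w H) = Cp K w (\<lambda>I u J v. h (H I u J v))"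
  unfolding Cp_def by (simp add: Us_additive Dc_additive additive_sg_comp)

lemma Cp_add: "Cp K w (\<lambda>I u J v. H I u J v + H' I u J v) = Cp K w H + Cp K w H'"
  unfolding Cp_def by (simp add: sg_add Dc_add Us_add)

lemma Cp_0 [simp]: "Cp K w (\<lambda>I u J v. 0) = 0"
  by (simp add: Cp_def)

lemma Cp_sg: "Cp K w (\<lambda>I u J v. sg n (H I u J v)) = sg n (Cp K w H)"
  by (rule Cp_additive[symmetric]) (rule additive_sg)

lemma Cp_sum: "Cp K w (\<lambda>I u J v. \<Sum>r\<in>R. H r I u J v) = (\<Sum>r\<in>R. Cp K w (H r))"
  by (induction R rule: infinite_finite_induct) (simp_all add: Cp_add)

text \<open>Both sides run over the same threefold splittings, and a letter passes every item of a
  later part in either bracketing.\<close>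

lemma Cp_assoc:
  "Cp K w (\<lambda>I u J v. Cp I u (\<lambda>I1 u1 I2 u2. H I1 u1 I2 u2 J v))
     = Cp K w (\<lambda>I1 u1 R r. Cp R r (\<lambda>I2 u2 J v. H I1 u1 I2 u2 J v))"
proof -
  have "Cp K w (\<lambda>I u J v. Cp I u (\<lambda>I1 u1 I2 u2. H I1 u1 I2 u2 J v))
    = Us K (\<lambda>I J. Us I (\<lambda>I1 I2. Dc w (\<lambda>u v. Dc u (\<lambda>u1 u2.
        sg (dg J * int (length u1) + dg J * int (length u2) + dg I2 * int (length u1)) (H I1 u1 I2 u2 J v)))))"
    unfolding Cp_def Dc_Us Us_sg[symmetric] Dc_sg[symmetric]
    by (intro Us_cong Dc_cong) (auto intro!: sg_cong simp: algebra_simps)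
  also have "\<dots> = Us K (\<lambda>I1 R. Us R (\<lambda>I2 J. Dc w (\<lambda>u1 r. Dc r (\<lambda>u2 v.
        sg (dg J * int (length u1) + dg J * int (length u2) + dg I2 * int (length u1)) (H I1 u1 I2 u2 J v)))))"
    by (simp add: Us_assoc Dc_assoc)
  also have "\<dots> = Cp K w (\<lambda>I1 u1 R r. Cp R r (\<lambda>I2 u2 J v. H I1 u1 I2 u2 J v))"
    unfolding Cp_def Dc_Us Us_sg[symmetric] Dc_sg[symmetric]
    by (intro Us_cong Dc_cong) (auto intro!: sg_cong simp: algebra_simps)
  finally show ?thesis .
qed

section \<open>Coderivations of the tensor coalgebra and their composites\<close>

definition madd :: "('a::ab_group_add list \<Rightarrow> 'm::ab_group_add) \<Rightarrow> bool" where
  "madd \<phi> \<longleftrightarrow> (\<forall>u v. additive (\<lambda>a. \<phi> (u @ a # v)))"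

lemma madd_additive: "madd \<phi> \<Longrightarrow> additive (\<lambda>a. \<phi> (u @ a # v))"
  by (simp add: madd_def)

lemma madd_additive_hd: "madd \<phi> \<Longrightarrow> additive (\<lambda>a. \<phi> (a # v))"
  using madd_additive[of \<phi> "[]"] by simp

lemma madd_0: "madd \<phi> \<Longrightarrow> \<phi> (u @ 0 # v) = 0"
  by (erule madd_additive[THEN additive.zero])

lemma madd_0_hd: "madd \<phi> \<Longrightarrow> \<phi> (0 # v) = 0"
  using madd_0[of \<phi> "[]"] by simp

lemma madd_Cons:
  assumes "madd \<phi>"
  shows "madd (\<lambda>v. \<phi> (a # v))"
  unfolding madd_def
proof (intro allI)
  fix u v
  show "additive (\<lambda>b. \<phi> (a # u @ b # v))"
    using madd_additive[OF assms, of "a # u" v] by simp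
qed

text \<open>The composite of \<open>\<phi>\<close> with the coderivation extending \<open>y\<close>:
  every contiguous piece \<open>u\<close> of the word, possibly empty, is replaced by the letter
  \<open>y u\<close>. The integer \<open>q\<close> is the degree of \<open>y\<close>, and each
  letter passed contributes one sign of that parity.\<close>

primrec hat :: "int \<Rightarrow> ('a list \<Rightarrow> 'a) \<Rightarrow> ('a list \<Rightarrow> 'm::ab_group_add) \<Rightarrow> 'a list \<Rightarrow> 'm" where
  "hat q y \<phi> [] = \<phi> [y []]"
| "hat q y \<phi> (a # w) = Dc (a # w) (\<lambda>u v. \<phi> (y u # v)) + sg q (hat q y (\<lambda>v. \<phi> (a # v)) w)"

lemma hat_unfold:
  "hat q y \<phi> w = Dc w (\<lambda>u v. \<phi> (y u # v))
     + (case w of [] \<Rightarrow> 0 | a # w' \<Rightarrow> sg q (hat q y (\<lambda>v. \<phi> (a # v)) w'))"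
  by (cases w) simp_all

lemma hat_additive: "additive h \<Longrightarrow> h (hat q y \<phi> w) = hat q y (\<lambda>v. h (\<phi> v)) w"
  by (induction w arbitrary: \<phi>) (simp_all add: additive.add additive_sg_comp Dc_additive)

lemma hat_add: "hat q y (\<lambda>v. \<phi> v + \<phi>' v) w = hat q y \<phi> w + hat q y \<phi>' w"
  by (induction w arbitrary: \<phi> \<phi>') (simp_all add: sg_add Dc_add)

lemma hat_0 [simp]: "hat q y (\<lambda>v. 0) w = 0"
  by (induction w) simp_all

lemma hat_sg: "hat q y (\<lambda>v. sg n (\<phi> v)) w = sg n (hat q y \<phi> w)"
  by (rule hat_additive[symmetric]) (rule additive_sg)

lemma hat_Us: "hat q y (\<lambda>v. Us K (\<lambda>I J. \<phi> I J v)) w = Us K (\<lambda>I J. hat q y (\<phi> I J) w)"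
  by (induction w arbitrary: \<phi>) (simp_all add: Us_add Us_sg Dc_Us)

lemma hat_diff: "hat q y (\<lambda>v. \<phi> v - \<phi>' v) w = hat q y \<phi> w - hat q y \<phi>' w"
  using hat_add[of q y \<phi> "\<lambda>v. sg 1 (\<phi>' v)" w] by (simp only: hat_sg) (simp add: sg_one)

lemma hat_Us_left:
  "madd \<phi> \<Longrightarrow> hat q (\<lambda>v. Us K (\<lambda>I J. y I J v)) \<phi> w = Us K (\<lambda>I J. hat q (y I J) \<phi> w)"
proof (induction w arbitrary: \<phi>)
  case Nil
  show ?case by (simp add: Us_additive[OF madd_additive_hd[OF Nil]])
next
  case (Cons a w)
  show ?case
    by (simp add: Us_additive[OF madd_additive_hd[OF Cons.prems]] Us_add Us_sg Dc_Us
        Cons.IH[OF madd_Cons[OF Cons.prems]])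
qed

lemma hat_sg_left: "madd \<phi> \<Longrightarrow> hat q (\<lambda>v. sg n (y v)) \<phi> w = sg n (hat q y \<phi> w)"
proof (induction w arbitrary: \<phi>)
  case Nil
  show ?case by (simp add: additive_sg_comp[OF madd_additive_hd[OF Nil]])
next
  case (Cons a w)
  show ?case
    by (simp add: additive_sg_comp[OF madd_additive_hd[OF Cons.prems]] sg_add Dc_sg add.commute
        Cons.IH[OF madd_Cons[OF Cons.prems]])
qed

lemma hat_0_left: "madd \<phi> \<Longrightarrow> hat q (\<lambda>v. 0) \<phi> w = 0"
  by (induction w arbitrary: \<phi>) (simp_all add: madd_0_hd madd_Cons)

lemma hat_cong: "(\<And>v. \<phi> v = \<phi>' v) \<Longrightarrow> hat q y \<phi> w = hat q y \<phi>' w"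
  by presburger

lemma hat_sg_parity: "even (q - q') \<Longrightarrow> hat q y \<phi> w = hat q' y \<phi> w"
  by (induction w arbitrary: \<phi>) (auto intro!: sg_cong)

text \<open>A piece whose length is congruent to q + 1 becomes a single letter, so the insertion
  changes the length of the word by q modulo 2. A sign that depends on the length thus leaves the
  sum as a constant. Pieces on which \<open>y\<close> vanishes are harmless because
  \<open>\<phi>\<close> kills the letter 0.\<close>

lemma hat_length_sg:
  assumes "\<And>v. y v \<noteq> 0 \<Longrightarrow> even (q + int (length v) + 1)"
    and "\<And>u v. \<phi> (u @ 0 # v) = 0"
  shows "hat q y (\<lambda>v. sg (n * int (length v)) (\<phi> v)) w
    = sg (n * (int (length w) + q)) (hat q y \<phi> w)"
  using assms(2)
proof (induction w arbitrary: \<phi> n)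
  case Nil
  have *: "odd q" if "\<phi> [y []] \<noteq> 0"
    using assms(1)[of "[]"] that Nil[of "[]" "[]"] by (cases "y [] = 0") auto
  then show ?case by (auto intro!: sg_cong_nonzero)
next
  case (Cons a w)
  have Z: "\<phi> (0 # v) = 0" for v using Cons.prems[of "[]"] by simp
  have 1: "sg (n * int (length (y u # v))) (\<phi> (y u # v))
      = sg (n * (int (length (a # w)) + q)) (\<phi> (y u # v))" if "u @ v = a # w" for u v
  proof (cases "y u = 0")
    case False
    have "length (a # w) = length u + length v" by (simp flip: that)
    then show ?thesis using assms(1)[OF False] by (intro sg_cong) auto
  qed (simp add: Z)
  have 2: "hat q y (\<lambda>v. sg (n * int (length (a # v))) (\<phi> (a # v))) w
      = sg (n * (int (length (a # w)) + q)) (hat q y (\<lambda>v. \<phi> (a # v)) w)"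
  proof -
    have "hat q y (\<lambda>v. sg (n * int (length (a # v))) (\<phi> (a # v))) w
        = sg n (hat q y (\<lambda>v. sg (n * int (length v)) (\<phi> (a # v))) w)"
      unfolding hat_sg[symmetric] by (intro hat_cong) (simp add: algebra_simps)
    also have "\<dots> = sg n (sg (n * (int (length w) + q)) (hat q y (\<lambda>v. \<phi> (a # v)) w))"
      by (subst Cons.IH) (auto simp: Cons.prems[of "a # u" for u, simplified])
    finally show ?thesis by (simp add: algebra_simps)
  qed
  show ?case
    unfolding hat.simps Dc_sg[symmetric] sg_add 2
    by (intro arg_cong2[of _ _ _ _ "(+)"] Dc_cong 1) (simp_all only: sg_sg add.commute)
qed

text \<open>The coderivation property: when the word is cut after the insertion, the new letter lies
  left or right of the cut, and in the second case \<open>y\<close> has passed all of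
  \<open>u\<close>.\<close>

lemma hat_Dc:
  "hat q y (\<lambda>w. Dc w H) w
     = Dc w (\<lambda>u v. hat q y (\<lambda>u. H u v) u + sg (q * int (length u)) (hat q y (H u) v))"
proof (induction w arbitrary: H)
  case (Cons a w)
  have "Dc (a # w) (\<lambda>u v. Dc (y u # v) H)
      = Dc (a # w) (\<lambda>u v. H [] (y u # v)) + Dc (a # w) (\<lambda>U v. Dc U (\<lambda>u1 u2. H (y u1 # u2) v))"
    by (simp only: Dc.simps(2)[of "y _"] Dc_add Dc_assoc)
  moreover have "hat q y (\<lambda>v. Dc (a # v) H) w
      = hat q y (\<lambda>v. H [] (a # v)) w
        + Dc w (\<lambda>u v. hat q y (\<lambda>u. H (a # u) v) u + sg (q * int (length u)) (hat q y (H (a # u)) v))"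
    by (simp add: hat_add Cons.IH)
  ultimately show ?case
    by (simp add: Dc_add sg_add Dc_sg[symmetric] algebra_simps)
qed simp

text \<open>Inserting \<open>z\<close> and, strictly to the right of it, \<open>y\<close>.\<close>

primrec hat2 ::
  "int \<Rightarrow> ('a list \<Rightarrow> 'a) \<Rightarrow> int \<Rightarrow> ('a list \<Rightarrow> 'a) \<Rightarrow> ('a list \<Rightarrow> 'm::ab_group_add) \<Rightarrow> 'a list \<Rightarrow> 'm" where
  "hat2 q y q' z \<phi> [] = hat q y (\<lambda>v. \<phi> (z [] # v)) []"
| "hat2 q y q' z \<phi> (a # w) =
     Dc (a # w) (\<lambda>u v. sg (q * int (length u)) (hat q y (\<lambda>v. \<phi> (z u # v)) v))
     + sg (q + q') (hat2 q y q' z (\<lambda>v. \<phi> (a # v)) w)"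

text \<open>Of two successive insertions, \<open>z\<close> either takes in the letter made by
  \<open>y\<close>, or the two act on disjoint pieces in one of two orders. The parity hypothesis on
  \<open>y\<close> is used when \<open>y\<close> acts on the left: \<open>z\<close> then passes one
  letter instead of the piece that it replaced.\<close>

lemma hat_hat:
  assumes y: "\<And>v. y v \<noteq> 0 \<Longrightarrow> even (q + int (length v) + 1)"
    and "madd \<phi>"
  shows "hat q y (hat q' z \<phi>) w = hat (q + q') (hat q y z) \<phi> w
    + hat2 q y q' z \<phi> w + sg (q * q') (hat2 q' z q y \<phi> w)"
  using assms(2)
proof (induction w arbitrary: \<phi>)
  let ?tl = "\<lambda>\<phi> w. case w of [] \<Rightarrow> 0 | a # w' \<Rightarrow> sg q' (hat q' z (\<lambda>v. \<phi> (a # v)) w')"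
  let ?tl2 = "\<lambda>q y q' z \<phi> w. case w of [] \<Rightarrow> 0 | a # w' \<Rightarrow> sg (q + q') (hat2 q y q' z (\<lambda>v. \<phi> (a # v)) w')"
  \<comment> \<open>Unfolding both insertions once separates those that involve the front of the
    word from those that happen entirely behind its first letter; the latter are left to the
    induction.\<close>
  have key: "hat q y (hat q' z \<phi>) w
      = Dc w (\<lambda>u v. \<phi> (hat q y z u # v))
        + Dc w (\<lambda>u v. sg (q * int (length u)) (hat q y (\<lambda>v. \<phi> (z u # v)) v))
        + sg (q * q') (Dc w (\<lambda>u v. sg (q' * int (length u)) (hat q' z (\<lambda>v. \<phi> (y u # v)) v)))
        + (case w of [] \<Rightarrow> 0 | a # w' \<Rightarrow> sg (q + q') (hat q y (hat q' z (\<lambda>v. \<phi> (a # v))) w'))"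
    if \<phi>: "madd \<phi>" for \<phi> w
  proof -
    have 1: "hat q y (\<lambda>w. Dc w (\<lambda>u v. \<phi> (z u # v))) w
      = Dc w (\<lambda>u v. \<phi> (hat q y z u # v))
        + Dc w (\<lambda>u v. sg (q * int (length u)) (hat q y (\<lambda>v. \<phi> (z u # v)) v))"
      unfolding hat_Dc Dc_add hat_additive[OF madd_additive_hd[OF \<phi>]] ..
    have 2: "Dc w (\<lambda>u v. ?tl \<phi> (y u # v))
      = sg (q * q') (Dc w (\<lambda>u v. sg (q' * int (length u)) (hat q' z (\<lambda>v. \<phi> (y u # v)) v)))"
    proof -
      have "sg q' (hat q' z (\<lambda>v. \<phi> (y u # v)) v)
          = sg (q * q' + q' * int (length u)) (hat q' z (\<lambda>v. \<phi> (y u # v)) v)" for u v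
      proof (cases "y u = 0")
        case False
        show ?thesis by (intro sg_cong) (use y[OF False] in auto)
      qed (simp add: madd_0_hd[OF \<phi>])
      then show ?thesis unfolding Dc_sg[symmetric] by simp
    qed
    have 3: "hat q y (?tl \<phi>) w = Dc w (\<lambda>u v. ?tl \<phi> (y u # v))
      + (case w of [] \<Rightarrow> 0 | a # w' \<Rightarrow> sg (q + q') (hat q y (hat q' z (\<lambda>v. \<phi> (a # v))) w'))"
      by (subst hat_unfold) (auto simp: hat_sg split: list.split)
    have "hat q y (hat q' z \<phi>) w = hat q y (\<lambda>w. Dc w (\<lambda>u v. \<phi> (z u # v)) + ?tl \<phi> w) w"
      by (intro hat_cong hat_unfold)
    then show ?thesis by (simp only: hat_add 1 2 3 add.assoc)
  qed
  {
    case Nil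
    show ?case unfolding key[OF Nil] by simp
  next
    case (Cons a w)
    show ?case
      unfolding key[OF Cons.prems] by (simp add: Cons.IH[OF madd_Cons[OF Cons.prems]] sg_add algebra_simps)
  }
qed

text \<open>Convolution composite of \<open>\<Psi>\<close> with the coderivation of
  \<open>X\<close>. The family \<open>X\<close> has degree q, and the sign lets it pass the items
  that go to \<open>\<Psi>\<close>.\<close>

definition comp ::
  "int \<Rightarrow> ((int \<times> 'x) list \<Rightarrow> 'a list \<Rightarrow> 'a) \<Rightarrow> ((int \<times> 'x) list \<Rightarrow> 'a list \<Rightarrow> 'm::ab_group_add)
     \<Rightarrow> (int \<times> 'x) list \<Rightarrow> 'a list \<Rightarrow> 'm" where
  "comp q X \<Psi> K w = Us K (\<lambda>I J. sg (q * dg I) (hat (q + dg J) (X J) (\<Psi> I) w))"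

lemma comp_additive: "additive h \<Longrightarrow> h (comp q X \<Psi> K w) = comp q X (\<lambda>K w. h (\<Psi> K w)) K w"
  by (simp add: comp_def Us_additive additive_sg_comp hat_additive)

lemma comp_diff: "comp q X (\<lambda>K w. \<Psi> K w - \<Psi>' K w) K w = comp q X \<Psi> K w - comp q X \<Psi>' K w"
  by (simp add: comp_def hat_diff sg_diff Us_diff)

text \<open>The square of an odd coderivation is again a coderivation: the two orders of a disjoint
  pair of insertions carry opposite signs and are matched by cocommutativity, so only nested
  insertions remain. They are counted once, hence no factor 1/2.\<close>

lemma comp_comp:
  assumes X: "\<And>J v. X J v \<noteq> 0 \<Longrightarrow> even (dg J + int (length v))"
    and \<Psi>: "\<And>A. madd (\<Psi> A)"
  shows "comp 1 X (comp 1 X \<Psi>) K w = comp 0 (comp 1 X X) \<Psi> K w"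
proof -
  let ?y = "\<lambda>J. 1 + dg J"
  have "comp 1 X (comp 1 X \<Psi>) K w
      = Us K (\<lambda>I J. Us I (\<lambda>A B. sg (dg B) (hat (?y J) (X J) (hat (?y B) (X B) (\<Psi> A)) w)))"
    unfolding comp_def hat_Us hat_sg Us_sg[symmetric]
    by (intro Us_cong) (auto intro!: sg_cong)
  also have "\<dots> = Us K (\<lambda>A R. Us R (\<lambda>B J. sg (dg B) (hat (?y J) (X J) (hat (?y B) (X B) (\<Psi> A)) w)))"
    by (rule Us_assoc)
  also have "\<dots> = Us K (\<lambda>A R. hat (dg R) (comp 1 X X R) (\<Psi> A) w)"
  proof (intro Us_cong, goal_cases)
    case (1 A R)
    let ?T = "\<lambda>B J. sg (dg B) (hat2 (?y J) (X J) (?y B) (X B) (\<Psi> A) w)"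
    let ?T' = "\<lambda>B J. sg (dg B + ?y J * ?y B) (hat2 (?y B) (X B) (?y J) (X J) (\<Psi> A) w)"
    have "Us R (\<lambda>B J. sg (dg B) (hat (?y J) (X J) (hat (?y B) (X B) (\<Psi> A)) w))
        = Us R (\<lambda>B J. hat (dg R) (\<lambda>w. sg (dg B) (hat (?y J) (X J) (X B) w)) (\<Psi> A) w) + (Us R ?T + Us R ?T')"
      unfolding Us_add[symmetric]
    proof (intro Us_cong, goal_cases)
      case (1 B J)
      show ?case
        by (subst hat_hat)
          (use X in \<open>auto simp: \<Psi> sg_add hat_sg_left 1 add.assoc
             intro!: arg_cong2[of _ _ _ _ "(+)"] sg_cong hat_sg_parity\<close>)
    qed
    moreover have "Us R ?T' = - Us R ?T"
      unfolding Us_minus[symmetric]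
      by (subst Us_comm) (auto simp: sg_one[symmetric] intro!: Us_cong sg_cong)
    ultimately show ?case
      unfolding comp_def by (simp add: hat_Us_left[OF \<Psi>])
  qed
  finally show ?thesis by (simp add: comp_def)
qed

text \<open>The coderivation property for families. When \<open>X\<close> acts on the right factor
  it has passed the items and the letters of the left one, each letter being odd.\<close>

lemma comp_Cp:
  assumes X: "\<And>J v. X J v \<noteq> 0 \<Longrightarrow> even (dg J + int (length v))"
    and H: "\<And>I u1 u2 J v. H I (u1 @ 0 # u2) J v = 0"
  shows "comp 1 X (\<lambda>K w. Cp K w H) K w = Cp K w (\<lambda>I u J v.
     comp 1 X (\<lambda>I u. H I u J v) I u + sg (dg I + int (length u)) (comp 1 X (H I u) J v))"
proof -
  let ?h = "\<lambda>J. hat (1 + dg J) (X J)"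
  \<comment> \<open>Cocommutativity moves the items of \<open>X\<close>, which stand last, next to
    those of the left factor on which \<open>X\<close> acts.\<close>
  have sw: "Us K (\<lambda>I1 R. Us R (\<lambda>I2 J. sg (dg J * dg I2) (G I1 I2 J)))
      = Us K (\<lambda>S I2. Us S (\<lambda>I1 J. G I1 I2 J))" for G :: "_ \<Rightarrow> _ \<Rightarrow> _ \<Rightarrow> 'c"
    unfolding Us_assoc by (rule Us_swap23[symmetric])
  have 1: "?h J (\<lambda>w. Dc w (\<lambda>u v. sg (dg I2 * int (length u)) (H I1 u I2 v))) w
      = Dc w (\<lambda>u v. sg (dg I2 * (int (length u) + (1 + dg J))) (?h J (\<lambda>u. H I1 u I2 v) u)
          + sg ((1 + dg J) * int (length u) + dg I2 * int (length u)) (?h J (H I1 u I2) v))" for I1 I2 J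
    unfolding hat_Dc hat_sg sg_sg
    by (intro Dc_cong arg_cong2[of _ _ _ _ "(+)"] refl hat_length_sg) (use X in \<open>auto simp: H\<close>)
  have "comp 1 X (\<lambda>K w. Cp K w H) K w
     = Us K (\<lambda>I J. Us I (\<lambda>I1 I2. Dc w (\<lambda>u v.
          sg (dg I + dg I2 * (int (length u) + (1 + dg J))) (?h J (\<lambda>u. H I1 u I2 v) u)
          + sg (dg I + (1 + dg J + dg I2) * int (length u)) (?h J (H I1 u I2) v))))"
    unfolding comp_def Cp_def hat_Us 1 Us_sg[symmetric] Dc_sg[symmetric] sg_add
    by (auto intro!: Us_cong Dc_cong arg_cong2[of _ _ _ _ "(+)"] sg_cong)
  also have "\<dots> = Us K (\<lambda>I J. Us I (\<lambda>I1 I2. sg (dg I2 * dg J) (Dc w (\<lambda>u v.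
          sg (dg I1 + dg I2 * int (length u)) (?h J (\<lambda>u. H I1 u I2 v) u)))))
      + Us K (\<lambda>I J. Us I (\<lambda>I1 I2. Dc w (\<lambda>u v.
          sg (dg I1 + int (length u) + (dg I2 + dg J) * int (length u) + dg I2) (?h J (H I1 u I2) v))))"
    unfolding Us_add[symmetric] Dc_sg[symmetric] Dc_add[symmetric] sg_sg
    by (intro Us_cong Dc_cong arg_cong2[of _ _ _ _ "(+)"] sg_cong refl) auto
  also have "\<dots> = Us K (\<lambda>I1 R. Us R (\<lambda>I2 J. sg (dg J * dg I2) (Dc w (\<lambda>u v.
          sg (dg I1 + dg I2 * int (length u)) (?h J (\<lambda>u. H I1 u I2 v) u)))))
      + Us K (\<lambda>I1 R. Us R (\<lambda>I2 J. Dc w (\<lambda>u v.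
          sg (dg I1 + int (length u) + dg R * int (length u) + dg I2) (?h J (H I1 u I2) v))))"
    unfolding Us_assoc
    by (intro arg_cong2[of _ _ _ _ "(+)"] Us_cong Dc_cong sg_cong) (auto simp: mult.commute)
  also have "\<dots> = Us K (\<lambda>I J. Us I (\<lambda>I1 I2. Dc w (\<lambda>u v.
          sg (dg I1 + dg J * int (length u)) (?h I2 (\<lambda>u. H I1 u J v) u))))
      + Us K (\<lambda>I1 R. Us R (\<lambda>I2 J. Dc w (\<lambda>u v.
          sg (dg I1 + int (length u) + dg R * int (length u) + dg I2) (?h J (H I1 u I2) v))))"
    by (simp only: sw)
  also have "\<dots> = Cp K w (\<lambda>I u J v.
     comp 1 X (\<lambda>I u. H I u J v) I u + sg (dg I + int (length u)) (comp 1 X (H I u) J v))"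
    unfolding Cp_def comp_def sg_add Dc_add Us_add Us_sg[symmetric] Dc_Us Dc_sg[symmetric]
    by (intro arg_cong2[of _ _ _ _ "(+)"] Us_cong Dc_cong) (auto intro!: sg_cong)
  finally show ?thesis .
qed

section \<open>Tensor powers of a family and their derivatives\<close>

lemma Us_Cp_assoc:
  "Us K (\<lambda>B R. Cp R w (\<lambda>I u J v. G B I u J v)) = Cp K w (\<lambda>S u J v. Us S (\<lambda>B I. G B I u J v))"
  unfolding Cp_def Dc_Us Us_sg[symmetric] by (simp add: Us_assoc)

lemma Us_Cp_swap:
  "Us K (\<lambda>B R. Cp R w (\<lambda>I u J v. G B I u J v))
     = Cp K w (\<lambda>I u S v. Us S (\<lambda>B J. sg (dg B * (dg I + int (length u))) (G B I u J v)))"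
  unfolding Cp_def Dc_Us Us_sg[symmetric]
  by (subst Us_swap) (auto simp: Dc_sg[symmetric] algebra_simps intro!: Us_cong Dc_cong sg_cong)

lemma Dc_Nil_right: "Dc w (\<lambda>u v. if v = [] then h u else 0) = h w"
  by (induction w arbitrary: h) (simp_all cong: if_cong)

lemma Cp_counit_right: "Cp K w (\<lambda>I u J v. if J = [] \<and> v = [] then h I u else 0) = h K w"
proof -
  have "Cp K w (\<lambda>I u J v. if J = [] \<and> v = [] then h I u else 0)
      = Us K (\<lambda>I J. if J = [] then Dc w (\<lambda>u v. if v = [] then h I u else 0) else 0)"
    unfolding Cp_def by (intro Us_cong) (auto intro!: Dc_cong)
  then show ?thesis by (simp add: Us_Nil_right Dc_Nil_right)
qed

lemma Cp_counit_left: "Cp K w (\<lambda>I u J v. if I = [] \<and> u = [] then g J v else 0) = g K w"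
proof -
  have "Dc w (\<lambda>u v. sg (dg J * int (length u)) (if u = [] then g J v else 0)) = g J w" for J
    by (cases w) simp_all
  moreover have "Cp K w (\<lambda>I u J v. if I = [] \<and> u = [] then g J v else 0)
    = Us K (\<lambda>I J. if I = [] then Dc w (\<lambda>u v. sg (dg J * int (length u)) (if u = [] then g J v else 0)) else 0)"
    unfolding Cp_def by (intro Us_cong) (auto intro!: Dc_cong)
  ultimately show ?thesis by (simp add: Us_Nil_left)
qed

text \<open>
  \<open>E r f \<phi>\<close> is the composite of \<open>\<phi>\<close> with the \<open>r\<close>-fold tensor power of \<open>f\<close>; in \<open>D r f y \<phi>\<close> one
  of the factors is replaced by the odd map \<open>y\<close>.
\<close>

primrec E :: "nat \<Rightarrow> ((int \<times> 'x) list \<Rightarrow> 'a list \<Rightarrow> 'b) \<Rightarrow> ('b list \<Rightarrow> 'm::ab_group_add)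
    \<Rightarrow> (int \<times> 'x) list \<Rightarrow> 'a list \<Rightarrow> 'm" where
  "E 0 f \<phi> K w = (if K = [] \<and> w = [] then \<phi> [] else 0)"
| "E (Suc r) f \<phi> K w = Cp K w (\<lambda>I u J v. E r f (\<lambda>x. \<phi> (f I u # x)) J v)"

primrec D :: "nat \<Rightarrow> ((int \<times> 'x) list \<Rightarrow> 'a list \<Rightarrow> 'b) \<Rightarrow> ((int \<times> 'x) list \<Rightarrow> 'a list \<Rightarrow> 'b)
    \<Rightarrow> ('b list \<Rightarrow> 'm::ab_group_add) \<Rightarrow> (int \<times> 'x) list \<Rightarrow> 'a list \<Rightarrow> 'm" where
  "D 0 f y \<phi> K w = 0"
| "D (Suc r) f y \<phi> K w = Cp K w (\<lambda>I u J v. E r f (\<lambda>x. \<phi> (y I u # x)) J v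
     + sg (dg I + int (length u)) (D r f y (\<lambda>x. \<phi> (f I u # x)) J v))"

lemma E_additive: "additive h \<Longrightarrow> h (E r f \<phi> K w) = E r f (\<lambda>v. h (\<phi> v)) K w"
  by (induction r arbitrary: \<phi> K w) (simp_all add: additive.zero Cp_additive)

lemma E_add: "E r f (\<lambda>v. \<phi> v + \<phi>' v) K w = E r f \<phi> K w + E r f \<phi>' K w"
  by (induction r arbitrary: \<phi> \<phi>' K w) (simp_all add: Cp_add)

lemma E_0 [simp]: "E r f (\<lambda>v. 0) K w = 0"
  by (induction r arbitrary: K w) simp_all

lemma E_sg: "E r f (\<lambda>v. sg n (\<phi> v)) K w = sg n (E r f \<phi> K w)"
  by (rule E_additive[symmetric]) (rule additive_sg)

lemma E_Us: "E r f (\<lambda>v. Us S (\<lambda>A B. \<phi> A B v)) K w = Us S (\<lambda>A B. E r f (\<phi> A B) K w)"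
  by (induction S arbitrary: \<phi>) (simp_all add: E_add E_sg)

lemma additive_E:
  assumes "\<And>v. additive (\<lambda>a. \<phi> a v)"
  shows "additive (\<lambda>a. E r f (\<phi> a) K w)"
proof (rule additive.intro)
  fix a b
  have "\<phi> (a + b) = (\<lambda>v. \<phi> a v + \<phi> b v)"
    using assms by (auto simp: additive_def)
  then show "E r f (\<phi> (a + b)) K w = E r f (\<phi> a) K w + E r f (\<phi> b) K w"
    by (simp add: E_add)
qed

lemma additive_E_hd: "madd \<phi> \<Longrightarrow> additive (\<lambda>a. E r f (\<lambda>x. \<phi> (a # x)) K w)"
  by (intro additive_E madd_additive_hd)

lemma D_additive_y:
  assumes "madd \<phi>"
  shows "D r f (\<lambda>K w. y K w + y' K w) \<phi> K w = D r f y \<phi> K w + D r f y' \<phi> K w"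
  using assms
proof (induction r arbitrary: \<phi> K w)
  case (Suc r)
  show ?case
    by (simp add: Cp_add[symmetric] Suc.IH[OF madd_Cons[OF Suc.prems]] sg_add
        additive.add[OF additive_E_hd[OF Suc.prems]] add.commute add.left_commute)
qed simp

lemma D_sg_y:
  assumes "madd \<phi>"
  shows "D r f (\<lambda>K w. sg n (y K w)) \<phi> K w = sg n (D r f y \<phi> K w)"
  using assms
proof (induction r arbitrary: \<phi> K w)
  case (Suc r)
  show ?case
    by (simp add: Cp_sg[symmetric] Suc.IH[OF madd_Cons[OF Suc.prems]] sg_add add.commute
        additive_sg_comp[OF additive_E_hd[OF Suc.prems]])
qed simp

lemma D_diff_y:
  "madd \<phi> \<Longrightarrow> D r f (\<lambda>K w. y K w - y' K w) \<phi> K w = D r f y \<phi> K w - D r f y' \<phi> K w"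
  using D_additive_y[of \<phi> r f y "\<lambda>K w. sg 1 (y' K w)" K w] by (simp only: D_sg_y) (simp add: sg_one)

lemma D_0_y: "madd \<phi> \<Longrightarrow> D r f (\<lambda>K w. 0) \<phi> K w = 0"
  using D_diff_y[of \<phi> r f "\<lambda>K w. 0" "\<lambda>K w. 0" K w] by simp

lemma D_sum_y:
  "madd \<phi> \<Longrightarrow> D r f (\<lambda>K w. \<Sum>i\<in>R. y i K w) \<phi> K w = (\<Sum>i\<in>R. D r f (y i) \<phi> K w)"
  by (induction R rule: infinite_finite_induct) (simp_all add: D_additive_y D_0_y)

lemma D_0 [simp]: "D r f y (\<lambda>v. 0) K w = 0"
  by (induction r arbitrary: K w) simp_all

text \<open>Chain rule: the coderivation acts on one tensor factor at a time, by
  \<open>comp_Cp\<close> on the first and by induction on the others. The empty power contributes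
  nothing, because an insertion never yields the empty word.\<close>

lemma comp_E:
  assumes X: "\<And>J v. X J v \<noteq> 0 \<Longrightarrow> even (dg J + int (length v))"
    and f: "\<And>I. madd (f I)" and "madd \<phi>"
  shows "comp 1 X (E r f \<phi>) K w = D r f (comp 1 X f) \<phi> K w"
  using assms(3)
proof (induction r arbitrary: \<phi> K w)
  case 0
  have "hat (1 + dg J) (X J) (E 0 f \<phi> I) w = 0" for I J
    by (cases w) (simp_all add: hat_unfold[of _ _ "\<lambda>v. if _ \<and> v = [] then _ else _"])
  then show ?case unfolding comp_def by (simp del: E.simps)
next
  case (Suc r)
  let ?H = "\<lambda>I u J v. E r f (\<lambda>x. \<phi> (f I u # x)) J v"
  have "E (Suc r) f \<phi> = (\<lambda>K w. Cp K w ?H)"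
    by (intro ext) simp
  then have "comp 1 X (E (Suc r) f \<phi>) K w = comp 1 X (\<lambda>K w. Cp K w ?H) K w"
    by (simp only:)
  also have "\<dots> = Cp K w (\<lambda>I u J v.
      comp 1 X (\<lambda>I u. ?H I u J v) I u + sg (dg I + int (length u)) (comp 1 X (?H I u) J v))"
    by (rule comp_Cp) (use X in \<open>auto simp: madd_0[OF f] madd_0_hd[OF Suc.prems]\<close>)
  also have "\<dots> = D (Suc r) f (comp 1 X f) \<phi> K w"
    by (simp add: Suc.IH[OF madd_Cons[OF Suc.prems]]
        comp_additive[OF additive_E_hd[OF Suc.prems], symmetric])
  finally show ?case .
qed

text \<open>The tensor powers of \<open>f\<close> form a morphism of coalgebras: cutting the r
  output letters after the k-th one cuts the items and the input word accordingly.\<close>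

lemma E_Dc:
  "E r f (\<lambda>w. Dc w h) K w
     = (\<Sum>k\<le>r. Cp K w (\<lambda>I u J v. E k f (\<lambda>x. E (r - k) f (h x) J v) I u))"
proof (induction r arbitrary: h K w)
  case 0
  have "Cp K w (\<lambda>I u J v. if I = [] \<and> u = [] then if J = [] \<and> v = [] then h [] [] else 0 else 0)
      = Cp K w (\<lambda>I u J v. if J = [] \<and> v = [] then if I = [] \<and> u = [] then h [] [] else 0 else 0)"
    by (intro Cp_cong) auto
  then show ?case by (simp add: Cp_counit_right)
next
  case (Suc r)
  have "E (Suc r) f (\<lambda>w. Dc w h) K w
     = Cp K w (\<lambda>I u J v. E r f (\<lambda>x. h [] (f I u # x)) J v)
       + Cp K w (\<lambda>I u J v. E r f (\<lambda>x. Dc x (\<lambda>u' v'. h (f I u # u') v')) J v)"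
    by (simp add: E_add Cp_add)
  also have "Cp K w (\<lambda>I u J v. E r f (\<lambda>x. Dc x (\<lambda>u' v'. h (f I u # u') v')) J v)
     = (\<Sum>k\<le>r. Cp K w (\<lambda>I u J v. Cp I u (\<lambda>I1 u1 I2 u2.
         E k f (\<lambda>x. E (r - k) f (h (f I1 u1 # x)) J v) I2 u2)))"
    unfolding Suc.IH Cp_sum Cp_assoc ..
  also have "\<dots> = (\<Sum>k\<le>r. Cp K w (\<lambda>I u J v. E (Suc k) f (\<lambda>x. E (r - k) f (h x) J v) I u))"
    by simp
  finally show ?case
    unfolding sum.atMost_Suc_shift by (simp add: Cp_counit_left del: sum.atMost_Suc)
qed

definition sub :: "nat \<Rightarrow> ((int \<times> 'x) list \<Rightarrow> 'a list \<Rightarrow> 'b) \<Rightarrow> ((int \<times> 'x) list \<Rightarrow> 'b list \<Rightarrow> 'm::ab_group_add)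
    \<Rightarrow> (int \<times> 'x) list \<Rightarrow> 'a list \<Rightarrow> 'm" where
  "sub r f \<Psi> K w = Us K (\<lambda>I J. E r f (\<Psi> I) J w)"

text \<open>An insertion into the r letters produced by \<open>f\<close> takes in j consecutive
  ones. What remains is a tensor power with r - j + 1 factors, one of which is the composite of
  \<open>X\<close> with j copies of \<open>f\<close>. The parity condition says that
  \<open>f\<close> is even, so \<open>X\<close> picks up the same sign from an output letter as from
  the input that \<open>f\<close> has turned into it.\<close>

lemma E_hat:
  assumes f: "\<And>I u. f I u \<noteq> 0 \<Longrightarrow> odd (dg I + int (length u))" and "madd \<phi>"
  shows "Us K (\<lambda>B R. E r f (hat (1 + dg B) (X B) \<phi>) R w)
    = (\<Sum>j\<le>r. D (Suc (r - j)) f (sub j f X) \<phi> K w)"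
  using assms(2)
proof (induction r arbitrary: \<phi> K w)
  case 0
  show ?case
    by (simp add: Cp_counit_right sub_def Us_additive[OF madd_additive_hd[OF 0]])
      (auto intro!: Us_cong simp: madd_0_hd[OF 0])
next
  case (Suc r)
  let ?L = "\<lambda>k J v a. E k f (\<lambda>x. \<phi> (a # x)) J v"
  let ?h = "\<lambda>B \<phi>. hat (1 + dg B) (X B) \<phi>"
  have "Us K (\<lambda>B R. E (Suc r) f (?h B \<phi>) R w)
    = Us K (\<lambda>B R. E (Suc r) f (\<lambda>w. Dc w (\<lambda>u v. \<phi> (X B u # v))) R w)
      + Us K (\<lambda>B R. Cp R w (\<lambda>I u J v. sg (1 + dg B) (E r f (?h B (\<lambda>x. \<phi> (f I u # x))) J v)))"
    unfolding Us_add[symmetric]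
  proof (intro Us_cong, goal_cases)
    case (1 B R)
    have "?h B \<phi> = (\<lambda>w. Dc w (\<lambda>u v. \<phi> (X B u # v))
      + (case w of [] \<Rightarrow> 0 | a # w' \<Rightarrow> sg (1 + dg B) (?h B (\<lambda>v. \<phi> (a # v)) w')))"
      by (intro ext hat_unfold)
    then have "E (Suc r) f (?h B \<phi>) R w = E (Suc r) f \<dots> R w"
      by (rule arg_cong)
    then show ?case unfolding E_add by (simp add: E_sg)
  qed
  also have "Us K (\<lambda>B R. E (Suc r) f (\<lambda>w. Dc w (\<lambda>u v. \<phi> (X B u # v))) R w)
    = (\<Sum>k\<le>Suc r. Cp K w (\<lambda>S u J v. ?L (Suc r - k) J v (sub k f X S u)))"
  proof -
    have "E (Suc r) f (\<lambda>w. Dc w (\<lambda>u v. \<phi> (X B u # v))) R w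
      = (\<Sum>k\<le>Suc r. Cp R w (\<lambda>I u J v. ?L (Suc r - k) J v (E k f (X B) I u)))" for B R
      unfolding E_Dc by (simp only: E_additive[OF additive_E_hd[OF Suc.prems]])
    then show ?thesis
      unfolding sub_def by (simp only: Us_sum Us_Cp_assoc Us_additive[OF additive_E_hd[OF Suc.prems]])
  qed
  also have "Us K (\<lambda>B R. Cp R w (\<lambda>I u J v. sg (1 + dg B) (E r f (?h B (\<lambda>x. \<phi> (f I u # x))) J v)))
    = Cp K w (\<lambda>I u S v. sg (dg I + int (length u))
        (Us S (\<lambda>B J. E r f (?h B (\<lambda>x. \<phi> (f I u # x))) J v)))"
    unfolding Us_Cp_swap Us_sg[symmetric]
  proof (intro Cp_cong Us_cong, goal_cases)
    case (1 I u S v B J)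
    show ?case
    proof (cases "f I u = 0")
      case False
      show ?thesis using f[OF False] by (auto intro!: sg_cong)
    qed (simp add: madd_0_hd[OF Suc.prems] hat_0[abs_def])
  qed
  also have "\<dots> = (\<Sum>j\<le>Suc r. Cp K w (\<lambda>I u S v. sg (dg I + int (length u))
        (D (Suc r - j) f (sub j f X) (\<lambda>x. \<phi> (f I u # x)) S v)))"
    unfolding Suc.IH[OF madd_Cons[OF Suc.prems]]
    by (simp add: Cp_sum[symmetric] Suc_diff_le additive.sum[OF additive_sg] del: D.simps(2))
  also have "(\<Sum>k\<le>Suc r. Cp K w (\<lambda>S u J v. ?L (Suc r - k) J v (sub k f X S u))) + \<dots>
    = (\<Sum>j\<le>Suc r. D (Suc (Suc r - j)) f (sub j f X) \<phi> K w)"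
    by (simp only: sum.distrib[symmetric] Cp_add[symmetric] D.simps)
  finally show ?case .
qed

section \<open>Arities, composition with a coalgebra morphism, and insertion of a new item\<close>

lemma Us_cong_set:
  "(\<And>I J. dg K = dg I + dg J \<Longrightarrow> set I \<subseteq> set K \<Longrightarrow> set J \<subseteq> set K
      \<Longrightarrow> length I + length J = length K \<Longrightarrow> H I J = H' I J) \<Longrightarrow> Us K H = Us K H'"
proof (induction K arbitrary: H H')
  case (Cons k K)
  show ?case
    by (simp, intro arg_cong2[of _ _ _ _ "(+)"] Cons.IH) (auto intro!: sg_cong Cons.prems)
qed simp

lemma Cp_cong_set:
  "(\<And>I u J v. dg K = dg I + dg J \<Longrightarrow> set I \<subseteq> set K \<Longrightarrow> set J \<subseteq> set K
      \<Longrightarrow> H I u J v = H' I u J v) \<Longrightarrow> Cp K w H = Cp K w H'"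
  unfolding Cp_def by (intro Us_cong_set Dc_cong sg_cong) auto

lemma D_cong:
  "(\<And>I u. set I \<subseteq> set K \<Longrightarrow> y I u = y' I u) \<Longrightarrow> D r f y \<phi> K w = D r f y' \<phi> K w"
proof (induction r arbitrary: \<phi> K w)
  case (Suc r)
  show ?case unfolding D.simps
  proof (intro Cp_cong_set arg_cong2[of _ _ _ _ "(+)"] sg_cong, goal_cases)
    case (3 I u J v)
    show ?case by (intro Suc.IH Suc.prems) (use 3 in blast)
  qed (simp_all add: Suc.prems)
qed simp

lemma E_cong_length: "(\<And>x. length x = r \<Longrightarrow> \<phi> x = \<phi>' x) \<Longrightarrow> E r f \<phi> K w = E r f \<phi>' K w"
proof (induction r arbitrary: \<phi> \<phi>' K w)
  case (Suc r)
  show ?case unfolding E.simps by (intro Cp_cong Suc.IH) (simp add: Suc.prems)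
qed simp

lemma E_length_eq_0: "(\<And>x. length x = r \<Longrightarrow> \<phi> x = 0) \<Longrightarrow> E r f \<phi> K w = 0"
  using E_cong_length[of r \<phi> "\<lambda>x. 0"] by simp

lemma D_length_eq_0: "(\<And>x. length x = r \<Longrightarrow> \<phi> x = 0) \<Longrightarrow> D r f y \<phi> K w = 0"
proof (induction r arbitrary: \<phi> K w)
  case (Suc r)
  have "E r f (\<lambda>x. \<phi> (y I u # x)) J v = 0" for I u J v
    by (intro E_length_eq_0 Suc.prems) simp
  moreover have "D r f y (\<lambda>x. \<phi> (f I u # x)) J v = 0" for I u J v
    by (intro Suc.IH Suc.prems) simp
  ultimately show ?case by simp
qed simp

lemma sum_delta_le: "a \<le> (N::nat) \<Longrightarrow> (\<And>r. r \<noteq> a \<Longrightarrow> h r = 0) \<Longrightarrow> (\<Sum>r\<le>N. h r) = h a"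
  by (subst sum.mono_neutral_right[of _ "{a}"]) auto

lemma hat_length_eq_0:
  assumes y: "\<And>v. y v \<noteq> 0 \<Longrightarrow> int (length v) = n"
    and "\<And>v. int (length v) \<noteq> m \<Longrightarrow> \<phi> v = 0" "int (length w) + 1 \<noteq> m + n" "madd \<phi>"
  shows "hat q y \<phi> w = 0"
  using assms(2-)
proof (induction w arbitrary: \<phi> m)
  case Nil
  show ?case
  proof (cases "y [] = 0")
    case False
    then show ?thesis using y[OF False] Nil by auto
  qed (simp add: madd_0_hd[OF Nil(3)])
next
  case (Cons a w)
  have "\<phi> (y u # v) = 0" if "u @ v = a # w" for u v
  proof (cases "y u = 0")
    case False
    have "length u + length v = Suc (length w)" using arg_cong[OF that, of length] by simp
    then show ?thesis using y[OF False] Cons.prems(2) by (intro Cons.prems(1)) auto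
  qed (simp add: madd_0_hd[OF Cons.prems(3)])
  then have "Dc (a # w) (\<lambda>u v. \<phi> (y u # v)) = Dc (a # w) (\<lambda>u v. 0)" by (intro Dc_cong)
  moreover have "hat q y (\<lambda>v. \<phi> (a # v)) w = 0"
    using Cons.prems by (intro Cons.IH[of "m - 1"] madd_Cons) auto
  ultimately show ?case by (simp only: hat.simps Dc_0) simp
qed

text \<open>
  A cochain whose value \<open>\<Psi> I\<close> lives on words of a single length \<open>dg I + n\<close>, composed with \<open>f\<close>.
\<close>

definition subst :: "int \<Rightarrow> ((int \<times> 'x) list \<Rightarrow> 'a list \<Rightarrow> 'b)
    \<Rightarrow> ((int \<times> 'x) list \<Rightarrow> 'b list \<Rightarrow> 'm::ab_group_add) \<Rightarrow> (int \<times> 'x) list \<Rightarrow> 'a list \<Rightarrow> 'm" where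
  "subst n f \<Psi> K w = Us K (\<lambda>I J. E (nat (dg I + n)) f (\<Psi> I) J w)"

text \<open>The odd coderivation first passes the items that go to \<open>\<Psi>\<close>, then acts
  on one factor of the tensor power by \<open>comp_E\<close>.\<close>

lemma comp_subst:
  assumes X: "\<And>J v. X J v \<noteq> 0 \<Longrightarrow> even (dg J + int (length v))"
    and f: "\<And>I. madd (f I)" and \<Psi>: "\<And>A. madd (\<Psi> A)"
  shows "comp 1 X (subst n f \<Psi>) K w
    = Us K (\<lambda>A R. sg (dg A) (D (nat (dg A + n)) f (comp 1 X f) (\<Psi> A) R w))"
proof -
  have "comp 1 X (subst n f \<Psi>) K w
    = Us K (\<lambda>I J. Us I (\<lambda>A B. sg (dg A + dg B) (hat (1 + dg J) (X J) (E (nat (dg A + n)) f (\<Psi> A) B) w)))"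
    unfolding comp_def subst_def[abs_def] hat_Us Us_sg[symmetric]
    by (intro Us_cong sg_cong) auto
  also have "\<dots> = Us K (\<lambda>A R. sg (dg A) (comp 1 X (E (nat (dg A + n)) f (\<Psi> A)) R w))"
    unfolding Us_assoc comp_def Us_sg[symmetric] by (simp add: add.commute)
  moreover have "comp 1 X (E r f (\<Psi> A)) R w = D r f (comp 1 X f) (\<Psi> A) R w" for r A R
    by (rule comp_E) (use X f \<Psi> in auto)
  ultimately show ?thesis by simp
qed

text \<open>The second associativity law: substituting \<open>f\<close> into a nested insertion
  means substituting it into the outer map, with one factor replaced by the inner map after e^f.
  Since \<open>E_hat\<close> mixes powers, it is applied for all r at once; the arity bound
  \<open>N\<close> keeps these sums finite and the supports pick out the summand that
  counts.\<close>

lemma subst_comp: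
  assumes X: "\<And>J v. X J v \<noteq> 0 \<Longrightarrow> int (length v) = dg J + n"
    and f: "\<And>I u. f I u \<noteq> 0 \<Longrightarrow> odd (dg I + int (length u))"
    and X_add: "\<And>A. madd (X A)"
    and bounded: "\<And>J v. set J \<subseteq> set K \<Longrightarrow> X J v \<noteq> 0 \<Longrightarrow> length v \<le> N"
  shows "subst (2 * n - 1) f (comp 1 X X) K w
    = Us K (\<lambda>A R. sg (dg A) (D (nat (dg A + n)) f (subst n f X) (X A) R w))"
proof -
  let ?h = "\<lambda>A B. hat (1 + dg B) (X B) (X A)"
  \<comment> \<open>The arities \<open>dg A + n\<close> and \<open>dg B + n\<close> add up, minus
    the place filled by the inserted letter.\<close>
  have supp: "?h A B v = 0" if "int (length v) \<noteq> dg A + dg B + (2 * n - 1)" for A B v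
    by (rule hat_length_eq_0[where m = "dg A + n" and n = "dg B + n"]) (use X that in \<open>auto simp: X_add\<close>)
  \<comment> \<open>Spread out over all r up to 2 N, only the prescribed power survives. A negative
    prescribed arity, which \<open>nat\<close> reads as 0, is covered because both sides vanish
    then.\<close>
  have E_arity: "E (nat (dg A + dg B + (2 * n - 1))) f (?h A B) R w
      = (\<Sum>r\<le>2 * N. E r f (?h A B) R w)" if "set A \<subseteq> set K" "set B \<subseteq> set K" for A B R
  proof -
    have Z: "E r f (?h A B) R w = 0" if "int r \<noteq> dg A + dg B + (2 * n - 1)" for r
      by (intro E_length_eq_0 supp) (use that in auto)
    show ?thesis
    proof (cases "0 \<le> dg A + dg B + (2 * n - 1) \<and> (\<exists>v. X A v \<noteq> 0) \<and> (\<exists>v. X B v \<noteq> 0)")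
      case True
      then obtain v v' where v: "X A v \<noteq> 0" "X B v' \<noteq> 0" by blast
      have "dg A + n \<le> N" "dg B + n \<le> N"
        using X[OF v(1)] X[OF v(2)] bounded[OF _ v(1)] bounded[OF _ v(2)] that by auto
      with True show ?thesis by (intro sum_delta_le[symmetric] Z) auto
    next
      case False
      have "?h A B = (\<lambda>v. 0)" if "0 \<le> dg A + dg B + (2 * n - 1)"
      proof (cases "X A = (\<lambda>v. 0)")
        case True
        then show ?thesis by (auto simp: hat_0[abs_def])
      next
        case A: False
        then have "X B = (\<lambda>v. 0)" using False that by auto
        then show ?thesis using hat_0_left[OF X_add] by auto
      qed
      moreover have "E r f (?h A B) R w = 0" if "\<not> 0 \<le> dg A + dg B + (2 * n - 1)" for r
        using that by (intro Z) auto
      ultimately show ?thesis by (cases "0 \<le> dg A + dg B + (2 * n - 1)") simp_all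
    qed
  qed
  have D_arity: "(\<Sum>r\<le>2 * N. \<Sum>j\<le>r. D (Suc (r - j)) f (sub j f X) (X A) R w)
      = D (nat (dg A + n)) f (subst n f X) (X A) R w" if "set A \<subseteq> set K" "set R \<subseteq> set K" for A R
  proof (cases "X A = (\<lambda>v. 0)")
    case False
    then obtain v where v: "X A v \<noteq> 0" by auto
    have m: "dg A + n \<le> N" "0 \<le> dg A + n" using X[OF v] bounded[OF that(1) v] by auto
    have Z: "D i f y (X A) R w = 0" if "int i \<noteq> dg A + n" for i y
      by (intro D_length_eq_0) (use X that in fastforce)
    show ?thesis
    proof (cases "dg A + n = 0")
      \<comment> \<open>An outer map of arity 0 has no place for an insertion, so both sides are
        0.\<close>
      case True
      then show ?thesis by (auto intro!: sum.neutral Z simp del: D.simps(2))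
    next
      case False
      define m where "m = nat (dg A + n) - 1"
      have m': "Suc m = nat (dg A + n)" "m < N" using m False by (auto simp: m_def)
      have im: "i = m" if "D (Suc i) f y (X A) R w \<noteq> 0" for i y
        using Z[of "Suc i" y] that m' by linarith
      \<comment> \<open>Now j counts the inner factors and i the outer factors besides the composite
        one. The arity of \<open>X A\<close> forces i = m, and the sum over j reassembles
        \<open>subst n f X\<close>.\<close>
      have "(\<Sum>r\<le>2 * N. \<Sum>j\<le>r. D (Suc (r - j)) f (sub j f X) (X A) R w)
        = (\<Sum>(j, i)\<in>{(j, i). j + i \<le> 2 * N}. D (Suc i) f (sub j f X) (X A) R w)"
        by (subst sum.triangle_reindex_eq) simp
      also have "\<dots> = (\<Sum>(j, i)\<in>{..2 * N - m} \<times> {m}. D (Suc i) f (sub j f X) (X A) R w)"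
      proof (intro sum.mono_neutral_right)
        have "{(j, i). j + i \<le> 2 * N} \<subseteq> {..2 * N} \<times> {..2 * N}" by auto
        then show "finite {(j, i). j + i \<le> 2 * N}" by (rule finite_subset) simp
      qed (use m' in \<open>auto dest: im simp del: D.simps(2)\<close>)
      also have "\<dots> = (\<Sum>j\<le>2 * N - m. D (Suc m) f (sub j f X) (X A) R w)"
        by (simp add: sum.cartesian_product[symmetric])
      also have "\<dots> = D (Suc m) f (\<lambda>K w. \<Sum>j\<le>2 * N - m. sub j f X K w) (X A) R w"
        by (rule D_sum_y[OF X_add, symmetric])
      also have "\<dots> = D (Suc m) f (subst n f X) (X A) R w"
      proof (intro D_cong)
        fix S u assume S: "set S \<subseteq> set R"
        show "(\<Sum>j\<le>2 * N - m. sub j f X S u) = subst n f X S u"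
          unfolding sub_def subst_def Us_sum[symmetric]
        proof (intro Us_cong_set)
          fix I J assume I: "set I \<subseteq> set S"
          have Z: "E r f (X I) J u = 0" if "int r \<noteq> dg I + n" for r
            by (intro E_length_eq_0) (use X that in fastforce)
          show "(\<Sum>j\<le>2 * N - m. E j f (X I) J u) = E (nat (dg I + n)) f (X I) J u"
          proof (cases "X I = (\<lambda>v. 0)")
            case False
            then obtain v where v: "X I v \<noteq> 0" by auto
            have "length v \<le> N" using bounded[OF _ v] I S that by auto
            with X[OF v] m' show ?thesis by (intro sum_delta_le Z) auto
          qed simp
        qed
      qed
      finally show ?thesis by (simp only: m')
    qed
  qed simp
  have "subst (2 * n - 1) f (comp 1 X X) K w
    = Us K (\<lambda>L R. Us L (\<lambda>A B. sg (dg A) (E (nat (dg A + dg B + (2 * n - 1))) f (?h A B) R w)))"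
    unfolding subst_def comp_def[abs_def] E_Us E_sg by (intro Us_cong) (auto intro!: Us_cong)
  also have "\<dots> = Us K (\<lambda>A S. sg (dg A)
      (\<Sum>r\<le>2 * N. Us S (\<lambda>B R. E r f (?h A B) R w)))"
    unfolding Us_assoc Us_sg
  proof (intro Us_cong_set arg_cong[of _ _ "sg _"], goal_cases)
    case (1 A S)
    show ?case unfolding Us_sum[symmetric]
      by (intro Us_cong_set E_arity) (use 1 in auto)
  qed
  also have "\<dots> = Us K (\<lambda>A R. sg (dg A) (D (nat (dg A + n)) f (subst n f X) (X A) R w))"
  proof (intro Us_cong_set arg_cong[of _ _ "sg _"], goal_cases)
    case (1 A S)
    have "Us S (\<lambda>B R. E r f (?h A B) R w) = (\<Sum>j\<le>r. D (Suc (r - j)) f (sub j f X) (X A) S w)" for r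
      by (rule E_hat) (use f X_add in auto)
    then show ?case using D_arity 1 by simp
  qed
  finally show ?thesis .
qed

text \<open>Leibniz rule. The item \<open>y I\<close> carries a value computed from \<open>I\<close>
  and has shifted degree \<open>dg I + 1\<close>. A splitting sends it to \<open>X\<close> or to
  \<open>\<Psi>\<close>, where it must be alone, so \<open>X\<close> is replaced by \<open>Y\<close>
  or \<open>\<Psi>\<close> by \<open>Z\<close>. The minus sign arises because the odd
  \<open>X\<close> passes the item, whose parity differs from that of \<open>I\<close>.\<close>

lemma comp_item:
  assumes deg: "\<And>I. fst (y I) = dg I + 2"
    and X: "\<And>I B. X (y I # B) = (if B = [] then Y I else (\<lambda>w. 0))"
    and \<Psi>: "\<And>I B. \<Psi> (y I # B) = (if B = [] then Z I else (\<lambda>w. 0))"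
    and \<Psi>_add: "\<And>A. madd (\<Psi> A)"
  shows "Us K (\<lambda>I J. comp 1 X \<Psi> (y I # J) w) = comp 0 Y \<Psi> K w - comp 1 X Z K w"
proof -
  have 1: "comp 1 X \<Psi> (y I # J) w = sg (dg I + 1) (hat (1 + dg J) (X J) (Z I) w)
      + sg (dg J * dg I) (hat (dg I) (Y I) (\<Psi> J) w)" for I J
  proof -
    have "Us J (\<lambda>A B. sg (dg (y I # A)) (hat (1 + dg B) (X B) (\<Psi> (y I # A)) w))
      = Us J (\<lambda>A B. if A = [] then sg (dg I + 1) (hat (1 + dg B) (X B) (Z I) w) else 0)"
      by (intro Us_cong) (simp add: \<Psi> deg add.commute)
    moreover have "Us J (\<lambda>A B. sg ((fst (y I) - 1) * dg A) (sg (dg A) (hat (1 + dg (y I # B)) (X (y I # B)) (\<Psi> A) w)))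
      = Us J (\<lambda>A B. if B = [] then sg (dg A * dg I) (hat (dg I) (Y I) (\<Psi> A) w) else 0)"
      by (intro Us_cong)
        (auto simp: X deg hat_0_left[OF \<Psi>_add] intro!: sg_cong hat_sg_parity)
    ultimately show ?thesis
      by (simp add: comp_def Us_Nil_left Us_Nil_right)
  qed
  have "Us K (\<lambda>I J. sg (dg J * dg I) (hat (dg I) (Y I) (\<Psi> J) w)) = comp 0 Y \<Psi> K w"
    unfolding comp_def by (subst Us_comm) (auto intro!: Us_cong sg_cong)
  moreover have "Us K (\<lambda>I J. sg (dg I + 1) (hat (1 + dg J) (X J) (Z I) w)) = - comp 1 X Z K w"
    unfolding comp_def Us_minus[symmetric]
    by (intro Us_cong) (simp add: sg_one[symmetric] add.commute)
  ultimately show ?thesis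
    unfolding 1 Us_add by simp
qed

text \<open>The factor that receives \<open>y I\<close> receives no other item and becomes
  \<open>Z\<close>; the sum over the factors is the derivative \<open>D\<close>. The extra parity of
  the item gives the sign in \<open>D\<close> for passing the factors before it.\<close>

lemma E_item:
  assumes deg: "\<And>I. fst (y I) = dg I + 2"
    and f: "\<And>I B. f (y I # B) = (if B = [] then Z I else (\<lambda>w. 0))"
    and \<phi>: "madd \<phi>"
  shows "Us K (\<lambda>I B. E r f \<phi> (y I # B) w) = D r f Z \<phi> K w"
  using \<phi>
proof (induction r arbitrary: \<phi> K w)
  case (Suc r)
  have 1: "E (Suc r) f \<phi> (y I # B) w
    = Dc w (\<lambda>u v. sg (dg B * int (length u)) (E r f (\<lambda>x. \<phi> (Z I u # x)) B v))
      + Cp B w (\<lambda>A u S v. sg ((dg I + 1) * (dg A + int (length u))) (E r f (\<lambda>x. \<phi> (f A u # x)) (y I # S) v))"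
    for I B
  proof -
    have "Us B (\<lambda>A S. Dc w (\<lambda>u v. sg (dg S * int (length u)) (E r f (\<lambda>x. \<phi> (f (y I # A) u # x)) S v)))
      = Us B (\<lambda>A S. if A = [] then
          Dc w (\<lambda>u v. sg (dg S * int (length u)) (E r f (\<lambda>x. \<phi> (Z I u # x)) S v)) else 0)"
      by (intro Us_cong) (simp add: f madd_0_hd[OF Suc.prems])
    moreover have "Us B (\<lambda>A S. sg ((fst (y I) - 1) * dg A)
        (Dc w (\<lambda>u v. sg (dg (y I # S) * int (length u)) (E r f (\<lambda>x. \<phi> (f A u # x)) (y I # S) v))))
      = Cp B w (\<lambda>A u S v. sg ((dg I + 1) * (dg A + int (length u))) (E r f (\<lambda>x. \<phi> (f A u # x)) (y I # S) v))"
      unfolding Cp_def Dc_sg[symmetric] sg_sg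
      by (intro Us_cong Dc_cong sg_cong) (simp_all add: deg algebra_simps)
    ultimately show ?thesis
      by (simp add: Cp_def Us_Nil_left)
  qed
  have "Us K (\<lambda>I B. Cp B w (\<lambda>A u S v. sg ((dg I + 1) * (dg A + int (length u)))
        (E r f (\<lambda>x. \<phi> (f A u # x)) (y I # S) v)))
     = Cp K w (\<lambda>A u S v. sg (dg A + int (length u)) (Us S (\<lambda>I S. E r f (\<lambda>x. \<phi> (f A u # x)) (y I # S) v)))"
    unfolding Us_Cp_swap Us_sg[symmetric] sg_sg
    by (intro Cp_cong Us_cong sg_cong) (simp_all add: algebra_simps)
  then show ?case
    unfolding 1 Us_add Suc.IH[OF madd_Cons[OF Suc.prems]] D.simps Cp_add by (simp add: Cp_def)
qed simp

section \<open>Symmetry and linearity in the items and in the letters\<close>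

definition gsym :: "((int \<times> 'x) list \<Rightarrow> 'm::ab_group_add) \<Rightarrow> bool" where
  "gsym h \<longleftrightarrow> (\<forall>A x y B. h (A @ x # y # B) = sg ((fst x - 1) * (fst y - 1)) (h (A @ y # x # B)))"

lemma gsymD: "gsym h \<Longrightarrow> h (A @ x # y # B) = sg ((fst x - 1) * (fst y - 1)) (h (A @ y # x # B))"
  unfolding gsym_def by blast

lemma gsymI:
  "(\<And>A x y B. h (A @ x # y # B) = sg ((fst x - 1) * (fst y - 1)) (h (A @ y # x # B))) \<Longrightarrow> gsym h"
  unfolding gsym_def by blast

lemma gsym_Cons:
  assumes "gsym h"
  shows "gsym (\<lambda>K. h (k # K))"
proof (rule gsymI)
  fix A x y B
  show "h (k # A @ x # y # B) = sg ((fst x - 1) * (fst y - 1)) (h (k # A @ y # x # B))"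
    using gsymD[OF assms, of "k # A" x y B] by simp
qed

lemma gsym_dg_sg:
  assumes "gsym h"
  shows "gsym (\<lambda>K. sg (n * dg K) (h K))"
proof (rule gsymI)
  fix A x y B
  show "sg (n * dg (A @ x # y # B)) (h (A @ x # y # B))
      = sg ((fst x - 1) * (fst y - 1)) (sg (n * dg (A @ y # x # B)) (h (A @ y # x # B)))"
    unfolding gsymD[OF assms, of A x y B] sg_sg by (rule sg_cong) (simp_all add: algebra_simps)
qed

lemma gsym_sg:
  assumes "gsym h"
  shows "gsym (\<lambda>K. sg n (h K))"
proof (rule gsymI)
  fix A x y B
  show "sg n (h (A @ x # y # B)) = sg ((fst x - 1) * (fst y - 1)) (sg n (h (A @ y # x # B)))"
    unfolding gsymD[OF assms, of A x y B] sg_sg by (rule sg_cong) simp_all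
qed

text \<open>Two adjacent items lie in the same part, where \<open>H\<close> exchanges them, or in
  different parts, and then two splittings trade places while their unshuffle signs differ by the
  Koszul sign of the pair.\<close>

lemma gsym_Us:
  assumes "\<And>J. gsym (\<lambda>I. H I J)" "\<And>I. gsym (H I)"
  shows "gsym (\<lambda>K. Us K H)"
  unfolding gsym_def
proof (intro allI)
  fix A x y B
  show "Us (A @ x # y # B) H = sg ((fst x - 1) * (fst y - 1)) (Us (A @ y # x # B) H)"
    using assms
  proof (induction A arbitrary: H)
    case Nil
    let ?dx = "fst x - 1" and ?dy = "fst y - 1"
    have H: "H (x # y # I) J = sg (?dx * ?dy) (H (y # x # I) J)"
      "H I (x # y # J) = sg (?dx * ?dy) (H I (y # x # J))" for I J
      using gsymD[OF Nil(1), where A = "[]" and x = x and y = y]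
        gsymD[OF Nil(2), where A = "[]" and x = x and y = y] by simp_all
    have "Us B (\<lambda>I J. H (x # y # I) J) = sg (?dx * ?dy) (Us B (\<lambda>I J. H (y # x # I) J))"
      unfolding H(1) Us_sg ..
    moreover have "Us B (\<lambda>I J. sg (?dy * dg I) (H (x # I) (y # J)))
        = sg (?dx * ?dy) (Us B (\<lambda>I J. sg (?dy * dg (x # I)) (H (x # I) (y # J))))"
      unfolding Us_sg[symmetric] sg_sg by (intro Us_cong sg_cong) (auto simp: algebra_simps)
    moreover have "Us B (\<lambda>I J. sg (?dx * dg (y # I)) (H (y # I) (x # J)))
        = sg (?dx * ?dy) (Us B (\<lambda>I J. sg (?dx * dg I) (H (y # I) (x # J))))"
      unfolding Us_sg[symmetric] sg_sg by (intro Us_cong sg_cong) (auto simp: algebra_simps)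
    moreover have "Us B (\<lambda>I J. sg (?dy * dg I) (sg (?dx * dg I) (H I (x # y # J))))
        = sg (?dx * ?dy) (Us B (\<lambda>I J. sg (?dx * dg I) (sg (?dy * dg I) (H I (y # x # J)))))"
      unfolding H(2) Us_sg[symmetric] sg_sg by (intro Us_cong sg_cong) (auto simp: algebra_simps)
    ultimately show ?case
      by (simp only: append_Nil Us.simps sg_add add_ac)
  next
    case (Cons k A)
    have "gsym (\<lambda>I. H (k # I) J)" "gsym (\<lambda>J. H I (k # J))" for I J
      using Cons.prems gsym_Cons by blast+
    moreover have "gsym (\<lambda>I. sg ((fst k - 1) * dg I) (H I (k # J)))"
      "gsym (\<lambda>J. sg ((fst k - 1) * dg I) (H I (k # J)))" for I J
      using Cons.prems(1) calculation(2) by (simp_all add: gsym_dg_sg gsym_sg)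
    ultimately show ?case
      using Cons.prems(2) by (simp add: Cons.IH sg_add)
  qed
qed

text \<open>Families that are affine in the parameters. The deformed products and the deformed
  morphism are of this kind; the higher terms of \<open>F\<close> come from composing them.\<close>

definition short :: "('i list \<Rightarrow> 'a list \<Rightarrow> 'b::zero) \<Rightarrow> bool" where
  "short f \<longleftrightarrow> (\<forall>K. 2 \<le> length K \<longrightarrow> f K = (\<lambda>w. 0))"

lemma short_snoc: "short f \<Longrightarrow> f (A @ x # y # B) = (\<lambda>w. 0)"
  by (simp add: short_def)

lemma gsym_comp:
  assumes "short X" "short \<Psi>" "\<And>I. madd (\<Psi> I)"
  shows "gsym (\<lambda>K. comp q X \<Psi> K w)"
  unfolding comp_def
  by (rule gsym_Us) (simp_all add: gsym_def short_snoc assms hat_0_left)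

lemma gsym_E:
  assumes "short f" "madd \<phi>"
  shows "gsym (\<lambda>K. E r f \<phi> K w)"
  using assms(2)
proof (induction r arbitrary: \<phi> w)
  case 0
  show ?case by (simp add: gsym_def)
next
  case (Suc r)
  have *: "gsym (\<lambda>J. Dc w (\<lambda>u v. sg (dg J * int (length u)) (E r f (\<lambda>x. \<phi> (f I u # x)) J v)))" for I
  proof (intro gsymI, unfold Dc_sg[symmetric], intro Dc_cong)
    fix A x y B u v
    let ?h = "\<lambda>K. E r f (\<lambda>x. \<phi> (f I u # x)) K v"
    have h: "gsym ?h" by (rule Suc.IH[OF madd_Cons[OF Suc.prems]])
    show "sg (dg (A @ x # y # B) * int (length u)) (?h (A @ x # y # B)) =
       sg ((fst x - 1) * (fst y - 1)) (sg (dg (A @ y # x # B) * int (length u)) (?h (A @ y # x # B)))"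
      unfolding gsymD[OF h, of A x y B] sg_sg
      by (rule sg_cong) auto
  qed
  show ?case
    unfolding E.simps Cp_def
    by (rule gsym_Us[OF _ *]) (simp add: gsym_def short_snoc assms(1) madd_0_hd[OF Suc.prems])
qed

lemma gsym_subst:
  assumes "short f" "short \<Psi>" "\<And>I. madd (\<Psi> I)"
  shows "gsym (\<lambda>K. subst n f \<Psi> K w)"
  unfolding subst_def
proof (rule gsym_Us)
  show "gsym (\<lambda>I. E (nat (dg I + n)) f (\<Psi> I) J w)" for J
    by (simp add: gsym_def short_snoc assms)
qed (use assms gsym_E in blast)

lemma gsym_diff:
  assumes "gsym h" "gsym h'"
  shows "gsym (\<lambda>K. h K - h' K)"
proof (rule gsymI)
  fix A x y B
  show "h (A @ x # y # B) - h' (A @ x # y # B)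
      = sg ((fst x - 1) * (fst y - 1)) (h (A @ y # x # B) - h' (A @ y # x # B))"
    unfolding gsymD[OF assms(1), of A x y B] gsymD[OF assms(2), of A x y B] sg_diff ..
qed

text \<open>Linearity in the items: \<open>z\<close> stands for \<open>x + c y\<close>, and \<open>\<sigma>\<close> for the multiplication by \<open>c\<close>.\<close>

definition ilin ::
  "('m \<Rightarrow> 'm) \<Rightarrow> int \<times> 'x \<Rightarrow> int \<times> 'x \<Rightarrow> int \<times> 'x \<Rightarrow> ((int \<times> 'x) list \<Rightarrow> 'm::ab_group_add) \<Rightarrow> bool" where
  "ilin \<sigma> x y z h \<longleftrightarrow> (\<forall>A B. h (A @ z # B) = h (A @ x # B) + \<sigma> (h (A @ y # B)))"

lemma ilinD: "ilin \<sigma> x y z h \<Longrightarrow> h (A @ z # B) = h (A @ x # B) + \<sigma> (h (A @ y # B))"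
  by (simp add: ilin_def)

lemma ilin_Cons:
  assumes "ilin \<sigma> x y z h"
  shows "ilin \<sigma> x y z (\<lambda>K. h (k # K))"
  unfolding ilin_def
proof (intro allI)
  fix A B
  show "h (k # A @ z # B) = h (k # A @ x # B) + \<sigma> (h (k # A @ y # B))"
    using ilinD[OF assms, of "k # A" B] by simp
qed

text \<open>The distinguished item lies in exactly one of the two parts, so linearity of
  \<open>H\<close> in each part suffices. Equal degrees of the three items keep the signs
  equal.\<close>

lemma ilin_Us:
  assumes \<sigma>: "additive \<sigma>" and fst: "fst z = fst x" "fst y = fst x"
    and "\<And>J. ilin \<sigma> x y z (\<lambda>I. H I J)" "\<And>I. ilin \<sigma> x y z (H I)"
  shows "ilin \<sigma> x y z (\<lambda>K. Us K H)"
  unfolding ilin_def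
proof (intro allI)
  fix A B
  show "Us (A @ z # B) H = Us (A @ x # B) H + \<sigma> (Us (A @ y # B) H)"
    using assms(4-)
  proof (induction A arbitrary: H)
    case Nil
    have 1: "H (z # I) J = H (x # I) J + \<sigma> (H (y # I) J)" for I J
      using ilinD[OF Nil(1), where A = "[]"] by simp
    have 2: "H I (z # J) = H I (x # J) + \<sigma> (H I (y # J))" for I J
      using ilinD[OF Nil(2), where A = "[]"] by simp
    show ?case
      by (simp add: 1 2 fst additive.add[OF \<sigma>] Us_add Us_additive[OF \<sigma>] sg_add additive_sg_comp[OF \<sigma>])
  next
    case (Cons k A)
    have "ilin \<sigma> x y z (\<lambda>I. H (k # I) J)" "ilin \<sigma> x y z (\<lambda>J. H I (k # J))" for I J
      using Cons.prems ilin_Cons by blast+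
    moreover have "ilin \<sigma> x y z (\<lambda>I. sg ((fst k - 1) * dg I) (H I (k # J)))" for J
      using Cons.prems(1)[of "k # J"] by (simp add: ilin_def fst sg_add additive_sg_comp[OF \<sigma>])
    moreover have "ilin \<sigma> x y z (\<lambda>J. sg ((fst k - 1) * dg I) (H I (k # J)))" for I
      using calculation(2)[of I] by (simp add: ilin_def sg_add additive_sg_comp[OF \<sigma>])
    ultimately show ?case
      using Cons.prems(2) by (simp add: Cons.IH additive.add[OF \<sigma>] add.assoc add.left_commute)
  qed
qed

text \<open>The maps \<open>\<sigma>\<close> and \<open>\<tau>\<close> are multiplication by the
  same scalar on arguments and on values. As bare maps they serve both spaces, and the scalar stays
  fixed throughout an induction.\<close>

definition mlin :: "('a \<Rightarrow> 'a) \<Rightarrow> ('m \<Rightarrow> 'm) \<Rightarrow> ('a::ab_group_add list \<Rightarrow> 'm::ab_group_add) \<Rightarrow> bool" where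
  "mlin \<sigma> \<tau> \<phi> \<longleftrightarrow> madd \<phi> \<and> (\<forall>u a v. \<phi> (u @ \<sigma> a # v) = \<tau> (\<phi> (u @ a # v)))"

lemma mlin_madd: "mlin \<sigma> \<tau> \<phi> \<Longrightarrow> madd \<phi>"
  by (simp add: mlin_def)

lemma mlinD: "mlin \<sigma> \<tau> \<phi> \<Longrightarrow> \<phi> (u @ \<sigma> a # v) = \<tau> (\<phi> (u @ a # v))"
  by (simp add: mlin_def)

lemma mlin_hd: "mlin \<sigma> \<tau> \<phi> \<Longrightarrow> \<phi> (\<sigma> a # v) = \<tau> (\<phi> (a # v))"
  using mlinD[of \<sigma> \<tau> \<phi> "[]"] by simp

lemma mlin_Cons:
  assumes "mlin \<sigma> \<tau> \<phi>"
  shows "mlin \<sigma> \<tau> (\<lambda>v. \<phi> (b # v))"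
  unfolding mlin_def
proof (intro conjI allI)
  show "madd (\<lambda>v. \<phi> (b # v))" using assms by (simp add: mlin_def madd_Cons)
  fix u a v
  show "\<phi> (b # u @ \<sigma> a # v) = \<tau> (\<phi> (b # u @ a # v))"
    using mlinD[OF assms, of "b # u"] by simp
qed

lemma mlin_hat_left:
  assumes "mlin \<sigma> \<tau> \<phi>" "additive \<tau>" "\<And>v. y v = y1 v + \<sigma> (y2 v)"
  shows "hat q y \<phi> w = hat q y1 \<phi> w + \<tau> (hat q y2 \<phi> w)"
  using assms(1)
proof (induction w arbitrary: \<phi>)
  case Nil
  show ?case by (simp add: assms(3) additive.add[OF madd_additive_hd] mlin_madd[OF Nil] mlin_hd[OF Nil])
next
  case (Cons a w)
  have "\<phi> (y u # v) = \<phi> (y1 u # v) + \<tau> (\<phi> (y2 u # v))" for u v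
    by (simp add: assms(3) additive.add[OF madd_additive_hd] mlin_madd[OF Cons.prems] mlin_hd[OF Cons.prems])
  then show ?case
    by (simp only: hat.simps Cons.IH[OF mlin_Cons[OF Cons.prems]] Dc_add sg_add additive.add[OF assms(2)]
      Dc_additive[OF assms(2)] additive_sg_comp[OF assms(2)] add_ac)
qed

lemma ilin_comp:
  assumes \<sigma>: "additive \<sigma>" and \<tau>: "additive \<tau>" and fst: "fst z = fst x" "fst y = fst x"
    and X: "\<And>v. ilin \<sigma> x y z (\<lambda>K. X K v)" and \<Psi>: "\<And>v. ilin \<tau> x y z (\<lambda>K. \<Psi> K v)"
    and mlin: "\<And>I. mlin \<sigma> \<tau> (\<Psi> I)"
  shows "ilin \<tau> x y z (\<lambda>K. comp q X \<Psi> K w)"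
  unfolding comp_def
proof (rule ilin_Us[OF \<tau> fst])
  fix J
  have "hat q' (X J) (\<Psi> (A @ z # B)) w
      = hat q' (X J) (\<Psi> (A @ x # B)) w + \<tau> (hat q' (X J) (\<Psi> (A @ y # B)) w)" for q' A B
    unfolding hat_additive[OF \<tau>] hat_add[symmetric]
    by (intro hat_cong) (use \<Psi> in \<open>simp add: ilin_def\<close>)
  then show "ilin \<tau> x y z (\<lambda>I. sg (q * dg I) (hat (q + dg J) (X J) (\<Psi> I) w))"
    by (simp add: ilin_def fst sg_add additive_sg_comp[OF \<tau>])
next
  fix I
  have "hat q' (X (A @ z # B)) (\<Psi> I) w
      = hat q' (X (A @ x # B)) (\<Psi> I) w + \<tau> (hat q' (X (A @ y # B)) (\<Psi> I) w)" for q' A B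
    by (rule mlin_hat_left[OF mlin \<tau>]) (use X in \<open>simp add: ilin_def\<close>)
  then show "ilin \<tau> x y z (\<lambda>J. sg (q * dg I) (hat (q + dg J) (X J) (\<Psi> I) w))"
    by (simp add: ilin_def fst sg_add additive_sg_comp[OF \<tau>])
qed

lemma ilin_E:
  assumes \<sigma>: "additive \<sigma>" and \<tau>: "additive \<tau>" and fst: "fst z = fst x" "fst y = fst x"
    and f: "\<And>v. ilin \<sigma> x y z (\<lambda>K. f K v)" and "mlin \<sigma> \<tau> \<phi>"
  shows "ilin \<tau> x y z (\<lambda>K. E r f \<phi> K w)"
  using assms(6)
proof (induction r arbitrary: \<phi> w)
  case 0
  show ?case by (simp add: ilin_def additive.zero[OF \<tau>])
next
  case (Suc r)
  show ?case
    unfolding E.simps Cp_def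
  proof (rule ilin_Us[OF \<tau> fst])
    fix J
    have "E r f (\<lambda>v. \<phi> (f (A @ z # B) u # v)) J v = E r f (\<lambda>v. \<phi> (f (A @ x # B) u # v)) J v
       + \<tau> (E r f (\<lambda>v. \<phi> (f (A @ y # B) u # v)) J v)" for A B u v
      unfolding E_additive[OF \<tau>] E_add[symmetric]
      using f[of u] unfolding ilin_def
      by (simp add: additive.add[OF madd_additive_hd[OF mlin_madd[OF Suc.prems]]] mlin_hd[OF Suc.prems])
    then show "ilin \<tau> x y z (\<lambda>I. Dc w (\<lambda>u v. sg (dg J * int (length u)) (E r f (\<lambda>x. \<phi> (f I u # x)) J v)))"
      by (simp add: ilin_def sg_add additive_sg_comp[OF \<tau>] Dc_add Dc_additive[OF \<tau>])
  next
    fix I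
    have "E r f (\<lambda>v. \<phi> (f I u # v)) (A @ z # B) v = E r f (\<lambda>v. \<phi> (f I u # v)) (A @ x # B) v
       + \<tau> (E r f (\<lambda>v. \<phi> (f I u # v)) (A @ y # B) v)" for A B u v
      using Suc.IH[OF mlin_Cons[OF Suc.prems], of "f I u" v] by (simp add: ilin_def)
    then show "ilin \<tau> x y z (\<lambda>J. Dc w (\<lambda>u v. sg (dg J * int (length u)) (E r f (\<lambda>x. \<phi> (f I u # x)) J v)))"
      by (simp add: ilin_def fst sg_add additive_sg_comp[OF \<tau>] Dc_add Dc_additive[OF \<tau>])
  qed
qed

lemma ilin_subst:
  assumes \<sigma>: "additive \<sigma>" and \<tau>: "additive \<tau>" and fst: "fst z = fst x" "fst y = fst x"
    and f: "\<And>v. ilin \<sigma> x y z (\<lambda>K. f K v)" and \<Psi>: "\<And>v. ilin \<tau> x y z (\<lambda>K. \<Psi> K v)"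
    and mlin: "\<And>I. mlin \<sigma> \<tau> (\<Psi> I)"
  shows "ilin \<tau> x y z (\<lambda>K. subst n f \<Psi> K w)"
  unfolding subst_def
proof (rule ilin_Us[OF \<tau> fst])
  fix J
  have "\<Psi> (A @ z # B) = (\<lambda>v. \<Psi> (A @ x # B) v + \<tau> (\<Psi> (A @ y # B) v))" for A B
    using \<Psi> by (auto simp: ilin_def)
  then show "ilin \<tau> x y z (\<lambda>I. E (nat (dg I + n)) f (\<Psi> I) J w)"
    by (simp add: ilin_def fst E_add E_additive[OF \<tau>])
qed (rule ilin_E[OF \<sigma> \<tau> fst f mlin])

lemma ilin_diff:
  "additive \<tau> \<Longrightarrow> ilin \<tau> x y z h \<Longrightarrow> ilin \<tau> x y z h' \<Longrightarrow> ilin \<tau> x y z (\<lambda>K. h K - h' K)"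
  unfolding ilin_def by (simp add: additive.diff)

lemma Dc_append_Cons:
  "Dc (u @ a # v) H = Dc u (\<lambda>u1 u2. H u1 (u2 @ a # v)) + Dc v (\<lambda>v1 v2. H (u @ a # v1) v2)"
  by (induction u arbitrary: H) (simp_all add: add.assoc)

lemma mlin_Dc:
  assumes \<tau>: "additive \<tau>" and H: "\<And>v. mlin \<sigma> \<tau> (\<lambda>u. H u v)" "\<And>u. mlin \<sigma> \<tau> (H u)"
  shows "mlin \<sigma> \<tau> (\<lambda>w. Dc w H)"
proof -
  have "H (u @ (a + b) # v1) = (\<lambda>v2. H (u @ a # v1) v2 + H (u @ b # v1) v2)" for u a b v1
    using H(1) by (auto simp: mlin_def madd_def additive_def)
  moreover have "H u (v1 @ (a + b) # v2) = H u (v1 @ a # v2) + H u (v1 @ b # v2)" for u a b v1 v2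
    using H(2)[of u] by (simp add: mlin_def madd_def additive_def)
  moreover have "H (u @ \<sigma> a # v1) = (\<lambda>v2. \<tau> (H (u @ a # v1) v2))" for u a v1
    using H(1) by (auto simp: mlin_def)
  moreover have "H u (v1 @ \<sigma> a # v2) = \<tau> (H u (v1 @ a # v2))" for u a v1 v2
    using H(2)[of u] by (simp add: mlin_def)
  ultimately show ?thesis
    by (simp add: mlin_def madd_def additive_def Dc_append_Cons Dc_add additive.add[OF \<tau>]
        Dc_additive[OF \<tau>] add.assoc add.left_commute)
qed

lemma mlin_compose:
  assumes "mlin \<sigma> \<sigma>' y" "\<And>a b. h (a + b) = h a + h b" "\<And>a. h (\<sigma>' a) = \<tau> (h a)"
  shows "mlin \<sigma> \<tau> (\<lambda>u. h (y u))"
  using assms by (simp add: mlin_def madd_def additive_def)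

lemma mlin_hat:
  assumes \<tau>: "additive \<tau>" and y: "mlin \<sigma> \<sigma> y" and "mlin \<sigma> \<tau> \<phi>"
  shows "mlin \<sigma> \<tau> (hat q y \<phi>)"
proof -
  have Dc: "mlin \<sigma> \<tau> (\<lambda>w. Dc w (\<lambda>u v. \<phi> (y u # v)))" if "mlin \<sigma> \<tau> \<phi>" for \<phi>
    by (intro mlin_Dc \<tau> mlin_Cons[OF that] mlin_compose[OF y] additive.add[OF madd_additive_hd]
        mlin_madd[OF that] mlin_hd[OF that])
  have "hat q y \<phi> (u @ (a + b) # v) = hat q y \<phi> (u @ a # v) + hat q y \<phi> (u @ b # v)
      \<and> hat q y \<phi> (u @ \<sigma> a # v) = \<tau> (hat q y \<phi> (u @ a # v))" for u a b v
    using assms(3)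
  proof (induction u arbitrary: \<phi>)
    case Nil
    have "Dc ([] @ (a + b) # v) (\<lambda>u v. \<phi> (y u # v))
        = Dc ([] @ a # v) (\<lambda>u v. \<phi> (y u # v)) + Dc ([] @ b # v) (\<lambda>u v. \<phi> (y u # v))"
      and "Dc ([] @ \<sigma> a # v) (\<lambda>u v. \<phi> (y u # v)) = \<tau> (Dc ([] @ a # v) (\<lambda>u v. \<phi> (y u # v)))"
      using Dc[OF Nil] unfolding mlin_def madd_def additive_def by blast+
    then show ?case
      by (simp del: Dc.simps add: hat_add additive.add[OF madd_additive_hd[OF mlin_madd[OF Nil]]]
          mlin_hd[OF Nil] hat_additive[OF \<tau>, symmetric] sg_add additive.add[OF \<tau>] additive_sg_comp[OF \<tau>])
  next
    case (Cons c u)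
    have "Dc ((c # u) @ (a + b) # v) (\<lambda>u v. \<phi> (y u # v))
        = Dc ((c # u) @ a # v) (\<lambda>u v. \<phi> (y u # v)) + Dc ((c # u) @ b # v) (\<lambda>u v. \<phi> (y u # v))"
      and "Dc ((c # u) @ \<sigma> a # v) (\<lambda>u v. \<phi> (y u # v)) = \<tau> (Dc ((c # u) @ a # v) (\<lambda>u v. \<phi> (y u # v)))"
      using Dc[OF Cons.prems] unfolding mlin_def madd_def additive_def by blast+
    then show ?case
      using Cons.IH[OF mlin_Cons[OF Cons.prems]]
      by (simp del: Dc.simps add: sg_add additive.add[OF \<tau>] additive_sg_comp[OF \<tau>])
  qed
  then show ?thesis by (simp add: mlin_def madd_def additive_def)
qed

lemma mlin_0: "additive \<tau> \<Longrightarrow> mlin \<sigma> \<tau> (\<lambda>w. 0)"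
  by (simp add: mlin_def madd_def additive_def additive.zero)

lemma mlin_add: "additive \<tau> \<Longrightarrow> mlin \<sigma> \<tau> \<phi> \<Longrightarrow> mlin \<sigma> \<tau> \<psi> \<Longrightarrow> mlin \<sigma> \<tau> (\<lambda>w. \<phi> w + \<psi> w)"
  by (simp add: mlin_def madd_def additive_def algebra_simps)

lemma mlin_length_sg:
  "additive \<tau> \<Longrightarrow> mlin \<sigma> \<tau> \<phi> \<Longrightarrow> mlin \<sigma> \<tau> (\<lambda>w. sg (n * int (length w)) (\<phi> w))"
  by (simp add: mlin_def madd_def additive_def sg_add additive_sg_comp[unfolded additive_def])

lemma mlin_sg: "additive \<tau> \<Longrightarrow> mlin \<sigma> \<tau> \<phi> \<Longrightarrow> mlin \<sigma> \<tau> (\<lambda>w. sg n (\<phi> w))"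
  by (simp add: mlin_def madd_def additive_def sg_add additive_sg_comp[unfolded additive_def])

lemma mlin_diff: "additive \<tau> \<Longrightarrow> mlin \<sigma> \<tau> \<phi> \<Longrightarrow> mlin \<sigma> \<tau> \<psi> \<Longrightarrow> mlin \<sigma> \<tau> (\<lambda>w. \<phi> w - \<psi> w)"
  using mlin_add[of \<tau> \<sigma> \<phi> "\<lambda>w. sg 1 (\<psi> w)"] mlin_sg[of \<tau> \<sigma> \<psi> 1] by (simp add: sg_one)

lemma mlin_Us:
  "additive \<tau> \<Longrightarrow> (\<And>I J. mlin \<sigma> \<tau> (H I J)) \<Longrightarrow> mlin \<sigma> \<tau> (\<lambda>w. Us K (\<lambda>I J. H I J w))"
  by (induction K arbitrary: H) (simp_all add: mlin_add mlin_sg)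

lemma mlin_comp:
  assumes "additive \<tau>" "\<And>J. mlin \<sigma> \<sigma> (X J)" "\<And>I. mlin \<sigma> \<tau> (\<Psi> I)"
  shows "mlin \<sigma> \<tau> (comp q X \<Psi> K)"
  unfolding comp_def[abs_def] by (intro mlin_Us mlin_sg mlin_hat assms)

lemma mlin_E:
  assumes \<tau>: "additive \<tau>" and f: "\<And>I. mlin \<sigma> \<sigma>' (f I)" and "mlin \<sigma>' \<tau> \<phi>"
  shows "mlin \<sigma> \<tau> (E r f \<phi> K)"
  using assms(3)
proof (induction r arbitrary: \<phi> K)
  case 0
  show ?case by (simp add: mlin_def madd_def additive_def additive.zero[OF \<tau>])
next
  case (Suc r)
  have *: "E r f (\<lambda>x. \<phi> (\<sigma>' a # x)) J v = \<tau> (E r f (\<lambda>x. \<phi> (a # x)) J v)" for a J v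
    by (simp add: mlin_hd[OF Suc.prems] E_additive[OF \<tau>])
  show ?case
    unfolding E.simps[abs_def] Cp_def
    by (intro mlin_Us mlin_Dc \<tau> mlin_length_sg mlin_sg Suc.IH mlin_Cons[OF Suc.prems]
        mlin_compose[OF f, where h = "\<lambda>a. E r f (\<lambda>x. \<phi> (a # x)) _ _"] *
        additive.add[OF additive_E_hd[OF mlin_madd[OF Suc.prems]]])
qed

lemma mlin_subst:
  assumes "additive \<tau>" "\<And>I. mlin \<sigma> \<sigma>' (f I)" "\<And>I. mlin \<sigma>' \<tau> (\<Psi> I)"
  shows "mlin \<sigma> \<tau> (subst n f \<Psi> K)"
  unfolding subst_def[abs_def] by (intro mlin_Us mlin_E[where \<sigma>' = \<sigma>'] assms)

section \<open>Supports: the degree determines the word length\<close>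

lemma comp_length_eq_0:
  assumes X: "\<And>J v. X J v \<noteq> 0 \<Longrightarrow> int (length v) = dg J + n"
    and \<Psi>: "\<And>I v. \<Psi> I v \<noteq> 0 \<Longrightarrow> int (length v) = dg I + m" "\<And>I. madd (\<Psi> I)"
    and w: "int (length w) + 1 \<noteq> dg K + m + n"
  shows "comp q X \<Psi> K w = 0"
proof -
  have "Us K (\<lambda>I J. sg (q * dg I) (hat (q + dg J) (X J) (\<Psi> I) w)) = Us K (\<lambda>I J. 0)"
  proof (intro Us_cong, goal_cases)
    case (1 I J)
    then have "hat (q + dg J) (X J) (\<Psi> I) w = 0"
      by (intro hat_length_eq_0[where n = "dg J + n" and m = "dg I + m"])
        (use X \<Psi> w in auto)
    then show ?case by simp
  qed
  then show ?thesis by (simp add: comp_def)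
qed

lemma E_length_word_eq_0:
  assumes f: "\<And>I v. f I v \<noteq> 0 \<Longrightarrow> int (length v) = dg I + 1" and "madd \<phi>"
    and "int (length w) \<noteq> dg K + int r"
  shows "E r f \<phi> K w = 0"
  using assms(2,3)
proof (induction r arbitrary: \<phi> K w)
  case (Suc r)
  have "Cp K w (\<lambda>I u J v. E r f (\<lambda>x. \<phi> (f I u # x)) J v) = Cp K w (\<lambda>I u J v. 0)"
  proof (intro Cp_cong, goal_cases)
    case *: (1 I u J v)
    show ?case
    proof (cases "f I u = 0")
      case False
      have "length w = length u + length v" using *(3) by auto
      then show ?thesis
        using f[OF False] Suc.prems(2) *(1) by (intro Suc.IH madd_Cons[OF Suc.prems(1)]) auto
    qed (simp add: madd_0_hd[OF Suc.prems(1)])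
  qed
  then show ?case by simp
qed auto

lemma subst_length_eq_0:
  assumes f: "\<And>I v. f I v \<noteq> 0 \<Longrightarrow> int (length v) = dg I + 1"
    and \<Psi>: "\<And>I v. \<Psi> I v \<noteq> 0 \<Longrightarrow> int (length v) = dg I + n" "\<And>I. madd (\<Psi> I)"
    and w: "int (length w) \<noteq> dg K + n"
  shows "subst n f \<Psi> K w = 0"
proof -
  have "Us K (\<lambda>I J. E (nat (dg I + n)) f (\<Psi> I) J w) = Us K (\<lambda>I J. 0)"
  proof (intro Us_cong, goal_cases)
    case (1 I J)
    show ?case
    proof (cases "dg I + n < 0")
      case True
      then show ?thesis by (intro E_length_eq_0) (use \<Psi>(1)[of I] in fastforce)
    next
      case False
      then show ?thesis by (intro E_length_word_eq_0 \<Psi>(2)) (use f w 1 in auto)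
    qed
  qed
  then show ?thesis by (simp add: subst_def)
qed

text \<open>Pigeonhole: each of the r factors takes at most one item. This is what bounds the order
  of the nonzero brackets at a degree 1 element.\<close>

lemma E_many_items_eq_0:
  assumes "short f" "madd \<phi>" "r < length K"
  shows "E r f \<phi> K w = 0"
  using assms(2,3)
proof (induction r arbitrary: \<phi> K w)
  case (Suc r)
  have "Cp K w (\<lambda>I u J v. E r f (\<lambda>x. \<phi> (f I u # x)) J v) = Cp K w (\<lambda>I u J v. 0)"
  proof (intro Cp_cong, goal_cases)
    case *: (1 I u J v)
    show ?case
    proof (cases "2 \<le> length I")
      case True
      then show ?thesis using assms(1) by (simp add: short_def madd_0_hd[OF Suc.prems(1)])
    next
      case False
      then show ?thesis using * Suc.prems by (intro Suc.IH madd_Cons) auto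
    qed
  qed
  then show ?case by simp
qed auto

section \<open>Permutations, inversions and unshuffles\<close>

definition inversions :: "(nat \<Rightarrow> nat) \<Rightarrow> nat \<Rightarrow> (nat \<times> nat) set" where
  "inversions \<sigma> n = {(a, b). a < b \<and> b < n \<and> \<sigma> b < \<sigma> a}"

lemma finite_inversions [simp]: "finite (inversions \<sigma> n)"
  by (rule finite_subset[of _ "{..<n} \<times> {..<n}"]) (auto simp: inversions_def)

lemma inversions_id [simp]: "inversions id n = {}" "inversions (\<lambda>a. a) n = {}"
  by (auto simp: inversions_def)

lemma inversions_transpose:
  assumes \<sigma>: "\<sigma> permutes {..<n}" and i: "Suc i < n" "\<sigma> i < \<sigma> (Suc i)"
  defines "t \<equiv> transpose i (Suc i)"
  shows "inversions (\<sigma> \<circ> t) n = insert (i, Suc i) (map_prod t t ` inversions \<sigma> n)"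
    and "(i, Suc i) \<notin> map_prod t t ` inversions \<sigma> n"
proof -
  have tt: "t (t a) = a" for a by (simp add: t_def)
  have tn: "t a < n \<longleftrightarrow> a < n" for a using i by (auto simp: t_def transpose_def)
  have inv: "(a, b) \<in> inversions (\<sigma> \<circ> t) n" if "(t a, t b) \<in> inversions \<sigma> n" for a b
    using that i tn[of b] by (auto simp: inversions_def t_def transpose_def split: if_splits)
  have inv': "(t a, t b) \<in> inversions \<sigma> n" if "(a, b) \<in> inversions (\<sigma> \<circ> t) n" "(a, b) \<noteq> (i, Suc i)" for a b
    using that i tn[of b] by (auto simp: inversions_def t_def transpose_def split: if_splits)
  show "inversions (\<sigma> \<circ> t) n = insert (i, Suc i) (map_prod t t ` inversions \<sigma> n)"
  proof (intro set_eqI iffI)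
    fix z assume z: "z \<in> inversions (\<sigma> \<circ> t) n"
    obtain a b where ab: "z = (a, b)" by (cases z)
    show "z \<in> insert (i, Suc i) (map_prod t t ` inversions \<sigma> n)"
    proof (cases "z = (i, Suc i)")
      case False
      then have "(t a, t b) \<in> inversions \<sigma> n" using inv' z ab by simp
      then have "map_prod t t (t a, t b) \<in> map_prod t t ` inversions \<sigma> n" by (rule imageI)
      then show ?thesis by (simp add: tt ab)
    qed simp
  next
    fix z assume "z \<in> insert (i, Suc i) (map_prod t t ` inversions \<sigma> n)"
    then show "z \<in> inversions (\<sigma> \<circ> t) n"
    proof
      assume "z \<in> map_prod t t ` inversions \<sigma> n"
      then show ?thesis using inv by (auto simp: tt)
    qed (use i in \<open>auto simp: inversions_def t_def\<close>)
  qed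
  show "(i, Suc i) \<notin> map_prod t t ` inversions \<sigma> n"
  proof
    assume "(i, Suc i) \<in> map_prod t t ` inversions \<sigma> n"
    then obtain a b where "(a, b) \<in> inversions \<sigma> n" "t a = i" "t b = Suc i" by auto
    then show False using tt[of a] tt[of b] by (simp add: inversions_def t_def)
  qed
qed

lemma sum_inversions_transpose:
  assumes "\<sigma> permutes {..<n}" "Suc i < n" "\<sigma> i < \<sigma> (Suc i)"
  defines "\<tau> \<equiv> \<sigma> \<circ> transpose i (Suc i)"
  shows "(\<Sum>(a, b)\<in>inversions \<tau> n. h (\<tau> a) (\<tau> b))
    = h (\<sigma> (Suc i)) (\<sigma> i) + (\<Sum>(a, b)\<in>inversions \<sigma> n. h (\<sigma> a) (\<sigma> b))"
proof -
  let ?t = "transpose i (Suc i)"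
  have "inj ?t" by (metis inj_on_inverseI transpose_involutory)
  then have inj: "inj_on (map_prod ?t ?t) (inversions \<sigma> n)"
    by (intro inj_on_subset[OF prod.inj_map]) auto
  show ?thesis
    unfolding \<tau>_def inversions_transpose(1)[OF assms(1-3)]
    by (subst sum.insert) (use inversions_transpose(2)[OF assms(1-3)] in
      \<open>auto simp: sum.reindex[OF inj] case_prod_beta\<close>)
qed

text \<open>Bubble sort: undoing a descent removes exactly one inversion, and a permutation without
  descents is the identity. As the step starts from an ascent, sums over inversions grow by a single
  term in it.\<close>

lemma permutes_adjacent_induct [consumes 1, case_names id transpose]:
  assumes "\<sigma> permutes {..<n}" "P id"
    and "\<And>\<sigma> i. \<sigma> permutes {..<n} \<Longrightarrow> Suc i < n \<Longrightarrow> \<sigma> i < \<sigma> (Suc i) \<Longrightarrow> P \<sigma>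
      \<Longrightarrow> P (\<sigma> \<circ> transpose i (Suc i))"
  shows "P \<sigma>"
  using assms(1)
proof (induction "card (inversions \<sigma> n)" arbitrary: \<sigma> rule: less_induct)
  case less
  show ?case
  proof (cases "\<exists>i. Suc i < n \<and> \<sigma> (Suc i) < \<sigma> i")
    case True
    then obtain i where i: "Suc i < n" "\<sigma> (Suc i) < \<sigma> i" by blast
    let ?t = "transpose i (Suc i)" and ?\<sigma> = "\<sigma> \<circ> transpose i (Suc i)"
    have \<sigma>: "?\<sigma> permutes {..<n}"
      by (intro permutes_compose permutes_swap_id less.prems) (use i in auto)
    have \<sigma>t: "?\<sigma> \<circ> ?t = \<sigma>" by (simp add: fun_eq_iff)
    have "inj ?t" by (metis inj_on_inverseI transpose_involutory)
    then have inj: "inj_on (map_prod ?t ?t) (inversions ?\<sigma> n)"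
      by (intro inj_on_subset[OF prod.inj_map]) auto
    have lt: "?\<sigma> i < ?\<sigma> (Suc i)" using i by simp
    have "card (inversions \<sigma> n) = Suc (card (inversions ?\<sigma> n))"
      using inversions_transpose[OF \<sigma> i(1) lt, unfolded \<sigma>t] card_image[OF inj]
      by (simp del: o_apply comp_apply)
    then have "P ?\<sigma>" using less.hyps \<sigma> by simp
    with \<sigma> i(1) lt have "P (?\<sigma> \<circ> ?t)" by (rule assms(3))
    then show ?thesis by (simp only: \<sigma>t)
  next
    case False
    have "\<sigma> i = i" if "i < n" for i
    proof -
      have step: "\<sigma> i < \<sigma> (Suc i)" if "Suc i < n" for i
        using False that permutes_inj[OF less.prems, THEN injD, of i "Suc i"]
        by (metis n_not_Suc_n nat_neq_iff)
      \<comment> \<open>A strictly increasing map of the first n numbers into themselves lies above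
        the identity when read from below and under it when read from above.\<close>
      have lo: "i \<le> \<sigma> i" if "i < n" for i
        using that by (induction i) (use step in \<open>auto intro: Suc_leI le_less_trans\<close>)
      have hi: "\<sigma> (n - Suc i) \<le> n - Suc i" if "i < n" for i
        using that
      proof (induction i)
        case 0
        then show ?case using permutes_in_image[OF less.prems, of "n - 1"] by simp
      next
        case (Suc i)
        then show ?case using step[of "n - Suc (Suc i)"] by (simp add: Suc_diff_Suc)
      qed
      show ?thesis using lo[OF that] hi[of "n - Suc i"] that by simp
    qed
    then have "\<sigma> x = x" for x using permutes_not_in[OF less.prems, of x] by (cases "x < n") auto
    then have "\<sigma> = id" by (simp add: fun_eq_iff)
    then show ?thesis using assms(2) by simp
  qed
qed

lemma permute_list_transpose:
  assumes "Suc i < length K"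
  shows "permute_list (transpose i (Suc i)) K = take i K @ K ! Suc i # K ! i # drop (Suc (Suc i)) K"
proof (rule nth_equalityI)
  show "length (permute_list (transpose i (Suc i)) K)
      = length (take i K @ K ! Suc i # K ! i # drop (Suc (Suc i)) K)"
    using assms by simp
  fix j assume j: "j < length (permute_list (transpose i (Suc i)) K)"
  have "transpose i (Suc i) permutes {..<length K}" by (rule permutes_swap_id) (use assms in auto)
  then show "permute_list (transpose i (Suc i)) K ! j
      = (take i K @ K ! Suc i # K ! i # drop (Suc (Suc i)) K) ! j"
    using assms j Suc_diff_Suc[of 1 j]
    by (cases j i rule: linorder_cases)
      (auto simp: numeral_2_eq_2 permute_list_nth nth_append transpose_def nth_Cons' Suc_diff_Suc)
qed

text \<open>Every adjacent exchange contributes the exponent of the pair that it inverts. The lemma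
  serves the antisymmetry of the brackets and also the parity of \<open>dexp\<close> under
  permutations.\<close>

lemma permute_list_sg:
  assumes G: "\<And>A x y B. G (A @ x # y # B) = sg (h x y) (G (A @ y # x # B))"
    and "\<sigma> permutes {..<length K}"
  shows "G (permute_list \<sigma> K) = sg (\<Sum>(a, b)\<in>inversions \<sigma> (length K). h (K ! \<sigma> a) (K ! \<sigma> b)) (G K)"
  using assms(2)
proof (induction rule: permutes_adjacent_induct)
  case id
  show ?case by simp
next
  case (transpose \<sigma> i)
  let ?K = "permute_list \<sigma> K"
  have t: "transpose i (Suc i) permutes {..<length K}"
    by (rule permutes_swap_id) (use transpose in auto)
  have K: "take i ?K @ ?K ! i # ?K ! Suc i # drop (Suc (Suc i)) ?K = ?K"
    using transpose(2) by (simp add: Cons_nth_drop_Suc)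
  have "permute_list (\<sigma> \<circ> transpose i (Suc i)) K = take i ?K @ ?K ! Suc i # ?K ! i # drop (Suc (Suc i)) ?K"
    using permute_list_transpose[of i ?K] transpose(2) by (simp add: permute_list_compose[OF t])
  then have "G (permute_list (\<sigma> \<circ> transpose i (Suc i)) K) = sg (h (?K ! Suc i) (?K ! i)) (G ?K)"
    using G[of "take i ?K" "?K ! Suc i" "?K ! i"] K by simp
  also have "\<dots> = sg (h (K ! \<sigma> (Suc i)) (K ! \<sigma> i)) (G ?K)"
    using transpose(1,2) by (simp add: permute_list_nth)
  finally show ?case
    unfolding transpose.IH
      sum_inversions_transpose[OF transpose(1-3), where h = "\<lambda>a b. h (K ! a) (K ! b)"] sg_sg .
qed

lemma sign_inversions: "\<sigma> permutes {..<n} \<Longrightarrow> sign \<sigma> = ksign (\<Sum>(a, b)\<in>inversions \<sigma> n. 1)"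
proof (induction rule: permutes_adjacent_induct)
  case id
  show ?case by (simp add: ksign_def)
next
  case (transpose \<sigma> i)
  have "permutation \<sigma>" using transpose(1) by (metis permutation_permutes finite_lessThan)
  then have "sign (\<sigma> \<circ> transpose i (Suc i)) = - sign \<sigma>"
    by (simp add: sign_compose permutation_swap_id sign_swap_id)
  then show ?case
    unfolding transpose.IH sum_inversions_transpose[OF transpose(1-3), where h = "\<lambda>a b. 1"] ksign_def
    by (simp only: even_add) simp
qed

text \<open>The sign of a permutation and the Koszul sign are both products over the inversions, so
  they merge into one exponent, in the form that \<open>permute_list_sg\<close> delivers.\<close>

lemma chi_inversions:
  assumes "\<sigma> permutes {..<length ps}"
  shows "chi \<sigma> ps = ksign (\<Sum>(a, b)\<in>inversions \<sigma> (length ps). 1 + ps ! \<sigma> a * ps ! \<sigma> b)"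
proof -
  have ksign_add: "ksign (p + q) = (ksign p * ksign q :: int)" for p q
    by (simp add: ksign_def)
  have "koszul_sign \<sigma> ps = (\<Prod>(a, b)\<in>inversions \<sigma> (length ps). ksign (ps ! \<sigma> a * ps ! \<sigma> b))"
    unfolding koszul_sign_def inversions_def ..
  also have "\<dots> = ksign (\<Sum>(a, b)\<in>inversions \<sigma> (length ps). ps ! \<sigma> a * ps ! \<sigma> b)"
    by (rule sum_comp_morphism[where h = "ksign", symmetric, unfolded comp_def]
        | (induction rule: infinite_finite_induct; auto simp: ksign_add ksign_def case_prod_beta))+
  finally show ?thesis
    unfolding chi_def sign_inversions[OF assms]
    by (simp add: ksign_add sum.distrib case_prod_beta)
qed

lemma nths_filter: "nths K A = map ((!) K) (filter (\<lambda>i. i \<in> A) [0..<length K])"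
  by (induction K rule: rev_induct) (auto simp: nths_append nth_append intro!: map_cong)

text \<open>The recursion decides for each position whether it belongs to \<open>S\<close>. The
  exponent collects the pairs that change their order: b stood before a, but only a moves to the
  left part.\<close>

lemma Us_nths:
  "Us K H = (\<Sum>S\<in>Pow {..<length K}.
     sg (\<Sum>(a, b)\<in>{(a, b). a \<in> S \<and> b < a \<and> b \<notin> S}. (fst (K ! a) - 1) * (fst (K ! b) - 1))
       (H (nths K S) (nths K (- S))))"
proof (induction K arbitrary: H)
  case Nil
  show ?case by simp
next
  case (Cons k K)
  let ?n = "length K"
  let ?h = "\<lambda>K a b. (fst (K ! a) - 1) * (fst (K ! b) - 1)"
  let ?e = "\<lambda>K S. \<Sum>(a, b)\<in>{(a, b). a \<in> S \<and> b < a \<and> b \<notin> S}. ?h K a b"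
  let ?f = "\<lambda>S. sg (?e (k # K) S) (H (nths (k # K) S) (nths (k # K) (- S)))"
  have Pow: "Pow {..<Suc ?n} = (\<lambda>S. insert 0 (Suc ` S)) ` Pow {..<?n} \<union> (`) Suc ` Pow {..<?n}"
    unfolding lessThan_Suc_eq_insert_0 Pow_insert by (simp add: image_Pow_surj image_image Un_commute flip: image_image[of "insert 0" "(`) Suc"])
  have inj: "inj_on (\<lambda>S. insert 0 (Suc ` S)) (Pow {..<?n})" "inj_on ((`) Suc) (Pow {..<?n})"
    by (auto simp: inj_on_def set_eq_iff image_iff)
  have inj_Suc2: "inj_on (map_prod Suc Suc) A" for A
    by (auto simp: inj_on_def)
  have e1: "?e (k # K) (insert 0 (Suc ` S)) = ?e K S" for S
  proof -
    have "{(a, b). a \<in> insert 0 (Suc ` S) \<and> b < a \<and> b \<notin> insert 0 (Suc ` S)}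
        = map_prod Suc Suc ` {(a, b). a \<in> S \<and> b < a \<and> b \<notin> S}" (is "?L = ?R")
    proof
      show "?L \<subseteq> ?R"
      proof
        fix z assume "z \<in> ?L"
        then obtain a b where "z = (Suc a, Suc b)" "a \<in> S" "b < a" "b \<notin> S"
          by (cases z, cases "snd z") auto
        then show "z \<in> ?R" by (auto intro!: image_eqI[of _ _ "(a, b)"])
      qed
    qed auto
    then show ?thesis
      by (simp add: sum.reindex[OF inj_Suc2] case_prod_beta)
  qed
  \<comment> \<open>The new first item stays in the right part and is passed by every item of
    \<open>S\<close>; the remaining pairs are the old ones with indices shifted by one.\<close>
  have e2: "?e (k # K) (Suc ` S) = (fst k - 1) * dg (nths K S) + ?e K S" if "S \<subseteq> {..<?n}" for S
  proof -
    have fin: "finite S" using that finite_subset by blast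
    let ?I = "{(a, b). a \<in> S \<and> b < a \<and> b \<notin> S}"
    have "{(a, b). a \<in> Suc ` S \<and> b < a \<and> b \<notin> Suc ` S}
        = (\<lambda>a. (Suc a, 0)) ` S \<union> map_prod Suc Suc ` ?I" (is "?L = ?R")
    proof
      show "?L \<subseteq> ?R"
      proof
        fix z assume z: "z \<in> ?L"
        obtain a b where ab: "z = (a, b)" by (cases z)
        show "z \<in> ?R"
        proof (cases b)
          case (Suc b')
          then show ?thesis using z ab by (auto intro!: image_eqI[of _ _ "(a - 1, b')"])
        qed (use z ab in auto)
      qed
    qed auto
    moreover have "finite ?I"
      by (rule finite_subset[of _ "S \<times> {..<?n}"]) (use that fin in auto)
    moreover have "(\<Sum>a\<in>S. fst (K ! a) - 1) = dg (nths K S)"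
    proof -
      have "dg (nths K S) = (\<Sum>a\<leftarrow>filter (\<lambda>i. i \<in> S) [0..<?n]. fst (K ! a) - 1)"
        by (simp add: dg_def nths_filter o_def)
      also have "\<dots> = (\<Sum>a\<in>set (filter (\<lambda>i. i \<in> S) [0..<?n]). fst (K ! a) - 1)"
        by (rule sum_list_distinct_conv_sum_set) simp
      also have "set (filter (\<lambda>i. i \<in> S) [0..<?n]) = S" using that by auto
      finally show ?thesis by simp
    qed
    moreover have "(\<lambda>a. (Suc a, 0)) ` S \<inter> map_prod Suc Suc ` ?I = {}" by auto
    moreover have "inj_on (\<lambda>a. (Suc a, 0 :: nat)) S" by (auto simp: inj_on_def)
    ultimately show ?thesis
      using fin by (simp add: sum.union_disjoint sum.reindex[OF inj_Suc2] sum.reindex case_prod_beta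
          sum_distrib_left[symmetric] mult.commute)
  qed
  have n1: "nths (k # K) (insert 0 (Suc ` S)) = k # nths K S" "nths (k # K) (- insert 0 (Suc ` S)) = nths K (- S)"
    "nths (k # K) (Suc ` S) = nths K S" "nths (k # K) (- Suc ` S) = k # nths K (- S)" for S
    by (auto simp: nths_Cons image_iff intro!: arg_cong[of _ _ "nths K"])
  have "Us (k # K) H = (\<Sum>S\<in>Pow {..<?n}. ?f (insert 0 (Suc ` S))) + (\<Sum>S\<in>Pow {..<?n}. ?f (Suc ` S))"
  proof -
    have "sg (?e K S) (sg ((fst k - 1) * dg (nths K S)) (H (nths K S) (k # nths K (- S)))) = ?f (Suc ` S)"
      if "S \<in> Pow {..<?n}" for S
      using that unfolding n1 by (subst e2) (simp_all add: add.commute)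
    then show ?thesis
      unfolding Us.simps Cons.IH e1 n1 by (intro arg_cong2[of _ _ _ _ "(+)"] sum.cong HOL.refl) simp_all
  qed
  also have "\<dots> = (\<Sum>S\<in>Pow {..<length (k # K)}. ?f S)"
    unfolding length_Cons Pow
    by (subst sum.union_disjoint) (auto simp: sum.reindex[OF inj(1)] sum.reindex[OF inj(2)])
  finally show ?case .
qed

text \<open>In each equation both lists are strictly increasing and have the same elements.\<close>

lemma unshuffles_lists:
  assumes "\<sigma> \<in> unshuffles i n" "i \<le> n"
  shows "map \<sigma> [0..<i] = filter (\<lambda>j. j \<in> \<sigma> ` {..<i}) [0..<n]"
    and "map \<sigma> [i..<n] = filter (\<lambda>j. j \<notin> \<sigma> ` {..<i}) [0..<n]"
proof -
  have \<sigma>: "\<sigma> permutes {..<n}" and mono: "strict_mono_on {..<i} \<sigma>" "strict_mono_on {i..<n} \<sigma>"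
    using assms(1) by (auto simp: unshuffles_def)
  have sorted: "sorted_wrt (<) (map \<sigma> [j..<k])" if "strict_mono_on {j..<k} \<sigma>" for j k
    unfolding sorted_wrt_map
    by (rule sorted_wrt_mono_rel[OF _ sorted_wrt_upt]) (use that in \<open>auto simp: strict_mono_on_def\<close>)
  have "\<sigma> ` {i..<n} = {..<n} - \<sigma> ` {..<i}"
  proof -
    have "\<sigma> ` ({..<n} - {..<i}) = \<sigma> ` {..<n} - \<sigma> ` {..<i}"
      by (rule image_set_diff) (rule permutes_inj[OF \<sigma>])
    moreover have "{..<n} - {..<i} = {i..<n}" by auto
    ultimately show ?thesis by (simp add: permutes_image[OF \<sigma>])
  qed
  then have "\<sigma> ` {i..<n} = {x \<in> {..<n}. x \<notin> \<sigma> ` {..<i}}" by blast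
  moreover have "\<sigma> ` {..<i} \<subseteq> \<sigma> ` {..<n}" using assms(2) by (intro image_mono) auto
  then have "\<sigma> ` {..<i} = {x \<in> {..<n}. x \<in> \<sigma> ` {..<i}}"
    unfolding permutes_image[OF \<sigma>] by blast
  ultimately have sets: "set (map \<sigma> [0..<i]) = set (filter (\<lambda>j. j \<in> \<sigma> ` {..<i}) [0..<n])"
    "set (map \<sigma> [i..<n]) = set (filter (\<lambda>j. j \<notin> \<sigma> ` {..<i}) [0..<n])"
    unfolding set_map set_filter set_upt atLeast0LessThan by blast+
  show "map \<sigma> [0..<i] = filter (\<lambda>j. j \<in> \<sigma> ` {..<i}) [0..<n]"
    by (rule strict_sorted_equal[OF _ _ sets(1)])
      (simp_all only: sorted_wrt_filter sorted_wrt_upt sorted[OF mono(1)[folded atLeast0LessThan]])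
  show "map \<sigma> [i..<n] = filter (\<lambda>j. j \<notin> \<sigma> ` {..<i}) [0..<n]"
    by (rule strict_sorted_equal[OF _ _ sets(2)])
      (simp_all only: sorted_wrt_filter sorted_wrt_upt sorted[OF mono(2)])
qed

text \<open>An unshuffle is determined by the set of its first i values. Conversely, a set listed in
  increasing order, followed by its complement in increasing order, is an unshuffle.\<close>

lemma bij_betw_unshuffles:
  assumes "i \<le> n"
  shows "bij_betw (\<lambda>\<sigma>. \<sigma> ` {..<i}) (unshuffles i n) {S \<in> Pow {..<n}. card S = i}"
  unfolding bij_betw_def
proof (intro conjI inj_onI subset_antisym subsetI)
  fix \<sigma> \<tau> assume \<sigma>: "\<sigma> \<in> unshuffles i n" and \<tau>: "\<tau> \<in> unshuffles i n" and eq: "\<sigma> ` {..<i} = \<tau> ` {..<i}"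
  have "map \<sigma> [0..<i] = map \<tau> [0..<i]" "map \<sigma> [i..<n] = map \<tau> [i..<n]"
    using unshuffles_lists[OF \<sigma> assms] unshuffles_lists[OF \<tau> assms] eq by simp_all
  then have "\<sigma> a = \<tau> a" if "a < n" for a
    using that by (cases "a < i") auto
  moreover have "\<sigma> a = \<tau> a" if "\<not> a < n" for a
    using \<sigma> \<tau> that permutes_not_in[of \<sigma> "{..<n}" a] permutes_not_in[of \<tau> "{..<n}" a]
    by (auto simp: unshuffles_def)
  ultimately show "\<sigma> = \<tau>" by blast
next
  fix S assume "S \<in> (\<lambda>\<sigma>. \<sigma> ` {..<i}) ` unshuffles i n"
  then obtain \<sigma> where \<sigma>: "\<sigma> permutes {..<n}" "S = \<sigma> ` {..<i}" by (auto simp: unshuffles_def)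
  have "\<sigma> ` {..<i} \<subseteq> \<sigma> ` {..<n}" using assms by (intro image_mono) auto
  moreover have "card (\<sigma> ` {..<i}) = i"
    using card_image[OF inj_on_subset[OF permutes_inj[OF \<sigma>(1)] subset_UNIV], of "{..<i}"] by simp
  ultimately show "S \<in> {S \<in> Pow {..<n}. card S = i}"
    unfolding permutes_image[OF \<sigma>(1)] \<sigma>(2) by blast
next
  fix S assume S: "S \<in> {S \<in> Pow {..<n}. card S = i}"
  define l1 where "l1 = filter (\<lambda>j. j \<in> S) [0..<n]"
  define l2 where "l2 = filter (\<lambda>j. j \<notin> S) [0..<n]"
  define \<sigma> where "\<sigma> = (\<lambda>j. if j < n then (l1 @ l2) ! j else j)"
  have sets: "set l1 = S" "set l2 = {..<n} - S" using S by (auto simp: l1_def l2_def)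
  have dist: "distinct l1" "distinct l2" by (simp_all add: l1_def l2_def)
  have len: "length l1 = i" using distinct_card[OF dist(1)] S sets by simp
  have "length (l1 @ l2) = n"
    using sum_length_filter_compl[of "\<lambda>j. j \<in> S" "[0..<n]"] by (simp add: l1_def l2_def)
  moreover have "bij_betw ((!) (l1 @ l2)) {..<length (l1 @ l2)} (set (l1 @ l2))"
    by (rule bij_betw_nth) (use dist sets in auto)
  moreover have "set (l1 @ l2) = {..<n}" using S sets by auto
  ultimately have bij: "bij_betw ((!) (l1 @ l2)) {..<n} {..<n}" and len2: "length l2 = n - i"
    using len by auto
  have "bij_betw \<sigma> {..<n} {..<n}"
    using bij by (subst bij_betw_cong[of _ _ "(!) (l1 @ l2)"]) (simp_all add: \<sigma>_def)
  then have "\<sigma> permutes {..<n}" by (rule bij_imp_permutes) (simp add: \<sigma>_def)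
  moreover
  have sorted: "sorted_wrt (<) l1" "sorted_wrt (<) l2"
    by (simp_all add: l1_def l2_def sorted_wrt_filter)
  have "strict_mono_on {..<i} \<sigma>"
    using assms len sorted_wrt_nth_less[OF sorted(1)]
    by (intro strict_mono_onI) (simp add: \<sigma>_def nth_append)
  moreover have "strict_mono_on {i..<n} \<sigma>"
    using len len2 sorted_wrt_nth_less[OF sorted(2)]
    by (intro strict_mono_onI) (simp add: \<sigma>_def nth_append)
  ultimately have "\<sigma> \<in> unshuffles i n" by (simp add: unshuffles_def)
  moreover have "\<sigma> ` {..<i} = S"
  proof -
    have "\<sigma> ` {..<i} = (!) l1 ` {..<i}"
      using assms len by (intro image_cong) (auto simp: \<sigma>_def nth_append)
    also have "\<dots> = set l1" using len by (auto simp: set_conv_nth)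
    finally show ?thesis by (simp add: sets)
  qed
  ultimately show "S \<in> (\<lambda>\<sigma>. \<sigma> ` {..<i}) ` unshuffles i n" by blast
qed

lemma inversions_unshuffle:
  assumes "\<sigma> \<in> unshuffles i n" "i \<le> n"
  shows "map_prod \<sigma> \<sigma> ` inversions \<sigma> n = {(a, b). a \<in> \<sigma> ` {..<i} \<and> b < a \<and> b \<notin> \<sigma> ` {..<i}}"
proof (intro subset_antisym subsetI)
  have \<sigma>: "\<sigma> permutes {..<n}" and mono: "strict_mono_on {..<i} \<sigma>" "strict_mono_on {i..<n} \<sigma>"
    using assms(1) by (auto simp: unshuffles_def)
  note inj = permutes_inj[OF \<sigma>]
  {
    fix z assume "z \<in> map_prod \<sigma> \<sigma> ` inversions \<sigma> n"
    then obtain a b where ab: "z = (\<sigma> a, \<sigma> b)" "a < b" "b < n" "\<sigma> b < \<sigma> a" by (auto simp: inversions_def)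
    have "a < i" using strict_mono_onD[OF mono(2), of a b] ab by (cases "a < i") auto
    moreover have "\<not> b < i" using strict_mono_onD[OF mono(1), of a b] ab by auto
    ultimately show "z \<in> {(a, b). a \<in> \<sigma> ` {..<i} \<and> b < a \<and> b \<notin> \<sigma> ` {..<i}}"
      using ab by (auto dest: injD[OF inj])
  next
    fix z assume "z \<in> {(a, b). a \<in> \<sigma> ` {..<i} \<and> b < a \<and> b \<notin> \<sigma> ` {..<i}}"
    then obtain a y where z: "z = (\<sigma> a, y)" "a < i" "y < \<sigma> a" "y \<notin> \<sigma> ` {..<i}" by auto
    have "\<sigma> a < n" using permutes_in_image[OF \<sigma>, of a] z assms(2) by auto
    then have "y \<in> \<sigma> ` {..<n}" using z permutes_image[OF \<sigma>] by auto
    then obtain b where b: "y = \<sigma> b" "b < n" by auto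
    with z have "i \<le> b" by (metis imageI lessThan_iff not_less)
    then have "(a, b) \<in> inversions \<sigma> n" using z b by (auto simp: inversions_def)
    then show "z \<in> map_prod \<sigma> \<sigma> ` inversions \<sigma> n"
      unfolding z b by (metis map_prod_simp imageI)
  }
qed

text \<open>The link between the recursive coproduct and the sums in \<open>L_infinity\<close>. The
  first block of a Jacobi term is nonempty, so the splitting with an empty left part is kept
  apart.\<close>

lemma Us_unshuffles:
  "Us K H = H [] K + (\<Sum>i = 1..length K. \<Sum>\<sigma>\<in>unshuffles i (length K).
     sg (\<Sum>(a, b)\<in>inversions \<sigma> (length K). (fst (K ! \<sigma> a) - 1) * (fst (K ! \<sigma> b) - 1))
       (H (take i (permute_list \<sigma> K)) (drop i (permute_list \<sigma> K))))"
proof -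
  let ?n = "length K"
  let ?h = "\<lambda>a b. (fst (K ! a) - 1) * (fst (K ! b) - 1)"
  let ?f = "\<lambda>S. sg (\<Sum>(a, b)\<in>{(a, b). a \<in> S \<and> b < a \<and> b \<notin> S}. ?h a b) (H (nths K S) (nths K (- S)))"
  have part: "(\<Sum>\<sigma>\<in>unshuffles i ?n. sg (\<Sum>(a, b)\<in>inversions \<sigma> ?n. ?h (\<sigma> a) (\<sigma> b))
       (H (take i (permute_list \<sigma> K)) (drop i (permute_list \<sigma> K))))
     = (\<Sum>S\<in>{S \<in> Pow {..<?n}. card S = i}. ?f S)" if "i \<le> ?n" for i
  proof (subst sum.reindex_bij_betw[OF bij_betw_unshuffles[OF that], symmetric], rule sum.cong[OF HOL.refl])
    fix \<sigma> assume \<sigma>: "\<sigma> \<in> unshuffles i ?n"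
    have inj: "inj_on (map_prod \<sigma> \<sigma>) A" for A
      using \<sigma> by (intro inj_on_subset[OF prod.inj_map]) (auto simp: unshuffles_def permutes_inj)
    have "(\<Sum>(a, b)\<in>inversions \<sigma> ?n. ?h (\<sigma> a) (\<sigma> b))
      = (\<Sum>(a, b)\<in>{(a, b). a \<in> \<sigma> ` {..<i} \<and> b < a \<and> b \<notin> \<sigma> ` {..<i}}. ?h a b)"
      unfolding inversions_unshuffle[OF \<sigma> that, symmetric]
      by (simp add: sum.reindex[OF inj] case_prod_beta)
    moreover have "take i (permute_list \<sigma> K) = nths K (\<sigma> ` {..<i})"
      unfolding nths_filter unshuffles_lists(1)[OF \<sigma> that, symmetric] permute_list_def
      using that by (simp add: take_map)
    moreover have "drop i (permute_list \<sigma> K) = nths K (- \<sigma> ` {..<i})"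
      unfolding nths_filter Compl_iff unshuffles_lists(2)[OF \<sigma> that, symmetric] permute_list_def
      by (simp add: drop_map)
    ultimately show "sg (\<Sum>(a, b)\<in>inversions \<sigma> ?n. ?h (\<sigma> a) (\<sigma> b))
       (H (take i (permute_list \<sigma> K)) (drop i (permute_list \<sigma> K))) = ?f (\<sigma> ` {..<i})"
      by simp
  qed
  have "Us K H = (\<Sum>i\<in>{0..?n}. \<Sum>S\<in>{S \<in> Pow {..<?n}. card S = i}. ?f S)"
    unfolding Us_nths
    by (rule sum.group[symmetric]) (auto simp: subset_eq_atLeast0_lessThan_card lessThan_atLeast0)
  also have "\<dots> = (\<Sum>S\<in>{S \<in> Pow {..<?n}. card S = 0}. ?f S)
      + (\<Sum>i = 1..?n. \<Sum>S\<in>{S \<in> Pow {..<?n}. card S = i}. ?f S)"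
    by (simp add: sum.atLeast_Suc_atMost)
  also have "{S \<in> Pow {..<?n}. card S = 0} = {{}}"
    by (auto dest: finite_subset)
  finally have "Us K H = H [] K + (\<Sum>i = 1..?n. \<Sum>S\<in>{S \<in> Pow {..<?n}. card S = i}. ?f S)"
    by (simp add: nths_all)
  also have "(\<Sum>i = 1..?n. \<Sum>S\<in>{S \<in> Pow {..<?n}. card S = i}. ?f S)
      = (\<Sum>i = 1..?n. \<Sum>\<sigma>\<in>unshuffles i ?n. sg (\<Sum>(a, b)\<in>inversions \<sigma> ?n. ?h (\<sigma> a) (\<sigma> b))
       (H (take i (permute_list \<sigma> K)) (drop i (permute_list \<sigma> K))))"
    by (intro sum.cong HOL.refl part[symmetric]) simp
  finally show ?thesis .
qed

section \<open>Multilinear maps on lists, and the components of the given structure\<close>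

lemma linear_iff_add_scale:
  assumes "vector_space s" "vector_space s'"
  shows "Vector_Spaces.linear s s' f \<longleftrightarrow>
    (\<forall>x y. f (x + y) = f x + f y) \<and> (\<forall>c x. f (s c x) = s' c (f x))"
  using assms by (simp add: module_hom_iff_linear[symmetric] module_hom_iff module_iff_vector_space)

text \<open>Extension by zero makes the linearity conditions hold at words of the wrong length too,
  so multilinearity can be stated for words of all lengths.\<close>

lemma multilin_iff:
  assumes "vector_space s" "vector_space s'"
  shows "f \<in> multilin s s' n \<longleftrightarrow>
    (\<forall>w. length w \<noteq> n \<longrightarrow> f w = 0) \<and> (\<forall>c. mlin (s c) (s' c) f)"
proof -
  interpret V: vector_space s' by fact
  have "(f (u @ (a + b) # v) = f (u @ a # v) + f (u @ b # v)) \<and> f (u @ s c a # v) = s' c (f (u @ a # v))"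
    if "f \<in> multilin s s' n" for u v a b c
  proof (cases "length u + length v + 1 = n")
    case True
    then have "Vector_Spaces.linear s s' (\<lambda>a. f (u @ a # v))"
      using that by (simp add: multilin_def)
    then show ?thesis by (simp add: linear_iff_add_scale[OF assms])
  next
    case False
    then show ?thesis using that by (simp add: multilin_def)
  qed
  then have "mlin (s c) (s' c) f" if "f \<in> multilin s s' n" for c
    using that unfolding mlin_def madd_def additive_def by blast
  moreover have "Vector_Spaces.linear s s' (\<lambda>a. f (u @ a # v))" if "\<forall>c. mlin (s c) (s' c) f" for u v
    using that unfolding linear_iff_add_scale[OF assms] mlin_def madd_def additive_def by blast
  ultimately show ?thesis
    unfolding multilin_def mem_Collect_eq by blast
qed

definition unary :: "('a \<Rightarrow> 'b::zero) \<Rightarrow> 'a list \<Rightarrow> 'b" where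
  "unary g w = (if length w = 1 then g (w ! 0) else 0)"

lemma product_cochain_simps [simp]:
  "product_cochain [] = 0" "product_cochain [a] = 0" "product_cochain [a, b] = a * b"
  "product_cochain (a # b # c # w) = 0"
  by (simp_all add: product_cochain_def)

lemma unary_simps [simp]: "unary g [] = 0" "unary g [a] = g a" "unary g (a # b # w) = 0"
  by (simp_all add: unary_def)

lemma mlin_product:
  assumes "\<And>x y. \<sigma> (x * y) = \<sigma> x * y" "\<And>x y. \<sigma> (x * y) = x * \<sigma> y" "\<sigma> 0 = 0"
  shows "mlin \<sigma> \<sigma> product_cochain"
proof -
  have "product_cochain (u @ (a + b) # v) = product_cochain (u @ a # v) + product_cochain (u @ b # v)
      \<and> product_cochain (u @ \<sigma> a # v) = \<sigma> (product_cochain (u @ a # v))" for u a b v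
    by (cases u rule: remdups_adj.cases; cases v rule: remdups_adj.cases)
      (simp_all add: assms(1,3) assms(2)[symmetric] distrib_left distrib_right product_cochain_def)
  then show ?thesis by (simp add: mlin_def madd_def additive_def)
qed

lemma mlin_unary:
  assumes "\<And>x y. g (x + y) = g x + g y" "\<And>x. g (\<sigma> x) = \<tau> (g x)" "\<tau> 0 = 0"
  shows "mlin \<sigma> \<tau> (unary g)"
  using assms unfolding mlin_def madd_def additive_def by (auto simp: unary_def nth_append)

section \<open>The L-infinity structure\<close>

locale algebra_map =
  fixes sU :: "'k::field_char_0 \<Rightarrow> 'u::ring \<Rightarrow> 'u"
    and sV :: "'k \<Rightarrow> 'v::ring \<Rightarrow> 'v"
    and g :: "'u \<Rightarrow> 'v"
  assumes algU: "assoc_algebra sU" and algV: "assoc_algebra sV" and morph: "algebra_morphism sU sV g"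
begin

sublocale U: vector_space sU using algU by (simp add: assoc_algebra_def)
sublocale V: vector_space sV using algV by (simp add: assoc_algebra_def)
sublocale UV: vector_space_pair sU sV by unfold_locales

abbreviation "L \<equiv> L_GS sU sV"
abbreviation "sc \<equiv> gs_scale sU sV"

lemma g_add: "g (x + y) = g x + g y" and g_scale: "g (sU c x) = sV c (g x)" and g_mult: "g (x * y) = g x * g y"
  using morph by (auto simp: algebra_morphism_def linear_iff_add_scale[OF U.vector_space_axioms V.vector_space_axioms])

lemma scale_mult:
  "sU c (x * y) = sU c x * y" "sU c (x * y) = x * sU c y"
  "sV c (a * b) = sV c a * b" "sV c (a * b) = a * sV c b"
  using algU algV unfolding assoc_algebra_def by blast+

lemma g_0 [simp]: "g 0 = 0"
  using g_add[of 0 0] by simp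

lemma additive_scale: "additive (sU c)" "additive (sV c)"
  by (simp_all add: additive_def U.scale_right_distrib V.scale_right_distrib)

text \<open>
  The sign of the components in \<open>Hom(U, U)\<close> and \<open>Hom(V, V)\<close> accounts for the shift of their
  degree relative to that of the component in \<open>Hom(U, V)\<close>.
\<close>

fun XU :: "(int \<times> ('u, 'v) gs_cochain) list \<Rightarrow> 'u list \<Rightarrow> 'u" where
  "XU [] = product_cochain"
| "XU [k] = (if snd k \<in> L (fst k) then (\<lambda>w. sg (fst k - 1) (fst (snd k) w)) else (\<lambda>w. 0))"
| "XU (k # k' # K) = (\<lambda>w. 0)"

fun XV :: "(int \<times> ('u, 'v) gs_cochain) list \<Rightarrow> 'v list \<Rightarrow> 'v" where
  "XV [] = product_cochain"
| "XV [k] = (if snd k \<in> L (fst k) then (\<lambda>w. sg (fst k - 1) (fst (snd (snd k)) w)) else (\<lambda>w. 0))"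
| "XV (k # k' # K) = (\<lambda>w. 0)"

fun XG :: "(int \<times> ('u, 'v) gs_cochain) list \<Rightarrow> 'u list \<Rightarrow> 'v" where
  "XG [] = unary g"
| "XG [k] = (if snd k \<in> L (fst k) then snd (snd (snd k)) else (\<lambda>w. 0))"
| "XG (k # k' # K) = (\<lambda>w. 0)"

lemma L_iff: "(xU, xV, xg) \<in> L p \<longleftrightarrow>
    (if p < 0 then xU = (\<lambda>w. 0) \<and> xV = (\<lambda>w. 0) \<and> xg = (\<lambda>w. 0)
     else xU \<in> multilin sU sU (nat p + 1) \<and> xV \<in> multilin sV sV (nat p + 1) \<and> xg \<in> multilin sU sV (nat p))"
  by (auto simp: L_GS_def C_GS_def zero_prod_def zero_fun_def)

lemmas multilin_iff' = multilin_iff[OF U.vector_space_axioms U.vector_space_axioms]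
  multilin_iff[OF V.vector_space_axioms V.vector_space_axioms]
  multilin_iff[OF U.vector_space_axioms V.vector_space_axioms]

lemma L_cases:
  assumes "x \<in> L p"
  obtains "p < 0" "x = 0" | "0 \<le> p" "fst x \<in> multilin sU sU (nat p + 1)"
    "fst (snd x) \<in> multilin sV sV (nat p + 1)" "snd (snd x) \<in> multilin sU sV (nat p)"
  using assms that by (cases "p < 0") (auto simp: L_GS_def C_GS_def)

lemma L_mlin:
  assumes "x \<in> L p"
  shows "mlin (sU c) (sU c) (fst x)" "mlin (sV c) (sV c) (fst (snd x))" "mlin (sU c) (sV c) (snd (snd x))"
  using assms by (cases rule: L_cases; simp add: zero_fun_def mlin_0 additive_scale multilin_iff')+

lemma L_length:
  assumes "x \<in> L p"
  shows "fst x u \<noteq> 0 \<Longrightarrow> int (length u) = p + 1" "fst (snd x) v \<noteq> 0 \<Longrightarrow> int (length v) = p + 1"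
    "snd (snd x) u \<noteq> 0 \<Longrightarrow> int (length u) = p"
proof -
  have "(fst x u \<noteq> 0 \<longrightarrow> int (length u) = p + 1) \<and> (fst (snd x) v \<noteq> 0 \<longrightarrow> int (length v) = p + 1)
    \<and> (snd (snd x) u \<noteq> 0 \<longrightarrow> int (length u) = p)"
    using assms
  proof (cases rule: L_cases)
    case 2
    then have "fst x u \<noteq> 0 \<Longrightarrow> length u = nat p + 1" "fst (snd x) v \<noteq> 0 \<Longrightarrow> length v = nat p + 1"
      "snd (snd x) u \<noteq> 0 \<Longrightarrow> length u = nat p"
      unfolding multilin_iff' by blast+
    with 2(1) show ?thesis by auto
  qed simp
  then show "fst x u \<noteq> 0 \<Longrightarrow> int (length u) = p + 1" "fst (snd x) v \<noteq> 0 \<Longrightarrow> int (length v) = p + 1"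
    "snd (snd x) u \<noteq> 0 \<Longrightarrow> int (length u) = p"
    by blast+
qed

text \<open>In degree -1 the first two components would have arity 0, yet the module is zero there;
  hence the condition \<open>0 \<le> p\<close> on them. The third component has arity p, which
  already excludes negative degrees.\<close>

lemma LI:
  assumes "\<And>c. mlin (sU c) (sU c) xU" "\<And>c. mlin (sV c) (sV c) xV" "\<And>c. mlin (sU c) (sV c) xg"
    and "\<And>u. xU u \<noteq> 0 \<Longrightarrow> int (length u) = p + 1 \<and> 0 \<le> p"
    and "\<And>v. xV v \<noteq> 0 \<Longrightarrow> int (length v) = p + 1 \<and> 0 \<le> p"
    and "\<And>u. xg u \<noteq> 0 \<Longrightarrow> int (length u) = p"
  shows "(xU, xV, xg) \<in> L p"
proof (cases "p < 0")
  case True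
  then have "xU u = 0" "xV v = 0" "xg u = 0" for u v using assms(4)[of u] assms(5)[of v] assms(6)[of u] by force+
  then show ?thesis using True by (auto simp: L_iff)
next
  case False
  have "xU u = 0" if "length u \<noteq> nat p + 1" for u
    by (rule ccontr) (use assms(4)[of u] False that in auto)
  moreover have "xV v = 0" if "length v \<noteq> nat p + 1" for v
    by (rule ccontr) (use assms(5)[of v] False that in auto)
  moreover have "xg u = 0" if "length u \<noteq> nat p" for u
    by (rule ccontr) (use assms(6)[of u] False that in auto)
  ultimately show ?thesis using False assms(1-3)
    unfolding L_iff multilin_iff' by simp
qed

lemma short_X: "short XU" "short XV" "short XG"
  by (auto simp: short_def Suc_le_length_iff numeral_2_eq_2)

text \<open>The guards in \<open>XU\<close>, \<open>XV\<close> and \<open>XG\<close> turn a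
  mislabelled item into 0, so that this and the identities built on it hold for arbitrary lists of
  items.\<close>

lemma mlin_X: "mlin (sU c) (sU c) (XU K)" "mlin (sV c) (sV c) (XV K)" "mlin (sU c) (sV c) (XG K)"
proof -
  have "mlin (sU c) (sU c) product_cochain" "mlin (sV c) (sV c) product_cochain"
    by (rule mlin_product[OF scale_mult(1,2)], simp) (rule mlin_product[OF scale_mult(3,4)], simp)
  moreover have "mlin (sU c) (sV c) (unary g)"
    by (rule mlin_unary) (auto simp: g_add g_scale)
  ultimately show "mlin (sU c) (sU c) (XU K)" "mlin (sV c) (sV c) (XV K)" "mlin (sU c) (sV c) (XG K)"
    by (cases K rule: XU.cases; auto intro!: mlin_0 mlin_sg L_mlin additive_scale)+
qed

lemmas madd_X = mlin_madd[OF mlin_X(1)] mlin_madd[OF mlin_X(2)] mlin_madd[OF mlin_X(3)]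

lemma X_length:
  "XU K u \<noteq> 0 \<Longrightarrow> int (length u) = dg K + 2"
  "XV K v \<noteq> 0 \<Longrightarrow> int (length v) = dg K + 2"
  "XG K u \<noteq> 0 \<Longrightarrow> int (length u) = dg K + 1"
proof -
  have sg: "sg n x \<noteq> 0 \<longleftrightarrow> x \<noteq> 0" for n and x :: "'c::ab_group_add" by (simp add: sg_def)
  show "XU K u \<noteq> 0 \<Longrightarrow> int (length u) = dg K + 2" "XV K v \<noteq> 0 \<Longrightarrow> int (length v) = dg K + 2"
    "XG K u \<noteq> 0 \<Longrightarrow> int (length u) = dg K + 1"
    by (cases K rule: XU.cases; auto simp: product_cochain_def unary_def sg
        dest: L_length split: if_splits)+
qed

text \<open>A value of \<open>FU\<close> or \<open>FV\<close> at the empty word would sit in degree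
  -1, where the module is zero; this excludes it.\<close>

lemma X_Nil: "XU K [] = 0" "XV K [] = 0"
proof -
  have "x \<in> L p \<Longrightarrow> fst x [] = 0 \<and> fst (snd x) [] = 0" for x p
    by (cases x) (auto simp: L_iff multilin_def split: if_splits)
  then show "XU K [] = 0" "XV K [] = 0"
    by (cases K rule: XU.cases; auto)+
qed

section \<open>The odd vector field and its square\<close>

definition "FU = comp 1 XU XU"
definition "FV = comp 1 XV XV"
definition "FG K w = comp 1 XU XG K w - subst 2 XG XV K w"

text \<open>The signs on the first two components undo those in \<open>XU\<close> and
  \<open>XV\<close> when a value of \<open>F\<close> is fed back as an item, see
  \<open>X_item\<close>.\<close>

definition F :: "(int \<times> ('u, 'v) gs_cochain) list \<Rightarrow> ('u, 'v) gs_cochain" where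
  "F K = (\<lambda>w. sg (dg K + 1) (FU K w), \<lambda>w. sg (dg K + 1) (FV K w), FG K)"

lemma comp_Nil:
  assumes "\<And>J. X J [] = 0" "\<And>I. madd (\<Psi> I)"
  shows "comp q X \<Psi> K [] = 0"
  by (simp add: comp_def assms(1) madd_0_hd[OF assms(2)])

lemma F_mem: "F K \<in> L (dg K + 2)"
  unfolding F_def
proof (rule LI)
  fix c
  show "mlin (sU c) (sU c) (\<lambda>w. sg (dg K + 1) (FU K w))" "mlin (sV c) (sV c) (\<lambda>w. sg (dg K + 1) (FV K w))"
    unfolding FU_def FV_def by (intro mlin_sg mlin_comp mlin_X additive_scale)+
  show "mlin (sU c) (sV c) (FG K)"
    unfolding FG_def[abs_def]
    by (intro mlin_diff mlin_comp mlin_subst[where \<sigma>' = "sV c"] mlin_X additive_scale)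
next
  fix u assume "sg (dg K + 1) (FU K u) \<noteq> 0"
  then have nz: "comp 1 XU XU K u \<noteq> 0" by (auto simp: FU_def)
  then have "int (length u) = dg K + 2 + 1"
    using comp_length_eq_0[of XU 2 XU 2 u K 1] X_length madd_X by force
  moreover have "u \<noteq> []" using nz comp_Nil[of XU XU 1 K] X_Nil madd_X by auto
  then have "0 < int (length u)" by simp
  ultimately show "int (length u) = dg K + 2 + 1 \<and> 0 \<le> dg K + 2" by linarith
next
  fix u assume "sg (dg K + 1) (FV K u) \<noteq> 0"
  then have nz: "comp 1 XV XV K u \<noteq> 0" by (auto simp: FV_def)
  then have "int (length u) = dg K + 2 + 1"
    using comp_length_eq_0[of XV 2 XV 2 u K 1] X_length madd_X by force
  moreover have "u \<noteq> []" using nz comp_Nil[of XV XV 1 K] X_Nil madd_X by auto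
  then have "0 < int (length u)" by simp
  ultimately show "int (length u) = dg K + 2 + 1 \<and> 0 \<le> dg K + 2" by linarith
next
  fix u assume "FG K u \<noteq> 0"
  then have "comp 1 XU XG K u \<noteq> 0 \<or> subst 2 XG XV K u \<noteq> 0" by (auto simp: FG_def)
  then show "int (length u) = dg K + 2"
    using comp_length_eq_0[of XU 2 XG 1 u K 1] subst_length_eq_0[of XG XV 2 u K] X_length madd_X by force
qed

text \<open>Degree \<open>dg I + 2\<close> means shifted degree \<open>dg I + 1\<close>: the vector
  field is odd.\<close>

definition item :: "(int \<times> ('u, 'v) gs_cochain) list \<Rightarrow> int \<times> ('u, 'v) gs_cochain" where
  "item I = (dg I + 2, F I)"

lemma X_item:
  "XU (item I # B) = (if B = [] then FU I else (\<lambda>w. 0))"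
  "XV (item I # B) = (if B = [] then FV I else (\<lambda>w. 0))"
  "XG (item I # B) = (if B = [] then FG I else (\<lambda>w. 0))"
proof -
  have "sg (1 + dg I) (sg (dg I + 1) x) = x" for x :: "'c::ab_group_add" by (simp add: sg_even)
  then show "XU (item I # B) = (if B = [] then FU I else (\<lambda>w. 0))"
    "XV (item I # B) = (if B = [] then FV I else (\<lambda>w. 0))"
    "XG (item I # B) = (if B = [] then FG I else (\<lambda>w. 0))"
    using F_mem[of I] by (cases B; auto simp: item_def F_def algebra_simps)+
qed

lemma X_even:
  "XU J v \<noteq> 0 \<Longrightarrow> even (dg J + int (length v))"
  "XV J v' \<noteq> 0 \<Longrightarrow> even (dg J + int (length v'))"
  "XG J v \<noteq> 0 \<Longrightarrow> odd (dg J + int (length v))"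
  using X_length(1)[of J v] X_length(2)[of J v'] X_length(3)[of J v] by auto

text \<open>By \<open>comp_item\<close> the sum is the difference of the two bracketings of a triple
  composite, and \<open>comp_comp\<close> identifies them.\<close>

lemma Jacobi_UV:
  "Us K (\<lambda>I J. FU (item I # J) w) = 0" "Us K (\<lambda>I J. FV (item I # J) w') = 0"
proof -
  have fst: "fst (item I) = dg I + 2" for I by (simp add: item_def)
  show "Us K (\<lambda>I J. FU (item I # J) w) = 0"
    using comp_item[of item XU FU XU FU, OF fst X_item(1) X_item(1) madd_X(1), of K w]
      comp_comp[of XU XU K w, OF X_even(1) madd_X(1)] by (simp add: FU_def)
  show "Us K (\<lambda>I J. FV (item I # J) w') = 0"
    using comp_item[of item XV FV XV FV, OF fst X_item(2) X_item(2) madd_X(2), of K w']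
      comp_comp[of XV XV K w', OF X_even(2) madd_X(2)] by (simp add: FV_def)
qed

text \<open>Let \<open>?s y\<close> denote \<open>XV\<close> after e^f with one factor replaced by
  \<open>y\<close>. In the first half of \<open>FG\<close> the terms with \<open>FU\<close> cancel
  by \<open>comp_comp\<close>, in the second half the two copies of
  \<open>?s (subst 2 XG XV)\<close> cancel by \<open>subst_comp\<close>; either half then equals
  \<open>?s (comp 1 XU XG)\<close>.\<close>

lemma Jacobi_G: "Us K (\<lambda>I J. FG (item I # J) w) = 0"
proof -
  have fst: "fst (item I) = dg I + 2" for I by (simp add: item_def)
  let ?s = "\<lambda>y. Us K (\<lambda>A R. sg (dg A) (D (nat (dg A + 2)) XG y (XV A) R w))"
  \<comment> \<open>The new item goes to \<open>XV\<close>, which it then fills alone, or into the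
    tensor power.\<close>
  have E: "subst 2 XG XV (item I # J) w = E (nat (dg I + 3)) XG (FV I) J w
      + Us J (\<lambda>A B. sg ((dg I + 1) * dg A) (E (nat (dg A + 2)) XG (XV A) (item I # B) w))" for I J
  proof -
    have "Us J (\<lambda>A B. E (nat (dg (item I # A) + 2)) XG (XV (item I # A)) B w)
      = Us J (\<lambda>A B. if A = [] then E (nat (dg I + 3)) XG (FV I) B w else 0)"
      by (intro Us_cong) (auto simp: X_item fst algebra_simps)
    then show ?thesis by (simp add: subst_def Us_Nil_left fst add_ac)
  qed
  have "Us K (\<lambda>I J. Us J (\<lambda>A B. sg ((dg I + 1) * dg A) (E (nat (dg A + 2)) XG (XV A) (item I # B) w)))
    = Us K (\<lambda>A R. sg (dg A) (Us R (\<lambda>I B. E (nat (dg A + 2)) XG (XV A) (item I # B) w)))"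
    by (subst Us_swap) (auto simp: Us_sg[symmetric] algebra_simps intro!: Us_cong sg_cong)
  also have "\<dots> = ?s FG"
    using E_item[of item XG FG, OF fst X_item(3) madd_X(2)] by simp
  finally have "Us K (\<lambda>I J. subst 2 XG XV (item I # J) w) = subst 3 XG FV K w + ?s FG"
    unfolding E Us_add by (simp add: subst_def)
  moreover have "Us K (\<lambda>I J. comp 1 XU XG (item I # J) w) = comp 0 FU XG K w - comp 1 XU FG K w"
    by (rule comp_item[of item]) (simp_all add: fst X_item madd_X)
  moreover have "comp 1 XU FG K w = comp 0 FU XG K w - ?s (comp 1 XU XG)"
  proof -
    have "comp 1 XU FG K w = comp 1 XU (comp 1 XU XG) K w - comp 1 XU (subst 2 XG XV) K w"
      unfolding FG_def[abs_def] by (rule comp_diff)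
    then show ?thesis
      using comp_comp[of XU XG K w, OF X_even(1) madd_X(3)]
        comp_subst[of XU XG XV 2 K w, OF X_even(1) madd_X(3) madd_X(2)]
      by (simp add: FU_def)
  qed
  moreover have "subst 3 XG FV K w = ?s (subst 2 XG XV)"
  proof -
    \<comment> \<open>An arity bound for \<open>XV\<close> on sublists of \<open>K\<close>: 2 for
      the product, \<open>fst k + 1\<close> for a single item.\<close>
    define N where "N = 2 + (\<Sum>k\<leftarrow>K. nat (fst k + 1))"
    have N: "length v \<le> N" if J: "set J \<subseteq> set K" and v: "XV J v \<noteq> 0" for J v
    proof (cases J rule: XV.cases)
      case 1
      then show ?thesis using X_length(2)[OF v] by (simp add: N_def)
    next
      case (2 k)
      then have "nat (fst k + 1) \<in> set (map (\<lambda>k. nat (fst k + 1)) K)" using J by auto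
      from member_le_sum_list[OF this] show ?thesis using X_length(2)[OF v] 2 by (simp add: N_def)
    next
      case 3
      then show ?thesis using v by simp
    qed
    show ?thesis
      using subst_comp[of XV 2 XG K N w, OF X_length(2) X_even(3) madd_X(2) N] by (simp add: FV_def)
  qed
  moreover have "?s FG = ?s (comp 1 XU XG) - ?s (subst 2 XG XV)"
    unfolding FG_def[abs_def] D_diff_y[OF madd_X(2)] sg_diff Us_diff ..
  ultimately show ?thesis
    unfolding FG_def Us_diff by (simp add: FG_def[abs_def, symmetric])
qed

lemma fst_Us: "fst (Us K H) = Us K (\<lambda>I J. fst (H I J))"
  and snd_Us: "snd (Us K H) = Us K (\<lambda>I J. snd (H I J))"
  and Us_apply: "(Us K H') w = Us K (\<lambda>I J. H' I J w)"
  using Us_additive[of fst K H] Us_additive[of snd K H] Us_additive[of "\<lambda>f. f w" K H']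
  by (simp_all add: additive_def)

lemma Jacobi_F: "Us K (\<lambda>I J. F (item I # J)) = 0"
proof -
  have "Us K (\<lambda>I J. sg (dg (item I # J) + 1) (FU (item I # J) w)) = 0"
    "Us K (\<lambda>I J. sg (dg (item I # J) + 1) (FV (item I # J) w')) = 0" for w w'
  proof -
    \<comment> \<open>The exponent is \<open>dg I + 1 + dg J + 1 = dg K + 2\<close>, the same for
      all splittings.\<close>
    have 1: "Us K (\<lambda>I J. sg (dg (item I # J) + 1) (h I J)) = sg (dg K) (Us K h)"
      for h :: "_ \<Rightarrow> _ \<Rightarrow> 'c::ab_group_add"
      unfolding Us_sg[symmetric] by (intro Us_cong sg_cong) (simp_all add: item_def)
    show "Us K (\<lambda>I J. sg (dg (item I # J) + 1) (FU (item I # J) w)) = 0"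
      "Us K (\<lambda>I J. sg (dg (item I # J) + 1) (FV (item I # J) w')) = 0"
      unfolding 1 Jacobi_UV by simp_all
  qed
  then show ?thesis
    by (intro prod_eqI ext) (simp_all add: fst_Us snd_Us Us_apply F_def Jacobi_G)
qed

end

text \<open>
  The exponent of the sign that relates the brackets \<open>l\<close> to the degree 1 operations \<open>F\<close> on the
  shifted complex. The term \<open>wexp\<close> is the usual shift; \<open>tri\<close> rescales the degree \<open>p\<close>
  component by \<open>(- 1) ^ (p * (p - 1) / 2)\<close>, which turns \<open>F [x]\<close> into the differential.
\<close>

definition tri :: "int \<Rightarrow> int" where
  "tri p = p * (p - 1) div 2"

primrec wexp :: "int list \<Rightarrow> int" where
  "wexp [] = 0"
| "wexp (p # ps) = int (length ps) * p + wexp ps"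

definition dexp :: "int list \<Rightarrow> int" where
  "dexp ps = int (length ps) + wexp ps + tri (sum_list ps + 2 - int (length ps)) + (\<Sum>p\<leftarrow>ps. tri p)"

lemma wexp_append: "wexp (ps @ qs) = wexp ps + int (length qs) * sum_list ps + wexp qs"
  by (induction ps) (simp_all add: algebra_simps)

lemma tri_Suc: "tri (p + 1) = tri p + p"
proof -
  have "(p + 1) * (p + 1 - 1) = p * (p - 1) + 2 * p" by (simp add: algebra_simps)
  then show ?thesis unfolding tri_def by simp
qed

text \<open>Adding p + q to the shifted Koszul exponent (p - 1)(q - 1) of \<open>F\<close> gives 1 +
  p q modulo 2, the exponent of antisymmetry.\<close>

lemma dexp_swap: "even (dexp (ps @ p # q # qs) - (dexp (ps @ q # p # qs) + (p + q)))"
  by (simp add: dexp_def wexp_append algebra_simps)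

text \<open>The term \<open>tri ?p\<close> of the inner result occurs once as an output of the inner
  bracket and once as an input of the outer one, so it cancels. Apart from
  \<open>dexp (ps @ qs)\<close> only the total degree and the total length remain, hence all terms
  of a Jacobi identity share this factor.\<close>

lemma dexp_nested:
  "even (dexp ((sum_list ps + 2 - int (length ps)) # qs) + dexp ps + int (length ps * length qs)
    - (1 + tri (sum_list (ps @ qs) + 3 - int (length (ps @ qs)))
       + tri (sum_list (ps @ qs) + 2 - int (length (ps @ qs))) + dexp (ps @ qs)))"
proof -
  let ?p = "sum_list ps + 2 - int (length ps)"
  have 1: "?p + sum_list qs + 2 - int (length (?p # qs)) = sum_list (ps @ qs) + 3 - int (length (ps @ qs))"
    by simp
  have "dexp (?p # qs) = 1 + int (length qs) + int (length qs) * ?p + wexp qs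
      + tri (sum_list (ps @ qs) + 3 - int (length (ps @ qs))) + tri ?p + (\<Sum>p\<leftarrow>qs. tri p)"
    unfolding dexp_def wexp.simps sum_list.Cons 1 by simp
  then show ?thesis by (simp add: dexp_def wexp_append algebra_simps)
qed

lemma parity_combine:
  "even (a + b + h + s) \<Longrightarrow> even (d + i - (w + a)) \<Longrightarrow> even (s + i + d - (w + b + h))"
  for a b h s d i w :: int
  by presburger

lemma dg_zip: "length ps = length xs \<Longrightarrow> dg (zip ps xs) = sum_list ps - int (length ps)"
  by (induction ps xs rule: list_induct2) simp_all

lemma sum_inversions_zip:
  assumes "\<sigma> permutes {..<length ps}" "length ps = length xs"
  shows "(\<Sum>(a, b)\<in>inversions \<sigma> (length ps). h (fst (zip ps xs ! \<sigma> a)) (fst (zip ps xs ! \<sigma> b)))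
    = (\<Sum>(a, b)\<in>inversions \<sigma> (length ps). h (ps ! \<sigma> a) (ps ! \<sigma> b))"
proof (rule sum.cong)
  fix z assume "z \<in> inversions \<sigma> (length ps)"
  then obtain a b where z: "z = (a, b)" "a < length ps" "b < length ps" by (auto simp: inversions_def)
  then have "\<sigma> a < length ps" "\<sigma> b < length ps" using permutes_in_image[OF assms(1)] by simp_all
  then show "(case z of (a, b) \<Rightarrow> h (fst (zip ps xs ! \<sigma> a)) (fst (zip ps xs ! \<sigma> b)))
      = (case z of (a, b) \<Rightarrow> h (ps ! \<sigma> a) (ps ! \<sigma> b))"
    using assms(2) z by simp
qed simp

lemma E_2: "E 2 f \<phi> K w = Cp K w (\<lambda>I u J v. \<phi> [f I u, f J v])"
  by (simp add: numeral_2_eq_2 Cp_counit_right)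

lemma hat_2_2:
  assumes m: "\<And>v. length v \<noteq> 2 \<Longrightarrow> m v = 0" and m': "\<And>v. length v \<noteq> 2 \<Longrightarrow> m' v = 0" "madd m'"
  shows "hat q m m' w
    = (if length w = 3 then m' [m [w ! 0, w ! 1], w ! 2] + sg q (m' [w ! 0, m [w ! 1, w ! 2]]) else 0)"
proof (cases "length w = 3")
  case True
  then obtain a b c where "w = [a, b, c]" by (auto simp: numeral_3_eq_3 length_Suc_conv)
  then show ?thesis by (simp add: m m' madd_0_hd[OF m'(2)])
next
  case False
  then show ?thesis using m m' by (subst hat_length_eq_0[where n = 2 and m = 2]) auto
qed

lemma hat_2_1:
  assumes m: "\<And>v. length v \<noteq> 2 \<Longrightarrow> m v = 0" and f: "\<And>v. length v \<noteq> 1 \<Longrightarrow> f v = 0" "madd f"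
  shows "hat q m f w = (if length w = 2 then f [m [w ! 0, w ! 1]] else 0)"
proof (cases "length w = 2")
  case True
  then obtain a b where "w = [a, b]" by (auto simp: numeral_2_eq_2 length_Suc_conv)
  then show ?thesis by (simp add: m f madd_0_hd[OF f(2)])
next
  case False
  then show ?thesis using m f by (subst hat_length_eq_0[where n = 2 and m = 1]) auto
qed

lemma Dc_1_1:
  assumes "\<And>v. length v \<noteq> 1 \<Longrightarrow> f v = 0" "\<And>v. length v \<noteq> 1 \<Longrightarrow> f' v = 0" "madd \<phi>"
  shows "Dc w (\<lambda>u v. \<phi> [f u, f' v]) = (if length w = 2 then \<phi> [f [w ! 0], f' [w ! 1]] else 0)"
proof (cases "length w = 2")
  case True
  then obtain a b where "w = [a, b]" by (auto simp: numeral_2_eq_2 length_Suc_conv)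
  then show ?thesis using assms madd_0[OF assms(3), of "[_]" "[]"] by (simp add: madd_0_hd)
next
  case False
  have "\<phi> [f u, f' v] = 0" if "u @ v = w" for u v
  proof -
    have "length u \<noteq> 1 \<or> length v \<noteq> 1" using that False by auto
    then show ?thesis
      using assms madd_0[OF assms(3), of "[_]" "[]"] by (auto simp: madd_0_hd)
  qed
  then have "Dc w (\<lambda>u v. \<phi> [f u, f' v]) = Dc w (\<lambda>u v. 0)" by (rule Dc_cong)
  then show ?thesis using False by simp
qed

section \<open>From the vector field to the brackets\<close>

context algebra_map
begin

lemma sc_simps [simp]:
  "fst (sc c x) u = sU c (fst x u)" "fst (snd (sc c x)) v = sV c (fst (snd x) v)"
  "snd (snd (sc c x)) u = sV c (snd (snd x) u)"
  by (cases x; simp add: gs_scale_def)+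

lemma gs_eqI:
  "(\<And>u. fst x u = fst y u) \<Longrightarrow> (\<And>v. fst (snd x) v = fst (snd y) v)
    \<Longrightarrow> (\<And>u. snd (snd x) u = snd (snd y) u) \<Longrightarrow> x = y" for x y :: "('u, 'v) gs_cochain"
  by (intro prod_eqI ext) auto

lemma module_sc: "module sc"
  by unfold_locales (auto intro!: gs_eqI simp: U.scale_right_distrib V.scale_right_distrib
      U.scale_left_distrib V.scale_left_distrib)

lemma additive_sc: "additive (sc c)"
  using module.scale_right_distrib[OF module_sc] by (simp add: additive_def)

lemma sc_ksign: "sc (of_int (ksign n)) x = sg n x"
  by (rule gs_eqI) (simp_all add: ksign_def sg_def)

lemma L_lincomb:
  assumes "a \<in> L p" "b \<in> L p"
  shows "a + sc c b \<in> L p"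
  using assms(1)
proof (cases rule: L_cases)
  case 1
  then have "a + sc c b = 0"
    using assms(2) by (cases b; intro gs_eqI) (auto simp: L_iff)
  then show ?thesis using 1 by (simp add: L_GS_def)
next
  case a: 2
  have b: "fst b \<in> multilin sU sU (nat p + 1)" "fst (snd b) \<in> multilin sV sV (nat p + 1)"
    "snd (snd b) \<in> multilin sU sV (nat p)"
    using assms(2) a(1) by (cases b; simp add: L_iff)+
  note m = L_mlin[OF assms(1)] L_mlin[OF assms(2)]
  have "mlin (sU d) (sU d) (\<lambda>w. fst a w + sU c (fst b w))"
    "mlin (sV d) (sV d) (\<lambda>w. fst (snd a) w + sV c (fst (snd b) w))"
    "mlin (sU d) (sV d) (\<lambda>w. snd (snd a) w + sV c (snd (snd b) w))" for d
    by (rule mlin_add[OF additive_scale(1) m(1) mlin_compose[OF m(4), where h = "sU c"]]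
        mlin_add[OF additive_scale(2) m(2) mlin_compose[OF m(5), where h = "sV c"]]
        mlin_add[OF additive_scale(2) m(3) mlin_compose[OF m(6), where h = "sV c"]];
      simp add: U.scale_right_distrib V.scale_right_distrib U.scale_left_commute V.scale_left_commute)+
  then have "(\<lambda>w. fst a w + sU c (fst b w), \<lambda>w. fst (snd a) w + sV c (fst (snd b) w),
      \<lambda>w. snd (snd a) w + sV c (snd (snd b) w)) \<in> L p"
    using a b unfolding L_iff multilin_iff' by simp
  also have "(\<lambda>w. fst a w + sU c (fst b w), \<lambda>w. fst (snd a) w + sV c (fst (snd b) w),
      \<lambda>w. snd (snd a) w + sV c (snd (snd b) w)) = a + sc c b"
    by (rule gs_eqI) simp_all
  finally show ?thesis .
qed

lemma L_0: "0 \<in> L p"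
  by (simp add: L_GS_def C_GS_def mem_Times_iff multilin_iff' zero_fun_def mlin_0 additive_scale)

lemma L_scale: "a \<in> L p \<Longrightarrow> sc c a \<in> L p"
  using L_lincomb[OF L_0, of a p c] by simp

lemma L_sg: "a \<in> L p \<Longrightarrow> sg n a \<in> L p"
  using L_scale[of a p "of_int (ksign n)"] by (simp add: sc_ksign)

lemma L_add: "a \<in> L p \<Longrightarrow> b \<in> L p \<Longrightarrow> a + b \<in> L p"
  using L_lincomb[of a p b 1] module.scale_one[OF module_sc] by simp

lemma L_unique: "x \<in> L p \<Longrightarrow> x \<in> L q \<Longrightarrow> x \<noteq> 0 \<Longrightarrow> p = q"
proof (rule ccontr)
  assume x: "x \<in> L p" "x \<in> L q" "p \<noteq> q" "x \<noteq> 0"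
  have "x = 0"
    by (rule gs_eqI) (use L_length[OF x(1)] L_length[OF x(2)] x(3) in force)+
  with x show False by simp
qed

lemma ilin_X:
  fixes a b :: "('u, 'v) gs_cochain" and c :: 'k and p :: int
  assumes "a \<in> L p" "b \<in> L p"
  defines "x \<equiv> (p, a)" and "y \<equiv> (p, b)" and "z \<equiv> (p, a + sc c b)"
  shows "ilin (sU c) x y z (\<lambda>K. XU K u)" "ilin (sV c) x y z (\<lambda>K. XV K v)" "ilin (sV c) x y z (\<lambda>K. XG K u)"
proof -
  have *: "f (A @ z # B) = f (A @ x # B) + \<sigma> (f (A @ y # B))"
    if "f [z] = f [x] + \<sigma> (f [y])" "\<And>k k' K. f (k # k' # K) = 0" "\<sigma> 0 = 0"
    for f :: "(int \<times> ('u, 'v) gs_cochain) list \<Rightarrow> 'm::ab_group_add" and \<sigma> A B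
    using that by (cases A; cases B; cases "tl A") auto
  show "ilin (sU c) x y z (\<lambda>K. XU K u)" "ilin (sV c) x y z (\<lambda>K. XV K v)" "ilin (sV c) x y z (\<lambda>K. XG K u)"
    unfolding ilin_def
    by (intro allI *; simp add: x_def y_def z_def assms L_lincomb sg_add additive_sg_comp[OF additive_scale(1)]
       additive_sg_comp[OF additive_scale(2)])+
qed

lemma F_linear:
  assumes "a \<in> L p" "b \<in> L p"
  shows "F (A @ (p, a + sc c b) # B) = F (A @ (p, a) # B) + sc c (F (A @ (p, b) # B))"
proof -
  let ?x = "(p, a)" and ?y = "(p, b)" and ?z = "(p, a + sc c b)"
  note X = ilin_X[OF assms, of c]
  have "ilin (sU c) ?x ?y ?z (\<lambda>K. FU K u)" "ilin (sV c) ?x ?y ?z (\<lambda>K. FV K v)" "ilin (sV c) ?x ?y ?z (\<lambda>K. FG K u)"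
    for u v
    unfolding FU_def FV_def FG_def
    by (intro ilin_diff ilin_comp[where \<sigma> = "sU c"] ilin_comp[where \<sigma> = "sV c"] ilin_subst[where \<sigma> = "sV c"]
        X mlin_X additive_scale; simp)+
  then show ?thesis
    by (intro gs_eqI) (simp_all add: F_def ilin_def sg_add additive_sg_comp[OF additive_scale(1)]
       additive_sg_comp[OF additive_scale(2)])
qed

lemma F_zero: "F (A @ (p, 0) # B) = 0"
  using F_linear[OF L_0 L_0, of A p 1 B] by (simp add: module.scale_one[OF module_sc])

lemma F_sg: "a \<in> L p \<Longrightarrow> F ((p, sg n a) # B) = sg n (F ((p, a) # B))"
  using F_linear[OF L_0, of a p "[]" "of_int (ksign n)" B] F_zero[of "[]" p B] by (simp add: sc_ksign)

lemma F_gsym: "gsym F"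
proof (rule gsymI)
  fix A B :: "(int \<times> ('u, 'v) gs_cochain) list" and x y
  have *: "gsym (\<lambda>K. FU K u)" "gsym (\<lambda>K. FV K v)" "gsym (\<lambda>K. FG K u)" for u v
    unfolding FU_def FV_def FG_def
    by (intro gsym_diff gsym_comp gsym_subst short_X madd_X)+
  have dg: "dg (A @ x # y # B) = dg (A @ y # x # B)" by simp
  have fst_sg: "fst (sg n c) = sg n (fst c)" "snd (sg n c) = sg n (snd c)" "(sg n h) w = sg n (h w)"
    for n w and c :: "'c::ab_group_add \<times> 'd::ab_group_add" and h :: "'e \<Rightarrow> 'f::ab_group_add"
    by (simp_all add: sg_def)
  show "F (A @ x # y # B) = sg ((fst x - 1) * (fst y - 1)) (F (A @ y # x # B))"
    unfolding F_def dg gsymD[OF *(1), of A x y B] gsymD[OF *(2), of A x y B]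
    by (rule gs_eqI) (simp_all add: fst_sg gsymD[OF *(3), of A x y B] add.commute)
qed

text \<open>The brackets take bare lists of cochains, so the degrees must be recovered. A nonzero
  element has only one; for 0 the choice is immaterial, because \<open>F\<close> vanishes as soon as
  one of its items is 0.\<close>

definition deg :: "('u, 'v) gs_cochain \<Rightarrow> int" where
  "deg x = (SOME p. x \<in> L p)"

definition l :: "nat \<Rightarrow> ('u, 'v) gs_cochain list \<Rightarrow> ('u, 'v) gs_cochain" where
  "l n xs = sg (dexp (map deg xs)) (F (zip (map deg xs) xs))"

lemma l_homogeneous:
  assumes "homogeneous L ps xs"
  shows "l n xs = sg (dexp ps) (F (zip ps xs))"
proof (cases "0 \<in> set xs")
  case True
  have "F (zip qs xs) = 0" if "length qs = length xs" for qs
  proof -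
    obtain i where i: "i < length xs" "xs ! i = 0" using True by (auto simp: in_set_conv_nth)
    then have "zip qs xs = take i (zip qs xs) @ (qs ! i, 0) # drop (Suc i) (zip qs xs)"
      using id_take_nth_drop[of i "zip qs xs"] that by simp
    then show ?thesis using F_zero by metis
  qed
  then show ?thesis using assms by (simp add: l_def homogeneous_def list_all2_lengthD)
next
  case False
  have "map deg xs = ps"
  proof (rule nth_equalityI)
    show len: "length (map deg xs) = length ps"
      using assms by (simp add: homogeneous_def list_all2_lengthD)
    fix i assume "i < length (map deg xs)"
    then have i: "i < length xs" by simp
    then have x: "xs ! i \<in> L (ps ! i)"
      using assms len by (simp add: homogeneous_def list_all2_conv_all_nth)
    have "xs ! i \<noteq> 0" using False nth_mem[OF i] by metis
    then have "deg (xs ! i) = ps ! i"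
      unfolding deg_def using x by (intro some_equality) (auto intro: L_unique)
    then show "map deg xs ! i = ps ! i" using i by simp
  qed
  then show ?thesis by (simp add: l_def)
qed

lemma l_mem:
  assumes "homogeneous L ps xs"
  shows "l n xs \<in> L (sum_list ps + 2 - int (length xs))"
proof -
  have "length ps = length xs" using assms by (simp add: homogeneous_def list_all2_lengthD)
  then show ?thesis
    using F_mem[of "zip ps xs"] unfolding l_homogeneous[OF assms]
    by (intro L_sg) (simp add: dg_zip algebra_simps)
qed

lemma l_linear:
  assumes "homogeneous L ps xs" "homogeneous L qs ys" "a \<in> L p" "b \<in> L p"
  shows "l n (xs @ (a + sc c b) # ys) = l n (xs @ a # ys) + sc c (l n (xs @ b # ys))"
proof -
  have h: "homogeneous L (ps @ p # qs) (xs @ x # ys)" if "x \<in> L p" for x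
    using assms that by (auto simp: homogeneous_def list_all2_appendI)
  have len: "length ps = length xs" using assms by (simp add: homogeneous_def list_all2_lengthD)
  show ?thesis
    unfolding l_homogeneous[OF h[OF L_lincomb[OF assms(3,4)]]] l_homogeneous[OF h[OF assms(3)]]
      l_homogeneous[OF h[OF assms(4)]]
    using len by (simp add: F_linear assms sg_add additive_sg_comp[OF additive_sc])
qed

lemma l_antisymmetric:
  assumes "homogeneous L ps xs" "\<sigma> permutes {..<length xs}"
  shows "l n (permute_list \<sigma> xs) = sc (of_int (chi \<sigma> ps)) (l n xs)"
proof -
  let ?K = "zip ps xs"
  have len: "length ps = length xs" using assms by (simp add: homogeneous_def list_all2_lengthD)
  have hom: "homogeneous L (permute_list \<sigma> ps) (permute_list \<sigma> xs)"
    using assms len unfolding homogeneous_def by (subst list_all2_permute_list_iff) auto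
  define G where "G = (\<lambda>K. sg (dexp (map fst K)) (F K))"
  have G: "G (A @ x # y # B) = sg (1 + fst x * fst y) (G (A @ y # x # B))" for A x y B
    unfolding G_def gsymD[OF F_gsym, of A x y B] sg_sg
    using dexp_swap[of "map fst A" "fst x" "fst y" "map fst B"] by (intro sg_cong) auto
  have "l n (permute_list \<sigma> xs) = G (permute_list \<sigma> ?K)"
    unfolding l_homogeneous[OF hom] G_def
      permute_list_zip[OF assms(2)[folded len] HOL.refl len] using len by simp
  also have "\<dots> = sg (\<Sum>(a, b)\<in>inversions \<sigma> (length ?K). 1 + fst (?K ! \<sigma> a) * fst (?K ! \<sigma> b)) (G ?K)"
    by (rule permute_list_sg[where h = "\<lambda>x y. 1 + fst x * fst y", OF G]) (use assms(2) len in simp)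
  also have "(\<Sum>(a, b)\<in>inversions \<sigma> (length ?K). 1 + fst (?K ! \<sigma> a) * fst (?K ! \<sigma> b))
      = (\<Sum>(a, b)\<in>inversions \<sigma> (length ps). 1 + ps ! \<sigma> a * ps ! \<sigma> b)"
    using sum_inversions_zip[of \<sigma> ps xs "\<lambda>p q. 1 + p * q"] assms(2) len by simp
  also have "sg \<dots> (G ?K) = sc (of_int (chi \<sigma> ps)) (l n xs)"
    using assms(2) len
    by (simp add: chi_inversions sc_ksign G_def l_homogeneous[OF assms(1)])
  finally show ?thesis .
qed

text \<open>The given structure satisfies its own equations, by associativity and multiplicativity.
  Otherwise the brackets would be curved: the splitting with an empty left part would add a term
  with the item \<open>F []\<close> to the Jacobi identity.\<close>

lemma F_Nil: "F [] = 0"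
proof -
  have p: "length v \<noteq> 2 \<Longrightarrow> product_cochain v = 0" for v :: "'a::ring list"
    by (simp add: product_cochain_def)
  have u: "length v \<noteq> 1 \<Longrightarrow> unary g v = 0" for v by (simp add: unary_def)
  have m: "madd (product_cochain :: 'u list \<Rightarrow> 'u)" "madd (product_cochain :: 'v list \<Rightarrow> 'v)" "madd (unary g)"
    using madd_X[of "[]"] by simp_all
  have "hat 1 product_cochain product_cochain w = (0 :: 'u)" "hat 1 product_cochain product_cochain w' = (0 :: 'v)"
    for w w'
    by (simp_all add: hat_2_2[OF p p m(1)] hat_2_2[OF p p m(2)] sg_one mult.assoc)
  moreover have "comp 1 XU XG [] w = subst 2 XG XV [] w" for w
    by (simp add: comp_def subst_def hat_2_1[OF p u m(3)] E_2 Cp_def Dc_1_1[OF u u m(2), simplified] g_mult)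
  ultimately show ?thesis
    by (intro gs_eqI) (simp_all add: F_def FU_def FV_def FG_def comp_def)
qed

text \<open>Each summand is a common sign \<open>?\<omega>\<close> times the summand of
  \<open>Us_unshuffles\<close> for \<open>Jacobi_F\<close>, so the task is a comparison of exponents
  modulo 2.\<close>

lemma l_Jacobi:
  assumes "homogeneous L ps xs"
  defines "n \<equiv> length xs"
  shows "(\<Sum>i = 1..n. \<Sum>\<sigma>\<in>unshuffles i n. sc (of_int (chi \<sigma> ps * (-1) ^ (i * (n + 1 - i - 1))))
     (l (n + 1 - i) (l i (take i (permute_list \<sigma> xs)) # drop i (permute_list \<sigma> xs)))) = 0"
proof -
  let ?K = "zip ps xs"
  let ?\<omega> = "1 + tri (sum_list ps + 3 - int n) + tri (sum_list ps + 2 - int n) + dexp ps"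
  let ?h = "\<lambda>\<sigma>. \<Sum>(a, b)\<in>inversions \<sigma> (length ?K). (fst (?K ! \<sigma> a) - 1) * (fst (?K ! \<sigma> b) - 1)"
  let ?f = "\<lambda>i \<sigma>. sg (?h \<sigma>) (F (item (take i (permute_list \<sigma> ?K)) # drop i (permute_list \<sigma> ?K)))"
  have len: "length ps = n" using assms by (simp add: homogeneous_def list_all2_lengthD)
  have "sc (of_int (chi \<sigma> ps * (-1) ^ (i * (n + 1 - i - 1))))
     (l (n + 1 - i) (l i (take i (permute_list \<sigma> xs)) # drop i (permute_list \<sigma> xs))) = sg ?\<omega> (?f i \<sigma>)"
    if i: "i \<in> {1..n}" and \<sigma>: "\<sigma> \<in> unshuffles i n" for i \<sigma>
  proof -
    have perm: "\<sigma> permutes {..<n}" using \<sigma> by (simp add: unshuffles_def)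
    let ?ps = "permute_list \<sigma> ps" and ?xs = "permute_list \<sigma> xs"
    let ?A = "zip (take i ?ps) (take i ?xs)" and ?B = "zip (drop i ?ps) (drop i ?xs)"
    have hom: "homogeneous L ?ps ?xs"
      using assms perm len unfolding homogeneous_def by (subst list_all2_permute_list_iff) auto
    then have homA: "homogeneous L (take i ?ps) (take i ?xs)" and homB: "homogeneous L (drop i ?ps) (drop i ?xs)"
      by (auto simp: homogeneous_def)
    have K: "permute_list \<sigma> ?K = zip ?ps ?xs"
      using perm len by (simp add: permute_list_zip n_def)
    have lens: "length ?ps = n" "length ?xs = n" using len by (simp_all add: n_def)
    let ?p = "sum_list (take i ?ps) + 2 - int (length (take i ?ps))"
    have dgA: "dg ?A + 2 = ?p" using lens by (simp add: dg_zip)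
    have y: "l i (take i ?xs) \<in> L ?p" using l_mem[OF homA, of i] lens by simp
    then have "homogeneous L (?p # drop i ?ps) (l i (take i ?xs) # drop i ?xs)"
      using homB by (simp add: homogeneous_def)
    then have "l (n + 1 - i) (l i (take i ?xs) # drop i ?xs)
      = sg (dexp (?p # drop i ?ps)) (F ((?p, sg (dexp (take i ?ps)) (F ?A)) # ?B))"
      by (simp add: l_homogeneous l_homogeneous[OF homA])
    also have "\<dots> = sg (dexp (?p # drop i ?ps) + dexp (take i ?ps)) (F (item ?A # ?B))"
      unfolding item_def dgA F_sg[OF F_mem[of ?A, unfolded dgA]] by simp
    finally have l: "l (n + 1 - i) (l i (take i ?xs) # drop i ?xs) = \<dots>" .
    \<comment> \<open>Permuting the degrees changes \<open>dexp\<close> by the sum of p + q over the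
      inversions. This is also the difference, modulo 2, between the exponent 1 + p q of
      \<open>chi\<close> and the shifted Koszul exponent (p - 1)(q - 1).\<close>
    have dexp: "even (dexp ?ps + dexp ps + ?h \<sigma> + (\<Sum>(a, b)\<in>inversions \<sigma> n. 1 + ps ! \<sigma> a * ps ! \<sigma> b))"
    proof -
      have h: "?h \<sigma> = (\<Sum>(a, b)\<in>inversions \<sigma> n. (ps ! \<sigma> a - 1) * (ps ! \<sigma> b - 1))"
        using sum_inversions_zip[of \<sigma> ps xs "\<lambda>p q. (p - 1) * (q - 1)"] perm len n_def by simp
      have sw: "sg (dexp (A @ p # q # B)) (1::int) = sg (p + q) (sg (dexp (A @ q # p # B)) 1)" for A p q B
        unfolding sg_sg by (rule sg_cong) (use dexp_swap[of A p q B] in \<open>simp_all add: algebra_simps\<close>)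
      have "sg (dexp ?ps) 1 = sg (\<Sum>(a, b)\<in>inversions \<sigma> n. ps ! \<sigma> a + ps ! \<sigma> b) (sg (dexp ps) (1::int))"
        using permute_list_sg[where G = "\<lambda>ps. sg (dexp ps) 1" and h = "(+)" and K = ps, OF sw] perm len
        by simp
      then have 1: "even (dexp ?ps + dexp ps + (\<Sum>(a, b)\<in>inversions \<sigma> n. ps ! \<sigma> a + ps ! \<sigma> b))"
        using len by (auto simp: sg_def split: if_splits)
      have "?h \<sigma> + (\<Sum>(a, b)\<in>inversions \<sigma> n. 1 + ps ! \<sigma> a * ps ! \<sigma> b)
        - (\<Sum>(a, b)\<in>inversions \<sigma> n. ps ! \<sigma> a + ps ! \<sigma> b)
        = 2 * (\<Sum>(a, b)\<in>inversions \<sigma> n. ps ! \<sigma> a * ps ! \<sigma> b - ps ! \<sigma> a - ps ! \<sigma> b + 1)"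
        unfolding h sum.distrib[symmetric] sum_subtractf[symmetric] sum_distrib_left
        by (rule sum.cong) (auto simp: algebra_simps)
      with 1 show ?thesis by presburger
    qed
    have sum: "sum_list ?ps = sum_list ps"
      using perm len by (simp add: sum_mset_sum_list[symmetric] mset_permute_list)
    have lens': "length (take i ?ps) = i" "length (drop i ?ps) = n - i" using i lens by auto
    have nested: "even (dexp (?p # drop i ?ps) + dexp (take i ?ps) + int (i * (n - i))
      - (1 + tri (sum_list ps + 3 - int n) + tri (sum_list ps + 2 - int n) + dexp ?ps))"
      using dexp_nested[of "take i ?ps" "drop i ?ps"] unfolding append_take_drop_id sum lens' lens .
    have e: "even ((\<Sum>(a, b)\<in>inversions \<sigma> n. 1 + ps ! \<sigma> a * ps ! \<sigma> b) + int (i * (n - i))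
      + (dexp (?p # drop i ?ps) + dexp (take i ?ps)) - (?\<omega> + ?h \<sigma>))"
      by (rule parity_combine[OF dexp nested])
    have pow: "(-1) ^ m = ksign (int m)" for m by (simp add: ksign_def)
    have ksign_mult: "ksign a * ksign b = (ksign (a + b) :: int)" for a b by (simp add: ksign_def)
    have "chi \<sigma> ps * (-1) ^ (i * (n + 1 - i - 1))
        = ksign ((\<Sum>(a, b)\<in>inversions \<sigma> n. 1 + ps ! \<sigma> a * ps ! \<sigma> b) + int (i * (n - i)))"
      using perm len by (simp add: chi_inversions pow ksign_mult)
    then show ?thesis
      unfolding l K take_zip drop_zip by (simp only: sc_ksign sg_sg) (rule sg_cong[OF e HOL.refl])
  qed
  then have "(\<Sum>i = 1..n. \<Sum>\<sigma>\<in>unshuffles i n. sc (of_int (chi \<sigma> ps * (-1) ^ (i * (n + 1 - i - 1))))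
     (l (n + 1 - i) (l i (take i (permute_list \<sigma> xs)) # drop i (permute_list \<sigma> xs))))
    = (\<Sum>i = 1..n. \<Sum>\<sigma>\<in>unshuffles i n. sg ?\<omega> (?f i \<sigma>))"
    by (intro sum.cong HOL.refl)
  also have "\<dots> = sg ?\<omega> (\<Sum>i = 1..length ?K. \<Sum>\<sigma>\<in>unshuffles i (length ?K). ?f i \<sigma>)"
    using len by (simp add: additive.sum[OF additive_sg] n_def)
  \<comment> \<open>The extra summand of \<open>Us_unshuffles\<close> has \<open>F []\<close> as its
    first item, so it is 0.\<close>
  also have "(\<Sum>i = 1..length ?K. \<Sum>\<sigma>\<in>unshuffles i (length ?K). ?f i \<sigma>) = 0"
    using Us_unshuffles[of ?K "\<lambda>I J. F (item I # J)"] Jacobi_F[of ?K] F_zero[of "[]"]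
    by (simp add: item_def F_Nil)
  finally show ?thesis by simp
qed

theorem L_infinity_l: "L_infinity sc L l"
  unfolding L_infinity_def Let_def
proof (intro conjI allI impI)
  show "module sc" by (rule module_sc)
  show "module.subspace sc (L p)" for p
    by (rule module.subspaceI[OF module_sc]) (auto intro: L_0 L_add L_scale)
  show "l (length xs) xs \<in> L (sum_list ps + 2 - int (length xs))" if "homogeneous L ps xs" for ps xs
    using that by (rule l_mem)
  fix ps xs qs ys p a b c
  assume *: "homogeneous L ps xs" "homogeneous L qs ys" "a \<in> L p" "b \<in> L p"
  let ?n = "length xs + length ys + 1"
  show "l ?n (xs @ (a + b) # ys) = l ?n (xs @ a # ys) + l ?n (xs @ b # ys)"
    \<comment> \<open>Additivity is the case of scalar 1; compatibility with scalars is the case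
      where the first summand is 0.\<close>
    using l_linear[OF *, of ?n 1] by (simp add: module.scale_one[OF module_sc])
  have "l ?n (xs @ 0 # ys) = 0"
    using l_linear[OF *(1,2) L_0 L_0, of ?n 1] by (simp add: module.scale_one[OF module_sc])
  then show "l ?n (xs @ sc c a # ys) = sc c (l ?n (xs @ a # ys))"
    using l_linear[OF *(1,2) L_0 *(3), of ?n c] by simp
qed (use l_antisymmetric l_Jacobi in \<open>simp_all\<close>)

end

section \<open>The unary bracket and the Gerstenhaber-Schack differential\<close>

lemma Dc_Nil_left: "Dc w (\<lambda>u v. if u = [] then h v else 0) = h w"
  by (cases w) simp_all

lemma Dc_single_right:
  "Dc w (\<lambda>u v. if length v = 1 then h u (hd v) else 0) = (if w = [] then 0 else h (butlast w) (last w))"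
  by (induction w arbitrary: h) (auto cong: if_cong)

lemma Dc_single_left:
  "Dc w (\<lambda>u v. if length u = 1 then h (hd u) v else 0) = (if w = [] then 0 else h (hd w) (tl w))"
proof (cases w)
  case (Cons a w')
  have "Dc w' (\<lambda>u v. if length (a # u) = 1 then h (hd (a # u)) v else 0)
      = Dc w' (\<lambda>u v. if u = [] then h a v else 0)"
    by (intro Dc_cong) auto
  then show ?thesis using Cons by (simp add: Dc_Nil_left)
qed simp

text \<open>An insertion always leaves a letter behind.\<close>

lemma hat_cong_nonempty: "(\<And>v. v \<noteq> [] \<Longrightarrow> \<phi> v = \<phi>' v) \<Longrightarrow> hat q y \<phi> w = hat q y \<phi>' w"
proof (induction w arbitrary: \<phi> \<phi>')
  case (Cons a w)
  have "hat q y (\<lambda>v. \<phi> (a # v)) w = hat q y (\<lambda>v. \<phi>' (a # v)) w"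
    by (intro Cons.IH Cons.prems) simp
  then show ?case by (simp add: Cons.prems)
qed simp

lemma hat_eq_0: "(\<And>v. v \<noteq> [] \<Longrightarrow> \<phi> v = 0) \<Longrightarrow> hat q y \<phi> w = 0"
  using hat_cong_nonempty[of \<phi> "\<lambda>v. 0"] by simp

lemma hat_unary: "hat q y (unary g) w = g (y w)"
proof -
  have "(case w of [] \<Rightarrow> 0 | a # w' \<Rightarrow> sg q (hat q y (\<lambda>v. unary g (a # v)) w')) = 0"
    by (cases w) (simp_all add: hat_eq_0 unary_def)
  moreover have "Dc w (\<lambda>u v. unary g (y u # v)) = Dc w (\<lambda>u v. if v = [] then g (y u) else 0)"
    by (intro Dc_cong) (simp add: unary_def)
  ultimately show ?thesis by (simp add: hat_unfold Dc_Nil_right)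
qed

text \<open>The product needs exactly two letters, so \<open>x\<close> takes in all letters but the
  last or all but the first. These are the two outer Hochschild terms.\<close>

lemma hat_into_product:
  "hat q x product_cochain w = (if w = [] then 0 else x (butlast w) * last w + sg q (hd w * x (tl w)))"
proof (cases w)
  case (Cons a w')
  have "Dc w (\<lambda>u v. product_cochain (x u # v)) = Dc w (\<lambda>u v. if length v = 1 then x u * hd v else 0)"
    by (intro Dc_cong) (auto simp: product_cochain_def length_Suc_conv)
  also have "\<dots> = x (butlast w) * last w"
    by (subst Dc_single_right) (simp add: Cons)
  finally have "Dc w (\<lambda>u v. product_cochain (x u # v)) = \<dots>" .
  moreover have "hat q x (\<lambda>v. product_cochain (a # v)) w' = a * x w'"
  proof -
    have "hat q x (\<lambda>v. product_cochain (a # v)) w' = hat q x (unary ((*) a)) w'"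
      by (rule arg_cong[of _ _ "\<lambda>\<phi>. hat q x \<phi> w'"]) (auto simp: fun_eq_iff product_cochain_def unary_def)
    then show ?thesis by (simp add: hat_unary)
  qed
  ultimately show ?thesis using Cons by (simp add: hat_unfold[of _ _ product_cochain w] del: Dc.simps)
qed simp

text \<open>The coderivation extending the product multiplies neighbouring letters, which is the
  inner part of the Hochschild differential up to an overall sign.\<close>

lemma hat_product:
  assumes "madd \<phi>"
  shows "hat 1 product_cochain \<phi> w = - (\<Sum>i<length w - 1.
    sg (int i + 1) (\<phi> (take i w @ (w ! i * w ! Suc i) # drop (Suc (Suc i)) w)))"
  using assms
proof (induction w arbitrary: \<phi>)
  case Nil
  then show ?case by (simp add: madd_0_hd)
next
  case (Cons a w)
  show ?case
  proof (cases w)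
    case Nil
    then show ?thesis by (simp add: madd_0_hd[OF Cons.prems] madd_0[OF Cons.prems, of "[_]" "[]", simplified])
  next
    case w: (Cons b w')
    have "Dc w' (\<lambda>u v. \<phi> (product_cochain (a # b # u) # v)) = Dc w' (\<lambda>u v. if u = [] then \<phi> (a * b # v) else 0)"
      by (intro Dc_cong) (auto simp: product_cochain_def madd_0_hd[OF Cons.prems])
    then have "Dc (a # w) (\<lambda>u v. \<phi> (product_cochain u # v)) = \<phi> (a * b # w')"
      by (simp add: w madd_0_hd[OF Cons.prems] Dc_Nil_left)
    moreover have "hat 1 product_cochain (\<lambda>v. \<phi> (a # v)) w
      = - (\<Sum>i<length w'. sg (int i + 1) (\<phi> (a # take i w @ (w ! i * w ! Suc i) # drop (Suc (Suc i)) w)))"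
      using Cons.IH[OF madd_Cons[OF Cons.prems]] w by simp
    moreover have "(\<Sum>i<length (a # w) - 1. G i) = G 0 + (\<Sum>i<length w'. G (Suc i))" for G :: "nat \<Rightarrow> 'b"
      by (simp add: w sum.lessThan_Suc_shift del: sum.lessThan_Suc)
    moreover have "sg (int (Suc i) + 1) x = - sg (int i + 1) x" for i and x :: 'b
      by (simp add: sg_def)
    ultimately show ?thesis
      by (simp only: hat.simps sg_one) (simp add: w sg_one sum_negf)
  qed
qed

lemma hochschild_hat:
  assumes "madd x" "as \<noteq> []"
  shows "hochschild la ra x as = la (hd as) (x (tl as)) - hat 1 product_cochain x as
    + sg (int (length as)) (ra (x (butlast as)) (last as))"
proof -
  define n where "n = length as - 1"
  have n: "length as = n + 1" using assms(2) by (simp add: n_def)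
  have "(\<Sum>i = 1..n. let y = x (take (i - 1) as @ (as ! (i - 1) * as ! i) # drop (i + 1) as)
      in if even i then y else - y) = - hat 1 product_cochain x as"
    unfolding hat_product[OF assms(1)]
    by (simp add: sum.atLeast1_atMost_eq n sg_def Let_def cong: if_cong)
  then show ?thesis
    using assms(2) n by (simp add: hochschild_def n_def[symmetric] Let_def sg_def)
qed

lemma hochschild_0:
  "(\<And>a. la a 0 = 0) \<Longrightarrow> (\<And>a. ra 0 a = 0) \<Longrightarrow> hochschild la ra (\<lambda>w. 0) as = 0"
  by (simp add: hochschild_def Let_def cong: if_cong)

context algebra_map
begin

text \<open>Without items every factor is \<open>g\<close>, which takes exactly one letter.\<close>

lemma E_pure:
  assumes "madd \<phi>"
  shows "E r XG \<phi> [] w = (if length w = r then \<phi> (map g w) else 0)"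
  using assms
proof (induction r arbitrary: \<phi> w)
  case (Suc r)
  have "E (Suc r) XG \<phi> [] w = Dc w (\<lambda>u v. if length u = 1 then E r XG (\<lambda>x. \<phi> (g (hd u) # x)) [] v else 0)"
    unfolding E.simps Cp_def Us.simps
    by (intro Dc_cong) (auto simp: unary_def length_Suc_conv madd_0_hd[OF Suc.prems])
  also have "\<dots> = (if w = [] then 0 else E r XG (\<lambda>x. \<phi> (g (hd w) # x)) [] (tl w))"
    by (rule Dc_single_left)
  finally show ?case
    by (cases w) (simp_all add: Suc.IH[OF madd_Cons[OF Suc.prems]] del: E.simps)
qed simp

text \<open>With a single item each composite has two terms, one for each place that can receive it.
  Signs in \<open>F\<close> depend on p and those in \<open>hochschild\<close> on the length of the
  word; they match because a cochain of degree p has a fixed arity.\<close>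

lemma l_1:
  assumes x: "x \<in> L p"
  shows "l 1 [x] = d_GS g x"
proof (cases "p < 0")
  case True
  then have "x = 0" using x by (auto elim: L_cases)
  moreover have "homogeneous L [p] [x]" using x by (simp add: homogeneous_def)
  ultimately have "l 1 [x] = 0"
    using F_zero[of "[]" p "[]"] by (simp add: l_homogeneous)
  moreover have "d_GS g 0 = 0"
    by (intro gs_eqI) (simp_all add: d_GS_def zero_prod_def zero_fun_def hochschild_0)
  ultimately show ?thesis using \<open>x = 0\<close> by simp
next
  case False
  obtain xU xV xg where x_eq: "x = (xU, xV, xg)" by (cases x)
  note madds = L_mlin[OF x, THEN mlin_madd, unfolded x_eq, simplified]
  have prod: "madd (product_cochain :: 'u list \<Rightarrow> 'u)" "madd (product_cochain :: 'v list \<Rightarrow> 'v)"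
    using madd_X[of "[]"] by simp_all
  \<comment> \<open>The rescaling contributes \<open>tri (p + 1) + tri p = 2 * tri p + p\<close>, so
    only the parity of 1 + p is left.\<close>
  have "dexp [p] = 1 + p + 2 * tri p" using tri_Suc[of p] by (simp add: dexp_def add.commute)
  then have "sg (dexp [p]) y = sg (1 + p) y" for y :: "('u, 'v) gs_cochain"
    by (intro sg_cong) simp_all
  then have l: "l 1 [x] = sg (1 + p) (F [(p, x)])"
    using x by (simp add: l_homogeneous[of "[p]"] homogeneous_def)
  have sg_prod: "fst (sg n c) = sg n (fst c)" "snd (sg n c) = sg n (snd c)" "(sg n h) w = sg n (h w)"
    for n w and c :: "'c::ab_group_add \<times> 'd::ab_group_add" and h :: "'e \<Rightarrow> 'f::ab_group_add"
    by (simp_all add: sg_def)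
  have U: "- hat 1 product_cochain y w + sg p (hat p y product_cochain w) = hochschild (*) (*) y w"
    if y: "madd y" and len: "\<And>v. y v \<noteq> 0 \<Longrightarrow> int (length v) = p + 1" for y :: "'c::ring list \<Rightarrow> 'c" and w
  proof (cases "w = []")
    case True
    then show ?thesis by (simp add: hochschild_def madd_0_hd[OF y])
  next
    case False
    \<comment> \<open>Where the left factor is nonzero, the word has length p + 2.\<close>
    have "sg p (y (butlast w) * last w) = sg (int (length w)) (y (butlast w) * last w)"
    proof (cases "y (butlast w) = 0")
      case nz: False
      then have "int (length w) = p + 2"
        using len[OF nz, unfolded length_butlast] False by (cases w) auto
      then show ?thesis by (intro sg_cong) simp_all
    qed simp
    moreover have "sg p (sg p z) = z" for z :: 'c by (simp add: sg_even)
    ultimately show ?thesis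
      using False by (simp add: hochschild_hat[OF y] hat_into_product sg_add)
  qed
  have XU1: "XU [(p, x)] = (\<lambda>w. sg (p - 1) (xU w))" "XV [(p, x)] = (\<lambda>w. sg (p - 1) (xV w))" "XG [(p, x)] = xg"
    using x by (simp_all add: x_eq)
  have "sg (1 + p) (sg (dg [(p, x)] + 1) (FU [(p, x)] w)) = hochschild (*) (*) xU w" for w
  proof -
    have FU: "FU [(p, x)] w = hat 1 product_cochain xU w + sg (p - 1) (hat p xU product_cochain w)"
      by (simp add: FU_def comp_def XU1 hat_sg hat_sg_left prod sg_even del: XU.simps(2))
    have "sg (1 + p) (sg (dg [(p, x)] + 1) (FU [(p, x)] w))
      = sg 1 (hat 1 product_cochain xU w) + sg p (hat p xU product_cochain w)"
      unfolding FU sg_add sg_sg by (intro arg_cong2[of _ _ _ _ "(+)"] sg_cong) simp_all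
    then show ?thesis
      using U[OF madds(1)] L_length(1)[OF x] by (simp add: x_eq sg_one)
  qed
  moreover have "sg (1 + p) (sg (dg [(p, x)] + 1) (FV [(p, x)] w)) = hochschild (*) (*) xV w" for w
  proof -
    have FV: "FV [(p, x)] w = hat 1 product_cochain xV w + sg (p - 1) (hat p xV product_cochain w)"
      by (simp add: FV_def comp_def XU1 hat_sg hat_sg_left prod sg_even del: XV.simps(2))
    have "sg (1 + p) (sg (dg [(p, x)] + 1) (FV [(p, x)] w))
      = sg 1 (hat 1 product_cochain xV w) + sg p (hat p xV product_cochain w)"
      unfolding FV sg_add sg_sg by (intro arg_cong2[of _ _ _ _ "(+)"] sg_cong) simp_all
    then show ?thesis
      using U[OF madds(2)] L_length(2)[OF x] by (simp add: x_eq sg_one)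
  qed
  moreover have "sg (1 + p) (FG [(p, x)] w) = g (xU w) - xV (map g w)
      - hochschild (\<lambda>a m. g a * m) (\<lambda>m a. m * g a) xg w" for w
  proof -
    have c: "comp 1 XU XG [(p, x)] w = sg (p - 1) (hat 1 product_cochain xg w) + sg (p - 1) (g (xU w))"
    proof -
      have "g (sg n y) = sg n (g y)" for n y
        by (rule additive_sg_comp) (simp add: additive_def g_add)
      then show ?thesis
        by (simp add: comp_def XU1 hat_unary del: XU.simps(2) XG.simps(2))
    qed
    have pure: "E (nat (p + 1)) XG (XV [(p, x)]) [] w = sg (p - 1) (xV (map g w))"
    proof -
      have "xV (map g w) = 0" if "length w \<noteq> nat (p + 1)"
        using L_length(2)[OF x, of "map g w"] that by (cases "xV (map g w) = 0") (auto simp: x_eq)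
      then show ?thesis
        using E_pure[OF madd_X(2), of "nat (p + 1)" "[(p, x)]" w] by (auto simp: XU1 simp del: XV.simps(2))
    qed
    \<comment> \<open>The item sits in one of the two factors and the other one is \<open>g\<close>
      on a single letter, which is the last or the first letter of the word.\<close>
    have two: "E 2 XG product_cochain [(p, x)] w
      = (if w = [] then 0 else xg (butlast w) * g (last w) + sg (p - 1) (g (hd w) * xg (tl w)))"
    proof -
      have "Dc w (\<lambda>u v. xg u * unary g v) = Dc w (\<lambda>u v. if length v = 1 then xg u * g (hd v) else 0)"
        by (intro Dc_cong) (auto simp: unary_def length_Suc_conv)
      also have "\<dots> = (if w = [] then 0 else xg (butlast w) * g (last w))"
        by (rule Dc_single_right)
      finally have 1: "Dc w (\<lambda>u v. xg u * unary g v) = \<dots>" .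
      have "Dc w (\<lambda>u v. sg ((p - 1) * int (length u)) (unary g u * xg v))
        = Dc w (\<lambda>u v. if length u = 1 then sg (p - 1) (g (hd u) * xg v) else 0)"
        by (intro Dc_cong) (auto simp: unary_def length_Suc_conv)
      also have "\<dots> = (if w = [] then 0 else sg (p - 1) (g (hd w) * xg (tl w)))"
        by (rule Dc_single_left)
      finally have 2: "Dc w (\<lambda>u v. sg ((p - 1) * int (length u)) (unary g u * xg v)) = \<dots>" .
      show ?thesis
        using 1 2 by (simp add: E_2 Cp_def XU1 del: XG.simps(2))
    qed
    have "subst 2 XG XV [(p, x)] w = sg (p - 1) (xV (map g w)) + E 2 XG product_cochain [(p, x)] w"
      using pure by (simp add: subst_def add.commute[of 1 p] del: XV.simps(2))
    then have FG: "FG [(p, x)] w = sg (p - 1) (hat 1 product_cochain xg w) + sg (p - 1) (g (xU w))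
      - (sg (p - 1) (xV (map g w)) + E 2 XG product_cochain [(p, x)] w)"
      by (simp add: FG_def c)
    show ?thesis
    proof (cases "w = []")
      case True
      have "xU [] = 0" "xV [] = 0"
        using L_length(1)[OF x, of "[]"] L_length(2)[OF x, of "[]"] False
        by (cases "xU [] = 0"; cases "xV [] = 0"; simp add: x_eq)+
      then show ?thesis
        using FG two True by (simp add: hochschild_def madd_0_hd[OF madds(3)])
    next
      case w: False
      have "sg (1 + p) (xg (butlast w) * g (last w)) = sg (int (length w)) (xg (butlast w) * g (last w))"
      proof (cases "xg (butlast w) = 0")
        case nz: False
        then have "int (length w) = p + 1" using L_length(3)[OF x, of "butlast w", unfolded length_butlast] w
          by (cases w) (auto simp: x_eq)
        then show ?thesis by (intro sg_cong) simp_all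
      qed simp
      moreover have "sg (1 + p + (p - 1)) z = z" for z :: 'v by (simp add: sg_even)
      ultimately show ?thesis
        using w by (simp only: FG two hochschild_hat[OF madds(3) w] sg_add sg_diff sg_sg if_False) (simp add: algebra_simps)
    qed
  qed
  ultimately show ?thesis
    unfolding l by (intro gs_eqI) (simp_all add: sg_prod F_def d_GS_def x_eq)
qed

section \<open>The Quantum Master Equation as the structure equations\<close>

definition is_structure :: "('u, 'v) gs_cochain \<Rightarrow> bool" where
  "is_structure = (\<lambda>(mU, mV, f).
     (\<forall>a b c. mU [mU [a, b], c] = mU [a, mU [b, c]]) \<and>
     (\<forall>a b c. mV [mV [a, b], c] = mV [a, mV [b, c]]) \<and>
     (\<forall>a b. f [mU [a, b]] = mV [f [a], f [b]]))"

lemma comp_many_items_eq_0: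
  assumes "short X" "short \<Psi>" "\<And>I. madd (\<Psi> I)" "3 \<le> length K"
  shows "comp q X \<Psi> K w = 0"
proof -
  have "Us K (\<lambda>I J. sg (q * dg I) (hat (q + dg J) (X J) (\<Psi> I) w)) = Us K (\<lambda>I J. 0)"
  proof (intro Us_cong, goal_cases)
    case (1 I J)
    then have "2 \<le> length I \<or> 2 \<le> length J" using assms(4) by linarith
    then show ?case using assms(1-3) by (auto simp: short_def hat_0_left)
  qed
  then show ?thesis by (simp add: comp_def)
qed

context
  fixes \<kappa> :: "('u, 'v) gs_cochain"
  assumes \<kappa>: "\<kappa> \<in> L 1"
begin

private abbreviation "k \<equiv> (1 :: int, \<kappa>)"

text \<open>A composite with a coderivation involves two families that take at most one item each.
  For \<open>XV\<close> after e^f the degree 1 items have shifted degree 0, so the arity stays 2: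
  one item for \<open>XV\<close> and one for each of the two factors, at most three in all.\<close>

lemma F_many_items_eq_0:
  assumes "4 \<le> n"
  shows "F (replicate n k) = 0"
proof -
  let ?K = "replicate n k"
  have "subst 2 XG XV ?K w = 0" for w
  proof -
    have "Us ?K (\<lambda>I J. E (nat (dg I + 2)) XG (XV I) J w) = Us ?K (\<lambda>I J. 0)"
    proof (intro Us_cong_set, goal_cases)
      case (1 I J)
      show ?case
      proof (cases "2 \<le> length I")
        case True
        then show ?thesis using short_X by (simp add: short_def)
      next
        case False
        then have "2 < length J" using 1 assms by simp
        moreover have "dg I = 0" using 1(2) assms by (induction I) auto
        ultimately show ?thesis
          using E_many_items_eq_0[OF short_X(3) madd_X(2), of 2 J] by simp
      qed
    qed
    then show ?thesis by (simp add: subst_def)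
  qed
  moreover have "comp 1 XU XU ?K u = 0" "comp 1 XV XV ?K v = 0" "comp 1 XU XG ?K u = 0" for u v
    by (rule comp_many_items_eq_0; use assms short_X madd_X in auto)+
  ultimately show ?thesis
    by (intro gs_eqI) (simp_all add: F_def FU_def FV_def FG_def)
qed

lemma \<kappa>_length:
  "length u \<noteq> 2 \<Longrightarrow> fst \<kappa> u = 0" "length v \<noteq> 2 \<Longrightarrow> fst (snd \<kappa>) v = 0" "length u \<noteq> 1 \<Longrightarrow> snd (snd \<kappa>) u = 0"
  using \<kappa> by (cases \<kappa>; simp add: L_iff multilin_iff')+

lemma \<kappa>_madd: "madd (fst \<kappa>)" "madd (fst (snd \<kappa>))" "madd (snd (snd \<kappa>))"
  using L_mlin[OF \<kappa>, THEN mlin_madd] .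

lemma X_k: "XU [k] = fst \<kappa>" "XV [k] = fst (snd \<kappa>)" "XG [k] = snd (snd \<kappa>)"
  using \<kappa> by simp_all

text \<open>Signs disappear because \<open>k\<close> has shifted degree 0. Two equal items can be
  distributed over the two factors in two ways, hence the doubled value.\<close>

lemma E_2_k:
  assumes "madd \<phi>"
  shows "E 2 XG \<phi> [] w = (if length w = 2 then \<phi> [g (w ! 0), g (w ! 1)] else 0)"
    and "E 2 XG \<phi> [k] w = (if length w = 2 then
      \<phi> [snd (snd \<kappa>) [w ! 0], g (w ! 1)] + \<phi> [g (w ! 0), snd (snd \<kappa>) [w ! 1]] else 0)"
    and "E 2 XG \<phi> [k, k] w = (if length w = 2 then
      \<phi> [snd (snd \<kappa>) [w ! 0], snd (snd \<kappa>) [w ! 1]] + \<phi> [snd (snd \<kappa>) [w ! 0], snd (snd \<kappa>) [w ! 1]] else 0)"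
proof -
  have u: "length v \<noteq> 1 \<Longrightarrow> unary g v = 0" for v by (simp add: unary_def)
  have Z: "\<phi> [0, b] = 0" "\<phi> [b, 0] = 0" for b
    using madd_0_hd[OF assms] madd_0[OF assms, of "[b]" "[]"] by simp_all
  note Dc = Dc_1_1[OF u u assms] Dc_1_1[OF \<kappa>_length(3) u assms] Dc_1_1[OF u \<kappa>_length(3) assms]
    Dc_1_1[OF \<kappa>_length(3) \<kappa>_length(3) assms]
  show "E 2 XG \<phi> [] w = (if length w = 2 then \<phi> [g (w ! 0), g (w ! 1)] else 0)"
    "E 2 XG \<phi> [k] w = (if length w = 2 then
      \<phi> [snd (snd \<kappa>) [w ! 0], g (w ! 1)] + \<phi> [g (w ! 0), snd (snd \<kappa>) [w ! 1]] else 0)"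
    "E 2 XG \<phi> [k, k] w = (if length w = 2 then
      \<phi> [snd (snd \<kappa>) [w ! 0], snd (snd \<kappa>) [w ! 1]] + \<phi> [snd (snd \<kappa>) [w ! 0], snd (snd \<kappa>) [w ! 1]] else 0)"
    by (simp_all add: E_2 Cp_def X_k Dc Z del: XG.simps(2))
qed

text \<open>Repeated summands count the distributions of equal items. With the doubling in
  \<open>E_2_k\<close> they make up the factors 2! and 3! that the coefficients of the Quantum
  Master Equation cancel.\<close>

lemma F_1_2_3:
  fixes w :: "'u list" and w' :: "'v list"
  defines "xU \<equiv> fst \<kappa>" and "xV \<equiv> fst (snd \<kappa>)" and "xg \<equiv> snd (snd \<kappa>)"
  shows "fst (F [k]) w = - (hat 1 product_cochain xU w + hat 1 xU product_cochain w)"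
    "fst (F [k, k]) w = - (hat 1 xU xU w + hat 1 xU xU w)" "fst (F [k, k, k]) w = 0"
    "fst (snd (F [k])) w' = - (hat 1 product_cochain xV w' + hat 1 xV product_cochain w')"
    "fst (snd (F [k, k])) w' = - (hat 1 xV xV w' + hat 1 xV xV w')" "fst (snd (F [k, k, k])) w' = 0"
    "snd (snd (F [k])) w = hat 1 product_cochain xg w + g (xU w)
      - (E 2 XG product_cochain [k] w + E 2 XG xV [] w)"
    "snd (snd (F [k, k])) w = xg [xU w] + xg [xU w] - (E 2 XG product_cochain [k, k] w
      + (E 2 XG xV [k] w + E 2 XG xV [k] w))"
    "snd (snd (F [k, k, k])) w = - (E 2 XG xV [k, k] w + E 2 XG xV [k, k] w + E 2 XG xV [k, k] w)"
proof -
  have P: "madd (product_cochain :: 'u list \<Rightarrow> 'u)" "madd (product_cochain :: 'v list \<Rightarrow> 'v)" "madd (unary g)"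
    using madd_X[of "[]"] by simp_all
  have xg: "hat 1 xU xg w = xg [xU w]"
  proof -
    have "hat 1 xU xg w = (if length w = 2 then xg [xU [w ! 0, w ! 1]] else 0)"
      unfolding xU_def xg_def by (rule hat_2_1) (simp_all add: \<kappa>_length \<kappa>_madd)
    moreover have "w = [w ! 0, w ! 1]" if "length w = 2"
      using that by (auto simp: length_Suc_conv numeral_2_eq_2)
    moreover have "xg [xU w] = 0" if "length w \<noteq> 2"
      using that madd_0_hd[OF \<kappa>_madd(3)] by (simp add: xU_def xg_def \<kappa>_length)
    ultimately show ?thesis by metis
  qed
  note simps = F_def FU_def FV_def FG_def comp_def subst_def X_k sg_one hat_unary P \<kappa>_madd hat_0_left xg
    xU_def[symmetric] xV_def[symmetric] xg_def[symmetric]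
  note E_0 = E_many_items_eq_0[OF short_X(3) P(2)]
  note madds = \<kappa>_madd[folded xU_def xV_def xg_def]
  show "fst (F [k]) w = - (hat 1 product_cochain xU w + hat 1 xU product_cochain w)"
    "fst (F [k, k]) w = - (hat 1 xU xU w + hat 1 xU xU w)" "fst (F [k, k, k]) w = 0"
    "fst (snd (F [k])) w' = - (hat 1 product_cochain xV w' + hat 1 xV product_cochain w')"
    "fst (snd (F [k, k])) w' = - (hat 1 xV xV w' + hat 1 xV xV w')" "fst (snd (F [k, k, k])) w' = 0"
    "snd (snd (F [k])) w = hat 1 product_cochain xg w + g (xU w)
      - (E 2 XG product_cochain [k] w + E 2 XG xV [] w)"
    "snd (snd (F [k, k])) w = xg [xU w] + xg [xU w] - (E 2 XG product_cochain [k, k] w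
      + (E 2 XG xV [k] w + E 2 XG xV [k] w))"
    "snd (snd (F [k, k, k])) w = - (E 2 XG xV [k, k] w + E 2 XG xV [k, k] w + E 2 XG xV [k, k] w)"
    by (simp_all add: simps madds E_0 del: XU.simps(2) XV.simps(2) XG.simps(2) E.simps)
qed

lemma qme_term_sum:
  "(\<Sum>n\<in>{1, 2, 3}. qme_term sc l \<kappa> n) = F [k] + sc (1 / 2) (F [k, k]) + sc (1 / 6) (F [k, k, k])"
proof -
  have l: "l n (replicate m \<kappa>) = sg (dexp (replicate m 1)) (F (replicate m k))" for n m
  proof -
    have "homogeneous L (replicate m 1) (replicate m \<kappa>)"
      using \<kappa> by (simp add: homogeneous_def list_all2_conv_all_nth)
    then show ?thesis by (simp add: l_homogeneous zip_replicate)
  qed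
  \<comment> \<open>The exponents are 2, 4 and 7. The resulting minus sign of the third bracket
    cancels the minus sign of its coefficient, which leaves the Taylor series of
    \<open>F\<close>.\<close>
  have "even (dexp [1])" "even (dexp [1, 1])" "odd (dexp [1, 1, 1])"
    by (simp_all add: dexp_def tri_def)
  then have ls: "l 1 [\<kappa>] = F [k]" "l 2 [\<kappa>, \<kappa>] = F [k, k]" "l 3 [\<kappa>, \<kappa>, \<kappa>] = - F [k, k, k]"
    using l[of 1 1] l[of 2 2] l[of 3 3] by (simp_all add: eval_nat_numeral sg_def)
  have rep: "replicate 1 \<kappa> = [\<kappa>]" "replicate 2 \<kappa> = [\<kappa>, \<kappa>]" "replicate 3 \<kappa> = [\<kappa>, \<kappa>, \<kappa>]"
    by (simp_all add: eval_nat_numeral)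
  have coeff: "- ((-1) ^ (1 * (1 + 1) div 2)) / fact 1 = (1 :: 'k)" "- ((-1) ^ (2 * (2 + 1) div 2)) / fact 2 = (1 / 2 :: 'k)"
    "- ((-1) ^ (3 * (3 + 1) div 2)) / fact 3 = (- (1 / 6) :: 'k)"
    by (simp_all add: fact_numeral)
  have minus: "sc (- c) (- x) = sc c x" for c x
    using module.scale_minus_right[OF module_sc] module.scale_minus_left[OF module_sc] by simp
  have "(\<Sum>n\<in>{1, 2, 3}. qme_term sc l \<kappa> n) = qme_term sc l \<kappa> 1 + qme_term sc l \<kappa> 2 + qme_term sc l \<kappa> 3"
    by (simp add: add.assoc)
  then show ?thesis
    unfolding qme_term_def rep coeff ls minus module.scale_one[OF module_sc] .
qed

lemma qme_term_eq_0:
  assumes "4 \<le> n"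
  shows "qme_term sc l \<kappa> n = 0"
proof -
  have "homogeneous L (replicate n 1) (replicate n \<kappa>)"
    using \<kappa> by (simp add: homogeneous_def list_all2_conv_all_nth)
  then show ?thesis
    using F_many_items_eq_0[OF assms] module.scale_zero_right[OF module_sc]
    by (simp add: qme_term_def l_homogeneous zip_replicate)
qed

lemma qme_support_subset: "qme_support sc l \<kappa> \<subseteq> {1, 2, 3}"
proof
  fix n assume "n \<in> qme_support sc l \<kappa>"
  then have "1 \<le> n" "\<not> 4 \<le> n" using qme_term_eq_0 by (auto simp: qme_support_def)
  then show "n \<in> {1, 2, 3}" by auto
qed

text \<open>The Taylor series at the given structure, whose constant term vanishes, adds up to the
  structure equations of \<open>base_structure g + \<kappa>\<close>: minus the associators of the
  two products and the defect of multiplicativity.\<close>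

lemma QME_iff: "quantum_master_equation sc l \<kappa> \<longleftrightarrow> is_structure (base_structure g + \<kappa>)"
proof -
  obtain xU xV xg where \<kappa>_eq: "\<kappa> = (xU, xV, xg)" by (cases \<kappa>)
  have \<kappa>_comps: "fst \<kappa> = xU" "fst (snd \<kappa>) = xV" "snd (snd \<kappa>) = xg" by (simp_all add: \<kappa>_eq)
  note len = \<kappa>_length[unfolded \<kappa>_comps]
  note madds = \<kappa>_madd[unfolded \<kappa>_comps]
  note P = madd_X[of "[]", simplified]
  have p: "length v \<noteq> 2 \<Longrightarrow> product_cochain v = 0" for v :: "'a::ring list"
    by (simp add: product_cochain_def)
  have add: "y (u @ (a + b) # v) = y (u @ a # v) + y (u @ b # v)" if "madd y"
    for y :: "'a::ab_group_add list \<Rightarrow> 'b::ab_group_add" and u a b v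
    by (rule additive.add[OF madd_additive[OF that]])
  have add2: "y [a + b] = y [a] + y [b]" "y [a + b, c] = y [a, c] + y [b, c]" "y [c, a + b] = y [c, a] + y [c, b]"
    if "madd y" for y :: "'a::ab_group_add list \<Rightarrow> 'b::ab_group_add" and a b c
    using add[OF that, of "[]"] add[OF that, of "[c]"] by simp_all
  let ?S = "F [k] + sc (1 / 2) (F [k, k]) + sc (1 / 6) (F [k, k, k])"
  let ?mU = "product_cochain + xU" and ?mV = "product_cochain + xV" and ?f = "unary g + xg"
  note F = F_1_2_3[unfolded \<kappa>_comps]
  have halfU: "sU (1 / 2) (- (x + x)) = - x" for x
    unfolding U.scale_minus_right U.scale_right_distrib using U.scale_left_distrib[of "1 / 2" "1 / 2" x] by simp
  have halfV: "sV (1 / 2) (x + x) = x" for x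
    unfolding V.scale_right_distrib using V.scale_left_distrib[of "1 / 2" "1 / 2" x] by simp
  have thirdV: "sV (1 / 6) (x + x + x) = sV (1 / 2) x" for x
    unfolding V.scale_right_distrib
    using V.scale_left_distrib[of "1 / 6" "1 / 6" x] V.scale_left_distrib[of "1 / 3" "1 / 6" x] by simp
  \<comment> \<open>The coefficients 1/2 and 1/6 meet the multiplicities 2 and 6; \<open>d\<close>
    is the cubic term.\<close>
  have comb: "sV (1 / 2) (a + a - (b + b + (c + c))) + sV (1 / 6) (- ((d + d) + (d + d) + (d + d))) = a - b - c - d"
    for a b c d
  proof -
    have "a + a - (b + b + (c + c)) = (a - b - c) + (a - b - c)" by (simp add: algebra_simps)
    then show ?thesis by (simp only: V.scale_minus_right thirdV halfV) simp
  qed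
  have "fst ?S w = (if length w = 3 then
      ?mU [w ! 0, ?mU [w ! 1, w ! 2]] - ?mU [?mU [w ! 0, w ! 1], w ! 2] else 0)" for w
    unfolding fst_add sc_simps plus_fun_def F halfU
    by (simp add: hat_2_2 p len madds P add2 sg_one algebra_simps)
  moreover have "fst (snd ?S) w = (if length w = 3 then
      ?mV [w ! 0, ?mV [w ! 1, w ! 2]] - ?mV [?mV [w ! 0, w ! 1], w ! 2] else 0)" for w
    unfolding fst_add snd_add sc_simps plus_fun_def F V.scale_minus_right halfV
    by (simp add: hat_2_2 p len madds P add2 sg_one algebra_simps)
  moreover have "snd (snd ?S) w = (if length w = 2 then
      ?f [?mU [w ! 0, w ! 1]] - ?mV [?f [w ! 0], ?f [w ! 1]] else 0)" for w
  proof -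
    have hat: "hat 1 product_cochain xg w = (if length w = 2 then xg [w ! 0 * w ! 1] else 0)"
      by (simp add: hat_2_1 p len madds)
    note E2 = E_2_k[unfolded \<kappa>_comps]
    have "snd (snd ?S) w = hat 1 product_cochain xg w + g (xU w)
      - (E 2 XG product_cochain [k] w + E 2 XG xV [] w)
      + (sV (1 / 2) (xg [xU w] + xg [xU w] - (E 2 XG product_cochain [k, k] w
          + (E 2 XG xV [k] w + E 2 XG xV [k] w)))
        + sV (1 / 6) (- (E 2 XG xV [k, k] w
          + E 2 XG xV [k, k] w + E 2 XG xV [k, k] w)))"
      unfolding snd_add sc_simps plus_fun_def F add.assoc ..
    also have "\<dots> = (if length w = 2 then
      ?f [?mU [w ! 0, w ! 1]] - ?mV [?f [w ! 0], ?f [w ! 1]] else 0)"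
    proof (cases "length w = 2")
      case True
      then have w: "w = [w ! 0, w ! 1]" by (auto simp: length_Suc_conv numeral_2_eq_2)
      have xU: "xU w = xU [w ! 0, w ! 1]" by (rule arg_cong[OF w])
      show ?thesis
        unfolding E2[OF P(2)] E2[OF madds(2)] hat if_P[OF True] comb xU
        by (simp add: add2 P madds g_add g_mult algebra_simps)
    next
      case False
      then show ?thesis
        unfolding E2[OF P(2)] E2[OF madds(2)] hat if_not_P[OF False] len(1)[OF False]
        by (simp add: madd_0_hd[OF madds(3)])
    qed
    finally show ?thesis .
  qed
  ultimately have fst_S: "\<And>w. fst ?S w = (if length w = 3 then
      ?mU [w ! 0, ?mU [w ! 1, w ! 2]] - ?mU [?mU [w ! 0, w ! 1], w ! 2] else 0)"
    and snd_S: "\<And>w. fst (snd ?S) w = (if length w = 3 then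
      ?mV [w ! 0, ?mV [w ! 1, w ! 2]] - ?mV [?mV [w ! 0, w ! 1], w ! 2] else 0)"
    and trd_S: "\<And>w. snd (snd ?S) w = (if length w = 2 then
      ?f [?mU [w ! 0, w ! 1]] - ?mV [?f [w ! 0], ?f [w ! 1]] else 0)" by blast+
  have S: "?S = 0 \<longleftrightarrow> is_structure (?mU, ?mV, ?f)"
  proof
    assume S: "?S = 0"
    then have "fst ?S w = 0" "fst (snd ?S) w' = 0" "snd (snd ?S) w = 0" for w w'
      by simp_all
    note * = this(1)[unfolded fst_S] this(2)[unfolded snd_S] this(3)[unfolded trd_S]
    have "?mU [?mU [a, b], c] = ?mU [a, ?mU [b, c]]" for a b c using *(1)[of "[a, b, c]"] by simp
    moreover have "?mV [?mV [a, b], c] = ?mV [a, ?mV [b, c]]" for a b c using *(2)[of "[a, b, c]"] by simp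
    moreover have "?f [?mU [a, b]] = ?mV [?f [a], ?f [b]]" for a b using *(3)[of "[a, b]"] by simp
    ultimately show "is_structure (?mU, ?mV, ?f)" unfolding is_structure_def by blast
  next
    assume "is_structure (?mU, ?mV, ?f)"
    then show "?S = 0"
      unfolding is_structure_def prod.case
      by (intro gs_eqI) (simp_all only: fst_S snd_S trd_S fst_zero snd_zero zero_fun_def, simp_all)
  qed
  have "(\<Sum>n\<in>qme_support sc l \<kappa>. qme_term sc l \<kappa> n) = ?S"
    unfolding qme_term_sum[symmetric]
    by (rule sum.mono_neutral_left) (use qme_support_subset in \<open>auto simp: qme_support_def\<close>)
  moreover have "finite (qme_support sc l \<kappa>)"
    by (rule finite_subset[OF qme_support_subset]) simp
  moreover have "base_structure g + \<kappa> = (?mU, ?mV, ?f)"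
    by (simp add: \<kappa>_eq base_structure_def unary_def[abs_def])
  ultimately show ?thesis
    using S by (simp add: quantum_master_equation_def)
qed

end

end

section \<open>Tensors and multilinear forms\<close>

lemma module_tscale: "module (\<lambda>c \<tau> \<phi>. c * \<tau> \<phi> :: 'k::field)"
  by unfold_locales (simp_all add: fun_eq_iff algebra_simps)

lemma vector_space_tscale: "vector_space (\<lambda>c \<tau> \<phi>. c * \<tau> \<phi> :: 'k::field)"
  using module_tscale by (simp add: module_iff_vector_space)

lemma vector_space_mult: "vector_space ((*) :: 'k::field \<Rightarrow> 'k \<Rightarrow> 'k)"
  by unfold_locales (simp_all add: algebra_simps)

text \<open>The map \<open>\<iota>\<close> marks an element by its color, so linearity in all slots
  of one color is stated without reference to a particular word of colors.\<close>

definition slot_linear ::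
  "('a \<Rightarrow> 'c) \<Rightarrow> ('k \<Rightarrow> 'a::plus \<Rightarrow> 'a) \<Rightarrow> ('k \<Rightarrow> 'm::plus \<Rightarrow> 'm) \<Rightarrow> ('c list \<Rightarrow> 'm) \<Rightarrow> bool" where
  "slot_linear \<iota> s s' f \<longleftrightarrow> (\<forall>u v a b c. f (u @ \<iota> (a + b) # v) = f (u @ \<iota> a # v) + f (u @ \<iota> b # v) \<and>
     f (u @ \<iota> (s c a) # v) = s' c (f (u @ \<iota> a # v)))"

lemma slot_linearD:
  assumes "slot_linear \<iota> s s' f"
  shows "f (u @ \<iota> (a + b) # v) = f (u @ \<iota> a # v) + f (u @ \<iota> b # v)"
    "f (u @ \<iota> (s c a) # v) = s' c (f (u @ \<iota> a # v))"
  using assms by (simp_all add: slot_linear_def)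

lemma slot_linear_append:
  assumes "slot_linear \<iota> s s' f"
  shows "slot_linear \<iota> s s' (\<lambda>v. f (w @ v))" "slot_linear \<iota> s s' (\<lambda>v. f (v @ w))"
proof -
  note * = slot_linearD[OF assms]
  show "slot_linear \<iota> s s' (\<lambda>v. f (w @ v))"
    unfolding slot_linear_def append_assoc[symmetric] * by simp
  show "slot_linear \<iota> s s' (\<lambda>v. f (v @ w))"
    unfolding slot_linear_def append_assoc append_Cons * by simp
qed

lemma colors_eq_append:
  "colors w = cs @ ds \<longleftrightarrow> colors (take (length cs) w) = cs \<and> colors (drop (length cs) w) = ds"
  by (metis append_eq_conv_conj append_take_drop_id drop_map map_append take_map)

locale two_spaces = U: vector_space sU + V: vector_space sV
  for sU :: "'k::field \<Rightarrow> 'u::ab_group_add \<Rightarrow> 'u" and sV :: "'k \<Rightarrow> 'v::ab_group_add \<Rightarrow> 'v"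
begin

abbreviation "Fm \<equiv> forms sU sV"
abbreviation "Tn \<equiv> tensors sU sV"
abbreviation "pr \<equiv> pure sU sV"
abbreviation "En \<equiv> End_T sU sV"

lemma col_multilin_iff:
  assumes "vector_space s'"
  shows "f \<in> col_multilin sU sV s' cs \<longleftrightarrow>
    (\<forall>w. colors w \<noteq> cs \<longrightarrow> f w = 0) \<and> slot_linear Inl sU s' f \<and> slot_linear Inr sV s' f"
proof -
  interpret S: vector_space s' by fact
  have 1: "Vector_Spaces.linear sU s' h \<longleftrightarrow> (\<forall>x y. h (x + y) = h x + h y) \<and> (\<forall>c x. h (sU c x) = s' c (h x))"
    "Vector_Spaces.linear sV s' h' \<longleftrightarrow> (\<forall>x y. h' (x + y) = h' x + h' y) \<and> (\<forall>c x. h' (sV c x) = s' c (h' x))" for h h'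
    by (rule linear_iff_add_scale; unfold_locales)+
  have "f (u @ Inl (a + b) # v) = f (u @ Inl a # v) + f (u @ Inl b # v) \<and>
     f (u @ Inl (sU c a) # v) = s' c (f (u @ Inl a # v))"
    if "f \<in> col_multilin sU sV s' cs" for u v a b c
    using that unfolding col_multilin_def 1 by (cases "colors u @ Black # colors v = cs") auto
  moreover have "f (u @ Inr (a + b) # v) = f (u @ Inr a # v) + f (u @ Inr b # v) \<and>
     f (u @ Inr (sV c a) # v) = s' c (f (u @ Inr a # v))"
    if "f \<in> col_multilin sU sV s' cs" for u v a b c
    using that unfolding col_multilin_def 1 by (cases "colors u @ White # colors v = cs") auto
  ultimately have "slot_linear Inl sU s' f \<and> slot_linear Inr sV s' f" if "f \<in> col_multilin sU sV s' cs"
    using that unfolding slot_linear_def by blast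
  moreover have "f \<in> col_multilin sU sV s' cs"
    if "\<forall>w. colors w \<noteq> cs \<longrightarrow> f w = 0" "slot_linear Inl sU s' f" "slot_linear Inr sV s' f"
    using that(1) slot_linearD[OF that(2)] slot_linearD[OF that(3)] unfolding col_multilin_def 1 by simp
  ultimately show ?thesis by (auto simp: col_multilin_def)
qed

lemma forms_iff: "\<phi> \<in> Fm cs \<longleftrightarrow>
    (\<forall>w. colors w \<noteq> cs \<longrightarrow> \<phi> w = 0) \<and> slot_linear Inl sU (*) \<phi> \<and> slot_linear Inr sV (*) \<phi>"
  unfolding forms_def by (rule col_multilin_iff[OF vector_space_mult])

lemma formsD: "\<phi> \<in> Fm cs \<Longrightarrow> colors w \<noteq> cs \<Longrightarrow> \<phi> w = 0"
  by (simp add: forms_iff)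

lemma forms_eqI:
  assumes "\<phi> \<in> Fm cs" "\<psi> \<in> Fm cs" "\<And>w. colors w = cs \<Longrightarrow> \<phi> w = \<psi> w"
  shows "\<phi> = \<psi>"
  by (rule ext) (metis assms formsD)

lemma forms_0: "(\<lambda>w. 0) \<in> Fm cs"
  by (simp add: forms_iff slot_linear_def)

lemma forms_add: "\<phi> \<in> Fm cs \<Longrightarrow> \<psi> \<in> Fm cs \<Longrightarrow> (\<lambda>w. \<phi> w + \<psi> w) \<in> Fm cs"
  by (simp add: forms_iff slot_linear_def algebra_simps)

lemma forms_scale: "\<phi> \<in> Fm cs \<Longrightarrow> (\<lambda>w. c * \<phi> w) \<in> Fm cs"
  by (simp add: forms_iff slot_linear_def algebra_simps)

lemma tensors_induct [consumes 1, case_names zero pure add scale]: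
  assumes "\<tau> \<in> Tn cs" "P (\<lambda>\<phi>. 0)" "\<And>w. colors w = cs \<Longrightarrow> P (pr cs w)"
    "\<And>\<tau> \<tau>'. \<tau> \<in> Tn cs \<Longrightarrow> \<tau>' \<in> Tn cs \<Longrightarrow> P \<tau> \<Longrightarrow> P \<tau>' \<Longrightarrow> P (\<lambda>\<phi>. \<tau> \<phi> + \<tau>' \<phi>)"
    "\<And>c \<tau>. \<tau> \<in> Tn cs \<Longrightarrow> P \<tau> \<Longrightarrow> P (\<lambda>\<phi>. c * \<tau> \<phi>)"
  shows "P \<tau>"
proof -
  let ?S = "{\<tau> \<in> Tn cs. P \<tau>}"
  note span = module.span_zero[OF module_tscale] module.span_add[OF module_tscale] module.span_scale[OF module_tscale]
  have "module.subspace (\<lambda>c \<tau> \<phi>. c * \<tau> \<phi>) ?S"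
    by (rule module.subspaceI[OF module_tscale])
      (use assms(2,4,5) span in \<open>auto simp: tensors_def zero_fun_def plus_fun_def\<close>)
  moreover have "pr cs ` {w. colors w = cs} \<subseteq> ?S"
    using assms(3) by (auto simp: tensors_def intro!: module.span_base[OF module_tscale])
  ultimately show ?thesis
    using assms(1) module.span_minimal[OF module_tscale] unfolding tensors_def by blast
qed

lemma tensors_0: "(\<lambda>\<phi>. 0) \<in> Tn cs"
  using module.span_zero[OF module_tscale] by (simp add: tensors_def zero_fun_def)

lemma tensors_add: "\<tau> \<in> Tn cs \<Longrightarrow> \<tau>' \<in> Tn cs \<Longrightarrow> (\<lambda>\<phi>. \<tau> \<phi> + \<tau>' \<phi>) \<in> Tn cs"
  using module.span_add[OF module_tscale] by (simp add: tensors_def plus_fun_def)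

lemma tensors_scale: "\<tau> \<in> Tn cs \<Longrightarrow> (\<lambda>\<phi>. c * \<tau> \<phi>) \<in> Tn cs"
  using module.span_scale[OF module_tscale] by (simp add: tensors_def)

lemma pure_tensors: "pr cs w \<in> Tn cs"
proof (cases "colors w = cs")
  case True
  then show ?thesis by (auto simp: tensors_def intro!: module.span_base[OF module_tscale])
next
  case False
  then have "pr cs w = (\<lambda>\<phi>. 0)" by (auto simp: pure_def formsD)
  then show ?thesis by (simp add: tensors_0)
qed

lemma tensor_outside_forms: "\<tau> \<in> Tn cs \<Longrightarrow> \<phi> \<notin> Fm cs \<Longrightarrow> \<tau> \<phi> = 0"
  by (induction rule: tensors_induct) (simp_all add: pure_def)

lemma tensor_form_add:
  "\<tau> \<in> Tn cs \<Longrightarrow> \<phi> \<in> Fm cs \<Longrightarrow> \<psi> \<in> Fm cs \<Longrightarrow> \<tau> (\<lambda>w. \<phi> w + \<psi> w) = \<tau> \<phi> + \<tau> \<psi>"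
  by (induction rule: tensors_induct) (simp_all add: pure_def forms_add algebra_simps)

lemma tensor_form_scale:
  "\<tau> \<in> Tn cs \<Longrightarrow> \<phi> \<in> Fm cs \<Longrightarrow> \<tau> (\<lambda>w. c * \<phi> w) = c * \<tau> \<phi>"
  by (induction rule: tensors_induct) (simp_all add: pure_def forms_scale algebra_simps)

lemma tensor_form_0: "\<tau> \<in> Tn cs \<Longrightarrow> \<tau> (\<lambda>w. 0) = 0"
  using tensor_form_scale[OF _ forms_0, of \<tau> cs 0] by simp

lemma slot_linear_tensor:
  assumes "\<tau> \<in> Tn cs" "\<And>v. (\<lambda>w. \<psi> w v) \<in> Fm cs" "\<And>w. slot_linear \<iota> s (*) (\<psi> w)"
  shows "slot_linear \<iota> s (*) (\<lambda>v. \<tau> (\<lambda>w. \<psi> w v))"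
  unfolding slot_linear_def slot_linearD[OF assms(3)]
  by (simp add: tensor_form_add[OF assms(1)] tensor_form_scale[OF assms(1)] assms(2))

lemma forms_tensor:
  assumes "\<tau> \<in> Tn cs" "\<And>v. (\<lambda>w. \<psi> w v) \<in> Fm cs" "\<And>w. \<psi> w \<in> Fm ds"
  shows "(\<lambda>v. \<tau> (\<lambda>w. \<psi> w v)) \<in> Fm ds"
proof -
  have "\<tau> (\<lambda>w. \<psi> w v) = 0" if "colors v \<noteq> ds" for v
    using formsD[OF assms(3) that] by (simp add: tensor_form_0[OF assms(1)])
  moreover have "slot_linear Inl sU (*) (\<psi> w)" "slot_linear Inr sV (*) (\<psi> w)" for w
    using assms(3)[of w] by (simp_all add: forms_iff)
  ultimately show ?thesis
    unfolding forms_iff by (blast intro: slot_linear_tensor[where \<psi> = \<psi>, OF assms(1,2)])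
qed

text \<open>Tensors are finite combinations of evaluations, and evaluations commute. The inner
  functions must be forms at every step, which \<open>forms_tensor\<close> guarantees.\<close>

lemma tensor_Fubini:
  assumes "\<tau>' \<in> Tn ds" "\<tau> \<in> Tn cs" "\<And>v. (\<lambda>w. \<psi> w v) \<in> Fm cs" "\<And>w. \<psi> w \<in> Fm ds"
  shows "\<tau> (\<lambda>w. \<tau>' (\<psi> w)) = \<tau>' (\<lambda>v. \<tau> (\<lambda>w. \<psi> w v))"
  using assms(1)
proof (induction rule: tensors_induct)
  case zero
  then show ?case by (simp add: tensor_form_0[OF assms(2)])
next
  case (pure w)
  then show ?case using forms_tensor[OF assms(2-4)] assms(4) by (simp add: pure_def)
next
  case (add \<sigma> \<sigma>')
  then show ?case
    using forms_tensor[OF add(1) assms(4,3)] forms_tensor[OF add(2) assms(4,3)]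
    by (simp add: tensor_form_add[OF assms(2)])
next
  case (scale c \<sigma>)
  then show ?case
    using forms_tensor[OF scale(1) assms(4,3)] by (simp add: tensor_form_scale[OF assms(2)])
qed

lemma forms_append_left:
  assumes "\<phi> \<in> Fm (cs @ ds)" "colors w = cs"
  shows "(\<lambda>v. \<phi> (w @ v)) \<in> Fm ds"
proof -
  have "\<phi> (w @ v) = 0" if "colors v \<noteq> ds" for v
    by (rule formsD[OF assms(1)]) (use that assms(2) in auto)
  then show ?thesis using assms(1) by (simp add: forms_iff slot_linear_append)
qed

lemma forms_append_right:
  assumes "\<phi> \<in> Fm (cs @ ds)" "colors v = ds"
  shows "(\<lambda>w. \<phi> (w @ v)) \<in> Fm cs"
proof -
  have "\<phi> (w @ v) = 0" if "colors w \<noteq> cs" for w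
    by (rule formsD[OF assms(1)]) (use that assms(2) in auto)
  then show ?thesis using assms(1) by (simp add: forms_iff slot_linear_append)
qed

text \<open>
  A form of type \<open>cs @ ds\<close> may be nonzero at \<open>w @ v\<close> although \<open>w\<close> does not have type \<open>cs\<close>; but then
  \<open>\<lambda>v. \<phi> (w @ v)\<close> is not a form of type \<open>ds\<close> and a tensor of type \<open>ds\<close> annihilates it.
\<close>

lemma tensor_append_eq_0:
  assumes "\<phi> \<in> Fm (cs @ ds)"
  shows "\<tau>' \<in> Tn ds \<Longrightarrow> colors w \<noteq> cs \<Longrightarrow> \<tau>' (\<lambda>v. \<phi> (w @ v)) = 0"
    and "\<tau> \<in> Tn cs \<Longrightarrow> colors v \<noteq> ds \<Longrightarrow> \<tau> (\<lambda>w. \<phi> (w @ v)) = 0"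
proof -
  show "\<tau>' (\<lambda>v. \<phi> (w @ v)) = 0" if "\<tau>' \<in> Tn ds" "colors w \<noteq> cs"
  proof (cases "(\<lambda>v. \<phi> (w @ v)) \<in> Fm ds")
    case True
    have "(\<lambda>v. \<phi> (w @ v)) = (\<lambda>v. 0)"
      by (rule forms_eqI[OF True forms_0]) (use assms that(2) in \<open>auto intro: formsD\<close>)
    then show ?thesis by (simp add: tensor_form_0[OF that(1)])
  qed (rule tensor_outside_forms[OF that(1)])
  show "\<tau> (\<lambda>w. \<phi> (w @ v)) = 0" if "\<tau> \<in> Tn cs" "colors v \<noteq> ds"
  proof (cases "(\<lambda>w. \<phi> (w @ v)) \<in> Fm cs")
    case True
    have "(\<lambda>w. \<phi> (w @ v)) = (\<lambda>w. 0)"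
      by (rule forms_eqI[OF True forms_0]) (use assms that(2) in \<open>auto intro: formsD\<close>)
    then show ?thesis by (simp add: tensor_form_0[OF that(1)])
  qed (rule tensor_outside_forms[OF that(1)])
qed

lemma forms_tensor_append:
  assumes "\<phi> \<in> Fm (cs @ ds)"
  shows "\<tau>' \<in> Tn ds \<Longrightarrow> (\<lambda>w. \<tau>' (\<lambda>v. \<phi> (w @ v))) \<in> Fm cs"
    and "\<tau> \<in> Tn cs \<Longrightarrow> (\<lambda>v. \<tau> (\<lambda>w. \<phi> (w @ v))) \<in> Fm ds"
proof -
  \<comment> \<open>The truncation of \<open>\<phi>\<close> to words whose two parts have the right
    colors is a form in each variable for every value of the other, as \<open>forms_tensor\<close>
    demands, and tensors do not distinguish it from \<open>\<phi>\<close>.\<close>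
  let ?\<psi> = "\<lambda>w v. if colors w = cs \<and> colors v = ds then \<phi> (w @ v) else 0"
  have L: "(\<lambda>v. ?\<psi> w v) \<in> Fm ds" for w
  proof (cases "colors w = cs")
    case True
    then have "(\<lambda>v. ?\<psi> w v) = (\<lambda>v. \<phi> (w @ v))"
      by (intro ext) (use formsD[OF assms] True in auto)
    then show ?thesis using forms_append_left[OF assms True] by simp
  qed (simp add: forms_0)
  have R: "(\<lambda>w. ?\<psi> w v) \<in> Fm cs" for v
  proof (cases "colors v = ds")
    case True
    then have "(\<lambda>w. ?\<psi> w v) = (\<lambda>w. \<phi> (w @ v))"
      by (intro ext) (use formsD[OF assms] True in auto)
    then show ?thesis using forms_append_right[OF assms True] by simp
  qed (simp add: forms_0)
  show "(\<lambda>w. \<tau>' (\<lambda>v. \<phi> (w @ v))) \<in> Fm cs" if \<tau>': "\<tau>' \<in> Tn ds"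
  proof -
    have "\<tau>' (\<lambda>v. \<phi> (w @ v)) = \<tau>' (?\<psi> w)" for w
    proof (cases "colors w = cs")
      case True
      have "(\<lambda>v. \<phi> (w @ v)) = ?\<psi> w"
        by (rule forms_eqI[OF forms_append_left[OF assms True] L]) (use True in simp)
      then show ?thesis by simp
    qed (simp add: tensor_append_eq_0(1)[OF assms \<tau>'] tensor_form_0[OF \<tau>'])
    then show ?thesis using forms_tensor[OF \<tau>' L R] by simp
  qed
  show "(\<lambda>v. \<tau> (\<lambda>w. \<phi> (w @ v))) \<in> Fm ds" if \<tau>: "\<tau> \<in> Tn cs"
  proof -
    have "\<tau> (\<lambda>w. \<phi> (w @ v)) = \<tau> (\<lambda>w. ?\<psi> w v)" for v
    proof (cases "colors v = ds")
      case True
      have "(\<lambda>w. \<phi> (w @ v)) = (\<lambda>w. ?\<psi> w v)"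
        by (rule forms_eqI[OF forms_append_right[OF assms True] R]) (use True in simp)
      then show ?thesis by simp
    qed (simp add: tensor_append_eq_0(2)[OF assms \<tau>] tensor_form_0[OF \<tau>])
    then show ?thesis using forms_tensor[OF \<tau> R L] by simp
  qed
qed

lemma tensor_Fubini_append:
  assumes "\<phi> \<in> Fm (cs @ ds)" "\<tau> \<in> Tn cs" "\<tau>' \<in> Tn ds"
  shows "\<tau> (\<lambda>w. \<tau>' (\<lambda>v. \<phi> (w @ v))) = \<tau>' (\<lambda>v. \<tau> (\<lambda>w. \<phi> (w @ v)))"
  using assms(2)
proof (induction rule: tensors_induct)
  case zero
  then show ?case by (simp add: tensor_form_0[OF assms(3)])
next
  case (pure w)
  have "(\<lambda>v. pr cs w (\<lambda>w. \<phi> (w @ v))) = (\<lambda>v. \<phi> (w @ v))"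
    by (rule forms_eqI[OF forms_tensor_append(2)[OF assms(1) pure_tensors] forms_append_left[OF assms(1) pure]])
      (simp add: pure_def forms_append_right[OF assms(1)])
  then show ?case
    using forms_tensor_append(1)[OF assms(1,3)] by (simp add: pure_def)
next
  case (add \<sigma> \<sigma>')
  then show ?case
    using tensor_form_add[OF assms(3) forms_tensor_append(2)[OF assms(1) add(1)]
        forms_tensor_append(2)[OF assms(1) add(2)]] by simp
next
  case (scale c \<sigma>)
  then show ?case
    using tensor_form_scale[OF assms(3) forms_tensor_append(2)[OF assms(1) scale(1)]] by simp
qed

lemma tensor_mult_pure:
  assumes "colors w = cs" "colors v = ds"
  shows "tensor_mult sU sV cs ds (pr cs w) (pr ds v) = pr (cs @ ds) (w @ v)"
proof
  fix \<phi>
  show "tensor_mult sU sV cs ds (pr cs w) (pr ds v) \<phi> = pr (cs @ ds) (w @ v) \<phi>"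
    using forms_tensor_append(1)[of \<phi> cs ds "pr ds v"] forms_append_left[OF _ assms(1), of \<phi> ds] pure_tensors
    by (simp add: tensor_mult_def pure_def)
qed

lemma tensor_mult_tensors:
  assumes "\<tau> \<in> Tn cs" "\<tau>' \<in> Tn ds"
  shows "tensor_mult sU sV cs ds \<tau> \<tau>' \<in> Tn (cs @ ds)"
  using assms(1)
proof (induction rule: tensors_induct)
  case zero
  then show ?case by (simp add: tensor_mult_def tensors_0)
next
  case (pure w)
  show ?case
    using assms(2)
  proof (induction rule: tensors_induct)
    case zero
    then show ?case by (simp add: tensor_mult_def tensors_0 tensor_form_0[OF pure_tensors[of cs w]] cong: if_cong)
  next
    case (pure v)
    then show ?case using \<open>colors w = cs\<close> by (simp add: tensor_mult_pure pure_tensors)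
  next
    case (add \<sigma> \<sigma>')
    have "tensor_mult sU sV cs ds (pr cs w) (\<lambda>\<phi>. \<sigma> \<phi> + \<sigma>' \<phi>)
      = (\<lambda>\<phi>. tensor_mult sU sV cs ds (pr cs w) \<sigma> \<phi> + tensor_mult sU sV cs ds (pr cs w) \<sigma>' \<phi>)"
      using tensor_form_add[OF pure_tensors forms_tensor_append(1)[OF _ add(1)] forms_tensor_append(1)[OF _ add(2)]]
      by (simp add: tensor_mult_def fun_eq_iff)
    then show ?case using tensors_add[OF add(3,4)] by simp
  next
    case (scale c \<sigma>)
    have "tensor_mult sU sV cs ds (pr cs w) (\<lambda>\<phi>. c * \<sigma> \<phi>)
      = (\<lambda>\<phi>. c * tensor_mult sU sV cs ds (pr cs w) \<sigma> \<phi>)"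
      using tensor_form_scale[OF pure_tensors forms_tensor_append(1)[OF _ scale(1)]]
      by (simp add: tensor_mult_def fun_eq_iff)
    then show ?case using tensors_scale[OF scale(2)] by simp
  qed
next
  case (add \<sigma> \<sigma>')
  have "tensor_mult sU sV cs ds (\<lambda>\<phi>. \<sigma> \<phi> + \<sigma>' \<phi>) \<tau>'
    = (\<lambda>\<phi>. tensor_mult sU sV cs ds \<sigma> \<tau>' \<phi> + tensor_mult sU sV cs ds \<sigma>' \<tau>' \<phi>)"
    by (simp add: tensor_mult_def fun_eq_iff)
  then show ?case using tensors_add[OF add(3,4)] by simp
next
  case (scale c \<sigma>)
  have "tensor_mult sU sV cs ds (\<lambda>\<phi>. c * \<sigma> \<phi>) \<tau>' = (\<lambda>\<phi>. c * tensor_mult sU sV cs ds \<sigma> \<tau>' \<phi>)"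
    by (simp add: tensor_mult_def fun_eq_iff)
  then show ?case using tensors_scale[OF scale(2)] by simp
qed

end

text \<open>A change of one letter does not move the cut, so the varied slot stays in one of the two
  parts.\<close>

lemma slot_linear_take_drop:
  assumes "\<And>y. slot_linear \<iota> s s' (\<lambda>x. T x y)" "\<And>x. slot_linear \<iota> s s' (\<lambda>y. T x y)"
  shows "slot_linear \<iota> s s' (\<lambda>w. T (take n w) (drop n w))"
  unfolding slot_linear_def
proof (intro allI)
  fix u v a b c
  let ?S = "\<lambda>w. T (take n w) (drop n w)"
  show "?S (u @ \<iota> (a + b) # v) = ?S (u @ \<iota> a # v) + ?S (u @ \<iota> b # v)
    \<and> ?S (u @ \<iota> (s c a) # v) = s' c (?S (u @ \<iota> a # v))"
  proof (cases "length u < n")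
    case True
    then obtain m where m: "n - length u = Suc m" by (metis Suc_diff_Suc)
    have 1: "take n u = u" "drop n u = []" using True by simp_all
    show ?thesis unfolding take_append drop_append m 1
      using slot_linearD(1)[OF assms(1), of u a b "take m v" "drop m v"]
        slot_linearD(2)[OF assms(1), of u c a "take m v" "drop m v"] by simp
  next
    case False
    then have m: "n - length u = 0" by simp
    show ?thesis unfolding take_append drop_append m
      using slot_linearD(1)[OF assms(2), of "take n u" "drop n u" a b v]
        slot_linearD(2)[OF assms(2), of "take n u" "drop n u" c a v] by simp
  qed
qed

lemma slot_linear_rotate:
  assumes "slot_linear \<iota> s s' \<phi>"
  shows "slot_linear \<iota> s s' (\<lambda>w. \<phi> (drop n w @ take n w))"
  by (rule slot_linear_take_drop[where T = "\<lambda>x y. \<phi> (y @ x)"]) (rule slot_linear_append[OF assms])+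

section \<open>Morphisms of the endomorphism PROP\<close>

context two_spaces
begin

lemma End_0_iff: "f \<in> En cs ds 0 \<longleftrightarrow> (\<forall>w. colors w \<noteq> cs \<longrightarrow> f w = (\<lambda>\<phi>. 0)) \<and>
    slot_linear Inl sU (\<lambda>c \<tau> \<phi>. c * \<tau> \<phi>) f \<and> slot_linear Inr sV (\<lambda>c \<tau> \<phi>. c * \<tau> \<phi>) f \<and> (\<forall>w. f w \<in> Tn ds)"
  unfolding End_T_def using col_multilin_iff[OF vector_space_tscale, of f cs] by (simp add: zero_fun_def)

lemma End_0D:
  assumes "f \<in> En cs ds 0"
  shows "colors w \<noteq> cs \<Longrightarrow> f w = (\<lambda>\<phi>. 0)" "f w \<in> Tn ds"
    "slot_linear Inl sU (\<lambda>c \<tau> \<phi>. c * \<tau> \<phi>) f" "slot_linear Inr sV (\<lambda>c \<tau> \<phi>. c * \<tau> \<phi>) f"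
  using assms unfolding End_0_iff by blast+

text \<open>In nonzero degree only the zero morphism exists, and it also lies in degree 0; thus
  facts about degree 0 apply to all degrees.\<close>

lemma End_subset_0: "f \<in> En cs ds p \<Longrightarrow> f \<in> En cs ds 0"
  by (cases "p = 0") (auto simp: End_0_iff End_T_def[of _ _ _ _ p] zero_fun_def slot_linear_def tensors_0)

lemma End_nonzero: "f \<in> En cs ds p \<Longrightarrow> p \<noteq> 0 \<Longrightarrow> f = (\<lambda>w \<phi>. 0)"
  by (simp add: End_T_def zero_fun_def)

lemma End_zero: "(\<lambda>w \<phi>. 0) \<in> En cs ds p"
  by (cases "p = 0") (auto simp: End_0_iff slot_linear_def tensors_0, simp add: End_T_def zero_fun_def)

text \<open>On words of other colors, and on functions that are not forms, both morphisms
  vanish.\<close>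

lemma End_eqI:
  assumes "f \<in> En cs ds 0" "f' \<in> En cs ds 0"
    and "\<And>w \<phi>. colors w = cs \<Longrightarrow> \<phi> \<in> Fm ds \<Longrightarrow> f w \<phi> = f' w \<phi>"
  shows "f = f'"
proof (intro ext)
  fix w \<phi>
  show "f w \<phi> = f' w \<phi>"
  proof (cases "colors w = cs \<and> \<phi> \<in> Fm ds")
    case False
    then show ?thesis
      using End_0D(1)[OF assms(1), of w] End_0D(1)[OF assms(2), of w]
        tensor_outside_forms[OF End_0D(2)[OF assms(1)], of \<phi> w] tensor_outside_forms[OF End_0D(2)[OF assms(2)], of \<phi> w]
      by (cases "colors w = cs") auto
  qed (use assms(3) in blast)
qed

text \<open>Evaluation at a fixed \<open>\<phi>\<close> makes a morphism into a form on its source,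
  so a tensor can be applied to it. This is what gives \<open>end_comp\<close> its meaning as a
  linear extension.\<close>

lemma End_form: "f \<in> En cs ds p \<Longrightarrow> (\<lambda>w. f w \<phi>) \<in> Fm cs"
  using End_subset_0[of f cs ds p] by (auto simp: End_0_iff forms_iff slot_linear_def plus_fun_def)

lemma End_I:
  assumes "\<And>\<phi>. (\<lambda>w. f w \<phi>) \<in> Fm cs" "\<And>w. colors w = cs \<Longrightarrow> f w \<in> Tn ds"
  shows "f \<in> En cs ds 0"
proof -
  have 0: "f w = (\<lambda>\<phi>. 0)" if "colors w \<noteq> cs" for w
    using formsD[OF assms(1) that] by auto
  then have "f w \<in> Tn ds" for w
    using assms(2) tensors_0 by (cases "colors w = cs") auto
  moreover have "slot_linear Inl sU (\<lambda>c \<tau> \<phi>. c * \<tau> \<phi>) f" "slot_linear Inr sV (\<lambda>c \<tau> \<phi>. c * \<tau> \<phi>) f"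
    using assms(1) by (auto simp: forms_iff slot_linear_def fun_eq_iff)
  ultimately show ?thesis using 0 by (simp add: End_0_iff)
qed

lemma End_add: "f \<in> En cs ds p \<Longrightarrow> f' \<in> En cs ds p \<Longrightarrow> (\<lambda>w \<phi>. f w \<phi> + f' w \<phi>) \<in> En cs ds p"
proof (cases "p = 0")
  case True
  assume *: "f \<in> En cs ds p" "f' \<in> En cs ds p"
  have "(\<lambda>w \<phi>. f w \<phi> + f' w \<phi>) \<in> En cs ds 0"
    by (rule End_I, rule forms_add[OF End_form[OF *(1)] End_form[OF *(2)]],
        rule tensors_add[OF End_0D(2)[OF End_subset_0[OF *(1)]] End_0D(2)[OF End_subset_0[OF *(2)]]])
  then show ?thesis using True by simp
qed (auto simp: End_T_def fun_eq_iff)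

lemma End_scale: "f \<in> En cs ds p \<Longrightarrow> (\<lambda>w \<phi>. c * f w \<phi>) \<in> En cs ds p"
proof (cases "p = 0")
  case True
  assume *: "f \<in> En cs ds p"
  have "(\<lambda>w \<phi>. c * f w \<phi>) \<in> En cs ds 0"
    by (rule End_I, rule forms_scale[OF End_form[OF *]],
        rule tensors_scale[OF End_0D(2)[OF End_subset_0[OF *]]])
  then show ?thesis using True by simp
qed (auto simp: End_T_def fun_eq_iff)

lemma End_pure: "pr cs \<in> En cs cs 0"
proof (rule End_I)
  show "(\<lambda>w. pr cs w \<phi>) \<in> Fm cs" for \<phi>
    by (cases "\<phi> \<in> Fm cs") (simp_all add: pure_def forms_0)
qed (rule pure_tensors)

lemma comp_tensors:
  assumes "f \<in> En cs ds p" "\<tau> \<in> Tn cs"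
  shows "(\<lambda>\<phi>. \<tau> (\<lambda>v. f v \<phi>)) \<in> Tn ds"
  using assms(2)
proof (induction rule: tensors_induct)
  case (pure w)
  then show ?case
    using End_0D(2)[OF End_subset_0[OF assms(1)], of w] End_form[OF assms(1)] by (simp add: pure_def)
qed (simp_all add: tensors_0 tensors_add tensors_scale)

lemma comp_0_right [simp]: "end_comp f (\<lambda>w \<phi>. 0) = (\<lambda>w \<phi>. 0)"
  by (simp add: end_comp_def fun_eq_iff)

lemma comp_0_left:
  assumes "f \<in> En cs ds p"
  shows "end_comp (\<lambda>w \<phi>. 0) f = (\<lambda>w \<phi>. 0)"
  using tensor_form_0[OF End_0D(2)[OF End_subset_0[OF assms]]] by (simp add: end_comp_def fun_eq_iff)

lemma End_comp_0: "f \<in> En ds es 0 \<Longrightarrow> h \<in> En cs ds 0 \<Longrightarrow> end_comp f h \<in> En cs es 0"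
  by (rule End_I) (simp_all add: end_comp_def[abs_def] End_form comp_tensors End_0D(2))

lemma End_comp: "f \<in> En ds es p \<Longrightarrow> h \<in> En cs ds q \<Longrightarrow> end_comp f h \<in> En cs es (p + q)"
proof (cases "p = 0 \<and> q = 0")
  case False
  assume *: "f \<in> En ds es p" "h \<in> En cs ds q"
  with False have "f = (\<lambda>w \<phi>. 0) \<or> h = (\<lambda>w \<phi>. 0)" using End_nonzero by metis
  then show ?thesis using comp_0_left[OF *(2)] by (auto simp: End_zero)
qed (simp add: End_comp_0)

lemma comp_pure: "f \<in> En ds es p \<Longrightarrow> h w = pr ds v \<Longrightarrow> end_comp f h w = f v"
  using End_form[of f ds es p] by (simp add: end_comp_def pure_def)

lemma tens_0_left [simp]: "end_tens sU sV cs ds ds' (\<lambda>w \<phi>. 0) f = (\<lambda>w \<phi>. 0)"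
  by (simp add: end_tens_def tensor_mult_def fun_eq_iff)

lemma tens_0_right:
  assumes "f \<in> En cs ds p"
  shows "end_tens sU sV cs ds ds' f (\<lambda>w \<phi>. 0) = (\<lambda>w \<phi>. 0)"
  using tensor_form_0[OF End_0D(2)[OF End_subset_0[OF assms]]] by (simp add: end_tens_def tensor_mult_def fun_eq_iff)

lemma End_tens_0:
  assumes "f \<in> En cs ds 0" "f' \<in> En cs' ds' 0"
  shows "end_tens sU sV cs ds ds' f f' \<in> En (cs @ cs') (ds @ ds') 0"
proof (rule End_I)
  fix \<phi>
  let ?T = "\<lambda>x y. f x (\<lambda>w. f' y (\<lambda>v. \<phi> (w @ v)))"
  show "(\<lambda>w. end_tens sU sV cs ds ds' f f' w \<phi>) \<in> Fm (cs @ cs')"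
  proof (cases "\<phi> \<in> Fm (ds @ ds')")
    case True
    have 0: "?T (take (length cs) w) (drop (length cs) w) = 0" if "colors w \<noteq> cs @ cs'" for w
    proof (cases "colors (take (length cs) w) = cs")
      case True
      then have "f' (drop (length cs) w) = (\<lambda>\<phi>. 0)"
        using that by (intro End_0D(1)[OF assms(2)]) (simp add: colors_eq_append)
      then show ?thesis by (simp add: tensor_form_0[OF End_0D(2)[OF assms(1)]])
    qed (simp add: End_0D(1)[OF assms(1)])
    have L: "(\<lambda>x. ?T x y) \<in> Fm cs" for y by (rule End_form[OF assms(1)])
    have R: "(\<lambda>y. ?T x y) \<in> Fm cs'" for x
    proof -
      have "(\<lambda>y. f x (\<lambda>w. f' y (\<lambda>v. \<phi> (w @ v)))) \<in> Fm cs'"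
      proof (rule forms_tensor[OF End_0D(2)[OF assms(1)]])
        show "(\<lambda>w. f' y (\<lambda>v. \<phi> (w @ v))) \<in> Fm ds" for y
          by (rule forms_tensor_append(1)[OF True End_0D(2)[OF assms(2)]])
      qed (rule End_form[OF assms(2)])
      then show ?thesis .
    qed
    have "(\<lambda>w. ?T (take (length cs) w) (drop (length cs) w)) \<in> Fm (cs @ cs')"
      unfolding forms_iff
      by (intro conjI allI impI 0 slot_linear_take_drop[where T = ?T]) (use L R in \<open>simp_all add: forms_iff\<close>)
    then show ?thesis using True by (simp add: end_tens_def tensor_mult_def)
  qed (simp add: end_tens_def tensor_mult_def forms_0)
  show "end_tens sU sV cs ds ds' f f' w \<in> Tn (ds @ ds')" for w
    unfolding end_tens_def by (intro tensor_mult_tensors End_0D(2)[OF assms(1)] End_0D(2)[OF assms(2)])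
qed

lemma End_tens:
  "f \<in> En cs ds p \<Longrightarrow> f' \<in> En cs' ds' q \<Longrightarrow> end_tens sU sV cs ds ds' f f' \<in> En (cs @ cs') (ds @ ds') (p + q)"
proof (cases "p = 0 \<and> q = 0")
  case False
  assume *: "f \<in> En cs ds p" "f' \<in> En cs' ds' q"
  with False have "f = (\<lambda>w \<phi>. 0) \<or> f' = (\<lambda>w \<phi>. 0)" using End_nonzero by metis
  then show ?thesis using tens_0_right[OF *(1)] by (auto simp: End_zero)
qed (simp add: End_tens_0)

lemma tens_pure:
  assumes "f w = pr ds v" "f' w' = pr ds' v'" "length w = length cs" "colors v = ds" "colors v' = ds'"
  shows "end_tens sU sV cs ds ds' f f' (w @ w') = pr (ds @ ds') (v @ v')"
  using assms by (simp add: end_tens_def tensor_mult_pure)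

lemma tens_apply:
  assumes "\<phi> \<in> Fm (ds @ ds')" "length w = length cs"
  shows "end_tens sU sV cs ds ds' f f' (w @ w') \<phi> = f w (\<lambda>v. f' w' (\<lambda>v'. \<phi> (v @ v')))"
  using assms by (simp add: end_tens_def tensor_mult_def)

lemma swap_append:
  "length w = length cs \<Longrightarrow> end_swap sU sV cs ds (w @ w') = pr (ds @ cs) (w' @ w)"
  by (simp add: end_swap_def)

lemma End_swap: "end_swap sU sV cs ds \<in> En (cs @ ds) (ds @ cs) 0"
proof (rule End_I)
  fix \<phi>
  show "(\<lambda>w. end_swap sU sV cs ds w \<phi>) \<in> Fm (cs @ ds)"
  proof (cases "\<phi> \<in> Fm (ds @ cs)")
    case True
    let ?t = "take (length cs)" and ?d = "drop (length cs)"
    have 0: "\<phi> (?d w @ ?t w) = 0" if "colors w \<noteq> cs @ ds" for w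
    proof (rule formsD[OF True], rule notI)
      assume *: "colors (?d w @ ?t w) = ds @ cs"
      then have "length (colors (?d w @ ?t w)) = length (ds @ cs)" by (rule arg_cong)
      then have "length w = length ds + length cs" by simp
      then have "length (colors (?t w)) = length cs" by simp
      then have "colors (?d w) = ds \<and> colors (?t w) = cs" using * by simp
      then show False using that by (simp add: colors_eq_append)
    qed
    have "(\<lambda>w. \<phi> (?d w @ ?t w)) \<in> Fm (cs @ ds)"
      unfolding forms_iff by (intro conjI allI impI 0 slot_linear_rotate) (use True in \<open>simp_all add: forms_iff\<close>)
    then show ?thesis using True by (simp add: end_swap_def pure_def)
  qed (simp add: end_swap_def pure_def forms_0)
qed (simp add: end_swap_def pure_tensors)

end

section \<open>The PROP laws for multilinear maps\<close>

context two_spaces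
begin

lemma end_comp_add_left:
  assumes "f \<in> En ds es p" "f' \<in> En ds es p" "h \<in> En cs ds q"
  shows "end_comp (f + f') h = end_comp f h + end_comp f' h"
proof (intro ext)
  fix w :: "('u, 'v) word" and \<phi> :: "('u, 'v) word \<Rightarrow> 'k"
  have "h w (\<lambda>v. f v \<phi> + f' v \<phi>) = h w (\<lambda>v. f v \<phi>) + h w (\<lambda>v. f' v \<phi>)"
    by (rule tensor_form_add[OF End_0D(2)[OF End_subset_0[OF assms(3)]] End_form[OF assms(1)] End_form[OF assms(2)]])
  then show "end_comp (f + f') h w \<phi> = (end_comp f h + end_comp f' h) w \<phi>"
    by (simp add: end_comp_def)
qed

lemma end_comp_scale_left:
  assumes "f \<in> En ds es p" "h \<in> En cs ds q"
  shows "end_comp (\<lambda>w \<phi>. c * f w \<phi>) h = (\<lambda>w \<phi>. c * end_comp f h w \<phi>)"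
proof (intro ext)
  fix w :: "('u, 'v) word" and \<phi> :: "('u, 'v) word \<Rightarrow> 'k"
  have "h w (\<lambda>v. c * f v \<phi>) = c * h w (\<lambda>v. f v \<phi>)"
    by (rule tensor_form_scale[OF End_0D(2)[OF End_subset_0[OF assms(2)]] End_form[OF assms(1)]])
  then show "end_comp (\<lambda>w \<phi>. c * f w \<phi>) h w \<phi> = c * end_comp f h w \<phi>"
    by (simp add: end_comp_def)
qed

lemma end_comp_add_right: "end_comp f (h + h') = end_comp f h + end_comp f h'"
  by (simp add: end_comp_def fun_eq_iff)

lemma end_comp_scale_right: "end_comp f (\<lambda>w \<phi>. c * h w \<phi>) = (\<lambda>w \<phi>. c * end_comp f h w \<phi>)"
  by (simp add: end_comp_def fun_eq_iff)

lemma end_comp_id_left: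
  assumes "f \<in> En cs ds p"
  shows "end_comp (pr ds) f = f"
proof (intro ext)
  fix w :: "('u, 'v) word" and \<phi> :: "('u, 'v) word \<Rightarrow> 'k"
  note * = End_0D(2)[OF End_subset_0[OF assms], of w]
  show "end_comp (pr ds) f w \<phi> = f w \<phi>"
    using tensor_form_0[OF *] tensor_outside_forms[OF *, of \<phi>]
    by (cases "\<phi> \<in> Fm ds") (simp_all add: end_comp_def pure_def)
qed

lemma end_comp_id_right:
  assumes "f \<in> En cs ds p"
  shows "end_comp f (pr cs) = f"
  using End_form[OF assms] by (intro ext) (simp add: end_comp_def pure_def)

lemma end_tens_add_left:
  "end_tens sU sV cs ds ds' (f + f') h = end_tens sU sV cs ds ds' f h + end_tens sU sV cs ds ds' f' h"
  by (simp add: end_tens_def tensor_mult_def fun_eq_iff)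

lemma end_tens_scale_left:
  "end_tens sU sV cs ds ds' (\<lambda>w \<phi>. c * f w \<phi>) h = (\<lambda>w \<phi>. c * end_tens sU sV cs ds ds' f h w \<phi>)"
  by (simp add: end_tens_def tensor_mult_def fun_eq_iff)

lemma end_tens_add_right:
  assumes "f \<in> En cs ds p" "h \<in> En cs' ds' q" "h' \<in> En cs' ds' q"
  shows "end_tens sU sV cs ds ds' f (h + h') = end_tens sU sV cs ds ds' f h + end_tens sU sV cs ds ds' f h'"
proof (intro ext)
  fix w :: "('u, 'v) word" and \<phi> :: "('u, 'v) word \<Rightarrow> 'k"
  show "end_tens sU sV cs ds ds' f (h + h') w \<phi> = (end_tens sU sV cs ds ds' f h + end_tens sU sV cs ds ds' f h') w \<phi>"
    using tensor_form_add[OF End_0D(2)[OF End_subset_0[OF assms(1)]]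
        forms_tensor_append(1)[OF _ End_0D(2)[OF End_subset_0[OF assms(2)]]]
        forms_tensor_append(1)[OF _ End_0D(2)[OF End_subset_0[OF assms(3)]]]]
    by (simp add: end_tens_def tensor_mult_def)
qed

lemma end_tens_scale_right:
  assumes "f \<in> En cs ds p" "h \<in> En cs' ds' q"
  shows "end_tens sU sV cs ds ds' f (\<lambda>w \<phi>. c * h w \<phi>) = (\<lambda>w \<phi>. c * end_tens sU sV cs ds ds' f h w \<phi>)"
proof (intro ext)
  fix w :: "('u, 'v) word" and \<phi> :: "('u, 'v) word \<Rightarrow> 'k"
  show "end_tens sU sV cs ds ds' f (\<lambda>w \<phi>. c * h w \<phi>) w \<phi> = c * end_tens sU sV cs ds ds' f h w \<phi>"
    using tensor_form_scale[OF End_0D(2)[OF End_subset_0[OF assms(1)]]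
        forms_tensor_append(1)[OF _ End_0D(2)[OF End_subset_0[OF assms(2)]]]]
    by (simp add: end_tens_def tensor_mult_def)
qed

lemma tensor_mult_assoc:
  assumes "\<tau> \<in> Tn cs" "\<tau>' \<in> Tn ds" "\<tau>'' \<in> Tn es"
  shows "tensor_mult sU sV (cs @ ds) es (tensor_mult sU sV cs ds \<tau> \<tau>') \<tau>''
    = tensor_mult sU sV cs (ds @ es) \<tau> (tensor_mult sU sV ds es \<tau>' \<tau>'')" (is "?l = ?r")
proof
  fix \<phi> :: "('u, 'v) word \<Rightarrow> 'k"
  show "?l \<phi> = ?r \<phi>"
  proof (cases "\<phi> \<in> Fm (cs @ ds @ es)")
    case True
    then have T: "\<phi> \<in> Fm ((cs @ ds) @ es)" by simp
    let ?\<psi> = "\<lambda>v. \<tau>'' (\<lambda>z. \<phi> (v @ z))"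
    have \<psi>: "?\<psi> \<in> Fm (cs @ ds)" by (rule forms_tensor_append(1)[OF T assms(3)])
    have "(\<lambda>x. \<tau>' (\<lambda>y. ?\<psi> (x @ y))) = (\<lambda>x. tensor_mult sU sV ds es \<tau>' \<tau>'' (\<lambda>v. \<phi> (x @ v)))"
    proof (rule forms_eqI)
      show "(\<lambda>x. \<tau>' (\<lambda>y. ?\<psi> (x @ y))) \<in> Fm cs"
        by (rule forms_tensor_append(1)[OF \<psi> assms(2)])
      show "(\<lambda>x. tensor_mult sU sV ds es \<tau>' \<tau>'' (\<lambda>v. \<phi> (x @ v))) \<in> Fm cs"
        by (rule forms_tensor_append(1)[OF True tensor_mult_tensors[OF assms(2,3)]])
      show "\<tau>' (\<lambda>y. ?\<psi> (x @ y)) = tensor_mult sU sV ds es \<tau>' \<tau>'' (\<lambda>v. \<phi> (x @ v))" if "colors x = cs" for x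
        using forms_append_left[OF True that] by (simp add: tensor_mult_def)
    qed
    then show ?thesis using True T \<psi> by (simp add: tensor_mult_def[of _ _ cs] tensor_mult_def[of _ _ "cs @ ds"])
  qed (simp add: tensor_mult_def)
qed

lemma end_tens_assoc:
  assumes "f \<in> En cs ds p" "f' \<in> En cs' ds' p'" "f'' \<in> En cs'' ds'' p''"
  shows "end_tens sU sV (cs @ cs') (ds @ ds') ds'' (end_tens sU sV cs ds ds' f f') f''
    = end_tens sU sV cs ds (ds' @ ds'') f (end_tens sU sV cs' ds' ds'' f' f'')"
proof
  fix w :: "('u, 'v) word"
  have 1: "take (length cs) (take (length cs + length cs') w) = take (length cs) w"
    "drop (length cs) (take (length cs + length cs') w) = take (length cs') (drop (length cs) w)"
    "drop (length cs + length cs') w = drop (length cs') (drop (length cs) w)"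
    by (simp_all add: drop_take add.commute)
  show "end_tens sU sV (cs @ cs') (ds @ ds') ds'' (end_tens sU sV cs ds ds' f f') f'' w
    = end_tens sU sV cs ds (ds' @ ds'') f (end_tens sU sV cs' ds' ds'' f' f'') w"
    unfolding end_tens_def length_append 1
    by (rule tensor_mult_assoc) (rule End_0D(2)[OF End_subset_0], rule assms)+
qed

lemma end_tens_unit_left:
  assumes "f \<in> En cs ds p"
  shows "end_tens sU sV [] [] ds (pr []) f = f"
proof (intro ext)
  fix w :: "('u, 'v) word" and \<phi> :: "('u, 'v) word \<Rightarrow> 'k"
  note * = End_0D(2)[OF End_subset_0[OF assms], of w]
  show "end_tens sU sV [] [] ds (pr []) f w \<phi> = f w \<phi>"
    using tensor_outside_forms[OF *, of \<phi>] forms_tensor_append(1)[of \<phi> "[]" ds, OF _ *]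
    by (cases "\<phi> \<in> Fm ds") (simp_all add: end_tens_def tensor_mult_def pure_def)
qed

lemma end_tens_unit_right:
  assumes "f \<in> En cs ds p"
  shows "end_tens sU sV cs ds [] f (pr []) = f"
proof (rule End_eqI)
  note * = End_subset_0[OF assms]
  show "end_tens sU sV cs ds [] f (pr []) \<in> En cs ds 0"
    using End_tens[OF * End_pure, of "[]"] by simp
  fix w :: "('u, 'v) word" and \<phi> :: "('u, 'v) word \<Rightarrow> 'k" assume w: "colors w = cs" and \<phi>: "\<phi> \<in> Fm ds"
  have "length w = length cs" using arg_cong[OF w, of length] by simp
  moreover have "(\<lambda>x. pr [] [] (\<lambda>v. \<phi> (x @ v))) = \<phi>"
  proof (rule forms_eqI[OF _ \<phi>])
    show "(\<lambda>x. pr [] [] (\<lambda>v. \<phi> (x @ v))) \<in> Fm ds"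
      by (rule forms_tensor_append(1)[OF _ pure_tensors]) (simp add: \<phi>)
    show "pr [] [] (\<lambda>v. \<phi> (x @ v)) = \<phi> x" if "colors x = ds" for x
      using forms_append_left[of \<phi> ds "[]", OF _ that] \<phi> by (simp add: pure_def)
  qed
  ultimately show "end_tens sU sV cs ds [] f (pr []) w \<phi> = f w \<phi>"
    using \<phi> by (simp add: end_tens_def tensor_mult_def)
qed (rule End_subset_0[OF assms])

lemma colors_appendE:
  assumes "colors w = cs @ ds"
  obtains a b where "w = a @ b" "colors a = cs" "colors b = ds" "length a = length cs" "length b = length ds"
  using assms by (metis length_map map_eq_append_conv)

lemma end_tens_id: "end_tens sU sV cs cs ds (pr cs) (pr ds) = pr (cs @ ds)"
proof (rule End_eqI)
  show "end_tens sU sV cs cs ds (pr cs) (pr ds) \<in> En (cs @ ds) (cs @ ds) 0"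
    using End_tens[OF End_pure End_pure] by simp
  fix w :: "('u, 'v) word" and \<phi> :: "('u, 'v) word \<Rightarrow> 'k" assume "colors w = cs @ ds"
  then obtain a b where "w = a @ b" "colors a = cs" "colors b = ds" "length a = length cs"
    by (rule colors_appendE)
  then show "end_tens sU sV cs cs ds (pr cs) (pr ds) w \<phi> = pr (cs @ ds) w \<phi>"
    by (simp add: tens_pure)
qed (rule End_pure)

text \<open>After evaluation the two sides differ only in the order in which the tensors
  \<open>h' b\<close> and \<open>f x\<close> are applied, and \<open>tensor_Fubini\<close> exchanges
  them.\<close>

lemma end_interchange:
  assumes "f \<in> En ds es 0" "h \<in> En cs ds 0" "f' \<in> En ds' es' 0" "h' \<in> En cs' ds' 0"
  shows "end_comp (end_tens sU sV ds es es' f f') (end_tens sU sV cs ds ds' h h')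
    = end_tens sU sV cs es es' (end_comp f h) (end_comp f' h')"
proof (rule End_eqI)
  note ff = End_tens_0[OF assms(1,3)]
  show "end_comp (end_tens sU sV ds es es' f f') (end_tens sU sV cs ds ds' h h') \<in> En (cs @ cs') (es @ es') 0"
    by (rule End_comp_0[OF ff End_tens_0[OF assms(2,4)]])
  show "end_tens sU sV cs es es' (end_comp f h) (end_comp f' h') \<in> En (cs @ cs') (es @ es') 0"
    by (rule End_tens_0[OF End_comp_0[OF assms(1,2)] End_comp_0[OF assms(3,4)]])
  fix w :: "('u, 'v) word" and \<phi> :: "('u, 'v) word \<Rightarrow> 'k" assume w: "colors w = cs @ cs'" and \<phi>: "\<phi> \<in> Fm (es @ es')"
  from w obtain a b where ab: "w = a @ b" "colors a = cs" "colors b = cs'" "length a = length cs"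
    by (rule colors_appendE)
  let ?\<psi> = "\<lambda>v. end_tens sU sV ds es es' f f' v \<phi>"
  have \<psi>: "?\<psi> \<in> Fm (ds @ ds')" by (rule End_form[OF ff])
  \<comment> \<open>These are the functions to which \<open>h a\<close> is applied. They are
    compared as forms, so only words \<open>x\<close> of color type \<open>ds\<close> matter, and
    for those \<open>tens_apply\<close> knows where to cut.\<close>
  have E: "(\<lambda>x. h' b (\<lambda>y. ?\<psi> (x @ y))) = (\<lambda>x. f x (\<lambda>u. h' b (\<lambda>y. f' y (\<lambda>u'. \<phi> (u @ u')))))"
  proof (rule forms_eqI)
    show "(\<lambda>x. h' b (\<lambda>y. ?\<psi> (x @ y))) \<in> Fm ds"
      by (rule forms_tensor_append(1)[OF \<psi> End_0D(2)[OF assms(4)]])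
    show "(\<lambda>x. f x (\<lambda>u. h' b (\<lambda>y. f' y (\<lambda>u'. \<phi> (u @ u'))))) \<in> Fm ds"
      by (rule End_form[OF assms(1)])
    fix x :: "('u, 'v) word" assume "colors x = ds"
    then have "length x = length ds" using length_map by metis
    then have "?\<psi> (x @ y) = f x (\<lambda>u. f' y (\<lambda>u'. \<phi> (u @ u')))" for y :: "('u, 'v) word"
      by (rule tens_apply[OF \<phi>])
    moreover have "h' b (\<lambda>y. f x (\<lambda>u. f' y (\<lambda>u'. \<phi> (u @ u')))) = f x (\<lambda>u. h' b (\<lambda>y. f' y (\<lambda>u'. \<phi> (u @ u'))))"
    proof (rule tensor_Fubini[OF End_0D(2)[OF assms(1)] End_0D(2)[OF assms(4)]])
      show "(\<lambda>y. f' y (\<lambda>u'. \<phi> (u @ u'))) \<in> Fm ds'" for u by (rule End_form[OF assms(3)])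
      show "(\<lambda>u. f' y (\<lambda>u'. \<phi> (u @ u'))) \<in> Fm es" for y
        by (rule forms_tensor_append(1)[OF \<phi> End_0D(2)[OF assms(3)]])
    qed
    ultimately show "h' b (\<lambda>y. ?\<psi> (x @ y)) = f x (\<lambda>u. h' b (\<lambda>y. f' y (\<lambda>u'. \<phi> (u @ u'))))" by simp
  qed
  have "end_comp (end_tens sU sV ds es es' f f') (end_tens sU sV cs ds ds' h h') w \<phi>
      = h a (\<lambda>x. h' b (\<lambda>y. ?\<psi> (x @ y)))"
    unfolding end_comp_def ab(1) by (rule tens_apply[OF \<psi> ab(4)])
  moreover have "end_tens sU sV cs es es' (end_comp f h) (end_comp f' h') w \<phi>
      = h a (\<lambda>x. f x (\<lambda>u. h' b (\<lambda>y. f' y (\<lambda>u'. \<phi> (u @ u')))))"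
    unfolding ab(1) tens_apply[OF \<phi> ab(4)] by (simp add: end_comp_def)
  ultimately show "end_comp (end_tens sU sV ds es es' f f') (end_tens sU sV cs ds ds' h h') w \<phi>
      = end_tens sU sV cs es es' (end_comp f h) (end_comp f' h') w \<phi>"
    using E by simp
qed

lemma end_swap_swap: "end_comp (end_swap sU sV ds cs) (end_swap sU sV cs ds) = pr (cs @ ds)"
proof (rule End_eqI)
  show "end_comp (end_swap sU sV ds cs) (end_swap sU sV cs ds) \<in> En (cs @ ds) (cs @ ds) 0"
    by (rule End_comp_0[OF End_swap End_swap])
  fix w :: "('u, 'v) word" and \<phi> :: "('u, 'v) word \<Rightarrow> 'k" assume "colors w = cs @ ds"
  then obtain a b where ab: "w = a @ b" "colors a = cs" "colors b = ds" "length a = length cs" "length b = length ds"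
    by (rule colors_appendE)
  have "end_comp (end_swap sU sV ds cs) (end_swap sU sV cs ds) w = end_swap sU sV ds cs (b @ a)"
    unfolding ab(1) by (rule comp_pure[OF End_swap]) (rule swap_append[OF ab(4)])
  then show "end_comp (end_swap sU sV ds cs) (end_swap sU sV cs ds) w \<phi> = pr (cs @ ds) w \<phi>"
    by (simp add: swap_append[OF ab(5)] ab(1))
qed (rule End_pure)

lemma end_swap_hexagon:
  "end_swap sU sV cs (ds @ es) = end_comp (end_tens sU sV ds ds (es @ cs) (pr ds) (end_swap sU sV cs es))
    (end_tens sU sV (cs @ ds) (ds @ cs) es (end_swap sU sV cs ds) (pr es))" (is "_ = end_comp ?T ?T'")
proof (rule End_eqI)
  have T: "?T \<in> En (ds @ cs @ es) (ds @ es @ cs) 0" by (rule End_tens_0[OF End_pure End_swap])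
  have T': "?T' \<in> En (cs @ ds @ es) (ds @ cs @ es) 0" using End_tens_0[OF End_swap End_pure] by simp
  show "end_swap sU sV cs (ds @ es) \<in> En (cs @ ds @ es) (ds @ es @ cs) 0" using End_swap[of cs "ds @ es"] by simp
  show "end_comp ?T ?T' \<in> En (cs @ ds @ es) (ds @ es @ cs) 0" by (rule End_comp_0[OF T T'])
  fix w :: "('u, 'v) word" and \<phi> :: "('u, 'v) word \<Rightarrow> 'k" assume "colors w = cs @ ds @ es"
  then obtain a v where a: "w = a @ v" "colors a = cs" "colors v = ds @ es" "length a = length cs"
    by (rule colors_appendE)
  from a(3) obtain b c where b: "v = b @ c" "colors b = ds" "colors c = es" "length b = length ds"
    by (rule colors_appendE)
  have "?T' ((a @ b) @ c) = pr ((ds @ cs) @ es) ((b @ a) @ c)"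
    by (rule tens_pure, rule swap_append[OF a(4)]) (use a b in simp_all)
  then have "end_comp ?T ?T' w = ?T (b @ a @ c)"
    unfolding a(1) b(1) by (intro comp_pure[OF T]) simp
  moreover have "?T (b @ a @ c) = pr (ds @ es @ cs) (b @ c @ a)"
    by (rule tens_pure, rule HOL.refl, rule swap_append[OF a(4)]) (use a b in simp_all)
  ultimately show "end_swap sU sV cs (ds @ es) w \<phi> = end_comp ?T ?T' w \<phi>"
    unfolding a(1) swap_append[OF a(4)] by (simp add: b(1))
qed

text \<open>Swapping the outputs amounts to applying the tensors \<open>f a\<close> and
  \<open>f' b\<close> in the opposite order, see \<open>tensor_Fubini_append\<close>.\<close>

lemma end_swap_natural:
  assumes "f \<in> En cs ds 0" "f' \<in> En cs' ds' 0"
  shows "end_comp (end_swap sU sV ds ds') (end_tens sU sV cs ds ds' f f')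
    = end_comp (end_tens sU sV cs' ds' ds f' f) (end_swap sU sV cs cs')" (is "?l = ?r")
proof (rule End_eqI)
  show "?l \<in> En (cs @ cs') (ds' @ ds) 0" by (rule End_comp_0[OF End_swap End_tens_0[OF assms]])
  note T = End_tens_0[OF assms(2,1)]
  show "?r \<in> En (cs @ cs') (ds' @ ds) 0" by (rule End_comp_0[OF T End_swap])
  fix w :: "('u, 'v) word" and \<phi> :: "('u, 'v) word \<Rightarrow> 'k" assume w: "colors w = cs @ cs'" and \<phi>: "\<phi> \<in> Fm (ds' @ ds)"
  from w obtain a b where ab: "w = a @ b" "colors a = cs" "colors b = cs'" "length a = length cs" "length b = length cs'"
    by (rule colors_appendE)
  let ?\<chi> = "\<lambda>v. end_swap sU sV ds ds' v \<phi>"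
  have \<chi>: "?\<chi> \<in> Fm (ds @ ds')" by (rule End_form[OF End_swap])
  have "?l w \<phi> = f a (\<lambda>x. f' b (\<lambda>y. ?\<chi> (x @ y)))"
    unfolding end_comp_def ab(1) by (rule tens_apply[OF \<chi> ab(4)])
  also have "\<dots> = f' b (\<lambda>y. f a (\<lambda>x. ?\<chi> (x @ y)))"
    by (rule tensor_Fubini_append[OF \<chi> End_0D(2)[OF assms(1)] End_0D(2)[OF assms(2)]])
  also have "(\<lambda>y. f a (\<lambda>x. ?\<chi> (x @ y))) = (\<lambda>y. f a (\<lambda>x. \<phi> (y @ x)))"
  proof (rule forms_eqI)
    show "(\<lambda>y. f a (\<lambda>x. ?\<chi> (x @ y))) \<in> Fm ds'"
      by (rule forms_tensor_append(2)[OF \<chi> End_0D(2)[OF assms(1)]])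
    show "(\<lambda>y. f a (\<lambda>x. \<phi> (y @ x))) \<in> Fm ds'"
      by (rule forms_tensor_append(1)[OF \<phi> End_0D(2)[OF assms(1)]])
    fix y :: "('u, 'v) word" assume y: "colors y = ds'"
    have "(\<lambda>x. ?\<chi> (x @ y)) = (\<lambda>x. \<phi> (y @ x))"
    proof (rule forms_eqI[OF forms_append_right[OF \<chi> y] forms_append_left[OF \<phi> y]])
      fix x :: "('u, 'v) word" assume "colors x = ds"
      then have "length x = length ds" using length_map by metis
      then show "?\<chi> (x @ y) = \<phi> (y @ x)" using \<phi> by (simp add: swap_append pure_def)
    qed
    then show "f a (\<lambda>x. ?\<chi> (x @ y)) = f a (\<lambda>x. \<phi> (y @ x))" by simp
  qed
  also have "f' b (\<lambda>y. f a (\<lambda>x. \<phi> (y @ x))) = end_tens sU sV cs' ds' ds f' f (b @ a) \<phi>"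
    by (rule tens_apply[OF \<phi> ab(5), symmetric])
  also have "end_tens sU sV cs' ds' ds f' f (b @ a) = ?r w"
    unfolding ab(1) by (rule comp_pure[OF T, symmetric]) (rule swap_append[OF ab(4)])
  finally show "?l w \<phi> = ?r w \<phi>" .
qed

end

section \<open>Terms of the free PROP\<close>

fun cdom :: "'k pterm \<Rightarrow> color list" where
  "cdom (Gen e) = gen_in e"
| "cdom (Iden cs) = cs"
| "cdom (Swap cs ds) = cs @ ds"
| "cdom (Comp s t) = cdom t"
| "cdom (Tens s t) = cdom s @ cdom t"
| "cdom (Zero cs ds p) = cs"
| "cdom (Add s t) = cdom s"
| "cdom (Scale c s) = cdom s"

fun ccod :: "'k pterm \<Rightarrow> color list" where
  "ccod (Gen e) = [gen_out e]"
| "ccod (Iden cs) = cs"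
| "ccod (Swap cs ds) = ds @ cs"
| "ccod (Comp s t) = ccod s"
| "ccod (Tens s t) = ccod s @ ccod t"
| "ccod (Zero cs ds p) = ds"
| "ccod (Add s t) = ccod s"
| "ccod (Scale c s) = ccod s"

fun wt :: "'k pterm \<Rightarrow> bool" where
  "wt (Gen e) \<longleftrightarrow> gen_valid e"
| "wt (Iden cs) \<longleftrightarrow> True"
| "wt (Swap cs ds) \<longleftrightarrow> True"
| "wt (Comp s t) \<longleftrightarrow> wt s \<and> wt t \<and> cdom s = ccod t"
| "wt (Tens s t) \<longleftrightarrow> wt s \<and> wt t"
| "wt (Zero cs ds p) \<longleftrightarrow> True"
| "wt (Add s t) \<longleftrightarrow> wt s \<and> wt t \<and> cdom s = cdom t \<and> ccod s = ccod t \<and> tdeg s = tdeg t"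
| "wt (Scale c s) \<longleftrightarrow> wt s"

text \<open>Source, target and degree are unique and computable from the term, so the typing
  judgement becomes a set of equations for the simplifier.\<close>

lemma typed_iff: "typed t cs ds p \<longleftrightarrow> wt t \<and> cs = cdom t \<and> ds = ccod t \<and> p = tdeg t"
proof
  show "typed t cs ds p \<Longrightarrow> wt t \<and> cs = cdom t \<and> ds = ccod t \<and> p = tdeg t"
    by (induction rule: typed.induct) auto
  have "wt t \<Longrightarrow> typed t (cdom t) (ccod t) (tdeg t)"
    by (induction t) (auto intro: typed.intros)
  then show "wt t \<and> cs = cdom t \<and> ds = ccod t \<and> p = tdeg t \<Longrightarrow> typed t cs ds p" by blast
qed

lemma prop_eq_wt: "s \<simeq> t \<Longrightarrow> wt s \<and> wt t \<and> cdom s = cdom t \<and> ccod s = ccod t \<and> tdeg s = tdeg t"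
  by (induction rule: prop_eq.induct) (auto simp: typed_iff)

lemma wt_term_sum:
  assumes "\<forall>t \<in> set ts. wt t \<and> cdom t = cs \<and> ccod t = ds \<and> tdeg t = p"
  shows "wt (term_sum cs ds p ts) \<and> cdom (term_sum cs ds p ts) = cs
    \<and> ccod (term_sum cs ds p ts) = ds \<and> tdeg (term_sum cs ds p ts) = p"
  using assms unfolding term_sum_def by (induction ts) auto

lemma compositions_sum: "rs \<in> set (compositions l n) \<Longrightarrow> length rs = l \<and> sum_list rs = n \<and> (\<forall>r \<in> set rs. 1 \<le> r)"
proof (induction l arbitrary: n rs)
  case (Suc l)
  then obtain r rs' where *: "rs = r # rs'" "1 \<le> r" "r \<le> n" "rs' \<in> set (compositions l (n - r))" by auto
  then show ?case using Suc.IH[OF *(4)] by auto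
qed (auto split: if_splits)

lemma wt_tens_list:
  fixes F :: "nat list \<Rightarrow> 'k pterm"
  defines "F rs \<equiv> foldr Tens (map (\<lambda>r. Gen (Fn r)) rs) (Iden [])"
  assumes "\<forall>r \<in> set rs. 1 \<le> r"
  shows "wt (F rs) \<and> cdom (F rs) = replicate (sum_list rs) Black \<and> ccod (F rs) = replicate (length rs) White
    \<and> tdeg (F rs) = int (sum_list rs) - int (length rs)"
  using assms(2) unfolding F_def by (induction rs) (auto simp: replicate_add)

lemma wt_plug:
  assumes "gen_valid x" "gen_valid y" "gen_in x = replicate i c" "gen_in y = replicate j c" "gen_out y = c" "s < i"
  shows "wt (plug x s y) \<and> cdom (plug x s y) = replicate (i + j - 1) c \<and> ccod (plug x s y) = [gen_out x]
    \<and> tdeg (plug x s y) = gen_deg x + gen_deg y"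
proof -
  have "replicate s c @ c # replicate (i - Suc s) c = replicate (s + Suc (i - Suc s)) c"
    unfolding replicate_add by simp
  moreover have "replicate s c @ replicate j c @ replicate (i - Suc s) c = replicate (s + (j + (i - Suc s))) c"
    unfolding replicate_add ..
  moreover have "s + Suc (i - Suc s) = i" "s + (j + (i - Suc s)) = i + j - 1" using assms(6) by simp_all
  moreover have "min s i = s" using assms(6) by simp
  ultimately show ?thesis using assms by (simp add: plug_def)
qed

text \<open>Degree count with i + j = n + 1: (i - 2) + (j - 2) = n - 3 and (i - 1) + (j - 2) = n -
  2. For a composition of n into l parts, (l - 2) + (n - l) = n - 2.\<close>

lemma wt_diff_gen_terms:
  assumes "gen_valid e" "t \<in> set (diff_gen_terms e)"
  shows "wt t \<and> cdom t = gen_in e \<and> ccod t = [gen_out e] \<and> tdeg t = gen_deg e - 1"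
proof (cases e)
  case (Mu n)
  then obtain i s c where t: "t = Scale c (plug (Mu i) s (Mu (n + 1 - i)))" and i: "2 \<le> i" "i < n"
    and s: "s < Suc (n - (n + 1 - i))"
    using assms(2) by (auto simp del: upt_Suc)
  have "s < i" "i + (n + 1 - i) - 1 = n" "int (n + 1 - i) = int n + 1 - int i" "2 \<le> n + 1 - i" using i s by auto
  then show ?thesis using wt_plug[of "Mu i" "Mu (n + 1 - i)" i Black "n + 1 - i" s] i unfolding t Mu by (simp del: One_nat_def add_Suc_right)
next
  case (Nu n)
  then obtain i s c where t: "t = Scale c (plug (Nu i) s (Nu (n + 1 - i)))" and i: "2 \<le> i" "i < n"
    and s: "s < Suc (n - (n + 1 - i))"
    using assms(2) by (auto simp del: upt_Suc)
  have "s < i" "i + (n + 1 - i) - 1 = n" "int (n + 1 - i) = int n + 1 - int i" "2 \<le> n + 1 - i" using i s by auto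
  then show ?thesis using wt_plug[of "Nu i" "Nu (n + 1 - i)" i White "n + 1 - i" s] i unfolding t Nu by (simp del: One_nat_def add_Suc_right)
next
  case (Fn n)
  then consider
    (A) l rs c where "t = Scale c (Comp (Gen (Nu l)) (foldr Tens (map (\<lambda>r. Gen (Fn r)) rs) (Iden [])))"
      "2 \<le> l" "rs \<in> set (compositions l n)"
  | (B) i s c where "t = Scale c (plug (Fn i) s (Mu (n + 1 - i)))" "1 \<le> i" "i < n" "s < Suc (n - (n + 1 - i))"
    using assms(2) by (auto simp del: upt_Suc)
  then show ?thesis
  proof cases
    case A
    note * = compositions_sum[OF A(3)]
    show ?thesis using A(2) * wt_tens_list[of rs] unfolding A(1) Fn by auto
  next
    case B
    have "s < i" "i + (n + 1 - i) - 1 = n" "int (n + 1 - i) = int n + 1 - int i" "2 \<le> n + 1 - i" using B by auto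
    then show ?thesis using wt_plug[of "Fn i" "Mu (n + 1 - i)" i Black "n + 1 - i" s] B unfolding B(1) Fn by (simp del: One_nat_def add_Suc_right)
  qed
qed

lemma wt_diff:
  "wt t \<Longrightarrow> wt (diff t) \<and> cdom (diff t) = cdom t \<and> ccod (diff t) = ccod t \<and> tdeg (diff t) = tdeg t - 1"
proof (induction t)
  case (Gen e)
  then have "\<forall>t \<in> set (diff_gen_terms e). wt t \<and> cdom t = gen_in e \<and> ccod t = [gen_out e] \<and> tdeg t = gen_deg e - 1"
    using wt_diff_gen_terms by auto
  from wt_term_sum[OF this] show ?case by simp
qed auto

section \<open>Evaluation of terms, given the action of the generators\<close>

locale gen_action = two_spaces sU sV
  for sU :: "'k::field \<Rightarrow> 'u::ab_group_add \<Rightarrow> 'u" and sV :: "'k \<Rightarrow> 'v::ab_group_add \<Rightarrow> 'v" +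
  fixes \<gamma> :: "gen \<Rightarrow> ('u, 'v, 'k) endo"
  assumes gen_End: "gen_valid e \<Longrightarrow> \<gamma> e \<in> En (gen_in e) [gen_out e] (gen_deg e)"
begin

fun ev :: "'k pterm \<Rightarrow> ('u, 'v, 'k) endo" where
  "ev (Gen e) = \<gamma> e"
| "ev (Iden cs) = pr cs"
| "ev (Swap cs ds) = end_swap sU sV cs ds"
| "ev (Comp s t) = end_comp (ev s) (ev t)"
| "ev (Tens s t) = end_tens sU sV (cdom s) (ccod s) (ccod t) (ev s) (ev t)"
| "ev (Zero cs ds p) = 0"
| "ev (Add s t) = ev s + ev t"
| "ev (Scale c s) = (\<lambda>w \<phi>. c * ev s w \<phi>)"

lemma ev_End: "wt t \<Longrightarrow> ev t \<in> En (cdom t) (ccod t) (tdeg t)"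
proof (induction t)
  case (Add s t)
  then show ?case using End_add[of "ev s" "cdom s" "ccod s" "tdeg s" "ev t"] by (simp add: plus_fun_def)
qed (auto simp: gen_End End_pure End_swap End_comp End_tens End_scale End_zero zero_fun_def)

lemma ev_nonzero: "wt t \<Longrightarrow> tdeg t \<noteq> 0 \<Longrightarrow> ev t = (\<lambda>w \<phi>. 0)"
  using End_nonzero[OF ev_End] by blast

lemma ev_End_0: "wt t \<Longrightarrow> ev t \<in> En (cdom t) (ccod t) 0"
  by (rule End_subset_0[OF ev_End])

text \<open>If the Koszul exponent is odd, \<open>s'\<close> has nonzero degree and acts by 0, so
  both sides vanish; otherwise this is \<open>end_interchange\<close>.\<close>

lemma ev_interchange:
  assumes "wt s" "wt t" "wt s'" "wt t'" "cdom s = ccod t" "cdom s' = ccod t'"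
  shows "ev (Comp (Tens s s') (Tens t t')) = ev (Scale (ksign (tdeg s' * tdeg t)) (Tens (Comp s t) (Comp s' t')))"
proof (cases "even (tdeg s' * tdeg t)")
  case True
  have "end_comp (end_tens sU sV (cdom s) (ccod s) (ccod s') (ev s) (ev s'))
      (end_tens sU sV (cdom t) (cdom s) (cdom s') (ev t) (ev t'))
    = end_tens sU sV (cdom t) (ccod s) (ccod s') (end_comp (ev s) (ev t)) (end_comp (ev s') (ev t'))"
    by (rule end_interchange) (use assms ev_End_0[of s] ev_End_0[of s'] ev_End_0[of t] ev_End_0[of t'] in auto)
  then show ?thesis using True assms(5,6) by (simp add: ksign_def)
next
  case False
  then have "tdeg s' \<noteq> 0" by auto
  then have 0: "ev s' = (\<lambda>w \<phi>. 0)" by (rule ev_nonzero[OF assms(3)])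
  have "end_tens sU sV (cdom s) (ccod s) (ccod s') (ev s) (\<lambda>w \<phi>. 0) = (\<lambda>w \<phi>. 0)"
    "end_tens sU sV (cdom t) (ccod s) (ccod s') (end_comp (ev s) (ev t)) (\<lambda>w \<phi>. 0) = (\<lambda>w \<phi>. 0)"
    using tens_0_right[OF ev_End[OF assms(1)]] tens_0_right[OF End_comp[OF ev_End[OF assms(1)], of "ev t" "cdom t" "tdeg t"]]
      ev_End[OF assms(2)] assms(5) by auto
  moreover have "end_comp (\<lambda>w \<phi>. 0) (ev t') = (\<lambda>w \<phi>. 0)"
    by (rule comp_0_left[OF ev_End[OF assms(4)]])
  moreover have "end_comp (\<lambda>w \<phi>. 0) (ev (Tens t t')) = (\<lambda>w \<phi>. 0)"
    by (rule comp_0_left[OF ev_End]) (use assms in simp)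
  ultimately show ?thesis using 0 by simp
qed

lemma ev_swap_natural:
  assumes "wt s" "wt t"
  shows "ev (Comp (Swap (ccod s) (ccod t)) (Tens s t))
    = ev (Scale (ksign (tdeg s * tdeg t)) (Comp (Tens t s) (Swap (cdom s) (cdom t))))"
proof (cases "even (tdeg s * tdeg t)")
  case True
  then show ?thesis
    using end_swap_natural[OF ev_End_0[OF assms(1)] ev_End_0[OF assms(2)]] by (simp add: ksign_def)
next
  case False
  then have "tdeg s \<noteq> 0" by auto
  then have 0: "ev s = (\<lambda>w \<phi>. 0)" by (rule ev_nonzero[OF assms(1)])
  show ?thesis
    using tens_0_right[OF ev_End[OF assms(2)]] comp_0_left[OF End_swap] by (simp add: 0)
qed

lemma prop_eq_ev: "s \<simeq> t \<Longrightarrow> ev s = ev t"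
proof (induction rule: prop_eq.induct)
  case (cong_tens s s' t t')
  then show ?case using prop_eq_wt[OF cong_tens(1)] prop_eq_wt[OF cong_tens(2)] by simp
next
  case (interchange s ds es p t cs q s' ds' es' p' t' cs' q')
  then show ?case using ev_interchange[of s t s' t'] by (simp only: typed_iff)
next
  case (swap_natural s cs ds p t cs' ds' q)
  then show ?case using ev_swap_natural[of s t] by (simp only: typed_iff)
next
  case (comp_add_left s ds es p s' t cs q)
  then show ?case using end_comp_add_left[OF ev_End, of s "ev s'" "ev t" cs q] ev_End[of s'] ev_End[of t] by (simp add: typed_iff)
next
  case (comp_scale_left s ds es p t cs q a)
  then show ?case using end_comp_scale_left[OF ev_End, of s "ev t" cs q] ev_End[of t] by (simp add: typed_iff)
next
  case (tens_add_right s cs ds p t cs' ds' q t')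
  then show ?case using end_tens_add_right[OF ev_End ev_End, of s t "ev t'"] ev_End[of t'] by (simp add: typed_iff)
next
  case (tens_scale_right s cs ds p t cs' ds' q a)
  then show ?case using end_tens_scale_right[OF ev_End ev_End, of s t] by (simp add: typed_iff)
next
  case (tens_assoc s cs ds p t cs' ds' q u cs'' ds'' r)
  then show ?case using end_tens_assoc[OF ev_End ev_End ev_End, of s t u] by (simp add: typed_iff)
next
  case (comp_id_left s cs ds p)
  then show ?case using end_comp_id_left[OF ev_End, of s] by (simp add: typed_iff)
next
  case (comp_id_right s cs ds p)
  then show ?case using end_comp_id_right[OF ev_End, of s] by (simp add: typed_iff)
next
  case (tens_unit_left s cs ds p)
  then show ?case using end_tens_unit_left[OF ev_End, of s] by (simp add: typed_iff)
next
  case (tens_unit_right s cs ds p)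
  then show ?case using end_tens_unit_right[OF ev_End, of s] by (simp add: typed_iff)
next
  case (swap_hexagon cs ds es)
  then show ?case using end_swap_hexagon[of cs ds es] by simp
next
  case (swap_swap ds cs)
  then show ?case using end_swap_swap[of ds cs] by simp
next
  case (tens_id cs ds)
  then show ?case using end_tens_id[of cs ds] by simp
next
  case (sym s t)
  show ?case by (rule sym(2)[symmetric])
next
  case (trans s t u)
  show ?case using trans(3,4) by simp
next
  case (cong_comp s s' t t')
  then show ?case by simp
next
  case (cong_add s s' t t')
  then show ?case by simp
next
  case (cong_scale s s' c)
  then show ?case by simp
next
  case (comp_add_right s ds es p t cs q t')
  then show ?case by (simp add: end_comp_add_right)
next
  case (tens_add_left s cs ds p s' t cs' ds' q)
  then show ?case by (simp add: end_tens_add_left typed_iff)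
next
  case (add_comm s cs ds p t)
  show ?case by (simp add: add.commute)
next
  case (add_assoc s cs ds p t u)
  show ?case by (simp add: add.assoc)
qed (simp_all add: end_comp_scale_right end_tens_scale_left end_comp_def fun_eq_iff algebra_simps)

end

section \<open>Multilinear maps as morphisms with a single output\<close>

lemma multilin_iff_slot_linear:
  assumes "vector_space s" "vector_space s'"
  shows "m \<in> multilin s s' n \<longleftrightarrow> (\<forall>as. length as \<noteq> n \<longrightarrow> m as = 0) \<and> slot_linear (\<lambda>x. x) s s' m"
proof -
  interpret S: vector_space s' by (rule assms(2))
  have "m (u @ (a + b) # v) = m (u @ a # v) + m (u @ b # v) \<and> m (u @ s c a # v) = s' c (m (u @ a # v))"
    if "m \<in> multilin s s' n" for u v a b c
    using that unfolding multilin_def linear_iff_add_scale[OF assms]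
    by (cases "length u + length v + 1 = n") auto
  moreover have "m \<in> multilin s s' n" if "\<forall>as. length as \<noteq> n \<longrightarrow> m as = 0" "slot_linear (\<lambda>x. x) s s' m"
    using that(1) slot_linearD[OF that(2)] unfolding multilin_def linear_iff_add_scale[OF assms] by simp
  ultimately show ?thesis by (auto simp: multilin_def slot_linear_def)
qed

lemma linear_functional_nonzero:
  assumes "vector_space s" "x \<noteq> 0"
  obtains h where "Vector_Spaces.linear s ((*) :: 'k::field \<Rightarrow> 'k \<Rightarrow> 'k) h" "h x \<noteq> 0"
proof -
  interpret vector_space_pair s "(*) :: 'k \<Rightarrow> 'k \<Rightarrow> 'k"
    using assms(1) vector_space_mult by (simp add: vector_space_pair_def)
  have "vs1.independent {x}" using assms(2) by simp
  from linear_independent_extend[OF this, of "\<lambda>_. 1"] that show ?thesis by fastforce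
qed

text \<open>A common frame for Hom(U^n, U), Hom(V^n, V) and Hom(U^n, V): arguments are marked by
  \<open>\<iota>\<close>, values by \<open>\<iota>'\<close>. By \<open>slots\<close>, a morphism
  supported on words of one color needs to be linear only in the slots of that color;
  \<open>form_linear\<close> and \<open>linear_form\<close> identify one-letter forms with linear
  functionals.\<close>

locale embedding = two_spaces sU sV
  for sU :: "'k::field \<Rightarrow> 'u::ab_group_add \<Rightarrow> 'u" and sV :: "'k \<Rightarrow> 'v::ab_group_add \<Rightarrow> 'v" +
  fixes s :: "'k \<Rightarrow> 'a::ab_group_add \<Rightarrow> 'a" and \<iota> :: "'a \<Rightarrow> 'u + 'v" and \<pi> :: "'u + 'v \<Rightarrow> 'a" and c :: color
    and s' :: "'k \<Rightarrow> 'b::ab_group_add \<Rightarrow> 'b" and \<iota>' :: "'b \<Rightarrow> 'u + 'v" and c' :: color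
  assumes vs: "vector_space s" and vs': "vector_space s'"
    and \<pi>_\<iota> [simp]: "\<pi> (\<iota> a) = a" and color_iff: "color_of x = c \<longleftrightarrow> x \<in> range \<iota>"
    and color_iff': "color_of x = c' \<longleftrightarrow> x \<in> range \<iota>'"
    and slots: "(\<forall>w. (\<exists>x \<in> set w. color_of x \<noteq> c) \<longrightarrow> (F :: ('u, 'v, 'k) endo) w = (\<lambda>\<phi>. 0)) \<Longrightarrow>
      slot_linear Inl sU (\<lambda>c \<tau> \<phi>. c * \<tau> \<phi>) F \<and> slot_linear Inr sV (\<lambda>c \<tau> \<phi>. c * \<tau> \<phi>) F
        \<longleftrightarrow> slot_linear \<iota> s (\<lambda>c \<tau> \<phi>. c * \<tau> \<phi>) F"
    and form_linear: "\<phi> \<in> Fm [c'] \<Longrightarrow> Vector_Spaces.linear s' (*) (\<lambda>x. \<phi> [\<iota>' x])"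
    and linear_form: "Vector_Spaces.linear s' (*) h \<Longrightarrow> \<exists>\<phi> \<in> Fm [c']. \<forall>x. \<phi> [\<iota>' x] = h x"
begin

definition emb :: "('a list \<Rightarrow> 'b) \<Rightarrow> ('u, 'v, 'k) endo" where
  "emb m w = (if \<forall>x \<in> set w. color_of x = c then pr [c'] [\<iota>' (m (map \<pi> w))] else 0)"

abbreviation "p1 \<equiv> \<lambda>x. pr [c'] [\<iota>' x]"

lemma p1_add: "p1 (x + y) = (\<lambda>\<phi>. p1 x \<phi> + p1 y \<phi>)"
  and p1_scale: "p1 (s' k x) = (\<lambda>\<phi>. k * p1 x \<phi>)"
  using form_linear by (auto simp: pure_def fun_eq_iff linear_iff_add_scale[OF vs' vector_space_mult])

lemma p1_0: "p1 0 = (\<lambda>\<phi>. 0)"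
proof -
  interpret V': vector_space s' by (rule vs')
  show ?thesis using p1_scale[of 0 0] by simp
qed

text \<open>All linear functionals occur as one-letter forms, and they separate the points of a
  vector space.\<close>

lemma p1_inj: "p1 x = p1 y \<Longrightarrow> x = y"
proof (rule ccontr)
  assume *: "p1 x = p1 y" "x \<noteq> y"
  interpret V': vector_space s' by (rule vs')
  obtain h where h: "Vector_Spaces.linear s' ((*) :: 'k \<Rightarrow> 'k \<Rightarrow> 'k) h" "h (x - y) \<noteq> 0"
    using linear_functional_nonzero[OF vs', of "x - y"] *(2) by auto
  obtain \<phi> where \<phi>: "\<phi> \<in> Fm [c']" "\<And>x. \<phi> [\<iota>' x] = h x" using linear_form[OF h(1)] by blast
  have "h x = h y" using fun_cong[OF *(1), of \<phi>] \<phi> by (simp add: pure_def)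
  moreover have "h (x - y) + h y = h x"
    using h(1) unfolding linear_iff_add_scale[OF vs' vector_space_mult] by (metis diff_add_cancel)
  ultimately show False using h(2) by simp
qed

text \<open>With only one tensor factor every tensor is decomposable.\<close>

lemma p1_surj: "\<tau> \<in> Tn [c'] \<Longrightarrow> \<exists>x. \<tau> = p1 x"
proof (induction rule: tensors_induct)
  case zero
  show ?case by (rule exI[of _ 0]) (rule p1_0[symmetric])
next
  case (pure w)
  then obtain x where "w = [x]" "color_of x = c'" by auto
  then show ?case using color_iff' by auto
next
  case (add \<tau> \<tau>')
  then obtain x y where "\<tau> = p1 x" "\<tau>' = p1 y" by blast
  then show ?case by (intro exI[of _ "x + y"]) (simp only: p1_add)
next
  case (scale k \<tau>)
  then obtain x where "\<tau> = p1 x" by blast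
  then show ?case by (intro exI[of _ "s' k x"]) (simp only: p1_scale)
qed

lemma color_\<iota> [simp]: "color_of (\<iota> a) = c"
  using color_iff by blast

lemma emb_map [simp]: "emb m (map \<iota> as) = p1 (m as)"
  by (simp add: emb_def o_def)

lemma emb_End:
  assumes "m \<in> multilin s s' n"
  shows "emb m \<in> En (replicate n c) [c'] 0"
proof -
  from assms have m: "\<And>as. length as \<noteq> n \<Longrightarrow> m as = 0" "slot_linear (\<lambda>x. x) s s' m"
    by (simp_all add: multilin_iff_slot_linear[OF vs vs'])
  note add = slot_linearD(1)[OF m(2)] and scale = slot_linearD(2)[OF m(2)]
  have "slot_linear \<iota> s (\<lambda>c \<tau> \<phi>. c * \<tau> \<phi>) (emb m)"
    unfolding slot_linear_def by (auto simp: emb_def add scale p1_add p1_scale fun_eq_iff)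
  moreover have "emb m w = (\<lambda>\<phi>. 0)" if "\<exists>x \<in> set w. color_of x \<noteq> c" for w
    using that by (auto simp: emb_def zero_fun_def)
  moreover have "emb m w = (\<lambda>\<phi>. 0)" if "colors w \<noteq> replicate n c" for w
  proof (cases "\<forall>x \<in> set w. color_of x = c")
    case True
    then have "colors w = replicate (length w) c" by (induction w) auto
    then have "length w \<noteq> n" using that by auto
    then show ?thesis using True by (simp add: emb_def m(1) p1_0)
  qed (auto simp: emb_def zero_fun_def)
  moreover have "emb m w \<in> Tn [c']" for w
    using tensors_0 by (simp add: emb_def pure_tensors zero_fun_def)
  ultimately show ?thesis unfolding End_0_iff using slots[of "emb m"] by blast
qed

lemma emb_inj: "emb m = emb m' \<Longrightarrow> m = m'"
proof
  fix as assume "emb m = emb m'"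
  then have "emb m (map \<iota> as) = emb m' (map \<iota> as)" by simp
  then show "m as = m' as" unfolding emb_map by (rule p1_inj)
qed

text \<open>The values of \<open>F\<close> are one-letter tensors, hence of the form
  \<open>p1 x\<close> with a unique \<open>x\<close>. As \<open>p1\<close> is linear and injective,
  multilinearity passes from \<open>F\<close> to these elements.\<close>

lemma emb_surj:
  assumes F: "F \<in> En (replicate n c) [c'] 0"
  shows "\<exists>m \<in> multilin s s' n. F = emb m"
proof -
  have "\<forall>as. \<exists>x. F (map \<iota> as) = p1 x"
    using p1_surj[OF End_0D(2)[OF F]] by blast
  then obtain m where m: "\<And>as. F (map \<iota> as) = p1 (m as)" by metis
  have 0: "F w = (\<lambda>\<phi>. 0)" if "\<exists>x \<in> set w. color_of x \<noteq> c" for w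
  proof (rule End_0D(1)[OF F], rule notI)
    assume "colors w = replicate n c"
    then have "set (colors w) \<subseteq> {c}" by auto
    then show False using that by auto
  qed
  then have S: "slot_linear \<iota> s (\<lambda>c \<tau> \<phi>. c * \<tau> \<phi>) F"
    using slots[of F] End_0D(3,4)[OF F] by blast
  have "m \<in> multilin s s' n"
    unfolding multilin_iff_slot_linear[OF vs vs'] slot_linear_def
  proof (intro conjI allI impI)
    fix as :: "'a list" assume "length as \<noteq> n"
    then have "colors (map \<iota> as) \<noteq> replicate n c" by (auto dest: arg_cong[of _ _ length])
    then have "F (map \<iota> as) = (\<lambda>\<phi>. 0)" by (rule End_0D(1)[OF F])
    then have "p1 (m as) = p1 0" by (simp only: m p1_0)
    then show "m as = 0" by (rule p1_inj)
  next
    fix u v a b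
    have "p1 (m (u @ (a + b) # v)) = p1 (m (u @ a # v) + m (u @ b # v))"
      unfolding p1_add m[symmetric] using slot_linearD(1)[OF S, of "map \<iota> u" a b "map \<iota> v"]
      by (simp add: plus_fun_def)
    then show "m (u @ (a + b) # v) = m (u @ a # v) + m (u @ b # v)" by (rule p1_inj)
  next
    fix u v a k
    have "p1 (m (u @ s k a # v)) = p1 (s' k (m (u @ a # v)))"
      unfolding p1_scale m[symmetric] using slot_linearD(2)[OF S, of "map \<iota> u" k a "map \<iota> v"] by simp
    then show "m (u @ s k a # v) = s' k (m (u @ a # v))" by (rule p1_inj)
  qed
  moreover have "F = emb m"
  proof
    fix w
    show "F w = emb m w"
    proof (cases "\<forall>x \<in> set w. color_of x = c")
      case True
      then have "\<forall>x \<in> set w. \<iota> (\<pi> x) = x" unfolding color_iff by auto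
      then have "w = map \<iota> (map \<pi> w)" by (simp add: o_def map_idI)
      then show ?thesis using emb_map m by metis
    next
      case False
      then have "F w = (\<lambda>\<phi>. 0)" by (intro 0) auto
      with False show ?thesis by (auto simp: emb_def zero_fun_def)
    qed
  qed
  ultimately show ?thesis by blast
qed

end

context two_spaces
begin

lemma slot_linear_other_color:
  assumes "\<forall>w. (\<exists>x \<in> set w. color_of x \<noteq> c) \<longrightarrow> F w = (\<lambda>\<phi>. 0)"
  shows "c = White \<Longrightarrow> slot_linear Inl sU (\<lambda>c \<tau> \<phi>. c * \<tau> \<phi>) F"
    and "c = Black \<Longrightarrow> slot_linear Inr sV (\<lambda>c \<tau> \<phi>. c * \<tau> \<phi>) F"
  using assms by (auto simp: slot_linear_def plus_fun_def)

lemma form_Black: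
  "\<phi> \<in> Fm [Black] \<Longrightarrow> Vector_Spaces.linear sU (*) (\<lambda>x. \<phi> [Inl x])"
  "Vector_Spaces.linear sU (*) h \<Longrightarrow> \<exists>\<phi> \<in> Fm [Black]. \<forall>x. \<phi> [Inl x] = h x"
proof -
  note lin = linear_iff_add_scale[OF U.vector_space_axioms vector_space_mult]
  show "Vector_Spaces.linear sU (*) (\<lambda>x. \<phi> [Inl x])" if "\<phi> \<in> Fm [Black]"
    using that unfolding lin forms_iff slot_linear_def by (metis append_Nil)
  assume h: "Vector_Spaces.linear sU (*) h"
  define \<psi> where "\<psi> w = (case w of [Inl x] \<Rightarrow> h x | _ \<Rightarrow> 0)" for w :: "('u, 'v) word"
  have "\<psi> \<in> Fm [Black]"
    using h unfolding lin forms_iff slot_linear_def \<psi>_def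
    by (auto simp: append_eq_Cons_conv neq_Nil_conv split: list.splits sum.splits)
  then show "\<exists>\<phi> \<in> Fm [Black]. \<forall>x. \<phi> [Inl x] = h x" by (intro bexI[of _ \<psi>]) (simp_all add: \<psi>_def)
qed

lemma form_White:
  "\<phi> \<in> Fm [White] \<Longrightarrow> Vector_Spaces.linear sV (*) (\<lambda>x. \<phi> [Inr x])"
  "Vector_Spaces.linear sV (*) h \<Longrightarrow> \<exists>\<phi> \<in> Fm [White]. \<forall>x. \<phi> [Inr x] = h x"
proof -
  note lin = linear_iff_add_scale[OF V.vector_space_axioms vector_space_mult]
  show "Vector_Spaces.linear sV (*) (\<lambda>x. \<phi> [Inr x])" if "\<phi> \<in> Fm [White]"
    using that unfolding lin forms_iff slot_linear_def by (metis append_Nil)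
  assume h: "Vector_Spaces.linear sV (*) h"
  define \<psi> where "\<psi> w = (case w of [Inr x] \<Rightarrow> h x | _ \<Rightarrow> 0)" for w :: "('u, 'v) word"
  have "\<psi> \<in> Fm [White]"
    using h unfolding lin forms_iff slot_linear_def \<psi>_def
    by (auto simp: append_eq_Cons_conv neq_Nil_conv split: list.splits sum.splits)
  then show "\<exists>\<phi> \<in> Fm [White]. \<forall>x. \<phi> [Inr x] = h x" by (intro bexI[of _ \<psi>]) (simp_all add: \<psi>_def)
qed

lemma color_of_iff: "color_of x = Black \<longleftrightarrow> x \<in> range Inl" "color_of x = White \<longleftrightarrow> x \<in> range Inr"
  by (cases x; auto)+

lemma embedding_UU: "embedding sU sV sU Inl projl Black sU Inl Black"
proof (rule embedding.intro[OF two_spaces_axioms embedding_axioms.intro])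
  fix F :: "('u, 'v, 'k) endo"
  assume "\<forall>w. (\<exists>x \<in> set w. color_of x \<noteq> Black) \<longrightarrow> F w = (\<lambda>\<phi>. 0)"
  then show "slot_linear Inl sU (\<lambda>c \<tau> \<phi>. c * \<tau> \<phi>) F \<and> slot_linear Inr sV (\<lambda>c \<tau> \<phi>. c * \<tau> \<phi>) F
        \<longleftrightarrow> slot_linear Inl sU (\<lambda>c \<tau> \<phi>. c * \<tau> \<phi>) F"
    using slot_linear_other_color(2)[of Black F] by simp
qed (rule U.vector_space_axioms color_of_iff form_Black | simp | assumption)+

lemma embedding_VV: "embedding sU sV sV Inr projr White sV Inr White"
proof (rule embedding.intro[OF two_spaces_axioms embedding_axioms.intro])
  fix F :: "('u, 'v, 'k) endo"
  assume "\<forall>w. (\<exists>x \<in> set w. color_of x \<noteq> White) \<longrightarrow> F w = (\<lambda>\<phi>. 0)"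
  then show "slot_linear Inl sU (\<lambda>c \<tau> \<phi>. c * \<tau> \<phi>) F \<and> slot_linear Inr sV (\<lambda>c \<tau> \<phi>. c * \<tau> \<phi>) F
        \<longleftrightarrow> slot_linear Inr sV (\<lambda>c \<tau> \<phi>. c * \<tau> \<phi>) F"
    using slot_linear_other_color(1)[of White F] by simp
qed (rule V.vector_space_axioms color_of_iff form_White | simp | assumption)+

lemma embedding_UV: "embedding sU sV sU Inl projl Black sV Inr White"
proof (rule embedding.intro[OF two_spaces_axioms embedding_axioms.intro])
  fix F :: "('u, 'v, 'k) endo"
  assume "\<forall>w. (\<exists>x \<in> set w. color_of x \<noteq> Black) \<longrightarrow> F w = (\<lambda>\<phi>. 0)"
  then show "slot_linear Inl sU (\<lambda>c \<tau> \<phi>. c * \<tau> \<phi>) F \<and> slot_linear Inr sV (\<lambda>c \<tau> \<phi>. c * \<tau> \<phi>) F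
        \<longleftrightarrow> slot_linear Inl sU (\<lambda>c \<tau> \<phi>. c * \<tau> \<phi>) F"
    using slot_linear_other_color(2)[of Black F] by simp
qed (rule U.vector_space_axioms V.vector_space_axioms color_of_iff form_White | simp | assumption)+

sublocale UU: embedding sU sV sU Inl projl Black sU Inl Black by (rule embedding_UU)
sublocale VV: embedding sU sV sV Inr projr White sV Inr White by (rule embedding_VV)
sublocale UV: embedding sU sV sU Inl projl Black sV Inr White by (rule embedding_UV)

lemma embed_eq_emb: "embed_UU sU sV = UU.emb" "embed_VV sU sV = VV.emb" "embed_UV sU sV = UV.emb"
proof -
  have "isl x \<longleftrightarrow> color_of x = Black" "\<not> isl x \<longleftrightarrow> color_of x = White" for x :: "'u + 'v"
    by (cases x; simp)+
  then show "embed_UU sU sV = UU.emb" "embed_VV sU sV = VV.emb" "embed_UV sU sV = UV.emb"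
    by (simp_all add: fun_eq_iff embed_UU_def embed_VV_def embed_UV_def UU.emb_def VV.emb_def UV.emb_def list_all_iff)
qed

end

section \<open>Algebra structures and their structure equations\<close>

lemma FE_algebraD:
  assumes "FE_algebra sU sV \<Phi>"
  shows "\<not> wt t \<Longrightarrow> \<Phi> t = 0"
    and "s \<simeq> t \<Longrightarrow> \<Phi> s = \<Phi> t"
    and "wt t \<Longrightarrow> \<Phi> t \<in> End_T sU sV (cdom t) (ccod t) (tdeg t)"
    and "wt (Add s t) \<Longrightarrow> \<Phi> (Add s t) = \<Phi> s + \<Phi> t"
    and "wt s \<Longrightarrow> \<Phi> (Scale c s) = (\<lambda>w. tscale c (\<Phi> s w))"
    and "\<Phi> (Iden cs) = pure sU sV cs"
    and "\<Phi> (Swap cs ds) = end_swap sU sV cs ds"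
    and "wt (Comp s t) \<Longrightarrow> \<Phi> (Comp s t) = end_comp (\<Phi> s) (\<Phi> t)"
    and "wt (Tens s t) \<Longrightarrow> \<Phi> (Tens s t) = end_tens sU sV (cdom s) (ccod s) (ccod t) (\<Phi> s) (\<Phi> t)"
    and "wt t \<Longrightarrow> \<Phi> (diff t) = 0"
  using assms unfolding FE_algebra_def typed_iff by (elim conjE, simp)+

context gen_action
begin

lemma ev_plug:
  assumes "gen_valid x" "take s (gen_in x) @ gen_out y # drop (Suc s) (gen_in x) = gen_in x"
    and "\<gamma> y w = pr [gen_out y] [v]" "color_of v = gen_out y"
    and "colors u = take s (gen_in x)" "colors w = gen_in y" "colors u' = drop (Suc s) (gen_in x)"
  shows "ev (plug x s y) (u @ w @ u') = \<gamma> x (u @ v # u')"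
proof -
  let ?T = "end_tens sU sV (gen_in y) [gen_out y] (drop (Suc s) (gen_in x)) (\<gamma> y) (pr (drop (Suc s) (gen_in x)))"
  have len: "length w = length (gen_in y)" "length u = length (take s (gen_in x))"
    using arg_cong[OF assms(5), of length] arg_cong[OF assms(6), of length] by simp_all
  have T: "?T (w @ u') = pr ([gen_out y] @ drop (Suc s) (gen_in x)) ([v] @ u')"
    by (rule tens_pure, rule assms(3), rule HOL.refl) (use assms len in simp_all)
  have "end_tens sU sV (take s (gen_in x)) (take s (gen_in x)) ([gen_out y] @ drop (Suc s) (gen_in x))
      (pr (take s (gen_in x))) ?T (u @ w @ u')
    = pr (take s (gen_in x) @ [gen_out y] @ drop (Suc s) (gen_in x)) (u @ [v] @ u')"
    by (rule tens_pure, rule HOL.refl, rule T) (use assms len in simp_all)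
  then show ?thesis
    using assms(2) by (simp add: plug_def comp_pure[OF gen_End[OF assms(1)]])
qed

text \<open>By the Leibniz rule each summand of the differential of a composite contains the
  differential of a smaller term, so the induction reduces to generators.\<close>

lemma ev_diff_eq_0:
  assumes "ev (diff (Gen (Mu 3))) = 0" "ev (diff (Gen (Nu 3))) = 0" "ev (diff (Gen (Fn 2))) = 0"
  shows "wt t \<Longrightarrow> ev (diff t) = 0"
proof (induction t)
  case (Gen e)
  show ?case
  proof (cases "gen_deg e = 1")
    case True
    then have "e = Mu 3 \<or> e = Nu 3 \<or> e = Fn 2" by (cases e) auto
    then show ?thesis using assms by blast
  next
    case False
    then show ?thesis
      using wt_diff[OF Gen] ev_nonzero[of "diff (Gen e)"] by (simp add: zero_fun_def del: diff.simps)
  qed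
next
  case (Comp s t)
  then have *: "ev (diff s) = (\<lambda>w \<phi>. 0)" "ev (diff t) = (\<lambda>w \<phi>. 0)" by (simp_all add: zero_fun_def)
  have "end_comp (\<lambda>w \<phi>. 0) (ev t) = (\<lambda>w \<phi>. 0)" by (rule comp_0_left[OF ev_End]) (use Comp.prems in simp)
  then show ?case by (simp add: * zero_fun_def plus_fun_def)
next
  case (Tens s t)
  then have *: "ev (diff s) = (\<lambda>w \<phi>. 0)" "ev (diff t) = (\<lambda>w \<phi>. 0)" by (simp_all add: zero_fun_def)
  have "end_tens sU sV (cdom s) (ccod s) ds (ev s) (\<lambda>w \<phi>. 0) = (\<lambda>w \<phi>. 0)" for ds
    by (rule tens_0_right[OF ev_End]) (use Tens.prems in simp)
  then show ?case using wt_diff[of s] wt_diff[of t] Tens.prems by (simp add: * zero_fun_def plus_fun_def)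
qed (simp_all add: fun_eq_iff)

text \<open>Only i = j = 2 occurs, and the exponent 2 + 3 s is even for s = 0 and odd for s =
  1.\<close>

lemma ev_diff_Mu3: "ev (diff (Gen (Mu 3))) w \<phi> = ev (plug (Mu 2) 0 (Mu 2)) w \<phi> - ev (plug (Mu 2) 1 (Mu 2)) w \<phi>"
  by (simp add: term_sum_def)

lemma ev_diff_Nu3: "ev (diff (Gen (Nu 3))) w \<phi> = ev (plug (Nu 2) 0 (Nu 2)) w \<phi> - ev (plug (Nu 2) 1 (Nu 2)) w \<phi>"
  by (simp add: term_sum_def)

text \<open>The composition (1, 1) has exponent 2 and gives the minus sign; the remaining term i =
  1, j = 2, s = 0 has exponent 1 and gives the plus sign.\<close>

lemma ev_diff_Fn2: "ev (diff (Gen (Fn 2))) w \<phi> = ev (plug (Fn 1) 0 (Mu 2)) w \<phi>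
    - ev (Comp (Gen (Nu 2)) (Tens (Gen (Fn 1)) (Tens (Gen (Fn 1)) (Iden [])))) w \<phi>"
  by (simp add: term_sum_def numeral_2_eq_2 r_exponent_def)

lemma FE_algebra_ev:
  assumes "\<And>t. wt t \<Longrightarrow> ev (diff t) = 0"
  shows "FE_algebra sU sV (\<lambda>t. if wt t then ev t else 0)"
  unfolding FE_algebra_def typed_iff
proof (intro conjI allI impI)
  fix s t :: "'k pterm" assume "s \<simeq> t"
  then show "(if wt s then ev s else 0) = (if wt t then ev t else 0)"
    using prop_eq_wt[of s t] prop_eq_ev[of s t] by simp
qed (use ev_End assms wt_diff in auto)

text \<open>Freeness: a morphism out of the free PROP is determined by its values on the
  generators.\<close>

lemma FE_algebra_eq_ev:
  assumes "FE_algebra sU sV \<Phi>" "\<And>e. gen_valid e \<Longrightarrow> \<Phi> (Gen e) = \<gamma> e"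
  shows "\<Phi> = (\<lambda>t. if wt t then ev t else 0)"
proof
  fix t
  note FE = FE_algebraD[OF assms(1)]
  have "wt t \<Longrightarrow> \<Phi> t = ev t"
  proof (induction t)
    case (Zero cs ds p)
    \<comment> \<open>The value at \<open>Zero\<close> follows from compatibility with scaling by
      0.\<close>
    have "Scale 0 (Zero cs ds p) \<simeq> Zero cs ds p" by (rule prop_eq.scale_zero) (rule typed.intros)
    then have "\<Phi> (Scale 0 (Zero cs ds p)) = \<Phi> (Zero cs ds p)" by (rule FE(2))
    then show ?case using FE(5)[of "Zero cs ds p" 0] by (simp add: zero_fun_def)
  next
    case (Gen e)
    then show ?case using assms(2) by simp
  next
    case (Iden cs)
    show ?case by (simp add: FE(6,7))
  next
    case (Swap cs ds)
    show ?case by (simp add: FE(6,7))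
  next
    case (Comp s t)
    have "\<Phi> (Comp s t) = end_comp (\<Phi> s) (\<Phi> t)" by (rule FE) (rule Comp.prems)
    then show ?case using Comp by simp
  next
    case (Tens s t)
    have "\<Phi> (Tens s t) = end_tens sU sV (cdom s) (ccod s) (ccod t) (\<Phi> s) (\<Phi> t)" by (rule FE) (rule Tens.prems)
    then show ?case using Tens by simp
  next
    case (Add s t)
    have "\<Phi> (Add s t) = \<Phi> s + \<Phi> t" by (rule FE) (rule Add.prems)
    then show ?case using Add by simp
  next
    case (Scale c s)
    then show ?case by (simp add: FE(5))
  qed
  moreover have "\<not> wt t \<Longrightarrow> \<Phi> t = 0" by (rule FE(1))
  ultimately show "\<Phi> t = (if wt t then ev t else 0)" by simp
qed

end

locale structure_maps = two_spaces sU sV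
  for sU :: "'k::field \<Rightarrow> 'u::ab_group_add \<Rightarrow> 'u" and sV :: "'k \<Rightarrow> 'v::ab_group_add \<Rightarrow> 'v" +
  fixes mU :: "'u list \<Rightarrow> 'u" and mV :: "'v list \<Rightarrow> 'v" and f :: "'u list \<Rightarrow> 'v"
  assumes mU: "mU \<in> multilin sU sU 2" and mV: "mV \<in> multilin sV sV 2" and f: "f \<in> multilin sU sV 1"
begin

definition act :: "gen \<Rightarrow> ('u, 'v, 'k) endo" where
  "act e = (if e = Mu 2 then UU.emb mU else if e = Nu 2 then VV.emb mV
    else if e = Fn 1 then UV.emb f else 0)"

lemma act_simps: "act (Mu 2) = UU.emb mU" "act (Nu 2) = VV.emb mV" "act (Fn 1) = UV.emb f"
  by (simp_all add: act_def)

sublocale gen_action sU sV act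
proof
  fix e assume "gen_valid e"
  have "(0 :: ('u, 'v, 'k) endo) \<in> En cs ds p" for cs ds p using End_zero by (simp add: zero_fun_def)
  then show "act e \<in> En (gen_in e) [gen_out e] (gen_deg e)"
    using UU.emb_End[OF mU] VV.emb_End[OF mV] UV.emb_End[OF f] by (auto simp: act_def)
qed

lemma emb_simps: "UU.emb mU [Inl a, Inl b] = pr [Black] [Inl (mU [a, b])]"
  "VV.emb mV [Inr c, Inr d] = pr [White] [Inr (mV [c, d])]" "UV.emb f [Inl a] = pr [White] [Inr (f [a])]"
  using UU.emb_map[of mU "[a, b]"] VV.emb_map[of mV "[c, d]"] UV.emb_map[of f "[a]"] by simp_all

lemma ev_diff_value:
  "ev (diff (Gen (Mu 3))) [Inl a, Inl b, Inl c] \<phi>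
    = UU.p1 (mU [mU [a, b], c]) \<phi> - UU.p1 (mU [a, mU [b, c]]) \<phi>"
  "ev (diff (Gen (Nu 3))) [Inr a', Inr b', Inr c'] \<phi>
    = VV.p1 (mV [mV [a', b'], c']) \<phi> - VV.p1 (mV [a', mV [b', c']]) \<phi>"
  "ev (diff (Gen (Fn 2))) [Inl a, Inl b] \<phi> = UV.p1 (f [mU [a, b]]) \<phi> - UV.p1 (mV [f [a], f [b]]) \<phi>"
proof -
  note simps = act_simps emb_simps numeral_2_eq_2[symmetric]
  have two: "replicate 2 x = [x, x]" for x :: color by (simp add: numeral_2_eq_2)
  have "ev (plug (Mu 2) 0 (Mu 2)) ([] @ [Inl a, Inl b] @ [Inl c]) = act (Mu 2) ([] @ Inl (mU [a, b]) # [Inl c])"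
    by (rule ev_plug) (simp_all add: act_simps emb_simps two)
  moreover have "ev (plug (Mu 2) 1 (Mu 2)) ([Inl a] @ [Inl b, Inl c] @ []) = act (Mu 2) ([Inl a] @ Inl (mU [b, c]) # [])"
    by (rule ev_plug) (simp_all add: act_simps emb_simps two)
  ultimately show "ev (diff (Gen (Mu 3))) [Inl a, Inl b, Inl c] \<phi>
    = UU.p1 (mU [mU [a, b], c]) \<phi> - UU.p1 (mU [a, mU [b, c]]) \<phi>"
    unfolding ev_diff_Mu3 by (simp add: act_simps emb_simps)
  have "ev (plug (Nu 2) 0 (Nu 2)) ([] @ [Inr a', Inr b'] @ [Inr c']) = act (Nu 2) ([] @ Inr (mV [a', b']) # [Inr c'])"
    by (rule ev_plug) (simp_all add: act_simps emb_simps two)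
  moreover have "ev (plug (Nu 2) 1 (Nu 2)) ([Inr a'] @ [Inr b', Inr c'] @ []) = act (Nu 2) ([Inr a'] @ Inr (mV [b', c']) # [])"
    by (rule ev_plug) (simp_all add: act_simps emb_simps two)
  ultimately show "ev (diff (Gen (Nu 3))) [Inr a', Inr b', Inr c'] \<phi>
    = VV.p1 (mV [mV [a', b'], c']) \<phi> - VV.p1 (mV [a', mV [b', c']]) \<phi>"
    unfolding ev_diff_Nu3 by (simp add: act_simps emb_simps)
  have 1: "ev (plug (Fn 1) 0 (Mu 2)) ([] @ [Inl a, Inl b] @ []) = act (Fn 1) ([] @ Inl (mU [a, b]) # [])"
    by (rule ev_plug) (simp_all add: act_simps[simplified] emb_simps two)
  let ?F = "act (Fn 1)"
  let ?T' = "end_tens sU sV [Black] [White] [] ?F (pr [])"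
  let ?T = "end_tens sU sV [Black] [White] [White] ?F ?T'"
  have F: "?F [Inl x] = pr [White] [Inr (f [x])]" for x unfolding act_simps emb_simps ..
  have "?T' ([Inl b] @ []) = pr ([White] @ []) ([Inr (f [b])] @ [])"
    by (rule tens_pure, rule F, rule HOL.refl) simp_all
  then have T': "?T' [Inl b] = pr [White] [Inr (f [b])]" by simp
  have T: "?T ([Inl a] @ [Inl b]) = pr ([White] @ [White]) ([Inr (f [a])] @ [Inr (f [b])])"
    by (rule tens_pure, rule F, rule T') simp_all
  have "act (Nu 2) \<in> En [White, White] [White] 0"
    using gen_End[of "Nu 2"] by (simp add: two)
  then have "end_comp (act (Nu 2)) ?T ([Inl a] @ [Inl b]) = act (Nu 2) ([Inr (f [a])] @ [Inr (f [b])])"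
    by (rule comp_pure) (use T in simp)
  then have "ev (Comp (Gen (Nu 2)) (Tens (Gen (Fn 1)) (Tens (Gen (Fn 1)) (Iden [])))) [Inl a, Inl b]
      = pr [White] [Inr (mV [f [a], f [b]])]"
    by (simp add: act_simps emb_simps)
  then show "ev (diff (Gen (Fn 2))) [Inl a, Inl b] \<phi> = UV.p1 (f [mU [a, b]]) \<phi> - UV.p1 (mV [f [a], f [b]]) \<phi>"
    unfolding ev_diff_Fn2 using 1 by (simp add: F[simplified])
qed

lemma ev_diff_iff:
  "ev (diff (Gen (Mu 3))) = 0 \<longleftrightarrow> (\<forall>a b c. mU [mU [a, b], c] = mU [a, mU [b, c]])"
  "ev (diff (Gen (Nu 3))) = 0 \<longleftrightarrow> (\<forall>a b c. mV [mV [a, b], c] = mV [a, mV [b, c]])"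
  "ev (diff (Gen (Fn 2))) = 0 \<longleftrightarrow> (\<forall>a b. f [mU [a, b]] = mV [f [a], f [b]])"
proof -
  have three: "replicate 3 x = [x, x, x]" "replicate 2 x = [x, x]" for x :: color
    by (simp_all add: numeral_3_eq_3 numeral_2_eq_2)
  have zeroI: "ev (diff (Gen e)) = 0"
    if "gen_valid e" "\<And>w \<phi>. colors w = gen_in e \<Longrightarrow> ev (diff (Gen e)) w \<phi> = 0" for e
  proof -
    have "ev (diff (Gen e)) \<in> En (gen_in e) [gen_out e] 0"
      using ev_End_0[of "diff (Gen e)"] wt_diff[of "Gen e :: 'k pterm"] that(1) by (simp del: diff.simps)
    then have "ev (diff (Gen e)) = (\<lambda>w \<phi>. 0)"
      by (rule End_eqI[OF _ End_zero]) (use that(2) in blast)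
    then show ?thesis by (simp add: zero_fun_def)
  qed
  have B: "color_of x = Black \<longleftrightarrow> (\<exists>a. x = Inl a)" for x :: "'u + 'v" by (cases x) auto
  have W: "color_of x = White \<longleftrightarrow> (\<exists>a. x = Inr a)" for x :: "'u + 'v" by (cases x) auto
  show "ev (diff (Gen (Mu 3))) = 0 \<longleftrightarrow> (\<forall>a b c. mU [mU [a, b], c] = mU [a, mU [b, c]])"
  proof (intro iffI allI)
    fix a b c assume *: "ev (diff (Gen (Mu 3))) = 0"
    have "UU.p1 (mU [mU [a, b], c]) = UU.p1 (mU [a, mU [b, c]])"
      using ev_diff_value(1)[of a b c] unfolding * by (simp add: fun_eq_iff)
    then show "mU [mU [a, b], c] = mU [a, mU [b, c]]" by (rule UU.p1_inj)
  next
    assume *: "\<forall>a b c. mU [mU [a, b], c] = mU [a, mU [b, c]]"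
    show "ev (diff (Gen (Mu 3))) = 0"
    proof (rule zeroI)
      fix w :: "('u, 'v) word" and \<phi> :: "('u, 'v) word \<Rightarrow> 'k" assume "colors w = gen_in (Mu 3)"
      then obtain a b c where "w = [Inl a, Inl b, Inl c]" by (auto simp: three map_eq_Cons_conv B)
      then show "ev (diff (Gen (Mu 3))) w \<phi> = 0" using ev_diff_value(1)[of a b c \<phi>] * by simp
    qed simp
  qed
  show "ev (diff (Gen (Nu 3))) = 0 \<longleftrightarrow> (\<forall>a b c. mV [mV [a, b], c] = mV [a, mV [b, c]])"
  proof (intro iffI allI)
    fix a b c assume *: "ev (diff (Gen (Nu 3))) = 0"
    have "VV.p1 (mV [mV [a, b], c]) = VV.p1 (mV [a, mV [b, c]])"
      using ev_diff_value(2)[of a b c] unfolding * by (simp add: fun_eq_iff)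
    then show "mV [mV [a, b], c] = mV [a, mV [b, c]]" by (rule VV.p1_inj)
  next
    assume *: "\<forall>a b c. mV [mV [a, b], c] = mV [a, mV [b, c]]"
    show "ev (diff (Gen (Nu 3))) = 0"
    proof (rule zeroI)
      fix w :: "('u, 'v) word" and \<phi> :: "('u, 'v) word \<Rightarrow> 'k" assume "colors w = gen_in (Nu 3)"
      then obtain a b c where "w = [Inr a, Inr b, Inr c]" by (auto simp: three map_eq_Cons_conv W)
      then show "ev (diff (Gen (Nu 3))) w \<phi> = 0" using ev_diff_value(2)[of a b c \<phi>] * by simp
    qed simp
  qed
  show "ev (diff (Gen (Fn 2))) = 0 \<longleftrightarrow> (\<forall>a b. f [mU [a, b]] = mV [f [a], f [b]])"
  proof (intro iffI allI)
    fix a b assume *: "ev (diff (Gen (Fn 2))) = 0"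
    have "UV.p1 (f [mU [a, b]]) = UV.p1 (mV [f [a], f [b]])"
      using ev_diff_value(3)[of a b] unfolding * by (simp add: fun_eq_iff)
    then show "f [mU [a, b]] = mV [f [a], f [b]]" by (rule UV.p1_inj)
  next
    assume *: "\<forall>a b. f [mU [a, b]] = mV [f [a], f [b]]"
    show "ev (diff (Gen (Fn 2))) = 0"
    proof (rule zeroI)
      fix w :: "('u, 'v) word" and \<phi> :: "('u, 'v) word \<Rightarrow> 'k" assume "colors w = gen_in (Fn 2)"
      then obtain a b where "w = [Inl a, Inl b]" by (auto simp: three map_eq_Cons_conv B)
      then show "ev (diff (Gen (Fn 2))) w \<phi> = 0" using ev_diff_value(3)[of a b \<phi>] * by simp
    qed simp
  qed
qed

lemma FE_algebra_unique:
  assumes "FE_algebra sU sV \<Phi>" "\<Phi> (Gen (Mu 2)) = embed_UU sU sV mU"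
    "\<Phi> (Gen (Nu 2)) = embed_VV sU sV mV" "\<Phi> (Gen (Fn 1)) = embed_UV sU sV f"
  shows "\<Phi> = (\<lambda>t. if wt t then ev t else 0)"
proof (rule FE_algebra_eq_ev[OF assms(1)])
  fix e assume e: "gen_valid e"
  have "\<Phi> (Gen e) \<in> En (gen_in e) [gen_out e] (gen_deg e)"
    using FE_algebraD(3)[OF assms(1), of "Gen e"] e by simp
  then show "\<Phi> (Gen e) = act e"
    using assms(2-4) e unfolding embed_eq_emb act_def End_T_def
    by (cases e) (auto split: if_splits)
qed

lemma FE_algebra_iff:
  "FE_algebra sU sV (\<lambda>t. if wt t then ev t else 0) \<longleftrightarrow>
    (\<forall>a b c. mU [mU [a, b], c] = mU [a, mU [b, c]]) \<and> (\<forall>a b c. mV [mV [a, b], c] = mV [a, mV [b, c]])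
    \<and> (\<forall>a b. f [mU [a, b]] = mV [f [a], f [b]])" (is "?FE \<longleftrightarrow> ?eqs")
proof
  assume FE: ?FE
  have "ev (diff (Gen e)) = 0" if "gen_valid e" for e
  proof -
    have "(\<lambda>t. if wt t then ev t else 0) (diff (Gen e)) = 0"
      by (rule FE_algebraD(10)[OF FE]) (simp add: that)
    then show ?thesis using wt_diff[of "Gen e :: 'k pterm"] that by (simp del: diff.simps)
  qed
  from this[of "Mu 3"] this[of "Nu 3"] this[of "Fn 2"] show ?eqs
    unfolding ev_diff_iff by simp
next
  assume ?eqs
  then show ?FE using FE_algebra_ev ev_diff_eq_0 unfolding ev_diff_iff by blast
qed

end

lemma (in two_spaces) FE_algebra_maps:
  assumes "FE_algebra sU sV \<Phi>"
  obtains mU mV f where "structure_maps sU sV mU mV f" "\<Phi> (Gen (Mu 2)) = embed_UU sU sV mU"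
    "\<Phi> (Gen (Nu 2)) = embed_VV sU sV mV" "\<Phi> (Gen (Fn 1)) = embed_UV sU sV f"
proof -
  have "\<Phi> (Gen e) \<in> En (gen_in e) [gen_out e] (gen_deg e)" if "gen_valid e" for e
    using FE_algebraD(3)[OF assms, of "Gen e"] that by simp
  from this[of "Mu 2"] this[of "Nu 2"] this[of "Fn 1"]
  have "\<Phi> (Gen (Mu 2)) \<in> En (replicate 2 Black) [Black] 0" "\<Phi> (Gen (Nu 2)) \<in> En (replicate 2 White) [White] 0"
    "\<Phi> (Gen (Fn 1)) \<in> En (replicate 1 Black) [White] 0" by simp_all
  then show ?thesis
    using UU.emb_surj VV.emb_surj UV.emb_surj that
    unfolding embed_eq_emb structure_maps_def structure_maps_axioms_def using two_spaces_axioms by blast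
qed

lemma product_cochain_multilin:
  assumes "assoc_algebra s"
  shows "product_cochain \<in> multilin s s 2"
proof -
  interpret vector_space s using assms by (simp add: assoc_algebra_def)
  have mult: "s c x * y = s c (x * y)" "x * s c y = s c (x * y)" for c x y
    using assms unfolding assoc_algebra_def by metis+
  have "slot_linear (\<lambda>x. x) s s product_cochain"
    unfolding slot_linear_def
  proof (intro allI)
    fix u v :: "'b list" and a b c
    consider x where "u = []" "v = [x]" | x where "u = [x]" "v = []" | "length u + length v \<noteq> 1"
      by (cases u; cases v) auto
    then show "product_cochain (u @ (a + b) # v) = product_cochain (u @ a # v) + product_cochain (u @ b # v)
      \<and> product_cochain (u @ s c a # v) = s c (product_cochain (u @ a # v))"
      by cases (auto simp: product_cochain_def mult algebra_simps)
  qed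
  then show ?thesis
    unfolding multilin_iff_slot_linear[OF vector_space_axioms vector_space_axioms]
    by (simp add: product_cochain_def)
qed

section \<open>The correspondence between solutions and algebra structures\<close>

context algebra_map
begin

sublocale T: two_spaces sU sV by unfold_locales

lemma L_1_iff: "(mU, mV, f) \<in> L 1 \<longleftrightarrow> structure_maps sU sV mU mV f"
  using T.two_spaces_axioms by (simp add: L_iff structure_maps_def structure_maps_axioms_def numeral_2_eq_2)

lemma base_structure_in_L: "base_structure g \<in> L 1"
proof -
  have g: "Vector_Spaces.linear sU sV g" using morph by (simp add: algebra_morphism_def)
  have "(\<lambda>as. if length as = 1 then g (as ! 0) else 0) \<in> multilin sU sV 1"
    unfolding multilin_def using g by simp
  then show ?thesis
    unfolding base_structure_def L_1_iff structure_maps_def structure_maps_axioms_def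
    using product_cochain_multilin[OF algU] product_cochain_multilin[OF algV] T.two_spaces_axioms by blast
qed

lemma subspace_L_1: "module sc" "module.subspace sc (L 1)"
  using L_infinity_l[unfolded L_infinity_def, THEN conjunct1]
    L_infinity_l[unfolded L_infinity_def, THEN conjunct2, THEN conjunct1] by simp_all

text \<open>Evaluation of terms at the components of \<open>base_structure g + \<kappa>\<close> is
  the only candidate, since all other generators are forced to act by 0.\<close>

lemma QME_FE_algebra:
  assumes \<kappa>: "\<kappa> \<in> L 1" "quantum_master_equation sc l \<kappa>"
  shows "\<exists>!\<Phi>. FE_algebra sU sV \<Phi> \<and> deformed_by sU sV g \<kappa> \<Phi>"
proof -
  obtain mU mV f where m: "base_structure g + \<kappa> = (mU, mV, f)" by (cases "base_structure g + \<kappa>")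
  have "base_structure g + \<kappa> \<in> L 1"
    by (rule module.subspace_add[OF subspace_L_1 base_structure_in_L \<kappa>(1)])
  then interpret M: structure_maps sU sV mU mV f unfolding m L_1_iff .
  let ?\<Phi> = "\<lambda>t. if wt t then M.ev t else 0"
  have deformed_iff: "deformed_by sU sV g \<kappa> \<Phi> \<longleftrightarrow> \<Phi> (Gen (Mu 2)) = embed_UU sU sV mU \<and>
     \<Phi> (Gen (Nu 2)) = embed_VV sU sV mV \<and> \<Phi> (Gen (Fn 1)) = embed_UV sU sV f" for \<Phi>
    unfolding deformed_by_def m by simp
  show ?thesis
  proof (rule ex1I[of _ ?\<Phi>], rule conjI)
    have "is_structure (mU, mV, f)" using QME_iff[OF \<kappa>(1)] \<kappa>(2) unfolding m by blast
    then show "FE_algebra sU sV ?\<Phi>"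
      unfolding M.FE_algebra_iff is_structure_def prod.case by blast
    show "deformed_by sU sV g \<kappa> ?\<Phi>"
      unfolding deformed_iff T.embed_eq_emb using M.act_simps by simp
  next
    fix \<Phi> assume "FE_algebra sU sV \<Phi> \<and> deformed_by sU sV g \<kappa> \<Phi>"
    then show "\<Phi> = ?\<Phi>" unfolding deformed_iff by (intro M.FE_algebra_unique) blast+
  qed
qed

text \<open>The three generators of degree 0 determine the maps, because the embeddings into the
  endomorphism PROP are bijective onto morphisms of the given type.\<close>

lemma FE_algebra_QME:
  assumes FE: "FE_algebra sU sV \<Phi>"
  shows "\<exists>!\<kappa>. \<kappa> \<in> L 1 \<and> quantum_master_equation sc l \<kappa> \<and> deformed_by sU sV g \<kappa> \<Phi>"
proof -
  obtain mU mV f where m: "structure_maps sU sV mU mV f" "\<Phi> (Gen (Mu 2)) = embed_UU sU sV mU"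
    "\<Phi> (Gen (Nu 2)) = embed_VV sU sV mV" "\<Phi> (Gen (Fn 1)) = embed_UV sU sV f"
    using T.FE_algebra_maps[OF FE] by blast
  interpret M: structure_maps sU sV mU mV f by (rule m(1))
  have "\<Phi> = (\<lambda>t. if wt t then M.ev t else 0)" by (rule M.FE_algebra_unique[OF FE m(2-4)])
  then have str: "is_structure (mU, mV, f)" using FE M.FE_algebra_iff unfolding is_structure_def prod.case by metis
  \<comment> \<open>Candidate structures are the elements of the vector space C^2, so every one of
    them differs from the given structure by a cochain of degree 1.\<close>
  define \<kappa> where "\<kappa> = (mU, mV, f) - base_structure g"
  have base: "base_structure g + \<kappa> = (mU, mV, f)" by (simp add: \<kappa>_def)
  have \<kappa>: "\<kappa> \<in> L 1"
    unfolding \<kappa>_def using m(1) L_1_iff by (intro module.subspace_diff[OF subspace_L_1 _ base_structure_in_L]) simp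
  show ?thesis
  proof (rule ex1I)
    show "\<kappa> \<in> L 1 \<and> quantum_master_equation sc l \<kappa> \<and> deformed_by sU sV g \<kappa> \<Phi>"
    proof (intro conjI)
      show "quantum_master_equation sc l \<kappa>" unfolding QME_iff[OF \<kappa>] base by (rule str)
      show "deformed_by sU sV g \<kappa> \<Phi>" unfolding deformed_by_def base prod.case using m(2-4) by blast
    qed (rule \<kappa>)
  next
    fix \<kappa>' assume "\<kappa>' \<in> L 1 \<and> quantum_master_equation sc l \<kappa>' \<and> deformed_by sU sV g \<kappa>' \<Phi>"
    then have d: "deformed_by sU sV g \<kappa>' \<Phi>" by blast
    obtain mU' mV' f' where m': "base_structure g + \<kappa>' = (mU', mV', f')" by (cases "base_structure g + \<kappa>'")
    have emb_eq: "T.UU.emb mU' = T.UU.emb mU" "T.VV.emb mV' = T.VV.emb mV" "T.UV.emb f' = T.UV.emb f"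
      using d m(2-4) unfolding deformed_by_def m' T.embed_eq_emb by simp_all
    have "mU' = mU" by (rule T.UU.emb_inj[OF emb_eq(1)])
    moreover have "mV' = mV" by (rule T.VV.emb_inj[OF emb_eq(2)])
    moreover have "f' = f" by (rule T.UV.emb_inj[OF emb_eq(3)])
    ultimately have "base_structure g + \<kappa>' = base_structure g + \<kappa>" unfolding m' base by simp
    then show "\<kappa>' = \<kappa>" by (rule add_left_imp_eq)
  qed
qed

end

theorem corollary5p6:
  fixes sU :: "'k::field_char_0 \<Rightarrow> 'u::ring \<Rightarrow> 'u"
    and sV :: "'k \<Rightarrow> 'v::ring \<Rightarrow> 'v"
    and g :: "'u \<Rightarrow> 'v"
  assumes "assoc_algebra sU" and "assoc_algebra sV"
    and "algebra_morphism sU sV g"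
  shows "\<exists>l :: nat \<Rightarrow> ('u, 'v) gs_cochain list \<Rightarrow> ('u, 'v) gs_cochain.
    L_infinity (gs_scale sU sV) (L_GS sU sV) l \<and>
    (\<forall>p. \<forall>x \<in> L_GS sU sV p. l 1 [x] = d_GS g x) \<and>
    (\<forall>\<kappa> \<in> L_GS sU sV 1. finite (qme_support (gs_scale sU sV) l \<kappa>)) \<and>
    (\<forall>\<kappa> \<in> L_GS sU sV 1. quantum_master_equation (gs_scale sU sV) l \<kappa> \<longrightarrow>
       (\<exists>!\<Phi>. FE_algebra sU sV \<Phi> \<and> deformed_by sU sV g \<kappa> \<Phi>)) \<and>
    (\<forall>\<Phi>. FE_algebra sU sV \<Phi> \<longrightarrow>
       (\<exists>!\<kappa>. \<kappa> \<in> L_GS sU sV 1 \<and> quantum_master_equation (gs_scale sU sV) l \<kappa> \<and>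
          deformed_by sU sV g \<kappa> \<Phi>))"
proof -
  interpret algebra_map sU sV g by (rule algebra_map.intro[OF assms])
  have "finite (qme_support sc l \<kappa>)" if "\<kappa> \<in> L 1" for \<kappa>
    using qme_support_subset[OF that] by (rule finite_subset) simp
  then show ?thesis
    by (intro exI[of _ l] conjI ballI allI impI L_infinity_l QME_FE_algebra FE_algebra_QME l_1)
qed

end
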